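(* Let $k$ be a field, let $\mathcal{C},\mathcal{D}$ be finite strict tensor categories over $k$ and let $F:\mathcal{C}\to\mathcal{D}$ be an exact $k$-linear strict monoidal functor. For all coefficients $\mathsf{V},\mathsf{W}\in\mathcal{Z}(F)$, the Davydov--Yetter cohomology of $F$ is isomorphic to the relative Ext groups of the adjunction defined by the forgetful functor $\mathcal{U}:\mathcal{Z}(F)\to\mathcal{D}$: $$H^n_{\mathrm{DY}}(F;\mathsf{V},\mathsf{W})\;\cong\;\mathrm{Ext}^n_{\mathcal{Z}(F),\mathcal{D}}(\mathsf{V},\mathsf{W})\qquad\text{for all } n\ge 0 .$$
   Context: A tensor category over $k$ is a $k$-linear abelian rigid monoidal category with $k$-bilinear tensor product whose unit $\mathbf{1}$ is simple with $\mathrm{End}(\mathbf{1})\cong k$. It is finite if it is equivalent, as a $k$-linear category, to the category of finite-dimensional modules over a finite-dimensional $k$-algebra. Centralizer. A half-braiding relative to $F$ on $V\in\mathcal{D}$ is a natural isomorphism $\rho^V_X:V\otimes F(X)\to F(X)\otimes V$ ($X\in\mathcal{C}$) with $\rho^V_{X\otimes Y}=(\mathrm{id}_{F(X)}\otimes\rho^V_Y)(\rho^V_X\otimes\mathrm{id}_{F(Y)})$. The category $\mathcal{Z}(F)$ has as objects the pairs $\mathsf{V}=(V,\rho^V)$, and as morphisms $(V,\rho^V)\to(W,\rho^W)$ the $f\in\mathrm{Hom}_{\mathcal{D}}(V,W)$ with $(\mathrm{id}_{F(X)}\otimes f)\rho^V_X=\rho^W_X(f\otimes\mathrm{id}_{F(X)})$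 for all $X$. The forgetful functor is $\mathcal{U}(V,\rho^V)=V$; since $\mathcal{C},\mathcal{D}$ are finite strict tensor categories over $k$ and $F$ is an exact $k$-linear strict monoidal functor, it is additive, exact, faithful and has a left adjoint $\mathcal{F}$. Davydov--Yetter cohomology. For $\mathsf{V}=(V,\rho^V),\mathsf{W}=(W,\rho^W)\in\mathcal{Z}(F)$, $C^n_{\mathrm{DY}}(F;\mathsf{V},\mathsf{W})$ is the space of natural transformations $f_{X_1,\dots,X_n}:V\otimes F(X_1)\otimes\cdots\otimes F(X_n)\to F(X_1)\otimes\cdots\otimes F(X_n)\otimes W$ (for $n=0$ it is $\mathrm{Hom}_{\mathcal{D}}(V,W)$), with differential $$\delta^n(f)_{X_0,\dots,X_n}=(\mathrm{id}_{F(X_0)}\otimes f_{X_1,\dots,X_n})(\rho^V_{X_0}\otimes\mathrm{id})+\sum_{i=1}^n(-1)^if_{X_0,\dots,X_{i-1}\otimes X_i,\dots,X_n}+(-1)^{n+1}(\mathrm{id}\otimes\rho^W_{X_n})(f_{X_0,\dots,X_{n-1}}\otimes\mathrm{id}_{F(X_n)}).$$ $H^n_{\mathrm{DY}}(F;\mathsf{V},\mathsf{W})$ is its $n$-th cohomology. Relative Ext. Let $\mathcal{U}:\mathcal{A}\to\mathcal{B}$ be an additive, exact, faithful functor between abelian categories, having a left adjoint. A morphism $f:V\to W$ in $\mathcal{A}$ is allowable if there is $s\in\mathrm{Hom}_{\mathcal{B}}(\mathcal{U}(W),\mathcal{U}(V))$ with $\mathcal{U}(f)s\,\mathcal{U}(f)=\mathcal{U}(f)$.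 An object $P$ is relatively projective if every morphism $P\to W$ lifts along every allowable epimorphism $V\to W$. A relatively projective resolution of $V$ is an exact sequence $\cdots\to P_1\to P_0\to V\to0$ with all $P_i$ relatively projective and all arrows allowable; these exist. $\mathrm{Ext}^n_{\mathcal{A},\mathcal{B}}(V,W)$ is the $n$-th cohomology of $0\to\mathrm{Hom}_{\mathcal{A}}(P_0,W)\to\mathrm{Hom}_{\mathcal{A}}(P_1,W)\to\cdots$, and it does not depend on the resolution. Here $\mathcal{A}=\mathcal{Z}(F)$ and $\mathcal{B}=\mathcal{D}$. *)

theory Defs
  imports "Jordan_Normal_Form.VS_Connect" "HOL-Algebra.AbelCoset"
begin

section \<open>Vector spaces\<close>

text \<open>
  The ground field is a type of class \<^class>\<open>field\<close>, turned into a ring record by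
  \<open>class_ring\<close>. The locales \<open>vectorspace\<close> and \<open>linear_map\<close> are those of the theory
  \<open>VectorSpace\<close>.
\<close>

definition bilinear_map ::
  "('k::field, 'a) module \<Rightarrow> ('k, 'b) module \<Rightarrow> ('k, 'c) module \<Rightarrow> ('a \<Rightarrow> 'b \<Rightarrow> 'c) \<Rightarrow> bool" where
  "bilinear_map U V W \<beta> \<longleftrightarrow>
     (\<forall>u\<in>carrier U. linear_map class_ring V W (\<beta> u)) \<and>
     (\<forall>v\<in>carrier V. linear_map class_ring U W (\<lambda>u. \<beta> u v))"

definition lin_isomorphic ::
  "('k::field, 'a) module \<Rightarrow> ('k, 'b) module \<Rightarrow> bool" where
  "lin_isomorphic V W \<longleftrightarrow>
     (\<exists>T. linear_map class_ring V W T \<and> bij_betw T (carrier V) (carrier W))"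

text \<open>The ring fields \<open>mult\<close> and \<open>one\<close> of a \<open>module\<close> record play no role for vector spaces.\<close>

definition quotient_space :: "('k::field, 'a) module \<Rightarrow> 'a set \<Rightarrow> ('k, 'a set) module" where
  "quotient_space V B =
     \<lparr>carrier = a_rcosets\<^bsub>V\<^esub> B, mult = undefined, one = undefined,
      zero = B, add = (\<lambda>S T. S <+>\<^bsub>V\<^esub> T),
      smult = (\<lambda>c S. {b \<oplus>\<^bsub>V\<^esub> c \<odot>\<^bsub>V\<^esub> s | b s. b \<in> B \<and> s \<in> S})\<rparr>"

text \<open>Cohomology of a complex \<open>K 0 \<rightarrow> K 1 \<rightarrow> \<dots>\<close> with differentials \<open>d n : K n \<rightarrow> K (n + 1)\<close>.\<close>

definition cohomology ::
  "(nat \<Rightarrow> ('k::field, 'a) module) \<Rightarrow> (nat \<Rightarrow> 'a \<Rightarrow> 'a) \<Rightarrow> nat \<Rightarrow> ('k, 'a set) module" where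
  "cohomology K d n =
     quotient_space
       ((K n)\<lparr>carrier := {z \<in> carrier (K n). d n z = \<zero>\<^bsub>K (Suc n)\<^esub>}\<rparr>)
       (case n of 0 \<Rightarrow> {\<zero>\<^bsub>K 0\<^esub>} | Suc m \<Rightarrow> d m ` carrier (K m))"


section \<open>Linear and abelian categories\<close>

text \<open>
  Hom-spaces for different pairs of objects may share elements. This allows the centralizer
  to take its arrows directly from \<open>D\<close>, and the category of modules over an algebra to take
  matrices as arrows. It is also why the arrow part of a functor is indexed by source and target.
\<close>

record ('k, 'o, 'm) lin_cat =
  Obj :: "'o set"
  HomV :: "'o \<Rightarrow> 'o \<Rightarrow> ('k, 'm) module"
  Ident :: "'o \<Rightarrow> 'm"
  Comp :: "'m \<Rightarrow> 'm \<Rightarrow> 'm" (infixl "\<cdot>\<index>" 60)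

abbreviation Mor :: "('k, 'o, 'm, 'z) lin_cat_scheme \<Rightarrow> 'o \<Rightarrow> 'o \<Rightarrow> 'm set" where
  "Mor C X Y \<equiv> carrier (HomV C X Y)"

locale linear_category =
  fixes C :: "('k::field, 'o, 'm, 'z) lin_cat_scheme" (structure)
  assumes hom_vectorspace:
      "\<lbrakk>X \<in> Obj C; Y \<in> Obj C\<rbrakk> \<Longrightarrow> vectorspace class_ring (HomV C X Y)"
    and comp_bilinear:
      "\<lbrakk>X \<in> Obj C; Y \<in> Obj C; Z \<in> Obj C\<rbrakk>
       \<Longrightarrow> bilinear_map (HomV C Y Z) (HomV C X Y) (HomV C X Z) (\<lambda>g f. g \<cdot> f)"
    and ident_in_hom: "X \<in> Obj C \<Longrightarrow> Ident C X \<in> Mor C X X"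
    and comp_ident_right:
      "\<lbrakk>X \<in> Obj C; Y \<in> Obj C; f \<in> Mor C X Y\<rbrakk> \<Longrightarrow> f \<cdot> Ident C X = f"
    and comp_ident_left:
      "\<lbrakk>X \<in> Obj C; Y \<in> Obj C; f \<in> Mor C X Y\<rbrakk> \<Longrightarrow> Ident C Y \<cdot> f = f"
    and comp_assoc:
      "\<lbrakk>X \<in> Obj C; Y \<in> Obj C; Z \<in> Obj C; T \<in> Obj C;
        f \<in> Mor C X Y; g \<in> Mor C Y Z; h \<in> Mor C Z T\<rbrakk> \<Longrightarrow> (h \<cdot> g) \<cdot> f = h \<cdot> (g \<cdot> f)"

definition isomorphism :: "('k, 'o, 'm, 'z) lin_cat_scheme \<Rightarrow> 'o \<Rightarrow> 'o \<Rightarrow> 'm \<Rightarrow> bool" where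
  "isomorphism C X Y f \<longleftrightarrow> f \<in> Mor C X Y \<and>
     (\<exists>g\<in>Mor C Y X. g \<cdot>\<^bsub>C\<^esub> f = Ident C X \<and> f \<cdot>\<^bsub>C\<^esub> g = Ident C Y)"

definition monic :: "('k, 'o, 'm, 'z) lin_cat_scheme \<Rightarrow> 'o \<Rightarrow> 'o \<Rightarrow> 'm \<Rightarrow> bool" where
  "monic C X Y f \<longleftrightarrow> f \<in> Mor C X Y \<and>
     (\<forall>T\<in>Obj C. \<forall>g\<in>Mor C T X. \<forall>h\<in>Mor C T X. f \<cdot>\<^bsub>C\<^esub> g = f \<cdot>\<^bsub>C\<^esub> h \<longrightarrow> g = h)"

definition epic :: "('k, 'o, 'm, 'z) lin_cat_scheme \<Rightarrow> 'o \<Rightarrow> 'o \<Rightarrow> 'm \<Rightarrow> bool" where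
  "epic C X Y f \<longleftrightarrow> f \<in> Mor C X Y \<and>
     (\<forall>T\<in>Obj C. \<forall>g\<in>Mor C Y T. \<forall>h\<in>Mor C Y T. g \<cdot>\<^bsub>C\<^esub> f = h \<cdot>\<^bsub>C\<^esub> f \<longrightarrow> g = h)"

definition zero_object :: "('k, 'o, 'm, 'z) lin_cat_scheme \<Rightarrow> 'o \<Rightarrow> bool" where
  "zero_object C Z \<longleftrightarrow> Z \<in> Obj C \<and>
     (\<forall>X\<in>Obj C. (\<exists>!f. f \<in> Mor C X Z) \<and> (\<exists>!f. f \<in> Mor C Z X))"

definition biproduct ::
  "('k, 'o, 'm, 'z) lin_cat_scheme \<Rightarrow> 'o \<Rightarrow> 'o \<Rightarrow> 'o \<Rightarrow> 'm \<Rightarrow> 'm \<Rightarrow> 'm \<Rightarrow> 'm \<Rightarrow> bool" where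
  "biproduct C X Y S i j p q \<longleftrightarrow> S \<in> Obj C \<and>
     i \<in> Mor C X S \<and> j \<in> Mor C Y S \<and> p \<in> Mor C S X \<and> q \<in> Mor C S Y \<and>
     p \<cdot>\<^bsub>C\<^esub> i = Ident C X \<and> q \<cdot>\<^bsub>C\<^esub> j = Ident C Y \<and>
     p \<cdot>\<^bsub>C\<^esub> j = \<zero>\<^bsub>HomV C Y X\<^esub> \<and> q \<cdot>\<^bsub>C\<^esub> i = \<zero>\<^bsub>HomV C X Y\<^esub> \<and>
     (i \<cdot>\<^bsub>C\<^esub> p) \<oplus>\<^bsub>HomV C S S\<^esub> (j \<cdot>\<^bsub>C\<^esub> q) = Ident C S"

text \<open>\<open>i : K \<rightarrow> X\<close> is a kernel of \<open>f : X \<rightarrow> Y\<close>; \<open>p : Y \<rightarrow> Q\<close> is a cokernel of \<open>f : X \<rightarrow> Y\<close>.\<close>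

definition is_kernel ::
  "('k, 'o, 'm, 'z) lin_cat_scheme \<Rightarrow> 'o \<Rightarrow> 'o \<Rightarrow> 'm \<Rightarrow> 'o \<Rightarrow> 'm \<Rightarrow> bool" where
  "is_kernel C X Y f K i \<longleftrightarrow> f \<in> Mor C X Y \<and> K \<in> Obj C \<and> i \<in> Mor C K X \<and>
     f \<cdot>\<^bsub>C\<^esub> i = \<zero>\<^bsub>HomV C K Y\<^esub> \<and>
     (\<forall>T\<in>Obj C. \<forall>h\<in>Mor C T X. f \<cdot>\<^bsub>C\<^esub> h = \<zero>\<^bsub>HomV C T Y\<^esub> \<longrightarrow>
        (\<exists>!u. u \<in> Mor C T K \<and> i \<cdot>\<^bsub>C\<^esub> u = h))"

definition is_cokernel ::
  "('k, 'o, 'm, 'z) lin_cat_scheme \<Rightarrow> 'o \<Rightarrow> 'o \<Rightarrow> 'm \<Rightarrow> 'o \<Rightarrow> 'm \<Rightarrow> bool" where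
  "is_cokernel C X Y f Q p \<longleftrightarrow> f \<in> Mor C X Y \<and> Q \<in> Obj C \<and> p \<in> Mor C Y Q \<and>
     p \<cdot>\<^bsub>C\<^esub> f = \<zero>\<^bsub>HomV C X Q\<^esub> \<and>
     (\<forall>T\<in>Obj C. \<forall>h\<in>Mor C Y T. h \<cdot>\<^bsub>C\<^esub> f = \<zero>\<^bsub>HomV C X T\<^esub> \<longrightarrow>
        (\<exists>!u. u \<in> Mor C Q T \<and> u \<cdot>\<^bsub>C\<^esub> p = h))"

locale abelian_category = linear_category +
  assumes ex_zero_object: "\<exists>Z. zero_object C Z"
    and ex_biproduct:
      "\<lbrakk>X \<in> Obj C; Y \<in> Obj C\<rbrakk> \<Longrightarrow> \<exists>S i j p q. biproduct C X Y S i j p q"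
    and ex_kernel:
      "\<lbrakk>X \<in> Obj C; Y \<in> Obj C; f \<in> Mor C X Y\<rbrakk> \<Longrightarrow> \<exists>K i. is_kernel C X Y f K i"
    and ex_cokernel:
      "\<lbrakk>X \<in> Obj C; Y \<in> Obj C; f \<in> Mor C X Y\<rbrakk> \<Longrightarrow> \<exists>Q p. is_cokernel C X Y f Q p"
    and monic_is_kernel:
      "\<lbrakk>X \<in> Obj C; Y \<in> Obj C; monic C X Y f\<rbrakk> \<Longrightarrow> \<exists>Z\<in>Obj C. \<exists>g. is_kernel C Y Z g X f"
    and epic_is_cokernel:
      "\<lbrakk>X \<in> Obj C; Y \<in> Obj C; epic C X Y f\<rbrakk> \<Longrightarrow> \<exists>Z\<in>Obj C. \<exists>g. is_cokernel C Z X g Y f"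

text \<open>
  Exactness of \<open>X \<rightarrow> Y \<rightarrow> Z\<close> at \<open>Y\<close>: the image of the first arrow, that is, the kernel of its
  cokernel, is the kernel of the second.
\<close>

definition exact_at ::
  "('k, 'o, 'm, 'z) lin_cat_scheme \<Rightarrow> 'o \<Rightarrow> 'o \<Rightarrow> 'o \<Rightarrow> 'm \<Rightarrow> 'm \<Rightarrow> bool" where
  "exact_at C X Y Z f g \<longleftrightarrow>
     (\<exists>Q p I i. is_cokernel C X Y f Q p \<and> is_kernel C Y Q p I i \<and> is_kernel C Y Z g I i)"

definition short_exact ::
  "('k, 'o, 'm, 'z) lin_cat_scheme \<Rightarrow> 'o \<Rightarrow> 'o \<Rightarrow> 'o \<Rightarrow> 'm \<Rightarrow> 'm \<Rightarrow> bool" where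
  "short_exact C X Y Z f g \<longleftrightarrow> is_kernel C Y Z g X f \<and> is_cokernel C X Y f Z g"


section \<open>Linear functors and equivalences\<close>

record ('o, 'm, 'p, 'n) functor_data =
  obj_map :: "'o \<Rightarrow> 'p"
  arr_map :: "'o \<Rightarrow> 'o \<Rightarrow> 'm \<Rightarrow> 'n"

definition linear_functor ::
  "('k::field, 'o, 'm, 'y) lin_cat_scheme \<Rightarrow> ('k, 'p, 'n, 'z) lin_cat_scheme \<Rightarrow>
   ('o, 'm, 'p, 'n) functor_data \<Rightarrow> bool" where
  "linear_functor C D F \<longleftrightarrow>
     (\<forall>X\<in>Obj C. obj_map F X \<in> Obj D) \<and>
     (\<forall>X\<in>Obj C. \<forall>Y\<in>Obj C.
        linear_map class_ring (HomV C X Y) (HomV D (obj_map F X) (obj_map F Y)) (arr_map F X Y)) \<and>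
     (\<forall>X\<in>Obj C. arr_map F X X (Ident C X) = Ident D (obj_map F X)) \<and>
     (\<forall>X\<in>Obj C. \<forall>Y\<in>Obj C. \<forall>Z\<in>Obj C. \<forall>f\<in>Mor C X Y. \<forall>g\<in>Mor C Y Z.
        arr_map F X Z (g \<cdot>\<^bsub>C\<^esub> f) = arr_map F Y Z g \<cdot>\<^bsub>D\<^esub> arr_map F X Y f)"

definition exact_functor ::
  "('k::field, 'o, 'm, 'y) lin_cat_scheme \<Rightarrow> ('k, 'p, 'n, 'z) lin_cat_scheme \<Rightarrow>
   ('o, 'm, 'p, 'n) functor_data \<Rightarrow> bool" where
  "exact_functor C D F \<longleftrightarrow>
     (\<forall>X\<in>Obj C. \<forall>Y\<in>Obj C. \<forall>Z\<in>Obj C. \<forall>f g. short_exact C X Y Z f g \<longrightarrow>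
        short_exact D (obj_map F X) (obj_map F Y) (obj_map F Z) (arr_map F X Y f) (arr_map F Y Z g))"

definition functor_comp ::
  "('p, 'n, 'q, 'l) functor_data \<Rightarrow> ('o, 'm, 'p, 'n) functor_data \<Rightarrow> ('o, 'm, 'q, 'l) functor_data"
  where
  "functor_comp G F =
     \<lparr>obj_map = (\<lambda>X. obj_map G (obj_map F X)),
      arr_map = (\<lambda>X Y f. arr_map G (obj_map F X) (obj_map F Y) (arr_map F X Y f))\<rparr>"

definition id_functor :: "('o, 'm, 'o, 'm) functor_data" where
  "id_functor = \<lparr>obj_map = (\<lambda>X. X), arr_map = (\<lambda>X Y f. f)\<rparr>"

definition natural_iso ::
  "('k::field, 'o, 'm, 'y) lin_cat_scheme \<Rightarrow> ('k, 'p, 'n, 'z) lin_cat_scheme \<Rightarrow>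
   ('o, 'm, 'p, 'n) functor_data \<Rightarrow> ('o, 'm, 'p, 'n) functor_data \<Rightarrow> ('o \<Rightarrow> 'n) \<Rightarrow> bool" where
  "natural_iso C D F G \<eta> \<longleftrightarrow>
     (\<forall>X\<in>Obj C. isomorphism D (obj_map F X) (obj_map G X) (\<eta> X)) \<and>
     (\<forall>X\<in>Obj C. \<forall>Y\<in>Obj C. \<forall>f\<in>Mor C X Y.
        arr_map G X Y f \<cdot>\<^bsub>D\<^esub> \<eta> X = \<eta> Y \<cdot>\<^bsub>D\<^esub> arr_map F X Y f)"

definition lin_equivalent ::
  "('k::field, 'o, 'm, 'y) lin_cat_scheme \<Rightarrow> ('k, 'p, 'n, 'z) lin_cat_scheme \<Rightarrow> bool" where
  "lin_equivalent C D \<longleftrightarrow>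
     (\<exists>F G \<eta> \<epsilon>. linear_functor C D F \<and> linear_functor D C G \<and>
        natural_iso C C id_functor (functor_comp G F) \<eta> \<and>
        natural_iso D D (functor_comp F G) id_functor \<epsilon>)"


section \<open>Finite-dimensional modules over a finite-dimensional algebra\<close>

text \<open>
  Up to isomorphism, a finite-dimensional algebra has underlying space \<open>k\<^sup>n\<close>, and a
  finite-dimensional module over it has underlying space \<open>k\<^sup>m\<close> with action given by a
  homomorphism into the \<open>m \<times> m\<close> matrices. Module homomorphisms are then the matrices that
  intertwine the actions.
\<close>

definition fd_algebra :: "nat \<Rightarrow> ('k::field vec \<Rightarrow> 'k vec \<Rightarrow> 'k vec) \<Rightarrow> 'k vec \<Rightarrow> bool" where
  "fd_algebra n \<mu> u \<longleftrightarrow>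
     bilinear_map (module_vec TYPE('k) n) (module_vec TYPE('k) n) (module_vec TYPE('k) n) \<mu> \<and>
     (\<forall>a\<in>carrier_vec n. \<forall>b\<in>carrier_vec n. \<forall>c\<in>carrier_vec n. \<mu> (\<mu> a b) c = \<mu> a (\<mu> b c)) \<and>
     u \<in> carrier_vec n \<and> (\<forall>a\<in>carrier_vec n. \<mu> u a = a \<and> \<mu> a u = a)"

definition fd_module ::
  "nat \<Rightarrow> ('k::field vec \<Rightarrow> 'k vec \<Rightarrow> 'k vec) \<Rightarrow> 'k vec \<Rightarrow> nat \<Rightarrow> ('k vec \<Rightarrow> 'k mat) \<Rightarrow> bool" where
  "fd_module n \<mu> u m \<theta> \<longleftrightarrow>
     linear_map class_ring (module_vec TYPE('k) n) (module_mat TYPE('k) m m) \<theta> \<and>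
     (\<forall>a\<in>carrier_vec n. \<forall>b\<in>carrier_vec n. \<theta> (\<mu> a b) = \<theta> a * \<theta> b) \<and>
     \<theta> u = 1\<^sub>m m"

definition fd_modules ::
  "nat \<Rightarrow> ('k::field vec \<Rightarrow> 'k vec \<Rightarrow> 'k vec) \<Rightarrow> 'k vec \<Rightarrow>
   ('k, nat \<times> ('k vec \<Rightarrow> 'k mat), 'k mat) lin_cat" where
  "fd_modules n \<mu> u =
     \<lparr>Obj = {(m, \<theta>). fd_module n \<mu> u m \<theta>},
      HomV = (\<lambda>(m, \<theta>) (m', \<theta>').
        (module_mat TYPE('k) m' m)
          \<lparr>carrier := {T \<in> carrier_mat m' m. \<forall>a\<in>carrier_vec n. T * \<theta> a = \<theta>' a * T}\<rparr>),
      Ident = (\<lambda>(m, \<theta>). 1\<^sub>m m),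
      Comp = (*)\<rparr>"

definition finite_category :: "('k::field, 'o, 'm, 'z) lin_cat_scheme \<Rightarrow> bool" where
  "finite_category C \<longleftrightarrow> (\<exists>n \<mu> u. fd_algebra n \<mu> u \<and> lin_equivalent C (fd_modules n \<mu> u))"


section \<open>Strict tensor categories\<close>

record ('k, 'o, 'm) mon_cat = "('k, 'o, 'm) lin_cat" +
  TensO :: "'o \<Rightarrow> 'o \<Rightarrow> 'o" (infixr "\<otimes>\<^sub>o\<index>" 70)
  TensM :: "'m \<Rightarrow> 'm \<Rightarrow> 'm" (infixr "\<otimes>\<^sub>m\<index>" 70)
  UnitO :: "'o"

locale strict_monoidal_category = linear_category C
  for C :: "('k::field, 'o, 'm, 'z) mon_cat_scheme" (structure) +
  assumes tens_obj: "\<lbrakk>X \<in> Obj C; Y \<in> Obj C\<rbrakk> \<Longrightarrow> X \<otimes>\<^sub>o Y \<in> Obj C"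
    and unit_obj: "UnitO C \<in> Obj C"
    and tens_bilinear:
      "\<lbrakk>X \<in> Obj C; Y \<in> Obj C; X' \<in> Obj C; Y' \<in> Obj C\<rbrakk>
       \<Longrightarrow> bilinear_map (HomV C X Y) (HomV C X' Y') (HomV C (X \<otimes>\<^sub>o X') (Y \<otimes>\<^sub>o Y')) (\<lambda>f g. f \<otimes>\<^sub>m g)"
    and tens_ident:
      "\<lbrakk>X \<in> Obj C; Y \<in> Obj C\<rbrakk> \<Longrightarrow> Ident C X \<otimes>\<^sub>m Ident C Y = Ident C (X \<otimes>\<^sub>o Y)"
    and tens_comp:
      "\<lbrakk>X \<in> Obj C; Y \<in> Obj C; Z \<in> Obj C; X' \<in> Obj C; Y' \<in> Obj C; Z' \<in> Obj C;
        f \<in> Mor C X Y; g \<in> Mor C Y Z; f' \<in> Mor C X' Y'; g' \<in> Mor C Y' Z'\<rbrakk>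
       \<Longrightarrow> (g \<cdot> f) \<otimes>\<^sub>m (g' \<cdot> f') = (g \<otimes>\<^sub>m g') \<cdot> (f \<otimes>\<^sub>m f')"
    and tens_obj_assoc:
      "\<lbrakk>X \<in> Obj C; Y \<in> Obj C; Z \<in> Obj C\<rbrakk> \<Longrightarrow> (X \<otimes>\<^sub>o Y) \<otimes>\<^sub>o Z = X \<otimes>\<^sub>o (Y \<otimes>\<^sub>o Z)"
    and tens_mor_assoc:
      "\<lbrakk>X \<in> Obj C; Y \<in> Obj C; X' \<in> Obj C; Y' \<in> Obj C; X'' \<in> Obj C; Y'' \<in> Obj C;
        f \<in> Mor C X Y; g \<in> Mor C X' Y'; h \<in> Mor C X'' Y''\<rbrakk>
       \<Longrightarrow> (f \<otimes>\<^sub>m g) \<otimes>\<^sub>m h = f \<otimes>\<^sub>m (g \<otimes>\<^sub>m h)"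
    and unit_obj_left: "X \<in> Obj C \<Longrightarrow> UnitO C \<otimes>\<^sub>o X = X"
    and unit_obj_right: "X \<in> Obj C \<Longrightarrow> X \<otimes>\<^sub>o UnitO C = X"
    and unit_mor_left:
      "\<lbrakk>X \<in> Obj C; Y \<in> Obj C; f \<in> Mor C X Y\<rbrakk> \<Longrightarrow> Ident C (UnitO C) \<otimes>\<^sub>m f = f"
    and unit_mor_right:
      "\<lbrakk>X \<in> Obj C; Y \<in> Obj C; f \<in> Mor C X Y\<rbrakk> \<Longrightarrow> f \<otimes>\<^sub>m Ident C (UnitO C) = f"

text \<open>\<open>L\<close> is left dual to \<open>R\<close>, equivalently \<open>R\<close> is right dual to \<open>L\<close>.\<close>

definition dual_pair ::
  "('k, 'o, 'm, 'z) mon_cat_scheme \<Rightarrow> 'o \<Rightarrow> 'o \<Rightarrow> 'm \<Rightarrow> 'm \<Rightarrow> bool" where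
  "dual_pair C L R ev coev \<longleftrightarrow> L \<in> Obj C \<and> R \<in> Obj C \<and>
     ev \<in> Mor C (L \<otimes>\<^sub>o\<^bsub>C\<^esub> R) (UnitO C) \<and> coev \<in> Mor C (UnitO C) (R \<otimes>\<^sub>o\<^bsub>C\<^esub> L) \<and>
     (Ident C R \<otimes>\<^sub>m\<^bsub>C\<^esub> ev) \<cdot>\<^bsub>C\<^esub> (coev \<otimes>\<^sub>m\<^bsub>C\<^esub> Ident C R) = Ident C R \<and>
     (ev \<otimes>\<^sub>m\<^bsub>C\<^esub> Ident C L) \<cdot>\<^bsub>C\<^esub> (Ident C L \<otimes>\<^sub>m\<^bsub>C\<^esub> coev) = Ident C L"

definition rigid :: "('k, 'o, 'm, 'z) mon_cat_scheme \<Rightarrow> bool" where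
  "rigid C \<longleftrightarrow> (\<forall>X\<in>Obj C. (\<exists>L ev coev. dual_pair C L X ev coev) \<and>
                          (\<exists>R ev coev. dual_pair C X R ev coev))"

definition simple_object :: "('k, 'o, 'm, 'z) lin_cat_scheme \<Rightarrow> 'o \<Rightarrow> bool" where
  "simple_object C X \<longleftrightarrow> X \<in> Obj C \<and> \<not> zero_object C X \<and>
     (\<forall>Y\<in>Obj C. \<forall>i. monic C Y X i \<longrightarrow> zero_object C Y \<or> isomorphism C Y X i)"

text \<open>The only algebra homomorphism from \<open>k\<close> to \<open>End(1)\<close> sends \<open>c\<close> to \<open>c\<close> times the identity.\<close>

locale strict_tensor_category = abelian_category C + strict_monoidal_category C
  for C :: "('k::field, 'o, 'm, 'z) mon_cat_scheme" (structure) +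
  assumes rigid: "rigid C"
    and unit_simple: "simple_object C (UnitO C)"
    and unit_endomorphisms:
      "bij_betw (\<lambda>c. c \<odot>\<^bsub>HomV C (UnitO C) (UnitO C)\<^esub> Ident C (UnitO C))
         UNIV (Mor C (UnitO C) (UnitO C))"

locale finite_strict_tensor_category = strict_tensor_category +
  assumes finite: "finite_category C"

definition strict_monoidal_functor ::
  "('k::field, 'o, 'm, 'y) mon_cat_scheme \<Rightarrow> ('k, 'p, 'n, 'z) mon_cat_scheme \<Rightarrow>
   ('o, 'm, 'p, 'n) functor_data \<Rightarrow> bool" where
  "strict_monoidal_functor C D F \<longleftrightarrow>
     obj_map F (UnitO C) = UnitO D \<and>
     (\<forall>X\<in>Obj C. \<forall>Y\<in>Obj C. obj_map F (X \<otimes>\<^sub>o\<^bsub>C\<^esub> Y) = obj_map F X \<otimes>\<^sub>o\<^bsub>D\<^esub> obj_map F Y) \<and>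
     (\<forall>X\<in>Obj C. \<forall>Y\<in>Obj C. \<forall>X'\<in>Obj C. \<forall>Y'\<in>Obj C. \<forall>f\<in>Mor C X Y. \<forall>g\<in>Mor C X' Y'.
        arr_map F (X \<otimes>\<^sub>o\<^bsub>C\<^esub> X') (Y \<otimes>\<^sub>o\<^bsub>C\<^esub> Y') (f \<otimes>\<^sub>m\<^bsub>C\<^esub> g) =
        arr_map F X Y f \<otimes>\<^sub>m\<^bsub>D\<^esub> arr_map F X' Y' g)"


section \<open>The centralizer of a functor\<close>

definition half_braiding ::
  "('k::field, 'o, 'm, 'y) mon_cat_scheme \<Rightarrow> ('k, 'p, 'n, 'z) mon_cat_scheme \<Rightarrow>
   ('o, 'm, 'p, 'n) functor_data \<Rightarrow> 'p \<Rightarrow> ('o \<Rightarrow> 'n) \<Rightarrow> bool" where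
  "half_braiding C D F V \<rho> \<longleftrightarrow> \<rho> \<in> extensional (Obj C) \<and>
     (\<forall>X\<in>Obj C. isomorphism D (V \<otimes>\<^sub>o\<^bsub>D\<^esub> obj_map F X) (obj_map F X \<otimes>\<^sub>o\<^bsub>D\<^esub> V) (\<rho> X)) \<and>
     (\<forall>X\<in>Obj C. \<forall>Y\<in>Obj C. \<forall>f\<in>Mor C X Y.
        (arr_map F X Y f \<otimes>\<^sub>m\<^bsub>D\<^esub> Ident D V) \<cdot>\<^bsub>D\<^esub> \<rho> X =
        \<rho> Y \<cdot>\<^bsub>D\<^esub> (Ident D V \<otimes>\<^sub>m\<^bsub>D\<^esub> arr_map F X Y f)) \<and>
     (\<forall>X\<in>Obj C. \<forall>Y\<in>Obj C.
        \<rho> (X \<otimes>\<^sub>o\<^bsub>C\<^esub> Y) =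
        (Ident D (obj_map F X) \<otimes>\<^sub>m\<^bsub>D\<^esub> \<rho> Y) \<cdot>\<^bsub>D\<^esub> (\<rho> X \<otimes>\<^sub>m\<^bsub>D\<^esub> Ident D (obj_map F Y)))"

definition centralizer ::
  "('k::field, 'o, 'm, 'y) mon_cat_scheme \<Rightarrow> ('k, 'p, 'n, 'z) mon_cat_scheme \<Rightarrow>
   ('o, 'm, 'p, 'n) functor_data \<Rightarrow> ('k, 'p \<times> ('o \<Rightarrow> 'n), 'n) lin_cat" where
  "centralizer C D F =
     \<lparr>Obj = {(V, \<rho>). V \<in> Obj D \<and> half_braiding C D F V \<rho>},
      HomV = (\<lambda>(V, \<rho>) (W, \<sigma>). (HomV D V W)
        \<lparr>carrier := {f \<in> Mor D V W. \<forall>X\<in>Obj C.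
           (Ident D (obj_map F X) \<otimes>\<^sub>m\<^bsub>D\<^esub> f) \<cdot>\<^bsub>D\<^esub> \<rho> X =
           \<sigma> X \<cdot>\<^bsub>D\<^esub> (f \<otimes>\<^sub>m\<^bsub>D\<^esub> Ident D (obj_map F X))}\<rparr>),
      Ident = (\<lambda>(V, \<rho>). Ident D V),
      Comp = Comp D\<rparr>"

definition forgetful :: "('p \<times> ('o \<Rightarrow> 'n), 'n, 'p, 'n) functor_data" where
  "forgetful = \<lparr>obj_map = fst, arr_map = (\<lambda>V W f. f)\<rparr>"


section \<open>Davydov--Yetter cohomology\<close>

definition obj_lists :: "('k, 'o, 'm, 'z) lin_cat_scheme \<Rightarrow> nat \<Rightarrow> 'o list set" where
  "obj_lists C n = {Xs. set Xs \<subseteq> Obj C \<and> length Xs = n}"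

definition tensor_objs :: "('k, 'o, 'm, 'z) mon_cat_scheme \<Rightarrow> 'o list \<Rightarrow> 'o" where
  "tensor_objs D Xs = foldr (\<lambda>X Y. X \<otimes>\<^sub>o\<^bsub>D\<^esub> Y) Xs (UnitO D)"

definition tensor_mors :: "('k, 'o, 'm, 'z) mon_cat_scheme \<Rightarrow> 'm list \<Rightarrow> 'm" where
  "tensor_mors D fs = foldr (\<lambda>f g. f \<otimes>\<^sub>m\<^bsub>D\<^esub> g) fs (Ident D (UnitO D))"

text \<open>\<open>F(X\<^sub>1) \<otimes> \<dots> \<otimes> F(X\<^sub>n)\<close> and \<open>F(g\<^sub>1) \<otimes> \<dots> \<otimes> F(g\<^sub>n)\<close>, where \<open>g\<^sub>i : X\<^sub>i \<rightarrow> Y\<^sub>i\<close>.\<close>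

definition F_objs ::
  "('k, 'p, 'n, 'z) mon_cat_scheme \<Rightarrow> ('o, 'm, 'p, 'n) functor_data \<Rightarrow> 'o list \<Rightarrow> 'p" where
  "F_objs D F Xs = tensor_objs D (map (obj_map F) Xs)"

definition F_mors ::
  "('k, 'p, 'n, 'z) mon_cat_scheme \<Rightarrow> ('o, 'm, 'p, 'n) functor_data \<Rightarrow>
   'o list \<Rightarrow> 'o list \<Rightarrow> 'm list \<Rightarrow> 'n" where
  "F_mors D F Xs Ys gs =
     tensor_mors D (map (\<lambda>i. arr_map F (Xs ! i) (Ys ! i) (gs ! i)) [0..<length gs])"

text \<open>The space in which the component of a cochain at \<open>X\<^sub>1, \<dots>, X\<^sub>n\<close> lives.\<close>

definition DY_hom ::
  "('k, 'p, 'n, 'z) mon_cat_scheme \<Rightarrow> ('o, 'm, 'p, 'n) functor_data \<Rightarrow> 'p \<Rightarrow> 'p \<Rightarrow>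
   'o list \<Rightarrow> ('k, 'n) module" where
  "DY_hom D F V W Xs = HomV D (V \<otimes>\<^sub>o\<^bsub>D\<^esub> F_objs D F Xs) (F_objs D F Xs \<otimes>\<^sub>o\<^bsub>D\<^esub> W)"

definition DY_cochains ::
  "('k::field, 'o, 'm, 'y) mon_cat_scheme \<Rightarrow> ('k, 'p, 'n, 'z) mon_cat_scheme \<Rightarrow>
   ('o, 'm, 'p, 'n) functor_data \<Rightarrow> 'p \<times> ('o \<Rightarrow> 'n) \<Rightarrow> 'p \<times> ('o \<Rightarrow> 'n) \<Rightarrow> nat \<Rightarrow>
   ('k, 'o list \<Rightarrow> 'n) module" where
  "DY_cochains C D F = (\<lambda>(V, \<rho>) (W, \<sigma>) n.
     \<lparr>carrier = {f \<in> extensional (obj_lists C n).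
        (\<forall>Xs\<in>obj_lists C n. f Xs \<in> carrier (DY_hom D F V W Xs)) \<and>
        (\<forall>Xs\<in>obj_lists C n. \<forall>Ys\<in>obj_lists C n. \<forall>gs.
           length gs = n \<and> (\<forall>i<n. gs ! i \<in> Mor C (Xs ! i) (Ys ! i)) \<longrightarrow>
           (F_mors D F Xs Ys gs \<otimes>\<^sub>m\<^bsub>D\<^esub> Ident D W) \<cdot>\<^bsub>D\<^esub> f Xs =
           f Ys \<cdot>\<^bsub>D\<^esub> (Ident D V \<otimes>\<^sub>m\<^bsub>D\<^esub> F_mors D F Xs Ys gs))},
      mult = undefined, one = undefined,
      zero = (\<lambda>Xs\<in>obj_lists C n. \<zero>\<^bsub>DY_hom D F V W Xs\<^esub>),
      add = (\<lambda>f g. \<lambda>Xs\<in>obj_lists C n. f Xs \<oplus>\<^bsub>DY_hom D F V W Xs\<^esub> g Xs),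
      smult = (\<lambda>c f. \<lambda>Xs\<in>obj_lists C n. c \<odot>\<^bsub>DY_hom D F V W Xs\<^esub> f Xs)\<rparr>)"

text \<open>
  \<open>merge_at C i [X\<^sub>0, \<dots>, X\<^sub>n]\<close> is \<open>[X\<^sub>0, \<dots>, X\<^sub>i\<^sub>-\<^sub>1 \<otimes> X\<^sub>i, \<dots>, X\<^sub>n]\<close>, for \<open>1 \<le> i \<le> n\<close>.
\<close>

definition merge_at :: "('k, 'o, 'm, 'z) mon_cat_scheme \<Rightarrow> nat \<Rightarrow> 'o list \<Rightarrow> 'o list" where
  "merge_at C i Xs = take (i - 1) Xs @ (Xs ! (i - 1) \<otimes>\<^sub>o\<^bsub>C\<^esub> Xs ! i) # drop (i + 1) Xs"

definition DY_diff ::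
  "('k::field, 'o, 'm, 'y) mon_cat_scheme \<Rightarrow> ('k, 'p, 'n, 'z) mon_cat_scheme \<Rightarrow>
   ('o, 'm, 'p, 'n) functor_data \<Rightarrow> 'p \<times> ('o \<Rightarrow> 'n) \<Rightarrow> 'p \<times> ('o \<Rightarrow> 'n) \<Rightarrow> nat \<Rightarrow>
   ('o list \<Rightarrow> 'n) \<Rightarrow> ('o list \<Rightarrow> 'n)" where
  "DY_diff C D F = (\<lambda>(V, \<rho>) (W, \<sigma>) n f. \<lambda>Xs\<in>obj_lists C (Suc n).
     let H = DY_hom D F V W Xs in
       ((Ident D (obj_map F (hd Xs)) \<otimes>\<^sub>m\<^bsub>D\<^esub> f (tl Xs)) \<cdot>\<^bsub>D\<^esub>
          (\<rho> (hd Xs) \<otimes>\<^sub>m\<^bsub>D\<^esub> Ident D (F_objs D F (tl Xs)))) \<oplus>\<^bsub>H\<^esub>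
       (\<Oplus>\<^bsub>H\<^esub>i\<in>{1..n}. (- 1) ^ i \<odot>\<^bsub>H\<^esub> f (merge_at C i Xs)) \<oplus>\<^bsub>H\<^esub>
       (- 1) ^ (n + 1) \<odot>\<^bsub>H\<^esub>
         ((Ident D (F_objs D F (butlast Xs)) \<otimes>\<^sub>m\<^bsub>D\<^esub> \<sigma> (last Xs)) \<cdot>\<^bsub>D\<^esub>
          (f (butlast Xs) \<otimes>\<^sub>m\<^bsub>D\<^esub> Ident D (obj_map F (last Xs)))))"

definition DY_cohomology ::
  "('k::field, 'o, 'm, 'y) mon_cat_scheme \<Rightarrow> ('k, 'p, 'n, 'z) mon_cat_scheme \<Rightarrow>
   ('o, 'm, 'p, 'n) functor_data \<Rightarrow> 'p \<times> ('o \<Rightarrow> 'n) \<Rightarrow> 'p \<times> ('o \<Rightarrow> 'n) \<Rightarrow> nat \<Rightarrow>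
   ('k, ('o list \<Rightarrow> 'n) set) module" where
  "DY_cohomology C D F V W n = cohomology (DY_cochains C D F V W) (DY_diff C D F V W) n"


section \<open>Relative Ext\<close>

definition allowable ::
  "('k::field, 'o, 'm, 'y) lin_cat_scheme \<Rightarrow> ('k, 'p, 'n, 'z) lin_cat_scheme \<Rightarrow>
   ('o, 'm, 'p, 'n) functor_data \<Rightarrow> 'o \<Rightarrow> 'o \<Rightarrow> 'm \<Rightarrow> bool" where
  "allowable A B U V W f \<longleftrightarrow> f \<in> Mor A V W \<and>
     (\<exists>s\<in>Mor B (obj_map U W) (obj_map U V).
        arr_map U V W f \<cdot>\<^bsub>B\<^esub> s \<cdot>\<^bsub>B\<^esub> arr_map U V W f = arr_map U V W f)"

definition rel_projective ::
  "('k::field, 'o, 'm, 'y) lin_cat_scheme \<Rightarrow> ('k, 'p, 'n, 'z) lin_cat_scheme \<Rightarrow>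
   ('o, 'm, 'p, 'n) functor_data \<Rightarrow> 'o \<Rightarrow> bool" where
  "rel_projective A B U P \<longleftrightarrow> P \<in> Obj A \<and>
     (\<forall>V\<in>Obj A. \<forall>W\<in>Obj A. \<forall>e. epic A V W e \<and> allowable A B U V W e \<longrightarrow>
        (\<forall>g\<in>Mor A P W. \<exists>h\<in>Mor A P V. e \<cdot>\<^bsub>A\<^esub> h = g))"

text \<open>The resolution \<open>\<dots> \<rightarrow> P 1 \<rightarrow> P 0 \<rightarrow> V \<rightarrow> 0\<close> has arrows \<open>d n : P (n + 1) \<rightarrow> P n\<close> and \<open>\<epsilon> : P 0 \<rightarrow> V\<close>.\<close>

definition rel_projective_resolution ::
  "('k::field, 'o, 'm, 'y) lin_cat_scheme \<Rightarrow> ('k, 'p, 'n, 'z) lin_cat_scheme \<Rightarrow>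
   ('o, 'm, 'p, 'n) functor_data \<Rightarrow> 'o \<Rightarrow> (nat \<Rightarrow> 'o) \<Rightarrow> (nat \<Rightarrow> 'm) \<Rightarrow> 'm \<Rightarrow> bool" where
  "rel_projective_resolution A B U V P d \<epsilon> \<longleftrightarrow>
     (\<forall>n. rel_projective A B U (P n)) \<and>
     allowable A B U (P 0) V \<epsilon> \<and> (\<forall>n. allowable A B U (P (Suc n)) (P n) (d n)) \<and>
     epic A (P 0) V \<epsilon> \<and> exact_at A (P 1) (P 0) V (d 0) \<epsilon> \<and>
     (\<forall>n. exact_at A (P (Suc (Suc n))) (P (Suc n)) (P n) (d (Suc n)) (d n))"

text \<open>
  Relative Ext does not depend on the chosen resolution up to isomorphism. The choice below
  is meaningful only if a resolution of \<open>V\<close> exists.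
\<close>

definition rel_Ext ::
  "('k::field, 'o, 'm, 'y) lin_cat_scheme \<Rightarrow> ('k, 'p, 'n, 'z) lin_cat_scheme \<Rightarrow>
   ('o, 'm, 'p, 'n) functor_data \<Rightarrow> 'o \<Rightarrow> 'o \<Rightarrow> nat \<Rightarrow> ('k, 'm set) module" where
  "rel_Ext A B U V W n =
     (let (P, d) = (SOME (P, d). \<exists>\<epsilon>. rel_projective_resolution A B U V P d \<epsilon>)
      in cohomology (\<lambda>i. HomV A (P i) W) (\<lambda>i f. f \<cdot>\<^bsub>A\<^esub> d i) n)"

end

theory Submission
  imports Defs
begin

text \<open>
  Natural transformations \<open>M \<otimes> F(X) \<rightarrow> F(X) \<otimes> W\<close> are determined by their component at a separator of the finite
  category \<open>C\<close>, hence are represented by an object \<open>Z(M)\<close> of \<open>D\<close>. This object carries a half-braiding, and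
  \<open>M \<mapsto> Z(M)\<close> is left adjoint to the forgetful functor. On a free object the universal property contracts the
  Davydov--Yetter complex. Relatively projective objects are retracts of free ones, so their complex is acyclic
  with \<open>H\<^sup>0 = Hom(P, W)\<close>; the same contraction yields \<open>\<delta>\<delta> = 0\<close>, by induction on the degree. A cochain depends on
  the first coefficient only through precomposition in \<open>D\<close>, where an allowable resolution is split. Hence the
  double complex of cochains with coefficients in a relatively projective resolution has exact rows and columns,
  and a diagram chase identifies the cohomologies of its two edges.
\<close>

section \<open>Vector spaces and their quotients\<close>

text \<open>Exactness in the centralizer is reached only along allowable arrows: their kernels and
  cokernels are images of idempotents of \<open>D\<close> to which the half-braiding restricts, and
  an exact pair of allowable arrows f, g with inner inverses s, t becomes the equation (1 - f s)(1 -
  t g) = 0 in \<open>D\<close>. The object \<open>Zo M\<close> is the coend of F(X)' \<otimes> M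
  \<otimes> F(X), with F(X)' a left dual of F(X). Since a finite category offers only finite
  colimits, naturality is tested at a separator G: an arrow out of L \<otimes> M \<otimes> F(G),
  with L left dual to F(G), comes from a natural transformation iff it kills one relation for each
  member of a finite list spanning End(G). Exactness of F and rigidity, by which tensoring preserves
  cokernels, extend the component at G to all objects. \<open>rel_Ext\<close> takes its resolution
  by choice, so matching one particular resolution with the Davydov--Yetter complex would not settle
  the theorem; the double complex works for whichever resolution was chosen. Deriving
  \<delta>\<delta> = 0 from h\<delta> = 1 - \<delta>h spares the cancellation of signed double sums
  over merged positions.\<close>

context
  fixes V :: "('k::field, 'a) module"
  assumes vs: "vectorspace class_ring V"
begin

interpretation vectorspace class_ring V by (rule vs)

lemma vs_zero: "\<zero>\<^bsub>V\<^esub> \<in> carrier V" by simp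
lemma vs_add: "x \<in> carrier V \<Longrightarrow> y \<in> carrier V \<Longrightarrow> x \<oplus>\<^bsub>V\<^esub> y \<in> carrier V" by simp
lemma vs_scale: "x \<in> carrier V \<Longrightarrow> c \<odot>\<^bsub>V\<^esub> x \<in> carrier V" by (rule smult_closed) simp
lemma vs_comm: "x \<in> carrier V \<Longrightarrow> y \<in> carrier V \<Longrightarrow> x \<oplus>\<^bsub>V\<^esub> y = y \<oplus>\<^bsub>V\<^esub> x" by (rule a_comm)
lemma vs_assoc:
  "x \<in> carrier V \<Longrightarrow> y \<in> carrier V \<Longrightarrow> z \<in> carrier V \<Longrightarrow> (x \<oplus>\<^bsub>V\<^esub> y) \<oplus>\<^bsub>V\<^esub> z = x \<oplus>\<^bsub>V\<^esub> (y \<oplus>\<^bsub>V\<^esub> z)"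
  by (rule a_assoc)
lemma vs_lcomm:
  "x \<in> carrier V \<Longrightarrow> y \<in> carrier V \<Longrightarrow> z \<in> carrier V \<Longrightarrow> x \<oplus>\<^bsub>V\<^esub> (y \<oplus>\<^bsub>V\<^esub> z) = y \<oplus>\<^bsub>V\<^esub> (x \<oplus>\<^bsub>V\<^esub> z)"
  by (rule a_lcomm)
lemma vs_zero_left: "x \<in> carrier V \<Longrightarrow> \<zero>\<^bsub>V\<^esub> \<oplus>\<^bsub>V\<^esub> x = x" by simp
lemma vs_zero_right: "x \<in> carrier V \<Longrightarrow> x \<oplus>\<^bsub>V\<^esub> \<zero>\<^bsub>V\<^esub> = x" by simp
lemma vs_scale_add:
  "x \<in> carrier V \<Longrightarrow> y \<in> carrier V \<Longrightarrow> c \<odot>\<^bsub>V\<^esub> (x \<oplus>\<^bsub>V\<^esub> y) = c \<odot>\<^bsub>V\<^esub> x \<oplus>\<^bsub>V\<^esub> c \<odot>\<^bsub>V\<^esub> y"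
  using smult_r_distr[of c x y] by simp
lemma vs_add_scale: "x \<in> carrier V \<Longrightarrow> (a + b) \<odot>\<^bsub>V\<^esub> x = a \<odot>\<^bsub>V\<^esub> x \<oplus>\<^bsub>V\<^esub> b \<odot>\<^bsub>V\<^esub> x"
  using smult_l_distr[of a b x] by simp
lemma vs_scale_scale: "x \<in> carrier V \<Longrightarrow> a \<odot>\<^bsub>V\<^esub> (b \<odot>\<^bsub>V\<^esub> x) = (a * b) \<odot>\<^bsub>V\<^esub> x"
  using smult_assoc1[of a b x] by simp
lemma vs_one: "x \<in> carrier V \<Longrightarrow> 1 \<odot>\<^bsub>V\<^esub> x = x"
  using smult_one[of x] by simp
lemma vs_scale_zero: "c \<odot>\<^bsub>V\<^esub> \<zero>\<^bsub>V\<^esub> = \<zero>\<^bsub>V\<^esub>"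
  using smult_r_null[of c] by simp
lemma vs_zero_scale: "x \<in> carrier V \<Longrightarrow> 0 \<odot>\<^bsub>V\<^esub> x = \<zero>\<^bsub>V\<^esub>"
  using smult_l_null[of x] by simp
lemma vs_neg_left: "x \<in> carrier V \<Longrightarrow> (- 1) \<odot>\<^bsub>V\<^esub> x \<oplus>\<^bsub>V\<^esub> x = \<zero>\<^bsub>V\<^esub>"
  using vs_add_scale[of x "-1" 1] by (simp add: vs_one vs_zero_scale)
lemma vs_neg_right: "x \<in> carrier V \<Longrightarrow> x \<oplus>\<^bsub>V\<^esub> (- 1) \<odot>\<^bsub>V\<^esub> x = \<zero>\<^bsub>V\<^esub>"
  using vs_add_scale[of x 1 "-1"] by (simp add: vs_one vs_zero_scale)
lemma vs_diff_cancel: "x \<in> carrier V \<Longrightarrow> y \<in> carrier V \<Longrightarrow> (y \<oplus>\<^bsub>V\<^esub> (- 1) \<odot>\<^bsub>V\<^esub> x) \<oplus>\<^bsub>V\<^esub> x = y"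
  by (simp add: vs_assoc vs_scale vs_neg_left)

end

lemmas vs_closed = vs_zero vs_add vs_scale
lemmas vs_ac = vs_assoc vs_comm vs_lcomm

lemma vectorspaceI:
  fixes V :: "('k::field, 'a) module"
  assumes "\<zero>\<^bsub>V\<^esub> \<in> carrier V"
    and "\<And>x y. x \<in> carrier V \<Longrightarrow> y \<in> carrier V \<Longrightarrow> x \<oplus>\<^bsub>V\<^esub> y \<in> carrier V"
    and "\<And>c x. x \<in> carrier V \<Longrightarrow> c \<odot>\<^bsub>V\<^esub> x \<in> carrier V"
    and "\<And>x y. x \<in> carrier V \<Longrightarrow> y \<in> carrier V \<Longrightarrow> x \<oplus>\<^bsub>V\<^esub> y = y \<oplus>\<^bsub>V\<^esub> x"
    and "\<And>x y z. x \<in> carrier V \<Longrightarrow> y \<in> carrier V \<Longrightarrow> z \<in> carrier V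
           \<Longrightarrow> (x \<oplus>\<^bsub>V\<^esub> y) \<oplus>\<^bsub>V\<^esub> z = x \<oplus>\<^bsub>V\<^esub> (y \<oplus>\<^bsub>V\<^esub> z)"
    and "\<And>x. x \<in> carrier V \<Longrightarrow> x \<oplus>\<^bsub>V\<^esub> \<zero>\<^bsub>V\<^esub> = x"
    and "\<And>x. x \<in> carrier V \<Longrightarrow> x \<oplus>\<^bsub>V\<^esub> (- 1) \<odot>\<^bsub>V\<^esub> x = \<zero>\<^bsub>V\<^esub>"
    and "\<And>c x y. x \<in> carrier V \<Longrightarrow> y \<in> carrier V
           \<Longrightarrow> c \<odot>\<^bsub>V\<^esub> (x \<oplus>\<^bsub>V\<^esub> y) = c \<odot>\<^bsub>V\<^esub> x \<oplus>\<^bsub>V\<^esub> c \<odot>\<^bsub>V\<^esub> y"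
    and "\<And>a b x. x \<in> carrier V \<Longrightarrow> (a + b) \<odot>\<^bsub>V\<^esub> x = a \<odot>\<^bsub>V\<^esub> x \<oplus>\<^bsub>V\<^esub> b \<odot>\<^bsub>V\<^esub> x"
    and "\<And>a b x. x \<in> carrier V \<Longrightarrow> a \<odot>\<^bsub>V\<^esub> (b \<odot>\<^bsub>V\<^esub> x) = (a * b) \<odot>\<^bsub>V\<^esub> x"
    and "\<And>x. x \<in> carrier V \<Longrightarrow> 1 \<odot>\<^bsub>V\<^esub> x = x"
  shows "vectorspace class_ring V"
proof (rule vs_criteria)
  show "field (class_ring :: 'k ring)" by (rule class_field)
  show "\<forall>v\<in>carrier V. \<exists>w\<in>carrier V. v \<oplus>\<^bsub>V\<^esub> w = \<zero>\<^bsub>V\<^esub>"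
    using assms(3,7) by blast
  show "\<forall>v w. v \<in> carrier V \<and> w \<in> carrier V \<longrightarrow> v \<oplus>\<^bsub>V\<^esub> w = w \<oplus>\<^bsub>V\<^esub> v"
    using assms(4) by blast
  show "\<forall>v w x. v \<in> carrier V \<and> w \<in> carrier V \<and> x \<in> carrier V
      \<longrightarrow> v \<oplus>\<^bsub>V\<^esub> w \<oplus>\<^bsub>V\<^esub> x = v \<oplus>\<^bsub>V\<^esub> (w \<oplus>\<^bsub>V\<^esub> x)"
    using assms(5) by blast
qed (use assms(1-3,6-) in simp_all)

lemma linear_mapI:
  fixes V :: "('k::field, 'a) module" and W :: "('k, 'b) module"
  assumes "vectorspace class_ring V" "vectorspace class_ring W"
    and "\<And>x. x \<in> carrier V \<Longrightarrow> T x \<in> carrier W"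
    and "\<And>x y. x \<in> carrier V \<Longrightarrow> y \<in> carrier V \<Longrightarrow> T (x \<oplus>\<^bsub>V\<^esub> y) = T x \<oplus>\<^bsub>W\<^esub> T y"
    and "\<And>c x. x \<in> carrier V \<Longrightarrow> T (c \<odot>\<^bsub>V\<^esub> x) = c \<odot>\<^bsub>W\<^esub> T x"
  shows "linear_map class_ring V W T"
proof -
  interpret V: vectorspace class_ring V by fact
  interpret W: vectorspace class_ring W by fact
  have "T \<in> LinearCombinations.module_hom class_ring V W"
    unfolding LinearCombinations.module_hom_def using assms(3-5) by blast
  hence "mod_hom class_ring V W T"
    by unfold_locales
  thus ?thesis
    using assms(1,2) by (intro linear_map.intro)
qed

context
  fixes V :: "('k::field, 'a) module" and W :: "('k, 'b) module" and T
  assumes T: "linear_map class_ring V W T"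
begin

interpretation linear_map class_ring V W T by (rule T)

lemma lm_vs_left: "vectorspace class_ring V" by unfold_locales
lemma lm_vs_right: "vectorspace class_ring W" by unfold_locales
lemma lm_closed: "x \<in> carrier V \<Longrightarrow> T x \<in> carrier W" by simp
lemma lm_add: "x \<in> carrier V \<Longrightarrow> y \<in> carrier V \<Longrightarrow> T (x \<oplus>\<^bsub>V\<^esub> y) = T x \<oplus>\<^bsub>W\<^esub> T y" by simp
lemma lm_scale: "x \<in> carrier V \<Longrightarrow> T (c \<odot>\<^bsub>V\<^esub> x) = c \<odot>\<^bsub>W\<^esub> T x"
  using T_smult[of c x] by simp
lemma lm_zero: "T \<zero>\<^bsub>V\<^esub> = \<zero>\<^bsub>W\<^esub>" by simp

end

section \<open>Subspaces and quotient spaces\<close>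

definition lin_closed :: "('k::field, 'a) module \<Rightarrow> 'a set \<Rightarrow> bool" where
  "lin_closed V U \<longleftrightarrow> U \<subseteq> carrier V \<and> \<zero>\<^bsub>V\<^esub> \<in> U \<and>
     (\<forall>x\<in>U. \<forall>y\<in>U. x \<oplus>\<^bsub>V\<^esub> y \<in> U) \<and> (\<forall>c. \<forall>x\<in>U. c \<odot>\<^bsub>V\<^esub> x \<in> U)"

lemma lin_closedI:
  assumes "\<And>x. x \<in> U \<Longrightarrow> x \<in> carrier V" "\<zero>\<^bsub>V\<^esub> \<in> U"
    "\<And>x y. x \<in> U \<Longrightarrow> y \<in> U \<Longrightarrow> x \<oplus>\<^bsub>V\<^esub> y \<in> U" "\<And>c x. x \<in> U \<Longrightarrow> c \<odot>\<^bsub>V\<^esub> x \<in> U"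
  shows "lin_closed V U"
  using assms by (auto simp: lin_closed_def)

lemma vectorspace_restrict:
  assumes V: "vectorspace class_ring V" and U: "lin_closed V U"
  shows "vectorspace class_ring (V\<lparr>carrier := U\<rparr>)"
proof -
  have U': "x \<in> U \<Longrightarrow> x \<in> carrier V" for x using U by (auto simp: lin_closed_def)
  show ?thesis
  proof (rule vectorspaceI)
    fix x y assume "x \<in> carrier (V\<lparr>carrier := U\<rparr>)" "y \<in> carrier (V\<lparr>carrier := U\<rparr>)"
    thus "x \<oplus>\<^bsub>V\<lparr>carrier := U\<rparr>\<^esub> y = y \<oplus>\<^bsub>V\<lparr>carrier := U\<rparr>\<^esub> x"
      using vs_comm[OF V] by (simp add: U')
  qed (use U in \<open>simp_all add: lin_closed_def U' vs_assoc[OF V] vs_zero_right[OF V]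
        vs_neg_right[OF V] vs_scale_add[OF V] vs_add_scale[OF V] vs_scale_scale[OF V] vs_one[OF V]\<close>)
qed

context
  fixes V :: "('k::field, 'a) module" and B
  assumes V: "vectorspace class_ring V" and B: "lin_closed V B"
begin

lemma B_carrier: "b \<in> B \<Longrightarrow> b \<in> carrier V"
  using B by (auto simp: lin_closed_def)

lemmas vsV = vs_closed[OF V] vs_zero_left[OF V] vs_zero_right[OF V] vs_scale_add[OF V]
  vs_scale_scale[OF V] vs_one[OF V]

definition coset where "coset x = B +>\<^bsub>V\<^esub> x"

lemma coset_eq: "coset x = {b \<oplus>\<^bsub>V\<^esub> x | b. b \<in> B}"
  by (auto simp: coset_def a_r_coset_def')

lemma coset_eq_iff:
  assumes x: "x \<in> carrier V" and y: "y \<in> carrier V"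
  shows "coset x = coset y \<longleftrightarrow> x \<oplus>\<^bsub>V\<^esub> (- 1) \<odot>\<^bsub>V\<^esub> y \<in> B"
proof
  assume "coset x = coset y"
  moreover have "x \<in> coset x" using B x by (force simp: coset_eq lin_closed_def vsV)
  ultimately obtain b where b: "b \<in> B" "x = b \<oplus>\<^bsub>V\<^esub> y" by (auto simp: coset_eq)
  hence "x \<oplus>\<^bsub>V\<^esub> (- 1) \<odot>\<^bsub>V\<^esub> y = b"
    using y by (simp add: vs_assoc[OF V] vsV B_carrier vs_neg_right[OF V])
  thus "x \<oplus>\<^bsub>V\<^esub> (- 1) \<odot>\<^bsub>V\<^esub> y \<in> B" using b by simp
next
  assume d: "x \<oplus>\<^bsub>V\<^esub> (- 1) \<odot>\<^bsub>V\<^esub> y \<in> B" (is "?d \<in> B")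
  have xd: "x = ?d \<oplus>\<^bsub>V\<^esub> y" using x y vs_diff_cancel[OF V y x] by simp
  have yd: "y = (- 1) \<odot>\<^bsub>V\<^esub> ?d \<oplus>\<^bsub>V\<^esub> x"
    using x y by (simp add: vsV vs_assoc[OF V] vs_comm[OF V, of _ y] vs_neg_right[OF V] vs_neg_left[OF V])
  have d': "(- 1) \<odot>\<^bsub>V\<^esub> ?d \<in> B" using d B by (auto simp: lin_closed_def)
  \<comment> \<open>An element e of B added to a representative is absorbed into the summand from B.
    This is used with e = x - y in one direction and e = y - x in the other.\<close>
  have shift: "\<exists>b'\<in>B. b \<oplus>\<^bsub>V\<^esub> (e \<oplus>\<^bsub>V\<^esub> z) = b' \<oplus>\<^bsub>V\<^esub> z"
    if "b \<in> B" "e \<in> B" "z \<in> carrier V" for b e z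
    using that B by (intro bexI[of _ "b \<oplus>\<^bsub>V\<^esub> e"]) (auto simp: vs_assoc[OF V] B_carrier lin_closed_def)
  show "coset x = coset y"
  proof (intro equalityI subsetI)
    fix z assume "z \<in> coset x"
    then obtain b where "b \<in> B" "z = b \<oplus>\<^bsub>V\<^esub> x" by (auto simp: coset_eq)
    with shift[OF _ d y, of b] xd show "z \<in> coset y" by (auto simp: coset_eq)
  next
    fix z assume "z \<in> coset y"
    then obtain b where "b \<in> B" "z = b \<oplus>\<^bsub>V\<^esub> y" by (auto simp: coset_eq)
    with shift[OF _ d' x, of b] yd show "z \<in> coset x" by (auto simp: coset_eq)
  qed
qed

lemma carrier_quotient: "carrier (quotient_space V B) = coset ` carrier V"
  by (auto simp: quotient_space_def coset_def A_RCOSETS_def')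

lemma zero_quotient: "\<zero>\<^bsub>quotient_space V B\<^esub> = coset \<zero>\<^bsub>V\<^esub>"
  by (auto simp: quotient_space_def coset_eq vsV B_carrier intro!: exI)

lemma add_quotient:
  assumes x: "x \<in> carrier V" and y: "y \<in> carrier V"
  shows "coset x \<oplus>\<^bsub>quotient_space V B\<^esub> coset y = coset (x \<oplus>\<^bsub>V\<^esub> y)"
proof -
  have "coset x <+>\<^bsub>V\<^esub> coset y = {(b \<oplus>\<^bsub>V\<^esub> x) \<oplus>\<^bsub>V\<^esub> (b' \<oplus>\<^bsub>V\<^esub> y) | b b'. b \<in> B \<and> b' \<in> B}"
    by (auto simp: set_add_def' coset_eq)
  also have "\<dots> = {(b \<oplus>\<^bsub>V\<^esub> b') \<oplus>\<^bsub>V\<^esub> (x \<oplus>\<^bsub>V\<^esub> y) | b b'. b \<in> B \<and> b' \<in> B}"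
  proof -
    have "(b \<oplus>\<^bsub>V\<^esub> x) \<oplus>\<^bsub>V\<^esub> (b' \<oplus>\<^bsub>V\<^esub> y) = (b \<oplus>\<^bsub>V\<^esub> b') \<oplus>\<^bsub>V\<^esub> (x \<oplus>\<^bsub>V\<^esub> y)" if "b \<in> B" "b' \<in> B" for b b'
      using x y that by (simp add: vs_assoc[OF V] vs_lcomm[OF V, of x] vsV B_carrier)
    thus ?thesis by (intro Collect_cong ex_cong1) auto
  qed
  also have "\<dots> = coset (x \<oplus>\<^bsub>V\<^esub> y)"
  proof (intro equalityI subsetI)
    fix z assume "z \<in> {(b \<oplus>\<^bsub>V\<^esub> b') \<oplus>\<^bsub>V\<^esub> (x \<oplus>\<^bsub>V\<^esub> y) | b b'. b \<in> B \<and> b' \<in> B}"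
    thus "z \<in> coset (x \<oplus>\<^bsub>V\<^esub> y)" using B by (auto simp: coset_eq lin_closed_def)
  next
    fix z assume "z \<in> coset (x \<oplus>\<^bsub>V\<^esub> y)"
    then obtain b where b: "b \<in> B" "z = b \<oplus>\<^bsub>V\<^esub> (x \<oplus>\<^bsub>V\<^esub> y)" by (auto simp: coset_eq)
    hence "z = (b \<oplus>\<^bsub>V\<^esub> \<zero>\<^bsub>V\<^esub>) \<oplus>\<^bsub>V\<^esub> (x \<oplus>\<^bsub>V\<^esub> y)" by (simp add: vsV B_carrier)
    moreover have "\<zero>\<^bsub>V\<^esub> \<in> B" using B by (simp add: lin_closed_def)
    ultimately show "z \<in> {(b \<oplus>\<^bsub>V\<^esub> b') \<oplus>\<^bsub>V\<^esub> (x \<oplus>\<^bsub>V\<^esub> y) | b b'. b \<in> B \<and> b' \<in> B}" using b(1) by blast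
  qed
  finally show ?thesis by (simp add: quotient_space_def)
qed

lemma scale_quotient:
  assumes x: "x \<in> carrier V"
  shows "c \<odot>\<^bsub>quotient_space V B\<^esub> coset x = coset (c \<odot>\<^bsub>V\<^esub> x)"
proof -
  have "{b \<oplus>\<^bsub>V\<^esub> c \<odot>\<^bsub>V\<^esub> s | b s. b \<in> B \<and> s \<in> coset x}
      = {b \<oplus>\<^bsub>V\<^esub> c \<odot>\<^bsub>V\<^esub> (b' \<oplus>\<^bsub>V\<^esub> x) | b b'. b \<in> B \<and> b' \<in> B}"
    by (auto simp: coset_eq)
  also have "\<dots> = {(b \<oplus>\<^bsub>V\<^esub> c \<odot>\<^bsub>V\<^esub> b') \<oplus>\<^bsub>V\<^esub> c \<odot>\<^bsub>V\<^esub> x | b b'. b \<in> B \<and> b' \<in> B}"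
  proof -
    have "b \<oplus>\<^bsub>V\<^esub> c \<odot>\<^bsub>V\<^esub> (b' \<oplus>\<^bsub>V\<^esub> x) = (b \<oplus>\<^bsub>V\<^esub> c \<odot>\<^bsub>V\<^esub> b') \<oplus>\<^bsub>V\<^esub> c \<odot>\<^bsub>V\<^esub> x" if "b \<in> B" "b' \<in> B" for b b'
      using x that by (simp add: vs_assoc[OF V] vsV B_carrier)
    thus ?thesis by (intro Collect_cong ex_cong1) auto
  qed
  also have "\<dots> = coset (c \<odot>\<^bsub>V\<^esub> x)"
  proof (intro equalityI subsetI)
    fix z assume "z \<in> {(b \<oplus>\<^bsub>V\<^esub> c \<odot>\<^bsub>V\<^esub> b') \<oplus>\<^bsub>V\<^esub> c \<odot>\<^bsub>V\<^esub> x | b b'. b \<in> B \<and> b' \<in> B}"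
    thus "z \<in> coset (c \<odot>\<^bsub>V\<^esub> x)" using B by (auto simp: coset_eq lin_closed_def)
  next
    fix z assume "z \<in> coset (c \<odot>\<^bsub>V\<^esub> x)"
    then obtain b where b: "b \<in> B" "z = b \<oplus>\<^bsub>V\<^esub> c \<odot>\<^bsub>V\<^esub> x" by (auto simp: coset_eq)
    hence "z = (b \<oplus>\<^bsub>V\<^esub> c \<odot>\<^bsub>V\<^esub> \<zero>\<^bsub>V\<^esub>) \<oplus>\<^bsub>V\<^esub> c \<odot>\<^bsub>V\<^esub> x" by (simp add: vsV B_carrier vs_scale_zero[OF V])
    moreover have "\<zero>\<^bsub>V\<^esub> \<in> B" using B by (simp add: lin_closed_def)
    ultimately show "z \<in> {(b \<oplus>\<^bsub>V\<^esub> c \<odot>\<^bsub>V\<^esub> b') \<oplus>\<^bsub>V\<^esub> c \<odot>\<^bsub>V\<^esub> x | b b'. b \<in> B \<and> b' \<in> B}" using b(1) by blast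
  qed
  finally show ?thesis by (simp add: quotient_space_def)
qed

lemma vectorspace_quotient: "vectorspace class_ring (quotient_space V B)"
proof (rule vectorspaceI)
  let ?Q = "quotient_space V B"
  note Q = add_quotient scale_quotient zero_quotient vsV
  show "\<zero>\<^bsub>?Q\<^esub> \<in> carrier ?Q" by (simp add: carrier_quotient zero_quotient vsV)
  fix S assume "S \<in> carrier ?Q"
  then obtain x where x: "x \<in> carrier V" and S: "S = coset x" by (auto simp: carrier_quotient)
  show "c \<odot>\<^bsub>?Q\<^esub> S \<in> carrier ?Q" for c using x by (simp add: S Q carrier_quotient)
  show "S \<oplus>\<^bsub>?Q\<^esub> \<zero>\<^bsub>?Q\<^esub> = S" using x by (simp add: S Q)
  show "S \<oplus>\<^bsub>?Q\<^esub> (- 1) \<odot>\<^bsub>?Q\<^esub> S = \<zero>\<^bsub>?Q\<^esub>" using x by (simp add: S Q vs_neg_right[OF V])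
  show "(a + b) \<odot>\<^bsub>?Q\<^esub> S = a \<odot>\<^bsub>?Q\<^esub> S \<oplus>\<^bsub>?Q\<^esub> b \<odot>\<^bsub>?Q\<^esub> S" for a b
    using x by (simp add: S Q vs_add_scale[OF V])
  show "a \<odot>\<^bsub>?Q\<^esub> (b \<odot>\<^bsub>?Q\<^esub> S) = (a * b) \<odot>\<^bsub>?Q\<^esub> S" for a b using x by (simp add: S Q)
  show "1 \<odot>\<^bsub>?Q\<^esub> S = S" using x by (simp add: S Q)
  fix T assume "T \<in> carrier ?Q"
  then obtain y where y: "y \<in> carrier V" and T: "T = coset y" by (auto simp: carrier_quotient)
  show "S \<oplus>\<^bsub>?Q\<^esub> T \<in> carrier ?Q" using x y by (simp add: S T Q carrier_quotient)
  show "S \<oplus>\<^bsub>?Q\<^esub> T = T \<oplus>\<^bsub>?Q\<^esub> S" using x y by (simp add: S T Q vs_comm[OF V, of x y])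
  show "c \<odot>\<^bsub>?Q\<^esub> (S \<oplus>\<^bsub>?Q\<^esub> T) = c \<odot>\<^bsub>?Q\<^esub> S \<oplus>\<^bsub>?Q\<^esub> c \<odot>\<^bsub>?Q\<^esub> T" for c
    using x y by (simp add: S T Q)
  fix U assume "U \<in> carrier ?Q"
  then obtain z where z: "z \<in> carrier V" and U: "U = coset z" by (auto simp: carrier_quotient)
  show "(S \<oplus>\<^bsub>?Q\<^esub> T) \<oplus>\<^bsub>?Q\<^esub> U = S \<oplus>\<^bsub>?Q\<^esub> (T \<oplus>\<^bsub>?Q\<^esub> U)"
    using x y z by (simp add: S T U Q vs_assoc[OF V])
qed

end

text \<open>
  A linear relation that is total on both sides and matches the two subspaces is an isomorphism
  of quotients. This is how all maps defined by diagram chasing are obtained.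
\<close>

lemma lin_isomorphic_by_relation:
  fixes V :: "('k::field, 'a) module" and V' :: "('k, 'b) module"
  assumes V: "vectorspace class_ring V" and B: "lin_closed V B"
    and V': "vectorspace class_ring V'" and B': "lin_closed V' B'"
    and R_add: "\<And>x y x' y'. x \<in> carrier V \<Longrightarrow> x' \<in> carrier V' \<Longrightarrow> y \<in> carrier V \<Longrightarrow> y' \<in> carrier V'
        \<Longrightarrow> R x x' \<Longrightarrow> R y y' \<Longrightarrow> R (x \<oplus>\<^bsub>V\<^esub> y) (x' \<oplus>\<^bsub>V'\<^esub> y')"
    and R_scale: "\<And>c x x'. x \<in> carrier V \<Longrightarrow> x' \<in> carrier V'
        \<Longrightarrow> R x x' \<Longrightarrow> R (c \<odot>\<^bsub>V\<^esub> x) (c \<odot>\<^bsub>V'\<^esub> x')"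
    and left_total: "\<And>x. x \<in> carrier V \<Longrightarrow> \<exists>x'\<in>carrier V'. R x x'"
    and right_total: "\<And>x'. x' \<in> carrier V' \<Longrightarrow> \<exists>x\<in>carrier V. R x x'"
    and R_iff: "\<And>x x'. x \<in> carrier V \<Longrightarrow> x' \<in> carrier V' \<Longrightarrow> R x x' \<Longrightarrow> x \<in> B \<longleftrightarrow> x' \<in> B'"
  shows "lin_isomorphic (quotient_space V B) (quotient_space V' B')"
proof -
  let ?c = "coset V B" and ?c' = "coset V' B'"
  note Q = carrier_quotient[OF V B] add_quotient[OF V B] scale_quotient[OF V B]
  note Q' = carrier_quotient[OF V' B'] add_quotient[OF V' B'] scale_quotient[OF V' B']
  \<comment> \<open>\<open>P\<close> is the relation induced by \<open>R\<close> on cosets. It is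
    single-valued in both directions, since \<open>R\<close> relates differences to differences and
    \<open>R_iff\<close> then matches B with B'; so the choice in \<open>T\<close> has only one
    possible outcome.\<close>
  define P where "P S S' \<longleftrightarrow> (\<exists>x\<in>carrier V. \<exists>x'\<in>carrier V'. R x x' \<and> S = ?c x \<and> S' = ?c' x')" for S S'
  define T where "T S = (SOME S'. P S S')" for S
  have R_coset: "?c x = ?c y \<longleftrightarrow> ?c' x' = ?c' y'"
    if "x \<in> carrier V" "x' \<in> carrier V'" "y \<in> carrier V" "y' \<in> carrier V'" "R x x'" "R y y'" for x x' y y'
  proof -
    have "R (x \<oplus>\<^bsub>V\<^esub> (- 1) \<odot>\<^bsub>V\<^esub> y) (x' \<oplus>\<^bsub>V'\<^esub> (- 1) \<odot>\<^bsub>V'\<^esub> y')"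
      using that by (intro R_add R_scale vs_closed[OF V] vs_closed[OF V'])
    from R_iff[OF _ _ this] show ?thesis
      using that by (simp add: coset_eq_iff[OF V B] coset_eq_iff[OF V' B'] vs_closed[OF V] vs_closed[OF V'])
  qed
  have T: "T (?c x) = ?c' x'" if x: "x \<in> carrier V" "x' \<in> carrier V'" "R x x'" for x x'
  proof -
    have "P (?c x) (?c' x')" unfolding P_def using x by blast
    hence "P (?c x) (T (?c x))" unfolding T_def by (rule someI)
    then obtain y y' where "y \<in> carrier V" "y' \<in> carrier V'" "R y y'" "?c x = ?c y" "T (?c x) = ?c' y'"
      unfolding P_def by blast
    thus ?thesis using R_coset[of x x' y y'] x by simp
  qed
  have "linear_map class_ring (quotient_space V B) (quotient_space V' B') T"
  proof (rule linear_mapI)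
    fix S assume "S \<in> carrier (quotient_space V B)"
    then obtain x where x: "x \<in> carrier V" "S = ?c x" by (auto simp: Q)
    obtain x' where x': "x' \<in> carrier V'" "R x x'" using left_total x by blast
    show "T S \<in> carrier (quotient_space V' B')" using T[OF x(1) x'] x x' by (simp add: Q')
    show "T (c \<odot>\<^bsub>quotient_space V B\<^esub> S) = c \<odot>\<^bsub>quotient_space V' B'\<^esub> T S" for c
      using T[OF x(1) x'] T[OF _ _ R_scale[OF x(1) x']] x x'
      by (simp add: Q Q' vs_closed[OF V] vs_closed[OF V'])
    fix S2 assume "S2 \<in> carrier (quotient_space V B)"
    then obtain y where y: "y \<in> carrier V" "S2 = ?c y" by (auto simp: Q)
    obtain y' where y': "y' \<in> carrier V'" "R y y'" using left_total y by blast
    show "T (S \<oplus>\<^bsub>quotient_space V B\<^esub> S2) = T S \<oplus>\<^bsub>quotient_space V' B'\<^esub> T S2"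
      using T[OF x(1) x'] T[OF y(1) y'] T[OF _ _ R_add[OF x(1) x'(1) y(1) y'(1) x'(2) y'(2)]] x x' y y'
      by (simp add: Q Q' vs_closed[OF V] vs_closed[OF V'])
  qed (simp_all add: vectorspace_quotient[OF V B] vectorspace_quotient[OF V' B'])
  moreover have "bij_betw T (carrier (quotient_space V B)) (carrier (quotient_space V' B'))"
    unfolding bij_betw_def
  proof
    show "inj_on T (carrier (quotient_space V B))"
    proof (rule inj_onI)
      fix S S2 assume "S \<in> carrier (quotient_space V B)" "S2 \<in> carrier (quotient_space V B)" and eq: "T S = T S2"
      then obtain x y where x: "x \<in> carrier V" "S = ?c x" and y: "y \<in> carrier V" "S2 = ?c y" by (auto simp: Q)
      obtain x' where x': "x' \<in> carrier V'" "R x x'" using left_total x by blast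
      obtain y' where y': "y' \<in> carrier V'" "R y y'" using left_total y by blast
      have "?c' x' = ?c' y'" using eq x y T[OF x(1) x'] T[OF y(1) y'] by simp
      thus "S = S2" using R_coset[OF x(1) x'(1) y(1) y'(1) x'(2) y'(2)] x y by simp
    qed
    show "T ` carrier (quotient_space V B) = carrier (quotient_space V' B')"
    proof (intro equalityI subsetI)
      fix S assume "S \<in> T ` carrier (quotient_space V B)"
      then obtain x where x: "x \<in> carrier V" "S = T (?c x)" by (auto simp: Q)
      obtain x' where x': "x' \<in> carrier V'" "R x x'" using left_total x by blast
      show "S \<in> carrier (quotient_space V' B')" using x x'(1) T[OF x(1) x'] by (simp add: Q')
    next
      fix S assume "S \<in> carrier (quotient_space V' B')"
      then obtain x' where x': "x' \<in> carrier V'" "S = ?c' x'" by (auto simp: Q')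
      obtain x where x: "x \<in> carrier V" "R x x'" using right_total x' by blast
      show "S \<in> T ` carrier (quotient_space V B)"
      proof (rule image_eqI)
        show "S = T (?c x)" using T[OF x(1) x'(1) x(2)] x' by simp
        show "?c x \<in> carrier (quotient_space V B)" using x by (simp add: Q)
      qed
    qed
  qed
  ultimately show ?thesis unfolding lin_isomorphic_def by (intro exI[of _ T] conjI)
qed

section \<open>Double complexes with exact rows and columns\<close>

text \<open>Rows, with differential \<open>d\<close>, raise p and are augmented by
  \<open>A q\<close> through \<open>i\<close>; columns, with differential \<open>\<delta>\<close>,
  raise q and are augmented by \<open>B p\<close> through \<open>j\<close>. Each exactness axiom is
  an equivalence, so it contains both that composites vanish and that cycles are images. The squares
  commute without signs because the total complex is never formed.\<close>

locale double_complex =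
  fixes A :: "nat \<Rightarrow> ('k::field, 'a) module" and B :: "nat \<Rightarrow> ('k, 'b) module" and K :: "nat \<Rightarrow> nat \<Rightarrow> ('k, 'c) module"
    and \<alpha> :: "nat \<Rightarrow> 'a \<Rightarrow> 'a" and \<beta> :: "nat \<Rightarrow> 'b \<Rightarrow> 'b" and d \<delta> :: "nat \<Rightarrow> nat \<Rightarrow> 'c \<Rightarrow> 'c"
    and i :: "nat \<Rightarrow> 'a \<Rightarrow> 'c" and j :: "nat \<Rightarrow> 'b \<Rightarrow> 'c"
  assumes \<alpha>_lin: "linear_map class_ring (A n) (A (Suc n)) (\<alpha> n)"
    and \<beta>_lin: "linear_map class_ring (B n) (B (Suc n)) (\<beta> n)"
    and i_lin: "linear_map class_ring (A q) (K 0 q) (i q)"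
    and j_lin: "linear_map class_ring (B p) (K p 0) (j p)"
    and d_lin: "linear_map class_ring (K p q) (K (Suc p) q) (d p q)"
    and \<delta>_lin: "linear_map class_ring (K p q) (K p (Suc q)) (\<delta> p q)"
    and comm: "x \<in> carrier (K p q) \<Longrightarrow> d p (Suc q) (\<delta> p q x) = \<delta> (Suc p) q (d p q x)"
    and i_comm: "a \<in> carrier (A q) \<Longrightarrow> \<delta> 0 q (i q a) = i (Suc q) (\<alpha> q a)"
    and j_comm: "b \<in> carrier (B p) \<Longrightarrow> d p 0 (j p b) = j (Suc p) (\<beta> p b)"
    and i_inj: "a \<in> carrier (A q) \<Longrightarrow> i q a = \<zero>\<^bsub>K 0 q\<^esub> \<Longrightarrow> a = \<zero>\<^bsub>A q\<^esub>"
    and j_inj: "b \<in> carrier (B p) \<Longrightarrow> j p b = \<zero>\<^bsub>K p 0\<^esub> \<Longrightarrow> b = \<zero>\<^bsub>B p\<^esub>"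
    and i_ker: "x \<in> carrier (K 0 q) \<Longrightarrow> d 0 q x = \<zero>\<^bsub>K (Suc 0) q\<^esub> \<longleftrightarrow> x \<in> i q ` carrier (A q)"
    and j_ker: "x \<in> carrier (K p 0) \<Longrightarrow> \<delta> p 0 x = \<zero>\<^bsub>K p (Suc 0)\<^esub> \<longleftrightarrow> x \<in> j p ` carrier (B p)"
    and d_exact: "x \<in> carrier (K (Suc p) q) \<Longrightarrow> d (Suc p) q x = \<zero>\<^bsub>K (Suc (Suc p)) q\<^esub> \<longleftrightarrow> x \<in> d p q ` carrier (K p q)"
    and \<delta>_exact: "x \<in> carrier (K p (Suc q)) \<Longrightarrow> \<delta> p (Suc q) x = \<zero>\<^bsub>K p (Suc (Suc q))\<^esub> \<longleftrightarrow> x \<in> \<delta> p q ` carrier (K p q)"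
begin

lemma vsA: "vectorspace class_ring (A n)" by (rule lm_vs_left[OF \<alpha>_lin])
lemma vsB: "vectorspace class_ring (B n)" by (rule lm_vs_left[OF \<beta>_lin])
lemma vsK: "vectorspace class_ring (K p q)" by (rule lm_vs_left[OF d_lin])

lemmas lm_rules [simp] = lm_closed[OF \<alpha>_lin] lm_closed[OF \<beta>_lin] lm_closed[OF i_lin] lm_closed[OF j_lin] lm_closed[OF d_lin] lm_closed[OF \<delta>_lin]
  lm_add[OF \<alpha>_lin] lm_add[OF \<beta>_lin] lm_add[OF i_lin] lm_add[OF j_lin] lm_add[OF d_lin] lm_add[OF \<delta>_lin]
  lm_scale[OF \<alpha>_lin] lm_scale[OF \<beta>_lin] lm_scale[OF i_lin] lm_scale[OF j_lin] lm_scale[OF d_lin] lm_scale[OF \<delta>_lin]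
  lm_zero[OF \<alpha>_lin] lm_zero[OF \<beta>_lin] lm_zero[OF i_lin] lm_zero[OF j_lin] lm_zero[OF d_lin] lm_zero[OF \<delta>_lin]

lemmas vs_rules [simp] = vs_closed[OF vsA] vs_closed[OF vsB] vs_closed[OF vsK] vs_neg_right[OF vsA] vs_neg_right[OF vsB] vs_neg_right[OF vsK]
  vs_zero_left[OF vsA] vs_zero_left[OF vsB] vs_zero_left[OF vsK] vs_zero_right[OF vsA] vs_zero_right[OF vsB] vs_zero_right[OF vsK]
  vs_scale_zero[OF vsA] vs_scale_zero[OF vsB] vs_scale_zero[OF vsK]

lemma eq_of_diff:
  fixes V :: "('k, 'x) module"
  assumes V: "vectorspace class_ring V" "x \<in> carrier V" "y \<in> carrier V" and "x \<oplus>\<^bsub>V\<^esub> (- 1) \<odot>\<^bsub>V\<^esub> y = \<zero>\<^bsub>V\<^esub>"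
  shows "x = y"
  using vs_diff_cancel[OF V(1,3,2)] assms(4) vs_zero_left[OF V(1,3)] by simp

lemma i_eq: "a \<in> carrier (A q) \<Longrightarrow> a' \<in> carrier (A q) \<Longrightarrow> i q a = i q a' \<Longrightarrow> a = a'"
  by (rule eq_of_diff[OF vsA]) (simp_all, rule i_inj, simp_all)

lemma j_eq: "b \<in> carrier (B p) \<Longrightarrow> b' \<in> carrier (B p) \<Longrightarrow> j p b = j p b' \<Longrightarrow> b = b'"
  by (rule eq_of_diff[OF vsB]) (simp_all, rule j_inj, simp_all)

lemma dd: "x \<in> carrier (K p q) \<Longrightarrow> d (Suc p) q (d p q x) = \<zero>\<^bsub>K (Suc (Suc p)) q\<^esub>"
  by (simp add: d_exact)
lemma \<delta>\<delta>: "x \<in> carrier (K p q) \<Longrightarrow> \<delta> p (Suc q) (\<delta> p q x) = \<zero>\<^bsub>K p (Suc (Suc q))\<^esub>"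
  by (simp add: \<delta>_exact)
lemma di: "a \<in> carrier (A q) \<Longrightarrow> d 0 q (i q a) = \<zero>\<^bsub>K (Suc 0) q\<^esub>"
  using i_ker[of "i q a" q] by simp
lemma \<delta>j: "b \<in> carrier (B p) \<Longrightarrow> \<delta> p 0 (j p b) = \<zero>\<^bsub>K p (Suc 0)\<^esub>"
  using j_ker[of "j p b" p] by simp

text \<open>The edges inherit the complex property from the interior, because \<open>i\<close> and
  \<open>j\<close> are injective.\<close>

lemma \<alpha>\<alpha>: "a \<in> carrier (A q) \<Longrightarrow> \<alpha> (Suc q) (\<alpha> q a) = \<zero>\<^bsub>A (Suc (Suc q))\<^esub>"
  by (rule i_inj) (simp_all add: i_comm[symmetric] \<delta>\<delta>)
lemma \<beta>\<beta>: "b \<in> carrier (B p) \<Longrightarrow> \<beta> (Suc p) (\<beta> p b) = \<zero>\<^bsub>B (Suc (Suc p))\<^esub>"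
  by (rule j_inj) (simp_all add: j_comm[symmetric] dd)

text \<open>\<open>zigzag q p u b\<close> holds if a staircase in the double complex leads from \<open>u\<close> in \<open>K p q\<close> to \<open>b\<close> in \<open>B (p + q)\<close>.\<close>

fun zigzag :: "nat \<Rightarrow> nat \<Rightarrow> 'c \<Rightarrow> 'b \<Rightarrow> bool" where
  "zigzag 0 p u b \<longleftrightarrow> u = j p b"
| "zigzag (Suc q) p u b \<longleftrightarrow> (\<exists>x\<in>carrier (K p q). u = \<delta> p q x \<and> zigzag q (Suc p) (d p q x) b)"

lemma zigzag_add:
  "b \<in> carrier (B (p + q)) \<Longrightarrow> b' \<in> carrier (B (p + q)) \<Longrightarrow> zigzag q p u b \<Longrightarrow> zigzag q p u' b' \<Longrightarrow>
   zigzag q p (u \<oplus>\<^bsub>K p q\<^esub> u') (b \<oplus>\<^bsub>B (p + q)\<^esub> b')"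
proof (induction q arbitrary: p u u')
  case (Suc q)
  obtain x x' where x: "x \<in> carrier (K p q)" "u = \<delta> p q x" "zigzag q (Suc p) (d p q x) b"
    and x': "x' \<in> carrier (K p q)" "u' = \<delta> p q x'" "zigzag q (Suc p) (d p q x') b'" using Suc.prems by auto
  have "zigzag q (Suc p) (d p q (x \<oplus>\<^bsub>K p q\<^esub> x')) (b \<oplus>\<^bsub>B (Suc p + q)\<^esub> b')"
    using Suc.IH[OF _ _ x(3) x'(3)] Suc.prems x x' by simp
  thus ?case using x x' by (auto intro!: bexI[of _ "x \<oplus>\<^bsub>K p q\<^esub> x'"])
qed simp

lemma zigzag_scale:
  "b \<in> carrier (B (p + q)) \<Longrightarrow> zigzag q p u b \<Longrightarrow> zigzag q p (c \<odot>\<^bsub>K p q\<^esub> u) (c \<odot>\<^bsub>B (p + q)\<^esub> b)"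
proof (induction q arbitrary: p u)
  case (Suc q)
  obtain x where x: "x \<in> carrier (K p q)" "u = \<delta> p q x" "zigzag q (Suc p) (d p q x) b" using Suc.prems by auto
  have "zigzag q (Suc p) (d p q (c \<odot>\<^bsub>K p q\<^esub> x)) (c \<odot>\<^bsub>B (Suc p + q)\<^esub> b)"
    using Suc.IH[OF _ x(3)] Suc.prems x by simp
  thus ?case using x by (auto intro!: bexI[of _ "c \<odot>\<^bsub>K p q\<^esub> x"])
qed simp

text \<open>A lift x of u along the column need not be d-closed, but d x is closed in both
  directions: \<delta>(d x) = d u = 0 and d(d x) = 0. So the staircase descends to q = 0, where the
  kernel of \<delta> is the image of \<open>j\<close>.\<close>

lemma zigzag_left_total:
  "u \<in> carrier (K p q) \<Longrightarrow> d p q u = \<zero>\<^bsub>K (Suc p) q\<^esub> \<Longrightarrow> \<delta> p q u = \<zero>\<^bsub>K p (Suc q)\<^esub> \<Longrightarrow>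
   \<exists>b\<in>carrier (B (p + q)). \<beta> (p + q) b = \<zero>\<^bsub>B (Suc (p + q))\<^esub> \<and> zigzag q p u b"
proof (induction q arbitrary: p u)
  case 0
  then obtain b where b: "b \<in> carrier (B p)" "u = j p b" using j_ker[of u p] by auto
  hence "j (Suc p) (\<beta> p b) = \<zero>\<^bsub>K (Suc p) 0\<^esub>" using 0 by (simp add: j_comm[symmetric])
  thus ?case using b j_inj[of "\<beta> p b" "Suc p"] by auto
next
  case (Suc q)
  then obtain x where x: "x \<in> carrier (K p q)" "u = \<delta> p q x" using \<delta>_exact[of u p q] by auto
  have "\<delta> (Suc p) q (d p q x) = \<zero>\<^bsub>K (Suc p) (Suc q)\<^esub>" using Suc.prems x comm[of x p q] by simp
  from Suc.IH[OF _ _ this] show ?case using x by (auto simp: dd)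
qed

text \<open>The staircase is climbed backwards: starting from its end in the edge, lifts are taken
  along rows instead of columns.\<close>

lemma zigzag_right_total:
  "b \<in> carrier (B (p + q)) \<Longrightarrow> \<beta> (p + q) b = \<zero>\<^bsub>B (Suc (p + q))\<^esub> \<Longrightarrow>
   \<exists>u\<in>carrier (K p q). d p q u = \<zero>\<^bsub>K (Suc p) q\<^esub> \<and> \<delta> p q u = \<zero>\<^bsub>K p (Suc q)\<^esub> \<and> zigzag q p u b"
proof (induction q arbitrary: p)
  case 0
  thus ?case by (intro bexI[of _ "j p b"]) (simp_all add: j_comm \<delta>j)
next
  case (Suc q)
  have "\<exists>u\<in>carrier (K (Suc p) q). d (Suc p) q u = \<zero>\<^bsub>K (Suc (Suc p)) q\<^esub> \<and> \<delta> (Suc p) q u = \<zero>\<^bsub>K (Suc p) (Suc q)\<^esub> \<and> zigzag q (Suc p) u b"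
    using Suc.prems by (intro Suc.IH) simp_all
  then obtain u where u: "u \<in> carrier (K (Suc p) q)" "d (Suc p) q u = \<zero>\<^bsub>K (Suc (Suc p)) q\<^esub>"
    "\<delta> (Suc p) q u = \<zero>\<^bsub>K (Suc p) (Suc q)\<^esub>" "zigzag q (Suc p) u b" by blast
  then obtain x where x: "x \<in> carrier (K p q)" "u = d p q x" using d_exact[of u p q] by auto
  show ?case using u x by (intro bexI[of _ "\<delta> p q x"]) (auto simp: \<delta>\<delta> comm)
qed

text \<open>Write v = \<delta> y. The staircase out of d v uses some lift x, possibly different from
  d y. The difference x - d y is \<delta>-closed and has the same image under d as x, so it takes
  the place of v one column further on.\<close>

lemma zigzag_boundary1:
  "v \<in> carrier (K p q) \<Longrightarrow> \<delta> p q v = \<zero>\<^bsub>K p (Suc q)\<^esub> \<Longrightarrow> b \<in> carrier (B (Suc p + q)) \<Longrightarrow> zigzag q (Suc p) (d p q v) b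
   \<Longrightarrow> b \<in> \<beta> (p + q) ` carrier (B (p + q))"
proof (induction q arbitrary: p v)
  case 0
  then obtain b' where b': "b' \<in> carrier (B p)" "v = j p b'" using j_ker[of v p] by auto
  hence "b = \<beta> p b'" using 0 by (intro j_eq[of _ "Suc p"]) (auto simp: j_comm)
  thus ?case using b' by simp
next
  case (Suc q)
  obtain x where x: "x \<in> carrier (K (Suc p) q)" "d p (Suc q) v = \<delta> (Suc p) q x" "zigzag q (Suc (Suc p)) (d (Suc p) q x) b"
    using Suc.prems by auto
  obtain y where y: "y \<in> carrier (K p q)" "v = \<delta> p q y" using Suc.prems \<delta>_exact[of v p q] by auto
  let ?w = "x \<oplus>\<^bsub>K (Suc p) q\<^esub> (- 1) \<odot>\<^bsub>K (Suc p) q\<^esub> d p q y"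
  have "\<delta> (Suc p) q ?w = \<zero>\<^bsub>K (Suc p) (Suc q)\<^esub>" using x y by (simp add: comm flip: x(2))
  moreover have "d (Suc p) q ?w = d (Suc p) q x" using x y by (simp add: dd)
  ultimately show ?case using Suc.IH[of ?w "Suc p"] x y Suc.prems(3) by simp
qed

text \<open>Mirror image of \<open>zigzag_boundary1\<close>, with the correction made along the
  rows: x - v is d-closed, hence of the form d y, and \<delta> y is the element sought.\<close>

lemma zigzag_boundary2:
  "u \<in> carrier (K (Suc p) q) \<Longrightarrow> b' \<in> carrier (B (p + q)) \<Longrightarrow> zigzag q (Suc p) u (\<beta> (p + q) b') \<Longrightarrow>
   \<exists>v\<in>carrier (K p q). \<delta> p q v = \<zero>\<^bsub>K p (Suc q)\<^esub> \<and> u = d p q v"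
proof (induction q arbitrary: p u)
  case 0
  thus ?case by (intro bexI[of _ "j p b'"]) (simp_all add: j_comm \<delta>j)
next
  case (Suc q)
  obtain x where x: "x \<in> carrier (K (Suc p) q)" "u = \<delta> (Suc p) q x" "zigzag q (Suc (Suc p)) (d (Suc p) q x) (\<beta> (p + Suc q) b')"
    using Suc.prems by auto
  obtain v where v: "v \<in> carrier (K (Suc p) q)" "\<delta> (Suc p) q v = \<zero>\<^bsub>K (Suc p) (Suc q)\<^esub>" "d (Suc p) q x = d (Suc p) q v"
    using Suc.IH[of "d (Suc p) q x" "Suc p"] x Suc.prems by auto
  let ?w = "x \<oplus>\<^bsub>K (Suc p) q\<^esub> (- 1) \<odot>\<^bsub>K (Suc p) q\<^esub> v"
  have "d (Suc p) q ?w = \<zero>\<^bsub>K (Suc (Suc p)) q\<^esub>" using x v by simp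
  then obtain y where y: "y \<in> carrier (K p q)" "?w = d p q y" using d_exact[of ?w p q] x v by auto
  have "u = \<delta> (Suc p) q ?w" using x v by simp
  also have "\<dots> = d p (Suc q) (\<delta> p q y)" using y by (simp add: comm)
  finally show ?case using y by (intro bexI[of _ "\<delta> p q y"]) (simp_all add: \<delta>\<delta>)
qed

text \<open>The first step x of the staircase is determined only up to the kernel of \<delta>. If a
  is a coboundary, x is corrected by an element coming from the edge \<open>A\<close>; if b is one,
  by the element found in \<open>zigzag_boundary2\<close>.\<close>

lemma coboundary_iff:
  assumes a: "a \<in> carrier (A n)" and b: "b \<in> carrier (B n)" and z: "zigzag n 0 (i n a) b"
  shows "a \<in> (case n of 0 \<Rightarrow> {\<zero>\<^bsub>A 0\<^esub>} | Suc m \<Rightarrow> \<alpha> m ` carrier (A m)) \<longleftrightarrow>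
         b \<in> (case n of 0 \<Rightarrow> {\<zero>\<^bsub>B 0\<^esub>} | Suc m \<Rightarrow> \<beta> m ` carrier (B m))"
proof (cases n)
  case 0
  have "a = \<zero>\<^bsub>A 0\<^esub> \<longleftrightarrow> b = \<zero>\<^bsub>B 0\<^esub>"
    using a b z 0 i_inj[of a 0] j_inj[of b 0] by auto
  thus ?thesis using 0 by simp
next
  case (Suc m)
  obtain x where x: "x \<in> carrier (K 0 m)" "i n a = \<delta> 0 m x" "zigzag m (Suc 0) (d 0 m x) b"
    using z Suc by auto
  have "b \<in> \<beta> m ` carrier (B m)" if h: "a \<in> \<alpha> m ` carrier (A m)"
  proof -
    obtain a' where a': "a' \<in> carrier (A m)" "a = \<alpha> m a'" using h by blast
    let ?w = "x \<oplus>\<^bsub>K 0 m\<^esub> (- 1) \<odot>\<^bsub>K 0 m\<^esub> i m a'"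
    have "\<delta> 0 m ?w = \<zero>\<^bsub>K 0 (Suc m)\<^esub>" using x a' by (simp add: i_comm Suc flip: x(2))
    moreover have "d 0 m ?w = d 0 m x" using x a' by (simp add: di)
    ultimately show ?thesis using zigzag_boundary1[of ?w 0 m b] x a' b Suc by simp
  qed
  moreover have "a \<in> \<alpha> m ` carrier (A m)" if h: "b \<in> \<beta> m ` carrier (B m)"
  proof -
    obtain b' where b': "b' \<in> carrier (B m)" "b = \<beta> m b'" using h by blast
    obtain v where v: "v \<in> carrier (K 0 m)" "\<delta> 0 m v = \<zero>\<^bsub>K 0 (Suc m)\<^esub>" "d 0 m x = d 0 m v"
      using zigzag_boundary2[of "d 0 m x" 0 m b'] x b' by auto
    let ?w = "x \<oplus>\<^bsub>K 0 m\<^esub> (- 1) \<odot>\<^bsub>K 0 m\<^esub> v"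
    have "d 0 m ?w = \<zero>\<^bsub>K (Suc 0) m\<^esub>" using x v by simp
    then obtain a' where a': "a' \<in> carrier (A m)" "?w = i m a'" using i_ker[of ?w m] x v by auto
    have "i n a = \<delta> 0 m ?w" using x v by simp
    hence "a = \<alpha> m a'" using a a' Suc by (intro i_eq[of _ n]) (simp_all add: i_comm)
    thus ?thesis using a' by simp
  qed
  ultimately show ?thesis using Suc by auto
qed

lemma lin_closed_coboundaries:
  assumes M: "\<And>n. linear_map class_ring (M n) (M (Suc n)) (f n)"
    and ff: "\<And>n x. x \<in> carrier (M n) \<Longrightarrow> f (Suc n) (f n x) = \<zero>\<^bsub>M (Suc (Suc n))\<^esub>"
  shows "vectorspace class_ring (M n\<lparr>carrier := {z \<in> carrier (M n). f n z = \<zero>\<^bsub>M (Suc n)\<^esub>}\<rparr>)"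
    "lin_closed (M n\<lparr>carrier := {z \<in> carrier (M n). f n z = \<zero>\<^bsub>M (Suc n)\<^esub>}\<rparr>)
      (case n of 0 \<Rightarrow> {\<zero>\<^bsub>M 0\<^esub>} | Suc m \<Rightarrow> f m ` carrier (M m))"
proof -
  note V = lm_vs_left[OF M]
  note [simp] = lm_closed[OF M] lm_add[OF M] lm_scale[OF M] lm_zero[OF M] vs_closed[OF V] vs_zero_left[OF V] vs_scale_zero[OF V]
  show "vectorspace class_ring (M n\<lparr>carrier := {z \<in> carrier (M n). f n z = \<zero>\<^bsub>M (Suc n)\<^esub>}\<rparr>)"
    by (rule vectorspace_restrict[OF V lin_closedI]) auto
  show "lin_closed (M n\<lparr>carrier := {z \<in> carrier (M n). f n z = \<zero>\<^bsub>M (Suc n)\<^esub>}\<rparr>)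
      (case n of 0 \<Rightarrow> {\<zero>\<^bsub>M 0\<^esub>} | Suc m \<Rightarrow> f m ` carrier (M m))"
  proof (cases n)
    case (Suc m)
    have "\<zero>\<^bsub>M (Suc m)\<^esub> \<in> f m ` carrier (M m)" by (rule image_eqI[of _ _ "\<zero>\<^bsub>M m\<^esub>"]) simp_all
    moreover have "f m x \<oplus>\<^bsub>M (Suc m)\<^esub> f m y \<in> f m ` carrier (M m)" if "x \<in> carrier (M m)" "y \<in> carrier (M m)" for x y
      using that by (intro image_eqI[of _ _ "x \<oplus>\<^bsub>M m\<^esub> y"]) simp_all
    moreover have "c \<odot>\<^bsub>M (Suc m)\<^esub> f m x \<in> f m ` carrier (M m)" if "x \<in> carrier (M m)" for c x
      using that by (intro image_eqI[of _ _ "c \<odot>\<^bsub>M m\<^esub> x"]) simp_all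
    ultimately show ?thesis unfolding Suc by (intro lin_closedI) (auto simp: ff)
  qed (auto intro!: lin_closedI)
qed

lemma cohomology_isomorphic: "lin_isomorphic (cohomology A \<alpha> n) (cohomology B \<beta> n)"
proof -
  let ?A = "A n\<lparr>carrier := {z \<in> carrier (A n). \<alpha> n z = \<zero>\<^bsub>A (Suc n)\<^esub>}\<rparr>"
  let ?B = "B n\<lparr>carrier := {z \<in> carrier (B n). \<beta> n z = \<zero>\<^bsub>B (Suc n)\<^esub>}\<rparr>"
  show ?thesis unfolding cohomology_def
  \<comment> \<open>The relation contains all choices of lifts at once. That different lifts lead to
    cohomologous ends is part of \<open>coboundary_iff\<close>, applied to differences.\<close>
  proof (rule lin_isomorphic_by_relation[where R = "\<lambda>a b. zigzag n 0 (i n a) b"])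
    fix a assume "a \<in> carrier ?A"
    thus "\<exists>b\<in>carrier ?B. zigzag n 0 (i n a) b"
      using zigzag_left_total[of "i n a" 0 n] by (auto simp: di i_comm)
  next
    fix b assume "b \<in> carrier ?B"
    then obtain u where u: "u \<in> carrier (K 0 n)" "d 0 n u = \<zero>\<^bsub>K (Suc 0) n\<^esub>" "\<delta> 0 n u = \<zero>\<^bsub>K 0 (Suc n)\<^esub>" "zigzag n 0 u b"
      using zigzag_right_total[of b 0 n] by auto
    then obtain a where a: "a \<in> carrier (A n)" "u = i n a" using i_ker[of u n] by auto
    have "\<alpha> n a = \<zero>\<^bsub>A (Suc n)\<^esub>" using u a by (intro i_inj) (simp_all add: i_comm)
    thus "\<exists>a\<in>carrier ?A. zigzag n 0 (i n a) b" using u a by auto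
  next
    fix a b assume "a \<in> carrier ?A" "b \<in> carrier ?B" "zigzag n 0 (i n a) b"
    thus "a \<in> (case n of 0 \<Rightarrow> {\<zero>\<^bsub>A 0\<^esub>} | Suc m \<Rightarrow> \<alpha> m ` carrier (A m)) \<longleftrightarrow>
         b \<in> (case n of 0 \<Rightarrow> {\<zero>\<^bsub>B 0\<^esub>} | Suc m \<Rightarrow> \<beta> m ` carrier (B m))"
      by (intro coboundary_iff) simp_all
  next
    fix a a' b b' assume "a \<in> carrier ?A" "a' \<in> carrier ?A" "b \<in> carrier ?B" "b' \<in> carrier ?B"
      "zigzag n 0 (i n a) b" "zigzag n 0 (i n a') b'"
    thus "zigzag n 0 (i n (a \<oplus>\<^bsub>?A\<^esub> a')) (b \<oplus>\<^bsub>?B\<^esub> b')" using zigzag_add[of b 0 n b' "i n a" "i n a'"] by simp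
  next
    fix c a b assume "a \<in> carrier ?A" "b \<in> carrier ?B" "zigzag n 0 (i n a) b"
    thus "zigzag n 0 (i n (c \<odot>\<^bsub>?A\<^esub> a)) (c \<odot>\<^bsub>?B\<^esub> b)" using zigzag_scale[of b 0 n "i n a" c] by simp
  qed (rule lin_closed_coboundaries \<alpha>_lin \<beta>_lin \<alpha>\<alpha> \<beta>\<beta>; assumption?)+
qed

end

section \<open>Arrows with source and target\<close>

text \<open>
  Since hom-spaces may overlap, an element of a hom-space does not determine its source and target.
  Calculations are carried out with triples that carry them, so that the side conditions of the
  category laws become equations between objects.
\<close>

definition mk :: "'o \<Rightarrow> 'm \<Rightarrow> 'o \<Rightarrow> 'o \<times> 'm \<times> 'o" where "mk X f Y = (X, f, Y)"
definition src :: "'o \<times> 'm \<times> 'o \<Rightarrow> 'o" where "src a = fst a"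
definition und :: "'o \<times> 'm \<times> 'o \<Rightarrow> 'm" where "und a = fst (snd a)"
definition tgt :: "'o \<times> 'm \<times> 'o \<Rightarrow> 'o" where "tgt a = snd (snd a)"

lemma src_mk [simp]: "src (mk X f Y) = X" by (simp add: src_def mk_def)
lemma und_mk [simp]: "und (mk X f Y) = f" by (simp add: und_def mk_def)
lemma tgt_mk [simp]: "tgt (mk X f Y) = Y" by (simp add: tgt_def mk_def)
lemma mk_und [simp]: "mk (src a) (und a) (tgt a) = a" by (simp add: src_def und_def tgt_def mk_def)
lemma mk_und': "src a = X \<Longrightarrow> tgt a = Y \<Longrightarrow> mk X (und a) Y = a" by auto
lemma mk_eq_iff [simp]: "mk X f Y = mk X' f' Y' \<longleftrightarrow> X = X' \<and> f = f' \<and> Y = Y'" by (simp add: mk_def)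
lemma arrow_eqI: "src a = src b \<Longrightarrow> und a = und b \<Longrightarrow> tgt a = tgt b \<Longrightarrow> a = b"
  by (metis mk_und)

definition arr :: "('k, 'o, 'm, 'z) lin_cat_scheme \<Rightarrow> 'o \<times> 'm \<times> 'o \<Rightarrow> bool" where
  "arr C a \<longleftrightarrow> src a \<in> Obj C \<and> tgt a \<in> Obj C \<and> und a \<in> Mor C (src a) (tgt a)"

definition idt :: "('k, 'o, 'm, 'z) lin_cat_scheme \<Rightarrow> 'o \<Rightarrow> 'o \<times> 'm \<times> 'o" ("\<iota>\<index>") where
  "idt C X = mk X (Ident C X) X"

definition cmp :: "('k, 'o, 'm, 'z) lin_cat_scheme \<Rightarrow> 'o \<times> 'm \<times> 'o \<Rightarrow> 'o \<times> 'm \<times> 'o \<Rightarrow> 'o \<times> 'm \<times> 'o"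
    (infixr "\<star>\<index>" 70) where
  "cmp C g f = mk (src f) (und g \<cdot>\<^bsub>C\<^esub> und f) (tgt g)"

definition pls :: "('k, 'o, 'm, 'z) lin_cat_scheme \<Rightarrow> 'o \<times> 'm \<times> 'o \<Rightarrow> 'o \<times> 'm \<times> 'o \<Rightarrow> 'o \<times> 'm \<times> 'o"
    (infixl "\<boxplus>\<index>" 65) where
  "pls C f g = mk (src f) (und f \<oplus>\<^bsub>HomV C (src f) (tgt f)\<^esub> und g) (tgt f)"

definition scl :: "('k, 'o, 'm, 'z) lin_cat_scheme \<Rightarrow> 'k \<Rightarrow> 'o \<times> 'm \<times> 'o \<Rightarrow> 'o \<times> 'm \<times> 'o"
    (infixr "\<boxdot>\<index>" 72) where
  "scl C c f = mk (src f) (c \<odot>\<^bsub>HomV C (src f) (tgt f)\<^esub> und f) (tgt f)"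

definition zr :: "('k, 'o, 'm, 'z) lin_cat_scheme \<Rightarrow> 'o \<Rightarrow> 'o \<Rightarrow> 'o \<times> 'm \<times> 'o" where
  "zr C X Y = mk X \<zero>\<^bsub>HomV C X Y\<^esub> Y"

definition tns :: "('k, 'o, 'm, 'z) mon_cat_scheme \<Rightarrow> 'o \<times> 'm \<times> 'o \<Rightarrow> 'o \<times> 'm \<times> 'o \<Rightarrow> 'o \<times> 'm \<times> 'o"
    (infixr "\<otimes>\<^sub>a\<index>" 75) where
  "tns C f g = mk (src f \<otimes>\<^sub>o\<^bsub>C\<^esub> src g) (und f \<otimes>\<^sub>m\<^bsub>C\<^esub> und g) (tgt f \<otimes>\<^sub>o\<^bsub>C\<^esub> tgt g)"

definition fm :: "('o, 'm, 'p, 'n) functor_data \<Rightarrow> 'o \<times> 'm \<times> 'o \<Rightarrow> 'p \<times> 'n \<times> 'p" where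
  "fm F a = mk (obj_map F (src a)) (arr_map F (src a) (tgt a) (und a)) (obj_map F (tgt a))"

lemma src_ops [simp]:
  "src (idt C X) = X" "src (cmp C g f) = src f" "src (pls C f g) = src f" "src (scl C c f) = src f"
  "src (zr C X Y) = X"
  by (simp_all add: idt_def cmp_def pls_def scl_def zr_def)
lemma tgt_ops [simp]:
  "tgt (idt C X) = X" "tgt (cmp C g f) = tgt g" "tgt (pls C f g) = tgt f" "tgt (scl C c f) = tgt f"
  "tgt (zr C X Y) = Y"
  by (simp_all add: idt_def cmp_def pls_def scl_def zr_def)
lemma src_tns [simp]: "src (tns C f g) = src f \<otimes>\<^sub>o\<^bsub>C\<^esub> src g" by (simp add: tns_def)
lemma tgt_tns [simp]: "tgt (tns C f g) = tgt f \<otimes>\<^sub>o\<^bsub>C\<^esub> tgt g" by (simp add: tns_def)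
lemma src_fm [simp]: "src (fm F a) = obj_map F (src a)" by (simp add: fm_def)
lemma tgt_fm [simp]: "tgt (fm F a) = obj_map F (tgt a)" by (simp add: fm_def)

lemma arr_mk [simp]: "arr C (mk X f Y) \<longleftrightarrow> X \<in> Obj C \<and> Y \<in> Obj C \<and> f \<in> Mor C X Y"
  by (simp add: arr_def)
lemma arr_objs: "arr C a \<Longrightarrow> src a \<in> Obj C" "arr C a \<Longrightarrow> tgt a \<in> Obj C"
  by (simp_all add: arr_def)
lemma arr_und: "arr C a \<Longrightarrow> src a = X \<Longrightarrow> tgt a = Y \<Longrightarrow> und a \<in> Mor C X Y"
  by (auto simp: arr_def)

context linear_category
begin

lemma bil_hom:
  assumes "X \<in> Obj C" "Y \<in> Obj C" "Z \<in> Obj C"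
  shows "g \<in> Mor C Y Z \<Longrightarrow> linear_map class_ring (HomV C X Y) (HomV C X Z) (\<lambda>f. g \<cdot> f)"
    and "f \<in> Mor C X Y \<Longrightarrow> linear_map class_ring (HomV C Y Z) (HomV C X Z) (\<lambda>g. g \<cdot> f)"
  using comp_bilinear[OF assms] by (auto simp: bilinear_map_def)

lemma arr_idt [simp]: "X \<in> Obj C \<Longrightarrow> arr C (\<iota> X)"
  by (simp add: idt_def ident_in_hom)

lemma arr_cmp [simp]: "arr C g \<Longrightarrow> arr C f \<Longrightarrow> src g = tgt f \<Longrightarrow> arr C (g \<star> f)"
  by (auto simp: cmp_def arr_def intro: lm_closed[OF bil_hom(1)[of "src f" "tgt f" "tgt g"]])

lemma arr_pls [simp]: "arr C f \<Longrightarrow> arr C g \<Longrightarrow> src f = src g \<Longrightarrow> tgt f = tgt g \<Longrightarrow> arr C (f \<boxplus> g)"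
  by (auto simp: pls_def arr_def vs_add hom_vectorspace)

lemma arr_scl [simp]: "arr C f \<Longrightarrow> arr C (c \<boxdot> f)"
  by (auto simp: scl_def arr_def vs_scale hom_vectorspace)

lemma arr_zr [simp]: "X \<in> Obj C \<Longrightarrow> Y \<in> Obj C \<Longrightarrow> arr C (zr C X Y)"
  by (auto simp: zr_def arr_def vs_zero hom_vectorspace)

lemma cmp_idt_right [simp]: "arr C f \<Longrightarrow> src f = X \<Longrightarrow> f \<star> \<iota> X = f"
  by (rule arrow_eqI) (auto simp: cmp_def idt_def arr_def comp_ident_right)

lemma cmp_idt_left [simp]: "arr C f \<Longrightarrow> tgt f = X \<Longrightarrow> \<iota> X \<star> f = f"
  by (rule arrow_eqI) (auto simp: cmp_def idt_def arr_def comp_ident_left)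

lemma cmp_assoc [simp]:
  "arr C f \<Longrightarrow> arr C g \<Longrightarrow> arr C h \<Longrightarrow> src g = tgt f \<Longrightarrow> src h = tgt g \<Longrightarrow> (h \<star> g) \<star> f = h \<star> (g \<star> f)"
  unfolding cmp_def arr_def by (simp add: comp_assoc[of "src f" "tgt f" "tgt g" "tgt h"])

text \<open>\<open>cmp_assoc\<close> nests composites to the right, which separates g and f as soon
  as an arrow x stands to the right of them. In this form an equation for g \<star> f still
  applies.\<close>

lemma cmp_assoc_eq:
  "g \<star> f = d \<Longrightarrow> arr C f \<Longrightarrow> arr C g \<Longrightarrow> arr C x \<Longrightarrow> src g = tgt f \<Longrightarrow> src f = tgt x \<Longrightarrow> g \<star> (f \<star> x) = d \<star> x"
  by (metis cmp_assoc)

lemma cmp_pls_right: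
  "arr C g \<Longrightarrow> arr C f \<Longrightarrow> arr C f' \<Longrightarrow> src f = src f' \<Longrightarrow> tgt f = tgt f' \<Longrightarrow> src g = tgt f
   \<Longrightarrow> g \<star> (f \<boxplus> f') = g \<star> f \<boxplus> g \<star> f'"
  unfolding cmp_def pls_def arr_def
  by (simp add: lm_add[OF bil_hom(1)[of "src f'" "tgt f'" "tgt g"]])

lemma cmp_pls_left:
  "arr C g \<Longrightarrow> arr C g' \<Longrightarrow> arr C f \<Longrightarrow> src g = src g' \<Longrightarrow> tgt g = tgt g' \<Longrightarrow> src g = tgt f
   \<Longrightarrow> (g \<boxplus> g') \<star> f = g \<star> f \<boxplus> g' \<star> f"
  unfolding cmp_def pls_def arr_def
  by (auto simp add: lm_add[OF bil_hom(2)[of "src f" "tgt f" "tgt g"]]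
      lm_add[OF bil_hom(2)[of "src f" "src g'" "tgt g'"]])

lemma cmp_scl_right [simp]:
  "arr C g \<Longrightarrow> arr C f \<Longrightarrow> src g = tgt f \<Longrightarrow> g \<star> (c \<boxdot> f) = c \<boxdot> (g \<star> f)"
  unfolding cmp_def scl_def arr_def
  by (simp add: lm_scale[OF bil_hom(1)[of "src f" "tgt f" "tgt g"]])

lemma cmp_scl_left [simp]:
  "arr C g \<Longrightarrow> arr C f \<Longrightarrow> src g = tgt f \<Longrightarrow> (c \<boxdot> g) \<star> f = c \<boxdot> (g \<star> f)"
  unfolding cmp_def scl_def arr_def
  by (auto simp add: lm_scale[OF bil_hom(2)[of "src f" "tgt f" "tgt g"]])

lemma cmp_zr_right [simp]: "arr C g \<Longrightarrow> src g = Y \<Longrightarrow> X \<in> Obj C \<Longrightarrow> g \<star> zr C X Y = zr C X (tgt g)"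
  unfolding cmp_def zr_def arr_def
  by (auto simp add: lm_zero[OF bil_hom(1)[of X Y "tgt g"]])

lemma cmp_zr_left [simp]: "arr C f \<Longrightarrow> tgt f = X \<Longrightarrow> Y \<in> Obj C \<Longrightarrow> zr C X Y \<star> f = zr C (src f) Y"
  unfolding cmp_def zr_def arr_def
  by (auto simp add: lm_zero[OF bil_hom(2)[of "src f" X Y]])

lemma hom_vs [simp]: "X \<in> Obj C \<Longrightarrow> Y \<in> Obj C \<Longrightarrow> vectorspace class_ring (HomV C X Y)"
  by (rule hom_vectorspace)

lemma pls_assoc:
  "arr C f \<Longrightarrow> arr C g \<Longrightarrow> arr C h \<Longrightarrow> src f = src g \<Longrightarrow> tgt f = tgt g \<Longrightarrow> src g = src h \<Longrightarrow> tgt g = tgt h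
   \<Longrightarrow> (f \<boxplus> g) \<boxplus> h = f \<boxplus> (g \<boxplus> h)"
  unfolding pls_def arr_def by (simp add: vs_assoc[of "HomV C (src h) (tgt h)"])

lemma pls_comm:
  "arr C f \<Longrightarrow> arr C g \<Longrightarrow> src f = src g \<Longrightarrow> tgt f = tgt g \<Longrightarrow> f \<boxplus> g = g \<boxplus> f"
  unfolding pls_def arr_def by (simp add: vs_comm[of "HomV C (src g) (tgt g)" "und f" "und g"])

lemma pls_lcomm:
  "arr C f \<Longrightarrow> arr C g \<Longrightarrow> arr C h \<Longrightarrow> src f = src g \<Longrightarrow> tgt f = tgt g \<Longrightarrow> src g = src h \<Longrightarrow> tgt g = tgt h
   \<Longrightarrow> f \<boxplus> (g \<boxplus> h) = g \<boxplus> (f \<boxplus> h)"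
  unfolding pls_def arr_def by (simp add: vs_lcomm[of "HomV C (src h) (tgt h)" "und f" "und g"])

lemma pls_zr_right [simp]: "arr C f \<Longrightarrow> src f = X \<Longrightarrow> tgt f = Y \<Longrightarrow> f \<boxplus> zr C X Y = f"
  unfolding pls_def zr_def arr_def by (rule arrow_eqI) (auto simp: vs_zero_right)

lemma pls_zr_left [simp]: "arr C f \<Longrightarrow> src f = X \<Longrightarrow> tgt f = Y \<Longrightarrow> zr C X Y \<boxplus> f = f"
  unfolding pls_def zr_def arr_def by (rule arrow_eqI) (auto simp: vs_zero_left)

lemma pls_neg [simp]: "arr C f \<Longrightarrow> f \<boxplus> (- 1) \<boxdot> f = zr C (src f) (tgt f)"
  unfolding pls_def zr_def scl_def arr_def by (auto simp: vs_neg_right)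

lemma neg_pls [simp]: "arr C f \<Longrightarrow> (- 1) \<boxdot> f \<boxplus> f = zr C (src f) (tgt f)"
  unfolding pls_def zr_def scl_def arr_def by (auto simp: vs_neg_left)

lemma scl_pls:
  "arr C f \<Longrightarrow> arr C g \<Longrightarrow> src f = src g \<Longrightarrow> tgt f = tgt g \<Longrightarrow> c \<boxdot> (f \<boxplus> g) = c \<boxdot> f \<boxplus> c \<boxdot> g"
  unfolding pls_def scl_def arr_def by (auto simp: vs_scale_add)

lemma scl_scl [simp]: "arr C f \<Longrightarrow> a \<boxdot> (b \<boxdot> f) = (a * b) \<boxdot> f"
  unfolding scl_def arr_def by (auto simp: vs_scale_scale)

lemma scl_one [simp]: "arr C f \<Longrightarrow> 1 \<boxdot> f = f"
  unfolding scl_def arr_def by (rule arrow_eqI) (auto simp: vs_one)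

lemma scl_zr [simp]: "X \<in> Obj C \<Longrightarrow> Y \<in> Obj C \<Longrightarrow> c \<boxdot> zr C X Y = zr C X Y"
  unfolding scl_def zr_def arr_def by (auto simp: vs_scale_zero)

declare arr_objs [simp]

lemma pls_neg_eq_zr_iff:
  assumes "arr C f" "arr C g" "src f = src g" "tgt f = tgt g"
  shows "f \<boxplus> (- 1) \<boxdot> g = zr C (src f) (tgt f) \<longleftrightarrow> f = g"
proof
  assume eq: "f \<boxplus> (- 1) \<boxdot> g = zr C (src f) (tgt f)"
  have "f = (f \<boxplus> (- 1) \<boxdot> g) \<boxplus> g" using assms by (simp add: pls_assoc)
  also have "\<dots> = g" unfolding eq using assms by simp
  finally show "f = g" .
next
  assume "f = g"
  thus "f \<boxplus> (- 1) \<boxdot> g = zr C (src f) (tgt f)" using assms by simp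
qed

end

declare arr_objs [simp del]

lemma (in strict_monoidal_category) bil_tns:
  assumes "X \<in> Obj C" "Y \<in> Obj C" "X' \<in> Obj C" "Y' \<in> Obj C"
  shows "f \<in> Mor C X Y
      \<Longrightarrow> linear_map class_ring (HomV C X' Y') (HomV C (X \<otimes>\<^sub>o X') (Y \<otimes>\<^sub>o Y')) (\<lambda>g. f \<otimes>\<^sub>m g)"
    and "g \<in> Mor C X' Y'
      \<Longrightarrow> linear_map class_ring (HomV C X Y) (HomV C (X \<otimes>\<^sub>o X') (Y \<otimes>\<^sub>o Y')) (\<lambda>f. f \<otimes>\<^sub>m g)"
  using tens_bilinear[OF assms] by (auto simp: bilinear_map_def)

context strict_monoidal_category
begin

declare tens_obj [simp] unit_obj [simp] tens_obj_assoc [simp] unit_obj_left [simp] unit_obj_right [simp]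


lemma arr_tns [simp]: "arr C f \<Longrightarrow> arr C g \<Longrightarrow> arr C (f \<otimes>\<^sub>a g)"
  unfolding arr_def tns_def
  by (auto intro: lm_closed[OF bil_tns(1)[of "src f" "tgt f" "src g" "tgt g"]])

lemma tns_idt: "X \<in> Obj C \<Longrightarrow> Y \<in> Obj C \<Longrightarrow> \<iota> X \<otimes>\<^sub>a \<iota> Y = \<iota> (X \<otimes>\<^sub>o Y)"
  by (simp add: tns_def idt_def tens_ident)

lemma interchange:
  "arr C f \<Longrightarrow> arr C g \<Longrightarrow> arr C f' \<Longrightarrow> arr C g' \<Longrightarrow> src g = tgt f \<Longrightarrow> src g' = tgt f'
   \<Longrightarrow> (g \<otimes>\<^sub>a g') \<star> (f \<otimes>\<^sub>a f') = (g \<star> f) \<otimes>\<^sub>a (g' \<star> f')"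
  unfolding arr_def tns_def cmp_def by (simp add: tens_comp[of "src f" "tgt f" "tgt g"  "src f'" "tgt f'" "tgt g'"])

lemma tns_assoc [simp]:
  "arr C f \<Longrightarrow> arr C g \<Longrightarrow> arr C h \<Longrightarrow> (f \<otimes>\<^sub>a g) \<otimes>\<^sub>a h = f \<otimes>\<^sub>a (g \<otimes>\<^sub>a h)"
  unfolding arr_def tns_def by (simp add: tens_mor_assoc[of "src f" "tgt f" "src g" "tgt g" "src h" "tgt h"])

lemma tns_unit_left [simp]: "arr C f \<Longrightarrow> \<iota> (UnitO C) \<otimes>\<^sub>a f = f"
  unfolding arr_def
  by (rule arrow_eqI) (simp_all add: tns_def idt_def unit_mor_left[of "src f" "tgt f"])

lemma tns_unit_right [simp]: "arr C f \<Longrightarrow> f \<otimes>\<^sub>a \<iota> (UnitO C) = f"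
  unfolding arr_def
  by (rule arrow_eqI) (simp_all add: tns_def idt_def unit_mor_right[of "src f" "tgt f"])

lemma tns_pls_right:
  "arr C f \<Longrightarrow> arr C g \<Longrightarrow> arr C h \<Longrightarrow> src g = src h \<Longrightarrow> tgt g = tgt h
   \<Longrightarrow> f \<otimes>\<^sub>a (g \<boxplus> h) = f \<otimes>\<^sub>a g \<boxplus> f \<otimes>\<^sub>a h"
  unfolding arr_def tns_def pls_def
  by (auto simp add: lm_add[OF bil_tns(1)[of "src f" "tgt f" "src h" "tgt h"]])

lemma tns_pls_left:
  "arr C f \<Longrightarrow> arr C g \<Longrightarrow> arr C h \<Longrightarrow> src f = src g \<Longrightarrow> tgt f = tgt g
   \<Longrightarrow> (f \<boxplus> g) \<otimes>\<^sub>a h = f \<otimes>\<^sub>a h \<boxplus> g \<otimes>\<^sub>a h"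
  unfolding arr_def tns_def pls_def
  by (auto simp add: lm_add[OF bil_tns(2)[of "src g" "tgt g" "src h" "tgt h"]])

lemma tns_scl_right [simp]: "arr C f \<Longrightarrow> arr C g \<Longrightarrow> f \<otimes>\<^sub>a (c \<boxdot> g) = c \<boxdot> (f \<otimes>\<^sub>a g)"
  unfolding arr_def tns_def scl_def
  by (simp add: lm_scale[OF bil_tns(1)[of "src f" "tgt f" "src g" "tgt g"]])

lemma tns_scl_left [simp]: "arr C f \<Longrightarrow> arr C g \<Longrightarrow> (c \<boxdot> f) \<otimes>\<^sub>a g = c \<boxdot> (f \<otimes>\<^sub>a g)"
  unfolding arr_def tns_def scl_def
  by (simp add: lm_scale[OF bil_tns(2)[of "src f" "tgt f" "src g" "tgt g"]])

lemma tns_zr_right [simp]: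
  "arr C f \<Longrightarrow> X \<in> Obj C \<Longrightarrow> Y \<in> Obj C \<Longrightarrow> f \<otimes>\<^sub>a zr C X Y = zr C (src f \<otimes>\<^sub>o X) (tgt f \<otimes>\<^sub>o Y)"
  unfolding arr_def tns_def zr_def
  by (simp add: lm_zero[OF bil_tns(1)[of "src f" "tgt f" X Y]])

lemma tns_zr_left [simp]:
  "arr C f \<Longrightarrow> X \<in> Obj C \<Longrightarrow> Y \<in> Obj C \<Longrightarrow> zr C X Y \<otimes>\<^sub>a f = zr C (X \<otimes>\<^sub>o src f) (Y \<otimes>\<^sub>o tgt f)"
  unfolding arr_def tns_def zr_def
  by (simp add: lm_zero[OF bil_tns(2)[of X Y "src f" "tgt f"]])

declare arr_objs [simp]

text \<open>The interchange law inside a composite nested to the right, for the same purpose as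
  \<open>cmp_assoc_eq\<close>.\<close>

lemma interchange':
  "arr C f \<Longrightarrow> arr C g \<Longrightarrow> arr C f' \<Longrightarrow> arr C g' \<Longrightarrow> src g = tgt f \<Longrightarrow> src g' = tgt f' \<Longrightarrow> arr C x
   \<Longrightarrow> src f \<otimes>\<^sub>o src f' = tgt x
   \<Longrightarrow> (g \<otimes>\<^sub>a g') \<star> ((f \<otimes>\<^sub>a f') \<star> x) = ((g \<star> f) \<otimes>\<^sub>a (g' \<star> f')) \<star> x"
  by (subst interchange[symmetric]) simp_all

end

declare arr_objs [simp del]

context
  fixes C :: "('k::field, 'o, 'm, 'y) lin_cat_scheme" and D :: "('k, 'p, 'n, 'z) lin_cat_scheme" and F
  assumes F: "linear_functor C D F"
begin

lemma fm_obj: "X \<in> Obj C \<Longrightarrow> obj_map F X \<in> Obj D"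
  using F by (simp add: linear_functor_def)

lemma fm_linear: "X \<in> Obj C \<Longrightarrow> Y \<in> Obj C
    \<Longrightarrow> linear_map class_ring (HomV C X Y) (HomV D (obj_map F X) (obj_map F Y)) (arr_map F X Y)"
  using F by (simp add: linear_functor_def)

lemma fm_arr: "arr C f \<Longrightarrow> arr D (fm F f)"
  by (simp add: arr_def fm_def fm_obj lm_closed[OF fm_linear])

lemma fm_idt: "X \<in> Obj C \<Longrightarrow> fm F (idt C X) = idt D (obj_map F X)"
  using F by (simp add: linear_functor_def fm_def idt_def)

lemma fm_cmp: "arr C f \<Longrightarrow> arr C g \<Longrightarrow> src g = tgt f \<Longrightarrow> fm F (cmp C g f) = cmp D (fm F g) (fm F f)"
  using F by (simp add: linear_functor_def fm_def cmp_def arr_def)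

lemma fm_pls: "arr C f \<Longrightarrow> arr C g \<Longrightarrow> src f = src g \<Longrightarrow> tgt f = tgt g
    \<Longrightarrow> fm F (pls C f g) = pls D (fm F f) (fm F g)"
  by (auto simp add: fm_def pls_def arr_def lm_add[OF fm_linear])

lemma fm_scl: "arr C f \<Longrightarrow> fm F (scl C c f) = scl D c (fm F f)"
  by (simp add: fm_def scl_def arr_def lm_scale[OF fm_linear])

lemma fm_zr: "X \<in> Obj C \<Longrightarrow> Y \<in> Obj C \<Longrightarrow> fm F (zr C X Y) = zr D (obj_map F X) (obj_map F Y)"
  by (simp add: fm_def zr_def lm_zero[OF fm_linear])

end

declare arr_objs [simp]

lemmas fm_simps = fm_obj fm_arr fm_idt fm_cmp fm_pls fm_scl fm_zr

section \<open>A separator of a finite category\<close>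

lemma carrier_vec_induct [consumes 1]:
  fixes v :: "'k::field vec"
  assumes v: "v \<in> carrier_vec n" and zero: "P (0\<^sub>v n)"
    and add: "\<And>x y. x \<in> carrier_vec n \<Longrightarrow> y \<in> carrier_vec n \<Longrightarrow> P x \<Longrightarrow> P y \<Longrightarrow> P (x + y)"
    and scale: "\<And>c x. x \<in> carrier_vec n \<Longrightarrow> P x \<Longrightarrow> P (c \<cdot>\<^sub>v x)"
    and unit: "\<And>i. i < n \<Longrightarrow> P (unit_vec n i)"
  shows "P v"
proof -
  \<comment> \<open>\<open>w k\<close> keeps the first k coordinates of v and is 0 elsewhere; it
    grows from the zero vector to v by one multiple of a unit vector at a time.\<close>
  define w where "w k = vec n (\<lambda>j. if j < k then v $ j else 0)" for k
  have "k \<le> n \<Longrightarrow> P (w k)" for k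
  proof (induction k)
    case 0
    have "w 0 = 0\<^sub>v n" by (auto simp: w_def)
    thus ?case using zero by simp
  next
    case (Suc k)
    have "w (Suc k) = w k + (v $ k) \<cdot>\<^sub>v unit_vec n k"
      using Suc.prems by (auto simp: w_def less_Suc_eq)
    moreover have "P (w k + (v $ k) \<cdot>\<^sub>v unit_vec n k)"
      using Suc by (intro add scale unit) (auto simp: w_def)
    ultimately show ?case by simp
  qed
  moreover have "w n = v" using v by (auto simp: w_def)
  ultimately show ?thesis by blast
qed

lemma mult_unit_vec:
  "(A :: 'k::field mat) \<in> carrier_mat m n \<Longrightarrow> j < n \<Longrightarrow> A *\<^sub>v unit_vec n j = col A j"
  by (rule eq_vecI) auto

lemma smult_mat_vec:
  assumes "(A :: 'k::field mat) \<in> carrier_mat m n" "v \<in> carrier_vec n"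
  shows "(c \<cdot>\<^sub>m A) *\<^sub>v v = c \<cdot>\<^sub>v (A *\<^sub>v v)"
  using assms by (intro eq_vecI) (auto simp: scalar_prod_def sum_distrib_left mult.assoc)

lemma mat_eq_by_vec:
  fixes A :: "'k::field mat"
  assumes A: "A \<in> carrier_mat m n" and B: "B \<in> carrier_mat m n"
    and eq: "\<And>v. v \<in> carrier_vec n \<Longrightarrow> A *\<^sub>v v = B *\<^sub>v v"
  shows "A = B"
proof (rule mat_col_eqI)
  fix j assume "j < dim_col B"
  hence j: "j < n" using B by simp
  show "col A j = col B j"
    using eq[OF unit_vec_carrier, of j] mult_unit_vec[OF A j] mult_unit_vec[OF B j] by simp
qed (use A B in auto)

definition mat_of_fun :: "nat \<Rightarrow> nat \<Rightarrow> ('k::field vec \<Rightarrow> 'k vec) \<Rightarrow> 'k mat" where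
  "mat_of_fun m n f = mat m n (\<lambda>(i, j). f (unit_vec n j) $ i)"

lemma mat_of_fun_carrier [simp]: "mat_of_fun m n f \<in> carrier_mat m n"
  by (simp add: mat_of_fun_def)

lemma mult_mat_of_fun:
  fixes f :: "'k::field vec \<Rightarrow> 'k vec"
  assumes cl: "\<And>x. x \<in> carrier_vec n \<Longrightarrow> f x \<in> carrier_vec m"
    and add: "\<And>x y. x \<in> carrier_vec n \<Longrightarrow> y \<in> carrier_vec n \<Longrightarrow> f (x + y) = f x + f y"
    and scale: "\<And>c x. x \<in> carrier_vec n \<Longrightarrow> f (c \<cdot>\<^sub>v x) = c \<cdot>\<^sub>v f x"
    and v: "v \<in> carrier_vec n"
  shows "mat_of_fun m n f *\<^sub>v v = f v"
proof -
  let ?M = "mat_of_fun m n f"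
  have modcat: "?M \<in> carrier_mat m n" by simp
  have zero: "?M *\<^sub>v 0\<^sub>v n = f (0\<^sub>v n)"
  proof -
    have "f (0 \<cdot>\<^sub>v 0\<^sub>v n) = 0 \<cdot>\<^sub>v f (0\<^sub>v n)" by (rule scale) simp
    moreover have "0 \<cdot>\<^sub>v (0\<^sub>v n :: 'k vec) = 0\<^sub>v n" by (rule eq_vecI) auto
    moreover have "0 \<cdot>\<^sub>v f (0\<^sub>v n) = 0\<^sub>v m" using cl[of "0\<^sub>v n"] by (intro eq_vecI) auto
    ultimately have "f (0\<^sub>v n) = 0\<^sub>v m" by simp
    moreover have "?M *\<^sub>v 0\<^sub>v n = 0\<^sub>v m" by (rule eq_vecI) (auto simp: mat_of_fun_def scalar_prod_def)
    ultimately show ?thesis by simp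
  qed
  show ?thesis
    using v
  proof (induction rule: carrier_vec_induct)
    show "?M *\<^sub>v 0\<^sub>v n = f (0\<^sub>v n)" by (rule zero)
  next
    fix x y assume "x \<in> carrier_vec n" "y \<in> carrier_vec n" "?M *\<^sub>v x = f x" "?M *\<^sub>v y = f y"
    thus "?M *\<^sub>v (x + y) = f (x + y)"
      using mult_add_distrib_mat_vec[OF modcat] add by simp
  next
    fix c x assume "x \<in> carrier_vec n" "?M *\<^sub>v x = f x"
    thus "?M *\<^sub>v (c \<cdot>\<^sub>v x) = f (c \<cdot>\<^sub>v x)"
      using mult_mat_vec[OF modcat] scale by simp
  next
    fix i assume i: "i < n"
    have "col ?M i = f (unit_vec n i)"
      using i cl[OF unit_vec_carrier, of i] by (intro eq_vecI) (auto simp: mat_of_fun_def)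
    thus "?M *\<^sub>v unit_vec n i = f (unit_vec n i)"
      using mult_unit_vec[OF modcat i] by simp
  qed
qed

text \<open>
  Finite generation is phrased as an induction principle: a property closed under linear
  combinations that holds on a finite list holds everywhere.
\<close>

definition finitely_spanned :: "('k, 'o, 'm, 'z) lin_cat_scheme \<Rightarrow> 'o \<Rightarrow> 'o \<Rightarrow> bool" where
  "finitely_spanned C G X \<longleftrightarrow> (\<exists>bs. (\<forall>b\<in>set bs. arr C b \<and> src b = G \<and> tgt b = X) \<and>
     (\<forall>P. P (zr C G X) \<longrightarrow>
        (\<forall>f g. arr C f \<longrightarrow> src f = G \<longrightarrow> tgt f = X \<longrightarrow> arr C g \<longrightarrow> src g = G \<longrightarrow> tgt g = X
           \<longrightarrow> P f \<longrightarrow> P g \<longrightarrow> P (pls C f g)) \<longrightarrow>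
        (\<forall>c f. arr C f \<longrightarrow> src f = G \<longrightarrow> tgt f = X \<longrightarrow> P f \<longrightarrow> P (scl C c f)) \<longrightarrow>
        (\<forall>b\<in>set bs. P b) \<longrightarrow>
        (\<forall>h. arr C h \<longrightarrow> src h = G \<longrightarrow> tgt h = X \<longrightarrow> P h)))"

text \<open>Finite spanning of hom(G, X) yields finitely many copies of G that map to X, and
  faithfulness of hom(G, -) makes such a map epic once every arrow from G factors through
  it.\<close>

definition separator :: "('k, 'o, 'm, 'z) lin_cat_scheme \<Rightarrow> 'o \<Rightarrow> bool" where
  "separator C G \<longleftrightarrow> G \<in> Obj C \<and> (\<forall>X\<in>Obj C. finitely_spanned C G X) \<and>
     (\<forall>f g. arr C f \<longrightarrow> arr C g \<longrightarrow> src f = src g \<longrightarrow> tgt f = tgt g \<longrightarrow>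
        (\<forall>h. arr C h \<longrightarrow> src h = G \<longrightarrow> tgt h = src f \<longrightarrow> cmp C f h = cmp C g h) \<longrightarrow> f = g)"

section \<open>Modules over a finite-dimensional algebra: the regular module as separator\<close>

context
  fixes n :: nat and \<mu> :: "'k::field vec \<Rightarrow> 'k vec \<Rightarrow> 'k vec" and u :: "'k vec"
  assumes alg: "fd_algebra n \<mu> u"
begin

abbreviation (input) "modcat \<equiv> fd_modules n \<mu> u"

lemma mu_left:
  assumes "a \<in> carrier_vec n"
  shows "b \<in> carrier_vec n \<Longrightarrow> \<mu> a b \<in> carrier_vec n"
    and "b \<in> carrier_vec n \<Longrightarrow> c \<in> carrier_vec n \<Longrightarrow> \<mu> a (b + c) = \<mu> a b + \<mu> a c"
    and "b \<in> carrier_vec n \<Longrightarrow> \<mu> a (k \<cdot>\<^sub>v b) = k \<cdot>\<^sub>v \<mu> a b"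
proof -
  have L: "linear_map class_ring (module_vec TYPE('k) n) (module_vec TYPE('k) n) (\<mu> a)"
    using alg assms by (simp add: fd_algebra_def bilinear_map_def module_vec_simps)
  show "b \<in> carrier_vec n \<Longrightarrow> \<mu> a b \<in> carrier_vec n"
    using lm_closed[OF L, of b] by (simp add: module_vec_simps)
  show "b \<in> carrier_vec n \<Longrightarrow> c \<in> carrier_vec n \<Longrightarrow> \<mu> a (b + c) = \<mu> a b + \<mu> a c"
    using lm_add[OF L, of b c] by (simp add: module_vec_simps)
  show "b \<in> carrier_vec n \<Longrightarrow> \<mu> a (k \<cdot>\<^sub>v b) = k \<cdot>\<^sub>v \<mu> a b"
    using lm_scale[OF L, of b k] by (simp add: module_vec_simps)
qed

lemma mu_right:
  assumes "b \<in> carrier_vec n"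
  shows "a \<in> carrier_vec n \<Longrightarrow> c \<in> carrier_vec n \<Longrightarrow> \<mu> (a + c) b = \<mu> a b + \<mu> c b"
    and "a \<in> carrier_vec n \<Longrightarrow> \<mu> (k \<cdot>\<^sub>v a) b = k \<cdot>\<^sub>v \<mu> a b"
proof -
  have L: "linear_map class_ring (module_vec TYPE('k) n) (module_vec TYPE('k) n) (\<lambda>a. \<mu> a b)"
    using alg assms by (simp add: fd_algebra_def bilinear_map_def module_vec_simps)
  show "a \<in> carrier_vec n \<Longrightarrow> c \<in> carrier_vec n \<Longrightarrow> \<mu> (a + c) b = \<mu> a b + \<mu> c b"
    using lm_add[OF L, of a c] by (simp add: module_vec_simps)
  show "a \<in> carrier_vec n \<Longrightarrow> \<mu> (k \<cdot>\<^sub>v a) b = k \<cdot>\<^sub>v \<mu> a b"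
    using lm_scale[OF L, of a k] by (simp add: module_vec_simps)
qed

lemma mu_assoc:
  "a \<in> carrier_vec n \<Longrightarrow> b \<in> carrier_vec n \<Longrightarrow> c \<in> carrier_vec n \<Longrightarrow> \<mu> (\<mu> a b) c = \<mu> a (\<mu> b c)"
  using alg by (simp add: fd_algebra_def)

lemma mu_unit: "u \<in> carrier_vec n" "a \<in> carrier_vec n \<Longrightarrow> \<mu> u a = a" "a \<in> carrier_vec n \<Longrightarrow> \<mu> a u = a"
  using alg by (simp_all add: fd_algebra_def)

lemma fd_module_theta:
  assumes "fd_module n \<mu> u m \<theta>" and a: "a \<in> carrier_vec n"
  shows "\<theta> a \<in> carrier_mat m m"
    and "b \<in> carrier_vec n \<Longrightarrow> \<theta> (a + b) = \<theta> a + \<theta> b"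
    and "\<theta> (k \<cdot>\<^sub>v a) = k \<cdot>\<^sub>m \<theta> a"
    and "b \<in> carrier_vec n \<Longrightarrow> \<theta> (\<mu> a b) = \<theta> a * \<theta> b"
    and "\<theta> u = 1\<^sub>m m"
proof -
  have L: "linear_map class_ring (module_vec TYPE('k) n) (module_mat TYPE('k) m m) \<theta>"
    using assms by (simp add: fd_module_def)
  show "\<theta> a \<in> carrier_mat m m"
    using lm_closed[OF L, of a] a by (simp add: module_vec_simps module_mat_simps)
  show "b \<in> carrier_vec n \<Longrightarrow> \<theta> (a + b) = \<theta> a + \<theta> b"
    using lm_add[OF L, of a b] a by (simp add: module_vec_simps module_mat_simps)
  show "\<theta> (k \<cdot>\<^sub>v a) = k \<cdot>\<^sub>m \<theta> a"
    using lm_scale[OF L, of a k] a by (simp add: module_vec_simps module_mat_simps)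
qed (use assms in \<open>simp_all add: fd_module_def\<close>)

lemma Obj_modules: "(m, \<theta>) \<in> Obj modcat \<longleftrightarrow> fd_module n \<mu> u m \<theta>"
  by (simp add: fd_modules_def)

lemma Mor_modules:
  "T \<in> Mor modcat (m, \<theta>) (m', \<theta>') \<longleftrightarrow> T \<in> carrier_mat m' m \<and> (\<forall>a\<in>carrier_vec n. T * \<theta> a = \<theta>' a * T)"
  by (simp add: fd_modules_def)

lemma HomV_modules:
  "add (HomV modcat (m, \<theta>) (m', \<theta>')) = (+)" "zero (HomV modcat (m, \<theta>) (m', \<theta>')) = 0\<^sub>m m' m"
  "smult (HomV modcat (m, \<theta>) (m', \<theta>')) = (\<cdot>\<^sub>m)"
  by (simp_all add: fd_modules_def module_mat_simps)

lemma Comp_modules: "g \<cdot>\<^bsub>modcat\<^esub> f = g * f" "Ident modcat (m, \<theta>) = 1\<^sub>m m"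
  by (simp_all add: fd_modules_def)

lemma linear_category_modules: "linear_category modcat"
proof (rule linear_category.intro)
  have vs: "vectorspace class_ring (HomV modcat X Y)" if XY: "X \<in> Obj modcat" "Y \<in> Obj modcat" for X Y
  proof -
    obtain m \<theta> m' \<theta>' where [simp]: "X = (m, \<theta>)" "Y = (m', \<theta>')" by (cases X, cases Y)
    note t = fd_module_theta(1)[OF XY(1)[simplified, unfolded Obj_modules]]
      fd_module_theta(1)[OF XY(2)[simplified, unfolded Obj_modules]]
    have "lin_closed (module_mat TYPE('k) m' m) {T \<in> carrier_mat m' m. \<forall>a\<in>carrier_vec n. T * \<theta> a = \<theta>' a * T}"
    proof (rule lin_closedI, goal_cases)
      case 1 thus ?case by (simp add: module_mat_simps)
    next
      case 2 show ?case
        using t by (auto simp: module_mat_simps left_mult_zero_mat[of _ m m] right_mult_zero_mat[of _ m' m'])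
    next
      case (3 x y)
      thus ?case using t
        by (auto simp: module_mat_simps add_mult_distrib_mat[of _ m' m _ _ m] mult_add_distrib_mat[of _ m' m' _ m])
    next
      case (4 c x)
      thus ?case using t
        by (auto simp: module_mat_simps mult_smult_assoc_mat[of _ m' m _ m] mult_smult_distrib[of _ m' m' _ m])
    qed
    from vectorspace_restrict[OF matrix_vs this] show ?thesis by (simp add: fd_modules_def)
  qed
  show "vectorspace class_ring (HomV modcat X Y)" if "X \<in> Obj modcat" "Y \<in> Obj modcat" for X Y
    using vs that by blast
  show "bilinear_map (HomV modcat Y Z) (HomV modcat X Y) (HomV modcat X Z) (\<lambda>g f. g \<cdot>\<^bsub>modcat\<^esub> f)"
    if XYZ: "X \<in> Obj modcat" "Y \<in> Obj modcat" "Z \<in> Obj modcat" for X Y Z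
  proof -
    obtain m1 t1 m2 t2 m3 t3 where [simp]: "X = (m1, t1)" "Y = (m2, t2)" "Z = (m3, t3)"
      by (cases X, cases Y, cases Z)
    note t = fd_module_theta(1)[OF XYZ(1)[simplified, unfolded Obj_modules]]
      fd_module_theta(1)[OF XYZ(2)[simplified, unfolded Obj_modules]]
      fd_module_theta(1)[OF XYZ(3)[simplified, unfolded Obj_modules]]
    have cl: "g * f \<in> Mor modcat X Z" if g: "g \<in> Mor modcat Y Z" and f: "f \<in> Mor modcat X Y" for g f
    proof -
      have "g * f * t1 a = t3 a * (g * f)" if a: "a \<in> carrier_vec n" for a
      proof -
        have gc: "g \<in> carrier_mat m3 m2" and fc: "f \<in> carrier_mat m2 m1"
          using g f by (simp_all add: Mor_modules)
        have "g * f * t1 a = g * (f * t1 a)" by (rule assoc_mult_mat[OF gc fc t(1)[OF a]])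
        also have "f * t1 a = t2 a * f" using f a by (simp add: Mor_modules)
        also have "g * (t2 a * f) = g * t2 a * f" by (rule assoc_mult_mat[OF gc t(2)[OF a] fc, symmetric])
        also have "g * t2 a = t3 a * g" using g a by (simp add: Mor_modules)
        also have "t3 a * g * f = t3 a * (g * f)" by (rule assoc_mult_mat[OF t(3)[OF a] gc fc])
        finally show ?thesis .
      qed
      thus ?thesis using g f by (simp add: Mor_modules mult_carrier_mat[of _ m3 m2])
    qed
    show ?thesis
      unfolding bilinear_map_def
    proof (intro conjI ballI linear_mapI)
      fix f g assume "f \<in> Mor modcat X Y" "g \<in> Mor modcat Y Z"
      thus "g \<cdot>\<^bsub>modcat\<^esub> f \<in> Mor modcat X Z" "g \<cdot>\<^bsub>modcat\<^esub> f \<in> Mor modcat X Z" using cl by (simp_all add: Comp_modules)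
    next
      fix g x y assume "g \<in> Mor modcat Y Z" "x \<in> Mor modcat X Y" "y \<in> Mor modcat X Y"
      thus "g \<cdot>\<^bsub>modcat\<^esub> (x \<oplus>\<^bsub>HomV modcat X Y\<^esub> y) = (g \<cdot>\<^bsub>modcat\<^esub> x) \<oplus>\<^bsub>HomV modcat X Z\<^esub> (g \<cdot>\<^bsub>modcat\<^esub> y)"
        by (simp add: Comp_modules HomV_modules Mor_modules mult_add_distrib_mat[of _ m3 m2 _ m1])
    next
      fix g c x assume "g \<in> Mor modcat Y Z" "x \<in> Mor modcat X Y"
      thus "g \<cdot>\<^bsub>modcat\<^esub> (c \<odot>\<^bsub>HomV modcat X Y\<^esub> x) = c \<odot>\<^bsub>HomV modcat X Z\<^esub> (g \<cdot>\<^bsub>modcat\<^esub> x)"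
        by (simp add: Comp_modules HomV_modules Mor_modules mult_smult_distrib[of _ m3 m2 _ m1])
    next
      fix f x y assume "f \<in> Mor modcat X Y" "x \<in> Mor modcat Y Z" "y \<in> Mor modcat Y Z"
      thus "(x \<oplus>\<^bsub>HomV modcat Y Z\<^esub> y) \<cdot>\<^bsub>modcat\<^esub> f = (x \<cdot>\<^bsub>modcat\<^esub> f) \<oplus>\<^bsub>HomV modcat X Z\<^esub> (y \<cdot>\<^bsub>modcat\<^esub> f)"
        by (simp add: Comp_modules HomV_modules Mor_modules add_mult_distrib_mat[of _ m3 m2 _ _ m1])
    next
      fix f c x assume "f \<in> Mor modcat X Y" "x \<in> Mor modcat Y Z"
      thus "(c \<odot>\<^bsub>HomV modcat Y Z\<^esub> x) \<cdot>\<^bsub>modcat\<^esub> f = c \<odot>\<^bsub>HomV modcat X Z\<^esub> (x \<cdot>\<^bsub>modcat\<^esub> f)"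
        by (simp add: Comp_modules HomV_modules Mor_modules mult_smult_assoc_mat[of _ m3 m2 _ m1])
    qed (use vs XYZ in auto)
  qed
  show "Ident modcat X \<in> Mor modcat X X" if X: "X \<in> Obj modcat" for X
  proof -
    obtain m \<theta> where [simp]: "X = (m, \<theta>)" by (cases X)
    note t = fd_module_theta(1)[OF X[simplified, unfolded Obj_modules]]
    show ?thesis
      using t by (simp add: Comp_modules Mor_modules left_mult_one_mat[of _ m m] right_mult_one_mat[of _ m m])
  qed
  show "f \<cdot>\<^bsub>modcat\<^esub> Ident modcat X = f" if f: "f \<in> Mor modcat X Y" for X Y f
    using f by (cases X, cases Y) (auto simp: Comp_modules Mor_modules intro: right_mult_one_mat)
  show "Ident modcat Y \<cdot>\<^bsub>modcat\<^esub> f = f" if f: "f \<in> Mor modcat X Y" for X Y f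
    using f by (cases X, cases Y) (auto simp: Comp_modules Mor_modules intro: left_mult_one_mat)
  show "(h \<cdot>\<^bsub>modcat\<^esub> g) \<cdot>\<^bsub>modcat\<^esub> f = h \<cdot>\<^bsub>modcat\<^esub> (g \<cdot>\<^bsub>modcat\<^esub> f)"
    if "f \<in> Mor modcat X Y" "g \<in> Mor modcat Y Z" "h \<in> Mor modcat Z T" for X Y Z T f g h
    using that by (cases X, cases Y, cases Z, cases T) (auto simp: Comp_modules Mor_modules intro: assoc_mult_mat)
qed

definition regular where "regular = (n, \<lambda>a. mat_of_fun n n (\<mu> a))"

lemma regular_mult:
  "a \<in> carrier_vec n \<Longrightarrow> b \<in> carrier_vec n \<Longrightarrow> mat_of_fun n n (\<mu> a) *\<^sub>v b = \<mu> a b"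
  by (rule mult_mat_of_fun) (simp_all add: mu_left)

lemma regular_obj: "regular \<in> Obj modcat"
proof -
  let ?L = "\<lambda>a. mat_of_fun n n (\<mu> a)"
  have "linear_map class_ring (module_vec TYPE('k) n) (module_mat TYPE('k) n n) ?L"
  proof (rule linear_mapI[OF vec_vs matrix_vs])
    fix x y assume "x \<in> carrier (module_vec TYPE('k) n)" "y \<in> carrier (module_vec TYPE('k) n)"
    hence "?L (x + y) = ?L x + ?L y"
      by (intro mat_eq_by_vec[of _ n n])
        (simp_all add: module_vec_simps regular_mult mu_right add_mult_distrib_mat_vec[of _ n n])
    thus "?L (x \<oplus>\<^bsub>module_vec TYPE('k) n\<^esub> y) = ?L x \<oplus>\<^bsub>module_mat TYPE('k) n n\<^esub> ?L y"
      by (simp add: module_vec_simps module_mat_simps)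
  next
    fix c x assume "x \<in> carrier (module_vec TYPE('k) n)"
    hence "?L (c \<cdot>\<^sub>v x) = c \<cdot>\<^sub>m ?L x"
      by (intro mat_eq_by_vec[of _ n n])
        (simp_all add: module_vec_simps regular_mult mu_right smult_mat_vec[of _ n n])
    thus "?L (c \<odot>\<^bsub>module_vec TYPE('k) n\<^esub> x) = c \<odot>\<^bsub>module_mat TYPE('k) n n\<^esub> ?L x"
      by (simp add: module_vec_simps module_mat_simps)
  qed (simp add: module_mat_simps)
  moreover have "?L (\<mu> a b) = ?L a * ?L b" if "a \<in> carrier_vec n" "b \<in> carrier_vec n" for a b
    using that by (intro mat_eq_by_vec[of _ n n])
      (simp_all add: regular_mult mu_left mu_assoc assoc_mult_mat_vec[of _ n n _ n] mult_carrier_mat[of _ n n])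
  moreover have "?L u = 1\<^sub>m n"
    by (intro mat_eq_by_vec[of _ n n]) (simp_all add: regular_mult mu_unit)
  ultimately show ?thesis by (simp add: regular_def Obj_modules fd_module_def)
qed

text \<open>The homomorphism from the regular module that sends the unit to v. By
  \<open>elem_surj\<close> all homomorphisms out of the regular module have this form, which is the
  isomorphism Hom(A, M) = M.\<close>

definition elem where "elem m \<theta> v = mat_of_fun m n (\<lambda>a. \<theta> a *\<^sub>v v)"

context
  fixes m \<theta> assumes mod: "fd_module n \<mu> u m \<theta>"
begin

lemmas th = fd_module_theta[OF mod]

lemma elem_carrier [simp]: "elem m \<theta> v \<in> carrier_mat m n"
  by (simp add: elem_def)

lemma elem_mult:
  assumes v: "v \<in> carrier_vec m" and a: "a \<in> carrier_vec n"
  shows "elem m \<theta> v *\<^sub>v a = \<theta> a *\<^sub>v v"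
  unfolding elem_def
  by (rule mult_mat_of_fun)
    (use v a in \<open>simp_all add: th add_mult_distrib_mat_vec[of _ m m] smult_mat_vec[of _ m m]
      mult_mat_vec_carrier[OF th(1)]\<close>)

lemma elem_Mor: "v \<in> carrier_vec m \<Longrightarrow> elem m \<theta> v \<in> Mor modcat regular (m, \<theta>)"
proof -
  assume v: "v \<in> carrier_vec m"
  have "elem m \<theta> v * mat_of_fun n n (\<mu> a) = \<theta> a * elem m \<theta> v" if a: "a \<in> carrier_vec n" for a
  proof (rule mat_eq_by_vec[of _ m n])
    fix b :: "'k vec" assume b: "b \<in> carrier_vec n"
    have "(elem m \<theta> v * mat_of_fun n n (\<mu> a)) *\<^sub>v b = elem m \<theta> v *\<^sub>v \<mu> a b"
      using b a by (subst assoc_mult_mat_vec[of _ m n _ n]) (simp_all add: regular_mult)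
    also have "\<dots> = \<theta> a *\<^sub>v (\<theta> b *\<^sub>v v)"
      using v a b th by (simp add: elem_mult mu_left assoc_mult_mat_vec[of _ m m _ m])
    also have "\<dots> = (\<theta> a * elem m \<theta> v) *\<^sub>v b"
      using v a b th by (subst assoc_mult_mat_vec[of _ m m _ n]) (simp_all add: elem_mult)
    finally show "(elem m \<theta> v * mat_of_fun n n (\<mu> a)) *\<^sub>v b = (\<theta> a * elem m \<theta> v) *\<^sub>v b" .
  next
    show "elem m \<theta> v * mat_of_fun n n (\<mu> a) \<in> carrier_mat m n" by (rule mult_carrier_mat[of _ m n]) simp_all
    show "\<theta> a * elem m \<theta> v \<in> carrier_mat m n" by (rule mult_carrier_mat[of _ m m]) (simp_all add: th(1)[OF a])
  qed
  thus ?thesis by (simp add: regular_def Mor_modules)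
qed

lemma elem_unit: "v \<in> carrier_vec m \<Longrightarrow> elem m \<theta> v *\<^sub>v u = v"
  by (simp add: elem_mult mu_unit th(5)[OF mu_unit(1)])

text \<open>Since a is the product of a with the unit, a homomorphism T sends a to the action of a
  on T u.\<close>

lemma elem_surj:
  assumes T: "T \<in> Mor modcat regular (m, \<theta>)"
  shows "T = elem m \<theta> (T *\<^sub>v u)" "T *\<^sub>v u \<in> carrier_vec m"
proof -
  have Tc: "T \<in> carrier_mat m n" using T by (simp add: regular_def Mor_modules)
  show Tu: "T *\<^sub>v u \<in> carrier_vec m" using Tc mu_unit by auto
  show "T = elem m \<theta> (T *\<^sub>v u)"
  proof (rule mat_eq_by_vec[of _ m n])
    fix a :: "'k vec" assume a: "a \<in> carrier_vec n"
    have "T *\<^sub>v a = T *\<^sub>v (mat_of_fun n n (\<mu> a) *\<^sub>v u)" using a by (simp add: regular_mult mu_unit)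
    also have "\<dots> = (T * mat_of_fun n n (\<mu> a)) *\<^sub>v u"
      using Tc mu_unit(1) by (subst assoc_mult_mat_vec[of _ m n _ n]) simp_all
    also have "\<dots> = (\<theta> a * T) *\<^sub>v u" using T a by (simp add: regular_def Mor_modules)
    also have "\<dots> = \<theta> a *\<^sub>v (T *\<^sub>v u)"
      using Tc mu_unit(1) th(1)[OF a] by (subst assoc_mult_mat_vec[of _ m m _ n]) simp_all
    finally show "T *\<^sub>v a = elem m \<theta> (T *\<^sub>v u) *\<^sub>v a" using elem_mult[OF Tu a] by simp
  qed (use Tc in auto)
qed

lemma elem_linear:
  "elem m \<theta> (0\<^sub>v m) = 0\<^sub>m m n"
  "v \<in> carrier_vec m \<Longrightarrow> w \<in> carrier_vec m \<Longrightarrow> elem m \<theta> (v + w) = elem m \<theta> v + elem m \<theta> w"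
  "v \<in> carrier_vec m \<Longrightarrow> elem m \<theta> (c \<cdot>\<^sub>v v) = c \<cdot>\<^sub>m elem m \<theta> v"
proof -
  show "elem m \<theta> (0\<^sub>v m) = 0\<^sub>m m n"
  proof (rule mat_eq_by_vec[of _ m n])
    fix a :: "'k vec" assume a: "a \<in> carrier_vec n"
    show "elem m \<theta> (0\<^sub>v m) *\<^sub>v a = 0\<^sub>m m n *\<^sub>v a"
      using th(1)[OF a] a by (simp add: elem_mult) (intro eq_vecI, auto simp: scalar_prod_def)
  qed simp_all
  show "v \<in> carrier_vec m \<Longrightarrow> w \<in> carrier_vec m \<Longrightarrow> elem m \<theta> (v + w) = elem m \<theta> v + elem m \<theta> w"
    using th(1) by (intro mat_eq_by_vec[of _ m n])
      (simp_all add: elem_mult add_mult_distrib_mat_vec[of _ m n] mult_add_distrib_mat_vec[of _ m m])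
  show "v \<in> carrier_vec m \<Longrightarrow> elem m \<theta> (c \<cdot>\<^sub>v v) = c \<cdot>\<^sub>m elem m \<theta> v"
    using th(1) by (intro mat_eq_by_vec[of _ m n])
      (simp_all add: elem_mult smult_mat_vec[of _ m n] mult_mat_vec[of _ m m])
qed

end

text \<open>Through Hom(A, M) = M the unit vectors give a spanning list. Two homomorphisms that
  agree after every \<open>elem m \<theta> v\<close> agree at v, because v is the value of
  \<open>elem m \<theta> v\<close> at the unit.\<close>

lemma separator_modules: "separator modcat regular"
  unfolding separator_def
proof (intro conjI ballI allI impI)
  show "regular \<in> Obj modcat" by (rule regular_obj)
  fix X assume X: "X \<in> Obj modcat"
  obtain m \<theta> where [simp]: "X = (m, \<theta>)" by (cases X)
  have mod: "fd_module n \<mu> u m \<theta>" using X by (simp add: Obj_modules)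
  let ?e = "\<lambda>v. mk regular (elem m \<theta> v) X"
  have e: "arr modcat (?e v)" if "v \<in> carrier_vec m" for v
    using that elem_Mor[OF mod] X regular_obj by simp
  show "finitely_spanned modcat regular X"
    unfolding finitely_spanned_def
  proof (intro exI[of _ "map (\<lambda>i. ?e (unit_vec m i)) [0..<m]"] conjI allI impI)
    show "\<forall>b\<in>set (map (\<lambda>i. ?e (unit_vec m i)) [0..<m]). arr modcat b \<and> src b = regular \<and> tgt b = X"
      using e[OF unit_vec_carrier] by auto
    fix P h
    assume zero: "P (zr modcat regular X)"
      and add: "\<forall>f g. arr modcat f \<longrightarrow> src f = regular \<longrightarrow> tgt f = X \<longrightarrow> arr modcat g \<longrightarrow> src g = regular \<longrightarrow> tgt g = X
             \<longrightarrow> P f \<longrightarrow> P g \<longrightarrow> P (pls modcat f g)"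
      and scale: "\<forall>c f. arr modcat f \<longrightarrow> src f = regular \<longrightarrow> tgt f = X \<longrightarrow> P f \<longrightarrow> P (scl modcat c f)"
      and unit: "\<forall>b\<in>set (map (\<lambda>i. ?e (unit_vec m i)) [0..<m]). P b"
      and h: "arr modcat h" "src h = regular" "tgt h = X"
    have "P (?e v)" if "v \<in> carrier_vec m" for v
      using that
    proof (induction rule: carrier_vec_induct)
      show "P (?e (0\<^sub>v m))"
        using zero by (simp add: elem_linear[OF mod] zr_def regular_def HomV_modules)
    next
      fix x y :: "'k vec"
      assume xy: "x \<in> carrier_vec m" "y \<in> carrier_vec m" and P: "P (?e x)" "P (?e y)"
      have "P (pls modcat (?e x) (?e y))"
        using xy P by (intro add[rule_format] e) simp_all
      thus "P (?e (x + y))"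
        using xy by (simp add: elem_linear[OF mod] pls_def regular_def HomV_modules)
    next
      fix c and x :: "'k vec"
      assume x: "x \<in> carrier_vec m" and P: "P (?e x)"
      have "P (scl modcat c (?e x))" using x P by (intro scale[rule_format] e) simp_all
      thus "P (?e (c \<cdot>\<^sub>v x))"
        using x by (simp add: elem_linear[OF mod] scl_def regular_def HomV_modules)
    next
      fix i assume "i < m"
      thus "P (?e (unit_vec m i))" using unit by simp
    qed
    moreover have "und h \<in> Mor modcat regular (m, \<theta>)" using h by (simp add: arr_def)
    ultimately have "P (mk regular (und h) X)" using elem_surj[OF mod] by metis
    thus "P h" using h by (simp add: mk_und')
  qed
next
  fix f g
  assume fg: "arr modcat f" "arr modcat g" "src f = src g" "tgt f = tgt g"
    and eq: "\<forall>h. arr modcat h \<longrightarrow> src h = regular \<longrightarrow> tgt h = src f \<longrightarrow> cmp modcat f h = cmp modcat g h"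
  obtain m \<theta> m' \<theta>' where s: "src g = (m, \<theta>)" and t: "tgt g = (m', \<theta>')" by (cases "src g", cases "tgt g")
  have obj: "(m, \<theta>) \<in> Obj modcat" using fg(2) s by (metis arr_objs(1))
  hence mod: "fd_module n \<mu> u m \<theta>" by (simp add: Obj_modules)
  have fc: "und f \<in> carrier_mat m' m" and gc: "und g \<in> carrier_mat m' m"
    using fg s t by (simp_all add: arr_def Mor_modules)
  have "und f = und g"
  proof (rule mat_eq_by_vec[OF fc gc])
    fix v :: "'k vec" assume v: "v \<in> carrier_vec m"
    have "cmp modcat f (mk regular (elem m \<theta> v) (m, \<theta>)) = cmp modcat g (mk regular (elem m \<theta> v) (m, \<theta>))"
      using eq[rule_format, of "mk regular (elem m \<theta> v) (m, \<theta>)"] elem_Mor[OF mod v] obj regular_obj fg s by simp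
    hence "und f * elem m \<theta> v = und g * elem m \<theta> v" by (simp add: cmp_def Comp_modules)
    hence "(und f * elem m \<theta> v) *\<^sub>v u = (und g * elem m \<theta> v) *\<^sub>v u" by simp
    thus "und f *\<^sub>v v = und g *\<^sub>v v"
      using fc gc v mu_unit(1) elem_carrier[OF mod]
      by (simp add: assoc_mult_mat_vec[of _ m' m _ n] elem_unit[OF mod])
  qed
  thus "f = g" using fg by (intro arrow_eqI)
qed

end

declare split_paired_All [simp del] split_paired_Ex [simp del]

section \<open>Invariance of separators under linear equivalence\<close>

lemma arr_eq_cmp:
  assumes "cmp C g f = cmp C g' f" "linear_category C" "arr C g" "arr C g'" "arr C f" "arr C h"
    "src g = tgt f" "src g' = tgt f" "tgt h = src f" "cmp C f h = idt C (tgt f)"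
  shows "g = g'"
proof -
  interpret linear_category C by fact
  have "cmp C (cmp C g f) h = cmp C (cmp C g' f) h" using assms(1) by simp
  thus ?thesis using assms(3-) by simp
qed

text \<open>Hom(\<Psi> A, X) is Hom(A, \<Phi> X): the isomorphism \<eta> identifies X with
  \<Psi>(\<Phi> X), and \<Psi> is full and faithful. As \<eta> and \<epsilon> need not satisfy the
  triangle identities, fullness of \<Psi> is obtained by way of faithfulness of \<Phi>.\<close>

lemma separator_transfer:
  assumes C: "linear_category C" and M: "linear_category M"
    and Phi: "linear_functor C M \<Phi>" and Psi: "linear_functor M C \<Psi>"
    and eta: "natural_iso C C id_functor (functor_comp \<Psi> \<Phi>) \<eta>"
    and eps: "natural_iso M M (functor_comp \<Phi> \<Psi>) id_functor \<epsilon>"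
    and A: "separator M A"
  shows "separator C (obj_map \<Psi> A)"
proof -
  interpret C: linear_category C by fact
  interpret M: linear_category M by fact
  note P [simp] = fm_simps[OF Phi] and Q [simp] = fm_simps[OF Psi]
  let ?P = "fm \<Phi>" and ?Q = "fm \<Psi>" and ?o = "\<lambda>X. obj_map \<Psi> (obj_map \<Phi> X)"
  let ?o' = "\<lambda>X. obj_map \<Phi> (obj_map \<Psi> X)"
  define e where "e X = mk X (\<eta> X) (?o X)" for X
  define k where "k X = mk (?o' X) (\<epsilon> X) X" for X
  have srcs [simp]: "src (e X) = X" "tgt (e X) = ?o X" "src (k Y) = ?o' Y" "tgt (k Y) = Y" for X Y
    by (simp_all add: e_def k_def)
  have eiso: "\<exists>e'. arr C e' \<and> src e' = ?o X \<and> tgt e' = X \<and> cmp C e' (e X) = idt C X \<and> cmp C (e X) e' = idt C (?o X)"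
    and earr [simp]: "arr C (e X)" if "X \<in> Obj C" for X
  proof -
    from eta that obtain g where g: "\<eta> X \<in> Mor C X (?o X)" "g \<in> Mor C (?o X) X"
      "g \<cdot>\<^bsub>C\<^esub> \<eta> X = Ident C X" "\<eta> X \<cdot>\<^bsub>C\<^esub> g = Ident C (?o X)"
      by (auto simp: natural_iso_def isomorphism_def id_functor_def functor_comp_def)
    show "arr C (e X)" using g that by (simp add: e_def)
    show "\<exists>e'. arr C e' \<and> src e' = ?o X \<and> tgt e' = X \<and> cmp C e' (e X) = idt C X \<and> cmp C (e X) e' = idt C (?o X)"
      using g that by (intro exI[of _ "mk (?o X) g X"]) (simp add: e_def cmp_def idt_def)
  qed
  have kiso: "\<exists>k'. arr M k' \<and> src k' = Y \<and> tgt k' = ?o' Y \<and> cmp M k' (k Y) = idt M (?o' Y) \<and> cmp M (k Y) k' = idt M Y"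
    and karr [simp]: "arr M (k Y)" if "Y \<in> Obj M" for Y
  proof -
    from eps that obtain g where g: "\<epsilon> Y \<in> Mor M (?o' Y) Y" "g \<in> Mor M Y (?o' Y)"
      "g \<cdot>\<^bsub>M\<^esub> \<epsilon> Y = Ident M (?o' Y)" "\<epsilon> Y \<cdot>\<^bsub>M\<^esub> g = Ident M Y"
      by (auto simp: natural_iso_def isomorphism_def id_functor_def functor_comp_def)
    show "arr M (k Y)" using g that by (simp add: k_def)
    show "\<exists>k'. arr M k' \<and> src k' = Y \<and> tgt k' = ?o' Y \<and> cmp M k' (k Y) = idt M (?o' Y) \<and> cmp M (k Y) k' = idt M Y"
      using g that by (intro exI[of _ "mk Y g (?o' Y)"]) (simp add: k_def cmp_def idt_def)
  qed
  have enat: "cmp C (?Q (?P f)) (e (src f)) = cmp C (e (tgt f)) f" if "arr C f" for f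
    using eta that unfolding natural_iso_def
    by (auto simp: arr_def id_functor_def functor_comp_def cmp_def fm_def e_def simp del: arr_objs)
  have knat: "cmp M g (k (src g)) = cmp M (k (tgt g)) (?P (?Q g))" if "arr M g" for g
    using eps that unfolding natural_iso_def
    by (auto simp: arr_def id_functor_def functor_comp_def cmp_def fm_def k_def simp del: arr_objs)
  \<comment> \<open>Naturality of the isomorphisms \<open>e X\<close> recovers f from \<Psi>(\<Phi>
    f); faithfulness of \<Psi> follows in the same way from \<open>k\<close>.\<close>
  have Phi_faithful: "f = g" if fg: "arr C f" "arr C g" "src f = src g" "tgt f = tgt g" and eq: "?P f = ?P g" for f g
  proof -
    obtain e' where e': "arr C e'" "src e' = ?o (tgt g)" "tgt e' = tgt g" "cmp C e' (e (tgt g)) = idt C (tgt g)"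
      using eiso[of "tgt g"] fg by auto
    have "cmp C (e (tgt g)) f = cmp C (e (tgt g)) g" using enat[of f] enat[of g] eq fg by simp
    hence "cmp C (cmp C e' (e (tgt g))) f = cmp C (cmp C e' (e (tgt g))) g" using e'(1-3) fg by simp
    thus "f = g" using e'(4) fg by simp
  qed
  have Psi_faithful: "f = g" if fg: "arr M f" "arr M g" "src f = src g" "tgt f = tgt g" and eq: "?Q f = ?Q g" for f g
  proof -
    obtain k' where k': "arr M k'" "src k' = src g" "tgt k' = ?o' (src g)" "cmp M (k (src g)) k' = idt M (src g)"
      using kiso[of "src g"] fg by auto
    have "cmp M f (k (src g)) = cmp M g (k (src g))" using knat[of f] knat[of g] eq fg by simp
    thus "f = g" by (rule arr_eq_cmp[OF _ M, where h = k']) (use fg k' in auto)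
  qed
  have Psi_full: "\<exists>g. arr M g \<and> src g = X \<and> tgt g = Y \<and> ?Q g = h"
    if XY: "X \<in> Obj M" "Y \<in> Obj M" and h: "arr C h" "src h = obj_map \<Psi> X" "tgt h = obj_map \<Psi> Y" for X Y h
  proof -
    obtain k' where k': "arr M k'" "src k' = X" "tgt k' = ?o' X" "cmp M k' (k X) = idt M (?o' X)"
      using kiso[OF XY(1)] by auto
    obtain l' where l': "arr M l'" "src l' = Y" "tgt l' = ?o' Y" "cmp M l' (k Y) = idt M (?o' Y)"
      using kiso[OF XY(2)] by auto
    \<comment> \<open>The preimage of h suggested by naturality of \<open>k\<close>. That \<Psi>
      sends it to h is seen after applying \<Phi>, where \<open>k Y\<close> can be cancelled, and
      \<Phi> is faithful.\<close>
    define g where "g = cmp M (k Y) (cmp M (?P h) k')"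
    have g: "arr M g" "src g = X" "tgt g = Y" using h k' XY by (simp_all add: g_def)
    have "cmp M (k Y) (?P (?Q g)) = cmp M g (k X)" using knat[OF g(1)] g by simp
    also have "\<dots> = cmp M (k Y) (?P h)" unfolding g_def using h k' XY by simp
    finally have "cmp M (cmp M l' (k Y)) (?P (?Q g)) = cmp M (cmp M l' (k Y)) (?P h)"
      using g h l'(1-3) XY by simp
    hence "?P (?Q g) = ?P h" using g h XY by (simp add: l'(4))
    hence "?Q g = h" by (intro Phi_faithful) (use g h in auto)
    thus ?thesis using g by blast
  qed
  show ?thesis
    unfolding separator_def
  proof (intro conjI ballI allI impI)
    have A': "A \<in> Obj M" using A by (simp add: separator_def)
    thus "obj_map \<Psi> A \<in> Obj C" by simp
    fix X assume X: "X \<in> Obj C"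
    obtain e' where e': "arr C e'" "src e' = ?o X" "tgt e' = X" "cmp C e' (e X) = idt C X"
      using eiso[OF X] by blast
    have "finitely_spanned M A (obj_map \<Phi> X)" using A X by (simp add: separator_def)
    then obtain bs where bs: "\<forall>b\<in>set bs. arr M b \<and> src b = A \<and> tgt b = obj_map \<Phi> X"
      and ind: "\<forall>P. P (zr M A (obj_map \<Phi> X)) \<longrightarrow>
        (\<forall>f g. arr M f \<longrightarrow> src f = A \<longrightarrow> tgt f = obj_map \<Phi> X \<longrightarrow> arr M g \<longrightarrow> src g = A \<longrightarrow> tgt g = obj_map \<Phi> X
           \<longrightarrow> P f \<longrightarrow> P g \<longrightarrow> P (pls M f g)) \<longrightarrow>
        (\<forall>c f. arr M f \<longrightarrow> src f = A \<longrightarrow> tgt f = obj_map \<Phi> X \<longrightarrow> P f \<longrightarrow> P (scl M c f)) \<longrightarrow>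
        (\<forall>b\<in>set bs. P b) \<longrightarrow> (\<forall>h. arr M h \<longrightarrow> src h = A \<longrightarrow> tgt h = obj_map \<Phi> X \<longrightarrow> P h)"
      unfolding finitely_spanned_def by blast
    show "finitely_spanned C (obj_map \<Psi> A) X"
      unfolding finitely_spanned_def
    proof (intro exI[of _ "map (\<lambda>b. cmp C e' (?Q b)) bs"] conjI allI impI)
      show "\<forall>b\<in>set (map (\<lambda>b. cmp C e' (?Q b)) bs). arr C b \<and> src b = obj_map \<Psi> A \<and> tgt b = X"
        using bs e' by auto
      fix P h
      assume P: "P (zr C (obj_map \<Psi> A) X)"
        "\<forall>f g. arr C f \<longrightarrow> src f = obj_map \<Psi> A \<longrightarrow> tgt f = X \<longrightarrow> arr C g \<longrightarrow> src g = obj_map \<Psi> A \<longrightarrow> tgt g = X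
           \<longrightarrow> P f \<longrightarrow> P g \<longrightarrow> P (pls C f g)"
        "\<forall>c f. arr C f \<longrightarrow> src f = obj_map \<Psi> A \<longrightarrow> tgt f = X \<longrightarrow> P f \<longrightarrow> P (scl C c f)"
        "\<forall>b\<in>set (map (\<lambda>b. cmp C e' (?Q b)) bs). P b"
        and h: "arr C h" "src h = obj_map \<Psi> A" "tgt h = X"
      \<comment> \<open>The induction principle for hom(A, \<Phi> X) is applied to the property
        pulled back along the linear map g \<mapsto> e' \<star> \<Psi> g.\<close>
      have all: "P (cmp C e' (?Q g))" if g: "arr M g" "src g = A" "tgt g = obj_map \<Phi> X" for g
      proof (rule ind[THEN spec[of _ "\<lambda>g. P (cmp C e' (?Q g))"], THEN mp, THEN mp, THEN mp, THEN mp,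
            THEN spec, THEN mp, THEN mp, THEN mp, OF _ _ _ _ g])
        show "P (cmp C e' (?Q (zr M A (obj_map \<Phi> X))))" using P(1) e' A' X by simp
        show "\<forall>f g. arr M f \<longrightarrow> src f = A \<longrightarrow> tgt f = obj_map \<Phi> X \<longrightarrow> arr M g \<longrightarrow> src g = A \<longrightarrow> tgt g = obj_map \<Phi> X
           \<longrightarrow> P (cmp C e' (?Q f)) \<longrightarrow> P (cmp C e' (?Q g)) \<longrightarrow> P (cmp C e' (?Q (pls M f g)))"
        proof (intro allI impI, goal_cases)
          case (1 f g)
          have "P (pls C (cmp C e' (?Q f)) (cmp C e' (?Q g)))"
            by (rule P(2)[rule_format]) (use 1 e' in auto)
          thus ?case using 1 e' by (simp add: C.cmp_pls_right)
        qed
        show "\<forall>c f. arr M f \<longrightarrow> src f = A \<longrightarrow> tgt f = obj_map \<Phi> X \<longrightarrow> P (cmp C e' (?Q f)) \<longrightarrow> P (cmp C e' (?Q (scl M c f)))"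
        proof (intro allI impI, goal_cases)
          case (1 c f)
          have "P (scl C c (cmp C e' (?Q f)))"
            by (rule P(3)[rule_format]) (use 1 e' in auto)
          thus ?case using 1 e' by simp
        qed
        show "\<forall>b\<in>set bs. P (cmp C e' (?Q b))" using P(4) by simp
      qed
      obtain g where g: "arr M g" "src g = A" "tgt g = obj_map \<Phi> X" "?Q g = cmp C (e X) h"
        using Psi_full[of A "obj_map \<Phi> X" "cmp C (e X) h"] h X A' by auto
      have "cmp C e' (?Q g) = cmp C (cmp C e' (e X)) h" using g e'(1-3) h X by simp
      also have "\<dots> = h" using e' h X by simp
      finally show "P h" using all[OF g(1-3)] by simp
    qed
  next
    fix f g
    assume fg: "arr C f" "arr C g" "src f = src g" "tgt f = tgt g"
      and eq: "\<forall>h. arr C h \<longrightarrow> src h = obj_map \<Psi> A \<longrightarrow> tgt h = src f \<longrightarrow> cmp C f h = cmp C g h"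
    let ?X = "src g"
    have X: "?X \<in> Obj C" using fg by simp
    obtain e' where e': "arr C e'" "src e' = ?o ?X" "tgt e' = ?X" "cmp C e' (e ?X) = idt C ?X"
      "cmp C (e ?X) e' = idt C (?o ?X)"
      using eiso[OF X] by blast
    have Pfg: "cmp M (?P f) h = cmp M (?P g) h" if h: "arr M h" "src h = A" "tgt h = obj_map \<Phi> ?X" for h
    proof (rule Psi_faithful)
      \<comment> \<open>Naturality of \<open>e\<close> rewrites \<Psi>(\<Phi> f') as f' conjugated
        by \<open>e\<close>, so that the hypothesis on arrows out of \<Psi> A applies to e' \<star>
        \<Psi> h.\<close>
      have *: "?Q (cmp M (?P f') h) = cmp C (e (tgt g)) (cmp C f' (cmp C e' (?Q h)))"
        if f': "arr C f'" "src f' = ?X" "tgt f' = tgt g" for f'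
      proof -
        have "cmp C (e (tgt g)) (cmp C f' (cmp C e' (?Q h))) = cmp C (cmp C (e (tgt g)) f') (cmp C e' (?Q h))"
          using f' h e'(1-3) fg by simp
        also have "cmp C (e (tgt g)) f' = cmp C (?Q (?P f')) (e ?X)" using enat[OF f'(1)] f' by simp
        also have "cmp C (cmp C (?Q (?P f')) (e ?X)) (cmp C e' (?Q h)) = cmp C (?Q (?P f')) (cmp C (cmp C (e ?X) e') (?Q h))"
          using f' h e'(1-3) fg X by simp
        also have "\<dots> = ?Q (cmp M (?P f') h)" using e'(5) f' h fg X by simp
        finally show ?thesis by simp
      qed
      have "cmp C f (cmp C e' (?Q h)) = cmp C g (cmp C e' (?Q h))"
        using e'(1-3) h fg by (intro eq[rule_format]) auto
      thus "?Q (cmp M (?P f) h) = ?Q (cmp M (?P g) h)" using *[of f] *[of g] fg by simp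
    qed (use h fg in auto)
    have sep: "\<And>f g. arr M f \<Longrightarrow> arr M g \<Longrightarrow> src f = src g \<Longrightarrow> tgt f = tgt g \<Longrightarrow>
        (\<And>h. arr M h \<Longrightarrow> src h = A \<Longrightarrow> tgt h = src f \<Longrightarrow> cmp M f h = cmp M g h) \<Longrightarrow> f = g"
      using A unfolding separator_def by metis
    have "?P f = ?P g" by (rule sep) (use fg Pfg in auto)
    thus "f = g" using fg by (intro Phi_faithful)
  qed
qed

lemma ex_separator:
  fixes C :: "('k::field, 'o, 'm, 'z) lin_cat_scheme"
  assumes C: "linear_category C" and fin: "finite_category C"
  shows "\<exists>G. separator C G"
proof -
  obtain n and \<mu> :: "'k vec \<Rightarrow> 'k vec \<Rightarrow> 'k vec" and u
    where alg: "fd_algebra n \<mu> u" and eq: "lin_equivalent C (fd_modules n \<mu> u)"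
    using fin by (auto simp: finite_category_def)
  obtain \<Phi> \<Psi> \<eta> \<epsilon> where "linear_functor C (fd_modules n \<mu> u) \<Phi>" "linear_functor (fd_modules n \<mu> u) C \<Psi>"
    "natural_iso C C id_functor (functor_comp \<Psi> \<Phi>) \<eta>"
    "natural_iso (fd_modules n \<mu> u) (fd_modules n \<mu> u) (functor_comp \<Phi> \<Psi>) id_functor \<epsilon>"
    using eq unfolding lin_equivalent_def by blast
  from separator_transfer[OF C linear_category_modules[OF alg] this separator_modules[OF alg]]
  show ?thesis by blast
qed

section \<open>Kernels, cokernels and epimorphisms\<close>

definition is_coker :: "('k, 'o, 'm, 'z) lin_cat_scheme \<Rightarrow> 'o \<times> 'm \<times> 'o \<Rightarrow> 'o \<times> 'm \<times> 'o \<Rightarrow> bool" where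
  "is_coker C f p \<longleftrightarrow> is_cokernel C (src f) (tgt f) (und f) (tgt p) (und p) \<and> arr C f \<and> arr C p \<and> src p = tgt f"

definition is_ker :: "('k, 'o, 'm, 'z) lin_cat_scheme \<Rightarrow> 'o \<times> 'm \<times> 'o \<Rightarrow> 'o \<times> 'm \<times> 'o \<Rightarrow> bool" where
  "is_ker C f i \<longleftrightarrow> is_kernel C (src f) (tgt f) (und f) (src i) (und i) \<and> arr C f \<and> arr C i \<and> tgt i = src f"

definition epi :: "('k, 'o, 'm, 'z) lin_cat_scheme \<Rightarrow> 'o \<times> 'm \<times> 'o \<Rightarrow> bool" where
  "epi C p \<longleftrightarrow> arr C p \<and> (\<forall>g h. arr C g \<longrightarrow> arr C h \<longrightarrow> src g = tgt p \<longrightarrow> src h = tgt p \<longrightarrow> tgt g = tgt h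
     \<longrightarrow> cmp C g p = cmp C h p \<longrightarrow> g = h)"

lemma epiD: "epi C p \<Longrightarrow> cmp C g p = cmp C h p \<Longrightarrow> arr C g \<Longrightarrow> arr C h \<Longrightarrow> src g = tgt p \<Longrightarrow> src h = tgt p
    \<Longrightarrow> tgt g = tgt h \<Longrightarrow> g = h"
  by (simp add: epi_def)

context linear_category
begin

lemma is_coker_iff:
  "is_coker C f p \<longleftrightarrow> arr C f \<and> arr C p \<and> src p = tgt f \<and> p \<star> f = zr C (src f) (tgt p) \<and>
     (\<forall>h. arr C h \<longrightarrow> src h = tgt f \<longrightarrow> h \<star> f = zr C (src f) (tgt h) \<longrightarrow>
        (\<exists>!w. arr C w \<and> src w = tgt p \<and> tgt w = tgt h \<and> w \<star> p = h))"
  (is "?L \<longleftrightarrow> ?R")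
proof
  assume L: ?L
  have 1: "p \<star> f = zr C (src f) (tgt p)" using L by (simp add: is_coker_def is_cokernel_def cmp_def zr_def)
  have 2: "\<exists>!w. arr C w \<and> src w = tgt p \<and> tgt w = tgt h \<and> w \<star> p = h"
    if h: "arr C h" "src h = tgt f" "h \<star> f = zr C (src f) (tgt h)" for h
  proof -
    have "\<exists>!v. v \<in> Mor C (tgt p) (tgt h) \<and> v \<cdot> und p = und h"
      using L h by (auto simp: is_coker_def is_cokernel_def arr_def cmp_def zr_def simp del: arr_objs)
    then obtain v where v: "v \<in> Mor C (tgt p) (tgt h)" "v \<cdot> und p = und h"
      and uniq: "\<And>v'. v' \<in> Mor C (tgt p) (tgt h) \<Longrightarrow> v' \<cdot> und p = und h \<Longrightarrow> v' = v" by blast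
    show ?thesis
    proof (rule ex1I[of _ "mk (tgt p) v (tgt h)"], goal_cases)
      case 1
      show ?case using v h L by (simp add: is_coker_def cmp_def mk_und')
    next
      case (2 w)
      have "und (w \<star> p) = und h" using 2 by simp
      hence "und w = v" using 2 by (intro uniq) (auto simp: arr_def cmp_def simp del: arr_objs)
      thus ?case using 2 by (intro arrow_eqI) auto
    qed
  qed
  show ?R using L 1 2 by (simp add: is_coker_def)
next
  assume R: ?R
  have "is_cokernel C (src f) (tgt f) (und f) (tgt p) (und p)"
    unfolding is_cokernel_def
  proof (intro conjI ballI impI)
    show "und f \<in> Mor C (src f) (tgt f)" "tgt p \<in> Obj C" "und p \<in> Mor C (tgt f) (tgt p)"
      using R by (auto intro: arr_und)
    have "und (p \<star> f) = und (zr C (src f) (tgt p))" using R by simp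
    thus "und p \<cdot> und f = \<zero>\<^bsub>HomV C (src f) (tgt p)\<^esub>" by (simp add: cmp_def zr_def)
    fix T h assume T: "T \<in> Obj C" "h \<in> Mor C (tgt f) T" "h \<cdot> und f = \<zero>\<^bsub>HomV C (src f) T\<^esub>"
    let ?h = "mk (tgt f) h T"
    have h: "arr C ?h" using T R by simp
    have "?h \<star> f = zr C (src f) (tgt ?h)" using T by (simp add: cmp_def zr_def)
    with R h obtain w where w: "arr C w" "src w = tgt p" "tgt w = T" "w \<star> p = ?h"
      and uniq: "\<And>w'. arr C w' \<Longrightarrow> src w' = tgt p \<Longrightarrow> tgt w' = T \<Longrightarrow> w' \<star> p = ?h \<Longrightarrow> w' = w" by (metis src_mk tgt_mk)
    show "\<exists>!u. u \<in> Mor C (tgt p) T \<and> u \<cdot> und p = h"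
    proof (rule ex1I[of _ "und w"], goal_cases)
      case 1
      have "und (w \<star> p) = h" using w by simp
      thus ?case using w by (auto intro: arr_und simp: cmp_def)
    next
      case (2 v)
      have "mk (tgt p) v T = w" using 2 R T by (intro uniq) (auto simp: cmp_def)
      thus ?case by (metis und_mk)
    qed
  qed
  thus ?L using R by (simp add: is_coker_def)
qed

lemma is_coker_eq: "is_coker C f p \<Longrightarrow> p \<star> f = zr C (src f) (tgt p)"
  by (simp add: is_coker_iff)

lemma is_coker_arr: "is_coker C f p \<Longrightarrow> arr C f" "is_coker C f p \<Longrightarrow> arr C p" "is_coker C f p \<Longrightarrow> src p = tgt f"
  by (simp_all add: is_coker_def)

lemma is_coker_factor:
  assumes "is_coker C f p" "arr C h" "src h = tgt f" "h \<star> f = zr C (src f) (tgt h)"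
  obtains w where "arr C w" "src w = tgt p" "tgt w = tgt h" "w \<star> p = h"
  using assms unfolding is_coker_iff by metis

lemma is_coker_epi:
  assumes p: "is_coker C f p" shows "epi C p"
  unfolding epi_def
proof (intro conjI allI impI)
  show "arr C p" using is_coker_arr[OF p] by simp
  fix g h assume gh: "arr C g" "arr C h" "src g = tgt p" "src h = tgt p" "tgt g = tgt h" "g \<star> p = h \<star> p"
  have "(h \<star> p) \<star> f = zr C (src f) (tgt h)"
    using gh is_coker_arr[OF p] is_coker_eq[OF p] by simp
  hence "\<exists>!w. arr C w \<and> src w = tgt p \<and> tgt w = tgt (h \<star> p) \<and> w \<star> p = h \<star> p"
    using p gh is_coker_arr[OF p] unfolding is_coker_iff
    by (elim conjE allE[of _ "h \<star> p"]) (simp add: is_coker_eq[OF p])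
  thus "g = h" using gh by (metis tgt_ops(2))
qed

lemma is_cokerI:
  assumes "arr C f" "arr C p" "src p = tgt f" "p \<star> f = zr C (src f) (tgt p)" "epi C p"
    and "\<And>h. arr C h \<Longrightarrow> src h = tgt f \<Longrightarrow> h \<star> f = zr C (src f) (tgt h) \<Longrightarrow>
           \<exists>w. arr C w \<and> src w = tgt p \<and> tgt w = tgt h \<and> w \<star> p = h"
  shows "is_coker C f p"
  unfolding is_coker_iff using assms by (metis (no_types, lifting) epiD)

lemma is_ker_iff:
  "is_ker C f i \<longleftrightarrow> arr C f \<and> arr C i \<and> tgt i = src f \<and> f \<star> i = zr C (src i) (tgt f) \<and>
     (\<forall>h. arr C h \<longrightarrow> tgt h = src f \<longrightarrow> f \<star> h = zr C (src h) (tgt f) \<longrightarrow>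
        (\<exists>!w. arr C w \<and> tgt w = src i \<and> src w = src h \<and> i \<star> w = h))"
  (is "?L \<longleftrightarrow> ?R")
proof
  assume L: ?L
  have 1: "f \<star> i = zr C (src i) (tgt f)" using L by (simp add: is_ker_def is_kernel_def cmp_def zr_def)
  have 2: "\<exists>!w. arr C w \<and> tgt w = src i \<and> src w = src h \<and> i \<star> w = h"
    if h: "arr C h" "tgt h = src f" "f \<star> h = zr C (src h) (tgt f)" for h
  proof -
    have "\<exists>!v. v \<in> Mor C (src h) (src i) \<and> und i \<cdot> v = und h"
      using L h by (auto simp: is_ker_def is_kernel_def arr_def cmp_def zr_def simp del: arr_objs)
    then obtain v where v: "v \<in> Mor C (src h) (src i)" "und i \<cdot> v = und h"
      and uniq: "\<And>v'. v' \<in> Mor C (src h) (src i) \<Longrightarrow> und i \<cdot> v' = und h \<Longrightarrow> v' = v" by blast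
    show ?thesis
    proof (rule ex1I[of _ "mk (src h) v (src i)"], goal_cases)
      case 1
      show ?case using v h L by (simp add: is_ker_def cmp_def mk_und')
    next
      case (2 w)
      have "und (i \<star> w) = und h" using 2 by simp
      hence "und w = v" using 2 by (intro uniq) (auto simp: arr_def cmp_def simp del: arr_objs)
      thus ?case using 2 by (intro arrow_eqI) auto
    qed
  qed
  show ?R using L 1 2 by (simp add: is_ker_def)
next
  assume R: ?R
  have "is_kernel C (src f) (tgt f) (und f) (src i) (und i)"
    unfolding is_kernel_def
  proof (intro conjI ballI impI)
    show "und f \<in> Mor C (src f) (tgt f)" "src i \<in> Obj C" "und i \<in> Mor C (src i) (src f)"
      using R by (auto intro: arr_und)
    have "und (f \<star> i) = und (zr C (src i) (tgt f))" using R by simp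
    thus "und f \<cdot> und i = \<zero>\<^bsub>HomV C (src i) (tgt f)\<^esub>" by (simp add: cmp_def zr_def)
    fix T h assume T: "T \<in> Obj C" "h \<in> Mor C T (src f)" "und f \<cdot> h = \<zero>\<^bsub>HomV C T (tgt f)\<^esub>"
    let ?h = "mk T h (src f)"
    have h: "arr C ?h" using T R by simp
    have "f \<star> ?h = zr C (src ?h) (tgt f)" using T by (simp add: cmp_def zr_def)
    with R h obtain w where w: "arr C w" "tgt w = src i" "src w = T" "i \<star> w = ?h"
      and uniq: "\<And>w'. arr C w' \<Longrightarrow> tgt w' = src i \<Longrightarrow> src w' = T \<Longrightarrow> i \<star> w' = ?h \<Longrightarrow> w' = w" by (metis src_mk tgt_mk)
    show "\<exists>!u. u \<in> Mor C T (src i) \<and> und i \<cdot> u = h"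
    proof (rule ex1I[of _ "und w"], goal_cases)
      case 1
      have "und (i \<star> w) = h" using w by simp
      thus ?case using w by (auto intro: arr_und simp: cmp_def)
    next
      case (2 v)
      have "mk T v (src i) = w" using 2 R T by (intro uniq) (auto simp: cmp_def)
      thus ?case by (metis und_mk)
    qed
  qed
  thus ?L using R by (simp add: is_ker_def)
qed

lemma epi_iff:
  "arr C p \<Longrightarrow> epic C (src p) (tgt p) (und p) \<longleftrightarrow> epi C p"
proof
  assume p: "arr C p" and e: "epic C (src p) (tgt p) (und p)"
  show "epi C p"
    unfolding epi_def
  proof (intro conjI allI impI p)
    fix g h assume gh: "arr C g" "arr C h" "src g = tgt p" "src h = tgt p" "tgt g = tgt h" "g \<star> p = h \<star> p"
    have "und g = und h"
    proof -
      have "und g \<cdot> und p = und h \<cdot> und p" using arg_cong[OF gh(6), of und] by (simp add: cmp_def)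
      thus ?thesis using e gh arr_und[of C] arr_objs[of C] unfolding epic_def by metis
    qed
    thus "g = h" using gh by (intro arrow_eqI) auto
  qed
next
  assume p: "arr C p" and e: "epi C p"
  show "epic C (src p) (tgt p) (und p)"
    unfolding epic_def
  proof (intro conjI ballI impI)
    show "und p \<in> Mor C (src p) (tgt p)" using p by (rule arr_und) simp_all
    fix T g h assume *: "T \<in> Obj C" "g \<in> Mor C (tgt p) T" "h \<in> Mor C (tgt p) T" "g \<cdot> und p = h \<cdot> und p"
    have "mk (tgt p) g T = mk (tgt p) h T"
      by (rule epiD[OF e]) (use * p in \<open>auto simp: cmp_def\<close>)
    thus "g = h" by simp
  qed
qed

lemma split_epi: "arr C p \<Longrightarrow> arr C s \<Longrightarrow> src p = tgt s \<Longrightarrow> p \<star> s = \<iota> (tgt p) \<Longrightarrow> epi C p"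
  unfolding epi_def using arr_eq_cmp[OF _ linear_category_axioms, of _ p _ s] by metis

end

lemma (in abelian_category) ex_coker: "arr C f \<Longrightarrow> \<exists>p. is_coker C f p"
proof -
  assume f: "arr C f"
  then obtain Q p where "is_cokernel C (src f) (tgt f) (und f) Q p"
    using ex_cokernel[of "src f" "tgt f" "und f"] arr_und[OF f] by auto
  hence "is_coker C f (mk (tgt f) p Q)"
    using f by (auto simp: is_coker_def is_cokernel_def)
  thus ?thesis by blast
qed

lemma (in abelian_category) ex_ker: "arr C f \<Longrightarrow> \<exists>i. is_ker C f i"
proof -
  assume f: "arr C f"
  then obtain K i where "is_kernel C (src f) (tgt f) (und f) K i"
    using ex_kernel[of "src f" "tgt f" "und f"] arr_und[OF f] by auto
  hence "is_ker C f (mk K i (src f))"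
    using f by (auto simp: is_ker_def is_kernel_def)
  thus ?thesis by blast
qed

text \<open>An epimorphism p is the cokernel of some g. Since g factors through the kernel k of p,
  an arrow that kills k kills g, so p is also the cokernel of k. Exactness of a functor is stated
  for such pairs.\<close>

lemma (in abelian_category) epi_short_exact:
  assumes p: "epi C p" shows "\<exists>k. is_ker C p k \<and> is_coker C k p"
proof -
  have pa: "arr C p" using p by (simp add: epi_def)
  then obtain Z g where "Z \<in> Obj C" "is_cokernel C Z (src p) g (tgt p) (und p)"
    using epic_is_cokernel[of "src p" "tgt p" "und p"] p by (auto simp: epi_iff)
  hence g: "is_coker C (mk Z g (src p)) p"
    using pa by (auto simp: is_coker_def is_cokernel_def)
  let ?g = "mk Z g (src p)"
  have ga: "arr C ?g" using is_coker_arr[OF g] by simp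
  obtain k where k: "is_ker C p k" using ex_ker[OF pa] by blast
  hence k': "arr C k" "tgt k = src p" "p \<star> k = zr C (src k) (tgt p)" by (auto simp: is_ker_iff)
  have "p \<star> ?g = zr C (src ?g) (tgt p)" using is_coker_eq[OF g] by simp
  then obtain w where w: "arr C w" "tgt w = src k" "src w = Z" "k \<star> w = ?g"
    using k ga unfolding is_ker_iff by (metis src_mk tgt_mk)
  have "is_coker C k p"
  proof (rule is_cokerI[OF k'(1) pa k'(2)[symmetric] k'(3) p])
    fix h assume h: "arr C h" "src h = tgt k" "h \<star> k = zr C (src k) (tgt h)"
    have "h \<star> ?g = (h \<star> k) \<star> w" unfolding w(4)[symmetric] using h(1,2) w(1,2) k'(1) by simp
    also have "\<dots> = zr C Z (tgt h)" unfolding h(3) using h(1) w k'(1) by simp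
    finally have *: "h \<star> ?g = zr C Z (tgt h)" .
    show "\<exists>w. arr C w \<and> src w = tgt p \<and> tgt w = tgt h \<and> w \<star> p = h"
      using is_coker_factor[OF g h(1)] * h(2) k'(2) by (metis src_mk tgt_mk)
  qed
  thus ?thesis using k by blast
qed

section \<open>Natural transformations from a separator\<close>

lemma biproduct_arrows:
  assumes C: "linear_category C" and XY: "X \<in> Obj C" "Y \<in> Obj C" and b: "biproduct C X Y S i j p q"
  obtains i' j' p' q' where "S \<in> Obj C"
    "arr C i'" "src i' = X" "tgt i' = S" "arr C j'" "src j' = Y" "tgt j' = S"
    "arr C p'" "src p' = S" "tgt p' = X" "arr C q'" "src q' = S" "tgt q' = Y"
    "cmp C p' i' = idt C X" "cmp C q' j' = idt C Y" "cmp C p' j' = zr C Y X" "cmp C q' i' = zr C X Y"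
    "pls C (cmp C i' p') (cmp C j' q') = idt C S"
  by (rule that[of "mk X i S" "mk Y j S" "mk S p X" "mk S q Y"])
    (use b XY in \<open>simp_all add: biproduct_def cmp_def pls_def zr_def idt_def\<close>)

lemma zero_object_idt:
  assumes C: "linear_category C" and Z: "zero_object C Z" shows "idt C Z = zr C Z Z"
proof -
  interpret linear_category C by fact
  have ZO: "Z \<in> Obj C" and uniq: "\<exists>!f. f \<in> Mor C Z Z" using Z by (auto simp: zero_object_def)
  have "Ident C Z \<in> Mor C Z Z" "\<zero>\<^bsub>HomV C Z Z\<^esub> \<in> Mor C Z Z"
    using ZO by (simp_all add: ident_in_hom vs_zero hom_vectorspace)
  thus ?thesis using uniq by (auto simp: idt_def zr_def)
qed

text \<open>Finite direct sums of copies of G. One summand is added at a time, so that each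
  induction step deals with a single biproduct.\<close>

inductive add_gen :: "('k, 'o, 'm, 'z) lin_cat_scheme \<Rightarrow> 'o \<Rightarrow> 'o \<Rightarrow> bool" for C G where
  zero: "zero_object C Z \<Longrightarrow> add_gen C G Z"
| sum: "add_gen C G S \<Longrightarrow> biproduct C S G T i j p q \<Longrightarrow> add_gen C G T"

lemma add_gen_obj: "add_gen C G S \<Longrightarrow> S \<in> Obj C"
  by (induction rule: add_gen.induct) (auto simp: zero_object_def biproduct_def)

text \<open>Abstracts the two sides of a natural transformation in one variable, \<Phi> = M
  \<otimes> F(-) and \<Psi> = F(-) \<otimes> W. Right exactness of \<Phi>, in the form
  \<open>Phi_exact\<close>, lets an arrow out of \<Phi>(X) be defined on a cover of X.\<close>

locale natural_extension = C: abelian_category C + D: linear_category D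
  for C :: "('k::field, 'o, 'm, 'y) lin_cat_scheme" and D :: "('k, 'p, 'n, 'z) lin_cat_scheme" +
  fixes \<Phi> \<Psi> :: "('o, 'm, 'p, 'n) functor_data" and G :: 'o
  assumes Phi: "linear_functor C D \<Phi>" and Psi: "linear_functor C D \<Psi>"
    and Phi_exact: "\<And>k p. is_ker C p k \<Longrightarrow> is_coker C k p \<Longrightarrow> is_coker D (fm \<Phi> k) (fm \<Phi> p)"
    and G: "separator C G"
begin

lemmas Phi_simps [simp] = fm_simps[OF Phi]
lemmas Psi_simps [simp] = fm_simps[OF Psi]

lemma G_obj [simp]: "G \<in> Obj C" using G by (simp add: separator_def)

lemma separate:
  assumes "arr C f" "arr C g" "src f = src g" "tgt f = tgt g"
    and "\<And>h. arr C h \<Longrightarrow> src h = G \<Longrightarrow> tgt h = src g \<Longrightarrow> f \<star>\<^bsub>C\<^esub> h = g \<star>\<^bsub>C\<^esub> h"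
  shows "f = g"
  using G assms unfolding separator_def by metis

lemma Phi_epi: "epi C p \<Longrightarrow> epi D (fm \<Phi> p)"
  using C.epi_short_exact Phi_exact D.is_coker_epi by blast

section \<open>Covers by finite sums of copies of the separator\<close>

lemma sum_cases:
  assumes "add_gen C G S" "biproduct C S G T i j p q"
  obtains i' j' p' q' where "S \<in> Obj C" "T \<in> Obj C"
    "arr C i'" "src i' = S" "tgt i' = T" "arr C j'" "src j' = G" "tgt j' = T"
    "arr C p'" "src p' = T" "tgt p' = S" "arr C q'" "src q' = T" "tgt q' = G"
    "p' \<star>\<^bsub>C\<^esub> i' = idt C S" "q' \<star>\<^bsub>C\<^esub> j' = idt C G" "p' \<star>\<^bsub>C\<^esub> j' = zr C G S" "q' \<star>\<^bsub>C\<^esub> i' = zr C S G"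
    "i' \<star>\<^bsub>C\<^esub> p' \<boxplus>\<^bsub>C\<^esub> j' \<star>\<^bsub>C\<^esub> q' = idt C T"
  using biproduct_arrows[OF C.linear_category_axioms add_gen_obj[OF assms(1)] G_obj assms(2)]
    add_gen_obj[OF assms(1)] by metis

lemma add_gen_cover_list:
  assumes X: "X \<in> Obj C" and "\<And>b. b \<in> set bs \<Longrightarrow> arr C b \<and> src b = G \<and> tgt b = X"
  shows "\<exists>p. arr C p \<and> add_gen C G (src p) \<and> tgt p = X \<and>
    (\<forall>b\<in>set bs. \<exists>c. arr C c \<and> src c = G \<and> tgt c = src p \<and> p \<star>\<^bsub>C\<^esub> c = b)"
  using assms(2)
proof (induction bs)
  case Nil
  obtain Z where "zero_object C Z" using C.ex_zero_object by blast
  hence Z: "add_gen C G Z" by (rule add_gen.zero)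
  thus ?case using X add_gen_obj[OF Z] by (intro exI[of _ "zr C Z X"]) simp
next
  case (Cons b bs)
  then obtain r where r: "arr C r" "add_gen C G (src r)" "tgt r = X"
    and cs: "\<forall>b\<in>set bs. \<exists>c. arr C c \<and> src c = G \<and> tgt c = src r \<and> r \<star>\<^bsub>C\<^esub> c = b" by auto
  have b: "arr C b" "src b = G" "tgt b = X" using Cons.prems by auto
  obtain T i0 j0 p0 q0 where bip: "biproduct C (src r) G T i0 j0 p0 q0"
    using C.ex_biproduct r by fastforce
  obtain i j p q where T: "src r \<in> Obj C" "T \<in> Obj C"
    and ij: "arr C i" "src i = src r" "tgt i = T" "arr C j" "src j = G" "tgt j = T"
    and pq: "arr C p" "src p = T" "tgt p = src r" "arr C q" "src q = T" "tgt q = G"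
    and eqs: "p \<star>\<^bsub>C\<^esub> i = idt C (src r)" "q \<star>\<^bsub>C\<^esub> j = idt C G" "p \<star>\<^bsub>C\<^esub> j = zr C G (src r)" "q \<star>\<^bsub>C\<^esub> i = zr C (src r) G"
      "i \<star>\<^bsub>C\<^esub> p \<boxplus>\<^bsub>C\<^esub> j \<star>\<^bsub>C\<^esub> q = idt C T"
    by (rule sum_cases[OF r(2) bip])
  \<comment> \<open>The arrow out of the biproduct with components r and b: whatever factored
    through r still factors, and b now factors through j.\<close>
  define r' where "r' = r \<star>\<^bsub>C\<^esub> p \<boxplus>\<^bsub>C\<^esub> b \<star>\<^bsub>C\<^esub> q"
  have r': "arr C r'" "src r' = T" "tgt r' = X" using r b pq by (simp_all add: r'_def)
  have "r' \<star>\<^bsub>C\<^esub> i = r" using r b ij pq eqs by (simp add: r'_def C.cmp_pls_left)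
  moreover have r'j: "r' \<star>\<^bsub>C\<^esub> j = b" using r b ij pq eqs by (simp add: r'_def C.cmp_pls_left)
  ultimately have *: "r' \<star>\<^bsub>C\<^esub> (i \<star>\<^bsub>C\<^esub> c) = r \<star>\<^bsub>C\<^esub> c" if "arr C c" "tgt c = src r" for c
    using C.cmp_assoc_eq[of r' i r c] ij r' that by simp
  show ?case
  proof (rule exI[of _ r'], intro conjI ballI)
    show "add_gen C G (src r')" using add_gen.sum[OF r(2) bip] r' by simp
    fix b' assume b': "b' \<in> set (b # bs)"
    show "\<exists>c. arr C c \<and> src c = G \<and> tgt c = src r' \<and> r' \<star>\<^bsub>C\<^esub> c = b'"
    proof (cases "b' = b")
      case True
      thus ?thesis using ij r' r'j by (intro exI[of _ j]) simp
    next
      case False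
      then obtain c where "arr C c" "src c = G" "tgt c = src r" "r \<star>\<^bsub>C\<^esub> c = b'" using cs b' by auto
      thus ?thesis using ij r' * by (intro exI[of _ "i \<star>\<^bsub>C\<^esub> c"]) simp
    qed
  qed (use r' in auto)
qed

text \<open>The members of a spanning list factor through the sum by construction, and
  factorizations can be added and scaled, so every arrow G -> X factors. As G separates, this forces
  p to be epic.\<close>

lemma add_gen_cover:
  assumes X: "X \<in> Obj C"
  shows "\<exists>p. epi C p \<and> add_gen C G (src p) \<and> tgt p = X \<and>
    (\<forall>h. arr C h \<longrightarrow> src h = G \<longrightarrow> tgt h = X \<longrightarrow>
      (\<exists>c. arr C c \<and> src c = G \<and> tgt c = src p \<and> p \<star>\<^bsub>C\<^esub> c = h))"
proof -
  have "finitely_spanned C G X" using G X by (simp add: separator_def)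
  then obtain bs where bs: "\<forall>b\<in>set bs. arr C b \<and> src b = G \<and> tgt b = X"
    and ind: "\<forall>P. P (zr C G X) \<longrightarrow>
        (\<forall>f g. arr C f \<longrightarrow> src f = G \<longrightarrow> tgt f = X \<longrightarrow> arr C g \<longrightarrow> src g = G \<longrightarrow> tgt g = X
           \<longrightarrow> P f \<longrightarrow> P g \<longrightarrow> P (pls C f g)) \<longrightarrow>
        (\<forall>c f. arr C f \<longrightarrow> src f = G \<longrightarrow> tgt f = X \<longrightarrow> P f \<longrightarrow> P (scl C c f)) \<longrightarrow>
        (\<forall>b\<in>set bs. P b) \<longrightarrow>
        (\<forall>h. arr C h \<longrightarrow> src h = G \<longrightarrow> tgt h = X \<longrightarrow> P h)"
    unfolding finitely_spanned_def by blast
  obtain p where p: "arr C p" "add_gen C G (src p)" "tgt p = X"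
    and cs: "\<forall>b\<in>set bs. \<exists>c. arr C c \<and> src c = G \<and> tgt c = src p \<and> p \<star>\<^bsub>C\<^esub> c = b"
    using add_gen_cover_list[OF X, of bs] bs by blast
  let ?P = "\<lambda>h. \<exists>c. arr C c \<and> src c = G \<and> tgt c = src p \<and> p \<star>\<^bsub>C\<^esub> c = h"
  have all: "?P h" if h: "arr C h" "src h = G" "tgt h = X" for h
  proof (rule ind[THEN spec[of _ ?P], THEN mp, THEN mp, THEN mp, THEN mp,
            THEN spec, THEN mp, THEN mp, THEN mp, OF _ _ _ _ h])
    show "?P (zr C G X)" using p by (intro exI[of _ "zr C G (src p)"]) simp
    show "\<forall>f g. arr C f \<longrightarrow> src f = G \<longrightarrow> tgt f = X \<longrightarrow> arr C g \<longrightarrow> src g = G \<longrightarrow> tgt g = X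
           \<longrightarrow> ?P f \<longrightarrow> ?P g \<longrightarrow> ?P (pls C f g)"
    proof (intro allI impI, elim exE conjE, goal_cases)
      case (1 f g c d)
      have "p \<star>\<^bsub>C\<^esub> (c \<boxplus>\<^bsub>C\<^esub> d) = f \<boxplus>\<^bsub>C\<^esub> g" using 1 p by (simp add: C.cmp_pls_right)
      thus ?case using 1 by (intro exI[of _ "c \<boxplus>\<^bsub>C\<^esub> d"]) simp
    qed
    show "\<forall>c f. arr C f \<longrightarrow> src f = G \<longrightarrow> tgt f = X \<longrightarrow> ?P f \<longrightarrow> ?P (scl C c f)"
    proof (intro allI impI, elim exE conjE, goal_cases)
      case (1 a f c)
      have "p \<star>\<^bsub>C\<^esub> (a \<boxdot>\<^bsub>C\<^esub> c) = a \<boxdot>\<^bsub>C\<^esub> f" using 1 p by simp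
      thus ?case using 1 by (intro exI[of _ "a \<boxdot>\<^bsub>C\<^esub> c"]) simp
    qed
  qed (use cs in auto)
  have "epi C p"
    unfolding epi_def
  proof (intro conjI allI impI p)
    fix g h assume gh: "arr C g" "arr C h" "src g = tgt p" "src h = tgt p" "tgt g = tgt h" "g \<star>\<^bsub>C\<^esub> p = h \<star>\<^bsub>C\<^esub> p"
    show "g = h"
    proof (rule separate)
      fix x assume x: "arr C x" "src x = G" "tgt x = src h"
      then obtain c where c: "arr C c" "tgt c = src p" "p \<star>\<^bsub>C\<^esub> c = x" using all[of x] gh p by auto
      have "(g \<star>\<^bsub>C\<^esub> p) \<star>\<^bsub>C\<^esub> c = (h \<star>\<^bsub>C\<^esub> p) \<star>\<^bsub>C\<^esub> c" using gh by simp
      thus "g \<star>\<^bsub>C\<^esub> x = h \<star>\<^bsub>C\<^esub> x" using gh(1-5) c p by simp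
    qed (use gh in auto)
  qed
  thus ?thesis using p(2,3) all by blast
qed

text \<open>A linear functor preserves the decomposition 1 = i p + j q of a biproduct, so arrows out
  of \<Phi>(S) are determined on the summands. Over a zero object 1 = 0, and any two parallel arrows
  out of it agree.\<close>

lemma add_gen_joint_epi:
  assumes "add_gen C G S" "arr D f" "arr D g" "src f = obj_map \<Phi> S" "src g = obj_map \<Phi> S" "tgt f = tgt g"
    and "\<And>c. arr C c \<Longrightarrow> src c = G \<Longrightarrow> tgt c = S \<Longrightarrow> f \<star>\<^bsub>D\<^esub> fm \<Phi> c = g \<star>\<^bsub>D\<^esub> fm \<Phi> c"
  shows "f = g"
  using assms
proof (induction arbitrary: f g rule: add_gen.induct)
  case (zero Z)
  have Z: "Z \<in> Obj C" using zero by (simp add: zero_object_def)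
  have id: "idt D (obj_map \<Phi> Z) = zr D (obj_map \<Phi> Z) (obj_map \<Phi> Z)"
    using zero_object_idt[OF C.linear_category_axioms zero(1)] Z Phi_simps(3)[OF Z] Phi_simps(7)[OF Z Z] by simp
  have "f \<star>\<^bsub>D\<^esub> idt D (obj_map \<Phi> Z) = g \<star>\<^bsub>D\<^esub> idt D (obj_map \<Phi> Z)"
    unfolding id using zero Z by simp
  thus ?case using zero by simp
next
  case (sum S T i0 j0 p0 q0)
  obtain i j p q where T: "S \<in> Obj C" "T \<in> Obj C"
    and ij: "arr C i" "src i = S" "tgt i = T" "arr C j" "src j = G" "tgt j = T"
    and pq: "arr C p" "src p = T" "tgt p = S" "arr C q" "src q = T" "tgt q = G"
    and eqs: "p \<star>\<^bsub>C\<^esub> i = idt C S" "q \<star>\<^bsub>C\<^esub> j = idt C G" "p \<star>\<^bsub>C\<^esub> j = zr C G S" "q \<star>\<^bsub>C\<^esub> i = zr C S G"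
      "i \<star>\<^bsub>C\<^esub> p \<boxplus>\<^bsub>C\<^esub> j \<star>\<^bsub>C\<^esub> q = idt C T"
    by (rule sum_cases[OF sum(1,2)])
  have I: "f \<star>\<^bsub>D\<^esub> fm \<Phi> i = g \<star>\<^bsub>D\<^esub> fm \<Phi> i"
  proof (rule sum.IH)
    fix c assume c: "arr C c" "src c = G" "tgt c = S"
    have "f \<star>\<^bsub>D\<^esub> fm \<Phi> (i \<star>\<^bsub>C\<^esub> c) = g \<star>\<^bsub>D\<^esub> fm \<Phi> (i \<star>\<^bsub>C\<^esub> c)"
      by (rule sum.prems(6)) (use c ij in auto)
    thus "(f \<star>\<^bsub>D\<^esub> fm \<Phi> i) \<star>\<^bsub>D\<^esub> fm \<Phi> c = (g \<star>\<^bsub>D\<^esub> fm \<Phi> i) \<star>\<^bsub>D\<^esub> fm \<Phi> c"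
      using c ij sum.prems(1-5) by simp
  qed (use sum.prems(1-5) ij in auto)
  have J: "f \<star>\<^bsub>D\<^esub> fm \<Phi> j = g \<star>\<^bsub>D\<^esub> fm \<Phi> j" by (rule sum.prems(6)) (use ij in auto)
  have *: "x = (x \<star>\<^bsub>D\<^esub> fm \<Phi> i) \<star>\<^bsub>D\<^esub> fm \<Phi> p \<boxplus>\<^bsub>D\<^esub> (x \<star>\<^bsub>D\<^esub> fm \<Phi> j) \<star>\<^bsub>D\<^esub> fm \<Phi> q"
    if x: "arr D x" "src x = obj_map \<Phi> T" for x
  proof -
    have "x = x \<star>\<^bsub>D\<^esub> fm \<Phi> (i \<star>\<^bsub>C\<^esub> p \<boxplus>\<^bsub>C\<^esub> j \<star>\<^bsub>C\<^esub> q)" using x T by (simp add: eqs)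
    also have "\<dots> = (x \<star>\<^bsub>D\<^esub> fm \<Phi> i) \<star>\<^bsub>D\<^esub> fm \<Phi> p \<boxplus>\<^bsub>D\<^esub> (x \<star>\<^bsub>D\<^esub> fm \<Phi> j) \<star>\<^bsub>D\<^esub> fm \<Phi> q"
      using x ij pq by (simp add: D.cmp_pls_right)
    finally show ?thesis .
  qed
  show ?case using *[of f] *[of g] sum.prems(1-5) I J by simp
qed

text \<open>\<Phi> preserves the epimorphism from a cover of X, which reduces X to a sum of copies
  of G.\<close>

lemma joint_epi:
  assumes X: "X \<in> Obj C" and fg: "arr D f" "arr D g" "src f = obj_map \<Phi> X" "src g = obj_map \<Phi> X" "tgt f = tgt g"
    and eq: "\<And>h. arr C h \<Longrightarrow> src h = G \<Longrightarrow> tgt h = X \<Longrightarrow> f \<star>\<^bsub>D\<^esub> fm \<Phi> h = g \<star>\<^bsub>D\<^esub> fm \<Phi> h"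
  shows "f = g"
proof -
  obtain p where p: "epi C p" "add_gen C G (src p)" "tgt p = X" using add_gen_cover[OF X] by blast
  have pa: "arr C p" using p by (simp add: epi_def)
  have "f \<star>\<^bsub>D\<^esub> fm \<Phi> p = g \<star>\<^bsub>D\<^esub> fm \<Phi> p"
  proof (rule add_gen_joint_epi[OF p(2)])
    fix c assume c: "arr C c" "src c = G" "tgt c = src p"
    show "(f \<star>\<^bsub>D\<^esub> fm \<Phi> p) \<star>\<^bsub>D\<^esub> fm \<Phi> c = (g \<star>\<^bsub>D\<^esub> fm \<Phi> p) \<star>\<^bsub>D\<^esub> fm \<Phi> c"
      using eq[of "p \<star>\<^bsub>C\<^esub> c"] c p pa fg by simp
  qed (use fg pa p in auto)
  thus ?thesis using epiD[OF Phi_epi[OF p(1)]] fg p by simp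
qed

section \<open>Extension of a transformation from the separator to all objects\<close>

context
  fixes t assumes t: "arr D t" "src t = obj_map \<Phi> G" "tgt t = obj_map \<Psi> G"
    and t_comm: "\<And>e. arr C e \<Longrightarrow> src e = G \<Longrightarrow> tgt e = G \<Longrightarrow> fm \<Psi> e \<star>\<^bsub>D\<^esub> t = t \<star>\<^bsub>D\<^esub> fm \<Phi> e"
begin

lemma extend_add_gen:
  assumes "add_gen C G S"
  shows "\<exists>s. arr D s \<and> src s = obj_map \<Phi> S \<and> tgt s = obj_map \<Psi> S \<and>
    (\<forall>c. arr C c \<longrightarrow> src c = G \<longrightarrow> tgt c = S \<longrightarrow> s \<star>\<^bsub>D\<^esub> fm \<Phi> c = fm \<Psi> c \<star>\<^bsub>D\<^esub> t)"
  using assms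
proof (induction rule: add_gen.induct)
  case (zero Z)
  have Z: "Z \<in> Obj C" using zero by (simp add: zero_object_def)
  have id: "idt C Z = zr C Z Z" by (rule zero_object_idt[OF C.linear_category_axioms zero])
  show ?case
  proof (intro exI[of _ "zr D (obj_map \<Phi> Z) (obj_map \<Psi> Z)"] conjI allI impI)
    fix c assume c: "arr C c" "src c = G" "tgt c = Z"
    have "c = zr C Z Z \<star>\<^bsub>C\<^esub> c" using c unfolding id[symmetric] by simp
    hence "c = zr C G Z" using c Z by simp
    thus "zr D (obj_map \<Phi> Z) (obj_map \<Psi> Z) \<star>\<^bsub>D\<^esub> fm \<Phi> c = fm \<Psi> c \<star>\<^bsub>D\<^esub> t" using t Z by simp
  qed (use Z in auto)
next
  case (sum S T i0 j0 p0 q0)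
  obtain i j p q where T: "S \<in> Obj C" "T \<in> Obj C"
    and ij: "arr C i" "src i = S" "tgt i = T" "arr C j" "src j = G" "tgt j = T"
    and pq: "arr C p" "src p = T" "tgt p = S" "arr C q" "src q = T" "tgt q = G"
    and eqs: "p \<star>\<^bsub>C\<^esub> i = idt C S" "q \<star>\<^bsub>C\<^esub> j = idt C G" "p \<star>\<^bsub>C\<^esub> j = zr C G S" "q \<star>\<^bsub>C\<^esub> i = zr C S G"
      "i \<star>\<^bsub>C\<^esub> p \<boxplus>\<^bsub>C\<^esub> j \<star>\<^bsub>C\<^esub> q = idt C T"
    by (rule sum_cases[OF sum(1,2)])
  obtain s where s: "arr D s" "src s = obj_map \<Phi> S" "tgt s = obj_map \<Psi> S"
    and sc: "\<And>c. arr C c \<Longrightarrow> src c = G \<Longrightarrow> tgt c = S \<Longrightarrow> s \<star>\<^bsub>D\<^esub> fm \<Phi> c = fm \<Psi> c \<star>\<^bsub>D\<^esub> t"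
    using sum.IH by blast
  \<comment> \<open>The arrow s on the old summands and \<open>t\<close> on the new copy of G.
    Testing against c uses \<open>t_comm\<close>, because q \<star> c is an endomorphism of
    G.\<close>
  let ?s = "fm \<Psi> i \<star>\<^bsub>D\<^esub> s \<star>\<^bsub>D\<^esub> fm \<Phi> p \<boxplus>\<^bsub>D\<^esub> fm \<Psi> j \<star>\<^bsub>D\<^esub> t \<star>\<^bsub>D\<^esub> fm \<Phi> q"
  show ?case
  proof (intro exI[of _ ?s] conjI allI impI)
    fix c assume c: "arr C c" "src c = G" "tgt c = T"
    have "?s \<star>\<^bsub>D\<^esub> fm \<Phi> c = fm \<Psi> i \<star>\<^bsub>D\<^esub> (s \<star>\<^bsub>D\<^esub> fm \<Phi> (p \<star>\<^bsub>C\<^esub> c)) \<boxplus>\<^bsub>D\<^esub> fm \<Psi> j \<star>\<^bsub>D\<^esub> (t \<star>\<^bsub>D\<^esub> fm \<Phi> (q \<star>\<^bsub>C\<^esub> c))"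
      using c ij pq s t by (simp add: D.cmp_pls_left)
    also have "s \<star>\<^bsub>D\<^esub> fm \<Phi> (p \<star>\<^bsub>C\<^esub> c) = fm \<Psi> (p \<star>\<^bsub>C\<^esub> c) \<star>\<^bsub>D\<^esub> t" using c pq by (intro sc) auto
    also have "t \<star>\<^bsub>D\<^esub> fm \<Phi> (q \<star>\<^bsub>C\<^esub> c) = fm \<Psi> (q \<star>\<^bsub>C\<^esub> c) \<star>\<^bsub>D\<^esub> t" using c pq by (intro t_comm[symmetric]) auto
    also have "fm \<Psi> i \<star>\<^bsub>D\<^esub> (fm \<Psi> (p \<star>\<^bsub>C\<^esub> c) \<star>\<^bsub>D\<^esub> t) \<boxplus>\<^bsub>D\<^esub> fm \<Psi> j \<star>\<^bsub>D\<^esub> (fm \<Psi> (q \<star>\<^bsub>C\<^esub> c) \<star>\<^bsub>D\<^esub> t)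
        = fm \<Psi> ((i \<star>\<^bsub>C\<^esub> p \<boxplus>\<^bsub>C\<^esub> j \<star>\<^bsub>C\<^esub> q) \<star>\<^bsub>C\<^esub> c) \<star>\<^bsub>D\<^esub> t"
      using c ij pq t by (simp add: C.cmp_pls_left D.cmp_pls_left)
    also have "\<dots> = fm \<Psi> c \<star>\<^bsub>D\<^esub> t" using c by (simp add: eqs)
    finally show "?s \<star>\<^bsub>D\<^esub> fm \<Phi> c = fm \<Psi> c \<star>\<^bsub>D\<^esub> t" .
  qed (use T ij pq s t in auto)
qed

text \<open>On a cover p of X the extension s exists; it descends to X once \<Psi>(p) s \<Phi>(k) =
  0 for the kernel k of p. The source of k is again covered by a sum of copies of G, and against an
  arrow from G this composite equals \<Psi> of an arrow that factors through p k = 0, followed after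
  \<open>t\<close>.\<close>

lemma extend_component:
  assumes X: "X \<in> Obj C"
  shows "\<exists>s. arr D s \<and> src s = obj_map \<Phi> X \<and> tgt s = obj_map \<Psi> X \<and>
    (\<forall>h. arr C h \<longrightarrow> src h = G \<longrightarrow> tgt h = X \<longrightarrow> s \<star>\<^bsub>D\<^esub> fm \<Phi> h = fm \<Psi> h \<star>\<^bsub>D\<^esub> t)"
proof -
  obtain p where p: "epi C p" "add_gen C G (src p)" "tgt p = X"
    and cov: "\<And>h. arr C h \<Longrightarrow> src h = G \<Longrightarrow> tgt h = X \<Longrightarrow>
      \<exists>c. arr C c \<and> src c = G \<and> tgt c = src p \<and> p \<star>\<^bsub>C\<^esub> c = h"
    using add_gen_cover[OF X] by blast
  have pa: "arr C p" using p by (simp add: epi_def)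
  obtain k where k: "is_ker C p k" "is_coker C k p" using C.epi_short_exact[OF p(1)] by blast
  have ka: "arr C k" "tgt k = src p" and pk: "p \<star>\<^bsub>C\<^esub> k = zr C (src k) X"
    using k p by (auto simp: C.is_ker_iff)
  obtain q where q: "epi C q" "add_gen C G (src q)" "tgt q = src k"
    using add_gen_cover[OF arr_objs(1)[OF ka(1)]] by blast
  have qa: "arr C q" using q by (simp add: epi_def)
  obtain s where s: "arr D s" "src s = obj_map \<Phi> (src p)" "tgt s = obj_map \<Psi> (src p)"
    and sc: "\<And>c. arr C c \<Longrightarrow> src c = G \<Longrightarrow> tgt c = src p \<Longrightarrow> s \<star>\<^bsub>D\<^esub> fm \<Phi> c = fm \<Psi> c \<star>\<^bsub>D\<^esub> t"
    using extend_add_gen[OF p(2)] by blast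
  let ?z = "(fm \<Psi> p \<star>\<^bsub>D\<^esub> s) \<star>\<^bsub>D\<^esub> fm \<Phi> k"
  have "?z \<star>\<^bsub>D\<^esub> fm \<Phi> q = zr D (obj_map \<Phi> (src k)) (obj_map \<Psi> X) \<star>\<^bsub>D\<^esub> fm \<Phi> q"
  proof (rule add_gen_joint_epi[OF q(2)])
    fix c assume c: "arr C c" "src c = G" "tgt c = src q"
    have "(?z \<star>\<^bsub>D\<^esub> fm \<Phi> q) \<star>\<^bsub>D\<^esub> fm \<Phi> c = fm \<Psi> p \<star>\<^bsub>D\<^esub> (s \<star>\<^bsub>D\<^esub> fm \<Phi> (k \<star>\<^bsub>C\<^esub> (q \<star>\<^bsub>C\<^esub> c)))"
      using c q qa ka pa s by simp
    also have "s \<star>\<^bsub>D\<^esub> fm \<Phi> (k \<star>\<^bsub>C\<^esub> (q \<star>\<^bsub>C\<^esub> c)) = fm \<Psi> (k \<star>\<^bsub>C\<^esub> (q \<star>\<^bsub>C\<^esub> c)) \<star>\<^bsub>D\<^esub> t"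
      by (rule sc) (use c q qa ka in auto)
    also have "fm \<Psi> p \<star>\<^bsub>D\<^esub> (fm \<Psi> (k \<star>\<^bsub>C\<^esub> (q \<star>\<^bsub>C\<^esub> c)) \<star>\<^bsub>D\<^esub> t) = fm \<Psi> ((p \<star>\<^bsub>C\<^esub> k) \<star>\<^bsub>C\<^esub> (q \<star>\<^bsub>C\<^esub> c)) \<star>\<^bsub>D\<^esub> t"
      using c q qa ka pa t by simp
    also have "\<dots> = zr D (obj_map \<Phi> G) (obj_map \<Psi> X)"
      unfolding pk using c q qa ka(1) X t by simp
    finally show "(?z \<star>\<^bsub>D\<^esub> fm \<Phi> q) \<star>\<^bsub>D\<^esub> fm \<Phi> c
        = (zr D (obj_map \<Phi> (src k)) (obj_map \<Psi> X) \<star>\<^bsub>D\<^esub> fm \<Phi> q) \<star>\<^bsub>D\<^esub> fm \<Phi> c"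
      using c q qa ka X by simp
  qed (use q qa ka pa p s X in auto)
  hence "?z = zr D (obj_map \<Phi> (src k)) (obj_map \<Psi> X)"
    by (rule epiD[OF Phi_epi[OF q(1)]]) (use q qa ka pa p s X in auto)
  then obtain w where w: "arr D w" "src w = obj_map \<Phi> X" "tgt w = obj_map \<Psi> X" "w \<star>\<^bsub>D\<^esub> fm \<Phi> p = fm \<Psi> p \<star>\<^bsub>D\<^esub> s"
    using D.is_coker_factor[OF Phi_exact[OF k], of "fm \<Psi> p \<star>\<^bsub>D\<^esub> s"] p pa s ka X by auto
  have "w \<star>\<^bsub>D\<^esub> fm \<Phi> h = fm \<Psi> h \<star>\<^bsub>D\<^esub> t" if h: "arr C h" "src h = G" "tgt h = X" for h
  proof -
    obtain c where c: "arr C c" "src c = G" "tgt c = src p" "p \<star>\<^bsub>C\<^esub> c = h" using cov[OF h] by blast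
    have "w \<star>\<^bsub>D\<^esub> fm \<Phi> h = (w \<star>\<^bsub>D\<^esub> fm \<Phi> p) \<star>\<^bsub>D\<^esub> fm \<Phi> c"
      unfolding c(4)[symmetric] using c(1-3) pa p w(1-3) by simp
    also have "\<dots> = fm \<Psi> p \<star>\<^bsub>D\<^esub> (s \<star>\<^bsub>D\<^esub> fm \<Phi> c)" unfolding w(4) using c(1-3) pa s by simp
    also have "s \<star>\<^bsub>D\<^esub> fm \<Phi> c = fm \<Psi> c \<star>\<^bsub>D\<^esub> t" by (rule sc) (use c in auto)
    also have "fm \<Psi> p \<star>\<^bsub>D\<^esub> (fm \<Psi> c \<star>\<^bsub>D\<^esub> t) = fm \<Psi> h \<star>\<^bsub>D\<^esub> t"
      unfolding c(4)[symmetric] using c(1-3) pa t by simp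
    finally show ?thesis .
  qed
  thus ?thesis using w by blast
qed

text \<open>The components are chosen independently of each other. Naturality holds nevertheless,
  since an arrow out of \<Phi>(X) is determined by its composites with arrows coming from G, and
  these are prescribed by \<open>t\<close>.\<close>

lemma extend_natural:
  obtains \<tau> where "\<And>X. X \<in> Obj C \<Longrightarrow> arr D (\<tau> X) \<and> src (\<tau> X) = obj_map \<Phi> X \<and> tgt (\<tau> X) = obj_map \<Psi> X"
    and "\<And>f. arr C f \<Longrightarrow> fm \<Psi> f \<star>\<^bsub>D\<^esub> \<tau> (src f) = \<tau> (tgt f) \<star>\<^bsub>D\<^esub> fm \<Phi> f"
    and "\<tau> G = t"
proof -
  obtain \<tau> where "\<forall>X\<in>Obj C. arr D (\<tau> X) \<and> src (\<tau> X) = obj_map \<Phi> X \<and> tgt (\<tau> X) = obj_map \<Psi> X \<and>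
    (\<forall>h. arr C h \<longrightarrow> src h = G \<longrightarrow> tgt h = X \<longrightarrow> \<tau> X \<star>\<^bsub>D\<^esub> fm \<Phi> h = fm \<Psi> h \<star>\<^bsub>D\<^esub> t)"
    using bchoice[of "Obj C" "\<lambda>X s. arr D s \<and> src s = obj_map \<Phi> X \<and> tgt s = obj_map \<Psi> X \<and>
    (\<forall>h. arr C h \<longrightarrow> src h = G \<longrightarrow> tgt h = X \<longrightarrow> s \<star>\<^bsub>D\<^esub> fm \<Phi> h = fm \<Psi> h \<star>\<^bsub>D\<^esub> t)"] extend_component by blast
  hence \<tau>: "X \<in> Obj C \<Longrightarrow> arr D (\<tau> X)" "X \<in> Obj C \<Longrightarrow> src (\<tau> X) = obj_map \<Phi> X" "X \<in> Obj C \<Longrightarrow> tgt (\<tau> X) = obj_map \<Psi> X"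
    and \<tau>h: "\<And>h. X \<in> Obj C \<Longrightarrow> arr C h \<Longrightarrow> src h = G \<Longrightarrow> tgt h = X \<Longrightarrow> \<tau> X \<star>\<^bsub>D\<^esub> fm \<Phi> h = fm \<Psi> h \<star>\<^bsub>D\<^esub> t"
    for X by auto
  have nat: "fm \<Psi> f \<star>\<^bsub>D\<^esub> \<tau> (src f) = \<tau> (tgt f) \<star>\<^bsub>D\<^esub> fm \<Phi> f" if f: "arr C f" for f
  proof (rule joint_epi[of "src f"])
    fix h assume h: "arr C h" "src h = G" "tgt h = src f"
    have "(fm \<Psi> f \<star>\<^bsub>D\<^esub> \<tau> (src f)) \<star>\<^bsub>D\<^esub> fm \<Phi> h = fm \<Psi> f \<star>\<^bsub>D\<^esub> (\<tau> (src f) \<star>\<^bsub>D\<^esub> fm \<Phi> h)" using f h \<tau> by simp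
    also have "\<tau> (src f) \<star>\<^bsub>D\<^esub> fm \<Phi> h = fm \<Psi> h \<star>\<^bsub>D\<^esub> t" by (rule \<tau>h) (use f h in auto)
    also have "fm \<Psi> f \<star>\<^bsub>D\<^esub> (fm \<Psi> h \<star>\<^bsub>D\<^esub> t) = fm \<Psi> (f \<star>\<^bsub>C\<^esub> h) \<star>\<^bsub>D\<^esub> t" using f h t by simp
    also have "\<dots> = \<tau> (tgt f) \<star>\<^bsub>D\<^esub> fm \<Phi> (f \<star>\<^bsub>C\<^esub> h)" by (rule \<tau>h[symmetric]) (use f h in auto)
    also have "\<dots> = (\<tau> (tgt f) \<star>\<^bsub>D\<^esub> fm \<Phi> f) \<star>\<^bsub>D\<^esub> fm \<Phi> h" using f h \<tau> by simp
    finally show "(fm \<Psi> f \<star>\<^bsub>D\<^esub> \<tau> (src f)) \<star>\<^bsub>D\<^esub> fm \<Phi> h = (\<tau> (tgt f) \<star>\<^bsub>D\<^esub> fm \<Phi> f) \<star>\<^bsub>D\<^esub> fm \<Phi> h" .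
  qed (use f \<tau> in auto)
  have "\<tau> G = t" using \<tau>h[of G "idt C G"] \<tau>[of G] t by simp
  with that[of \<tau>] \<tau> nat show thesis by blast
qed

end

end

section \<open>Duals\<close>

context strict_monoidal_category
begin

declare tns_idt [simp]

lemma tns_idt' [simp]: "X \<in> Obj C \<Longrightarrow> Y \<in> Obj C \<Longrightarrow> arr C f \<Longrightarrow> \<iota> X \<otimes>\<^sub>a (\<iota> Y \<otimes>\<^sub>a f) = \<iota> (X \<otimes>\<^sub>o Y) \<otimes>\<^sub>a f"
  by (simp flip: tns_assoc)

lemma tns_cmp_left: "X \<in> Obj C \<Longrightarrow> arr C f \<Longrightarrow> arr C g \<Longrightarrow> src g = tgt f \<Longrightarrow>
    \<iota> X \<otimes>\<^sub>a (g \<star> f) = (\<iota> X \<otimes>\<^sub>a g) \<star> (\<iota> X \<otimes>\<^sub>a f)"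
  by (simp add: interchange)

lemma tns_cmp_right: "X \<in> Obj C \<Longrightarrow> arr C f \<Longrightarrow> arr C g \<Longrightarrow> src g = tgt f \<Longrightarrow>
    (g \<star> f) \<otimes>\<^sub>a \<iota> X = (g \<otimes>\<^sub>a \<iota> X) \<star> (f \<otimes>\<^sub>a \<iota> X)"
  by (simp add: interchange)

lemma tns_split1: "arr C f \<Longrightarrow> arr C g \<Longrightarrow> src f = X \<Longrightarrow> tgt g = Y \<Longrightarrow> f \<otimes>\<^sub>a g = (f \<otimes>\<^sub>a \<iota> Y) \<star> (\<iota> X \<otimes>\<^sub>a g)"
  by (auto simp: interchange)

lemma tns_split2: "arr C f \<Longrightarrow> arr C g \<Longrightarrow> tgt f = X \<Longrightarrow> src g = Y \<Longrightarrow> f \<otimes>\<^sub>a g = (\<iota> X \<otimes>\<^sub>a g) \<star> (f \<otimes>\<^sub>a \<iota> Y)"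
  by (auto simp: interchange)

end

definition dual :: "('k, 'o, 'm, 'z) mon_cat_scheme \<Rightarrow> 'o \<Rightarrow> 'o \<Rightarrow> 'o \<times> 'm \<times> 'o \<Rightarrow> 'o \<times> 'm \<times> 'o \<Rightarrow> bool" where
  "dual C L R ev coev \<longleftrightarrow> L \<in> Obj C \<and> R \<in> Obj C \<and>
     arr C ev \<and> src ev = L \<otimes>\<^sub>o\<^bsub>C\<^esub> R \<and> tgt ev = UnitO C \<and>
     arr C coev \<and> src coev = UnitO C \<and> tgt coev = R \<otimes>\<^sub>o\<^bsub>C\<^esub> L \<and>
     cmp C (tns C (idt C R) ev) (tns C coev (idt C R)) = idt C R \<and>
     cmp C (tns C ev (idt C L)) (tns C (idt C L) coev) = idt C L"

lemma (in strict_monoidal_category) dual_mk: "dual_pair C L R ev coev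
    \<Longrightarrow> dual C L R (mk (L \<otimes>\<^sub>o R) ev (UnitO C)) (mk (UnitO C) coev (R \<otimes>\<^sub>o L))"
  by (simp add: dual_pair_def dual_def cmp_def tns_def idt_def)

lemma (in strict_tensor_category) ex_dual:
  assumes "X \<in> Obj C"
  shows "\<exists>R ev coev. dual C X R ev coev" "\<exists>L ev coev. dual C L X ev coev"
  using rigid assms dual_mk unfolding rigid_def by metis+

locale dual_objects = strict_monoidal_category +
  fixes L R ev coev
  assumes dual: "dual C L R ev coev"
begin

lemma dual_simps [simp]:
  "L \<in> Obj C" "R \<in> Obj C" "arr C ev" "src ev = L \<otimes>\<^sub>o R" "tgt ev = UnitO C"
  "arr C coev" "src coev = UnitO C" "tgt coev = R \<otimes>\<^sub>o L"
  using dual by (simp_all add: dual_def)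

lemma zigzag1: "(\<iota> R \<otimes>\<^sub>a ev) \<star> (coev \<otimes>\<^sub>a \<iota> R) = \<iota> R" and zigzag2: "(ev \<otimes>\<^sub>a \<iota> L) \<star> (\<iota> L \<otimes>\<^sub>a coev) = \<iota> L"
  using dual by (simp_all add: dual_def)

lemma zigzag1_tns: "X \<in> Obj C \<Longrightarrow> Y \<in> Obj C \<Longrightarrow>
    (\<iota> (X \<otimes>\<^sub>o R) \<otimes>\<^sub>a ev \<otimes>\<^sub>a \<iota> Y) \<star> (\<iota> X \<otimes>\<^sub>a coev \<otimes>\<^sub>a \<iota> (R \<otimes>\<^sub>o Y)) = \<iota> (X \<otimes>\<^sub>o R \<otimes>\<^sub>o Y)"
  using arg_cong[OF zigzag1, of "\<lambda>z. \<iota> X \<otimes>\<^sub>a z \<otimes>\<^sub>a \<iota> Y"]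
  by (simp add: tns_cmp_left tns_cmp_right)

lemma zigzag2_tns: "X \<in> Obj C \<Longrightarrow> Y \<in> Obj C \<Longrightarrow>
    (\<iota> X \<otimes>\<^sub>a ev \<otimes>\<^sub>a \<iota> (L \<otimes>\<^sub>o Y)) \<star> (\<iota> (X \<otimes>\<^sub>o L) \<otimes>\<^sub>a coev \<otimes>\<^sub>a \<iota> Y) = \<iota> (X \<otimes>\<^sub>o L \<otimes>\<^sub>o Y)"
  using arg_cong[OF zigzag2, of "\<lambda>z. \<iota> X \<otimes>\<^sub>a z \<otimes>\<^sub>a \<iota> Y"]
  by (simp add: tns_cmp_left tns_cmp_right)

text \<open>\<open>Hom(L \<otimes> A, B) = Hom(A, R \<otimes> B)\<close> and \<open>Hom(A \<otimes> R, B) = Hom(A, B \<otimes> L)\<close>.\<close>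

definition curl where "curl A h = (\<iota> R \<otimes>\<^sub>a h) \<star> (coev \<otimes>\<^sub>a \<iota> A)"
definition uncurl where "uncurl B g = (ev \<otimes>\<^sub>a \<iota> B) \<star> (\<iota> L \<otimes>\<^sub>a g)"
definition curr where "curr A h = (h \<otimes>\<^sub>a \<iota> L) \<star> (\<iota> A \<otimes>\<^sub>a coev)"
definition uncurr where "uncurr B g = (\<iota> B \<otimes>\<^sub>a ev) \<star> (g \<otimes>\<^sub>a \<iota> R)"

lemma curl_arr:
  assumes "arr C h" "src h = L \<otimes>\<^sub>o A" "A \<in> Obj C"
  shows "arr C (curl A h)" "src (curl A h) = A" "tgt (curl A h) = R \<otimes>\<^sub>o tgt h"
  using assms by (simp_all add: curl_def)

lemma uncurl_arr:
  assumes "arr C g" "tgt g = R \<otimes>\<^sub>o B" "B \<in> Obj C"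
  shows "arr C (uncurl B g)" "src (uncurl B g) = L \<otimes>\<^sub>o src g" "tgt (uncurl B g) = B"
  using assms by (simp_all add: uncurl_def)

lemma curr_arr:
  assumes "arr C h" "src h = A \<otimes>\<^sub>o R" "A \<in> Obj C"
  shows "arr C (curr A h)" "src (curr A h) = A" "tgt (curr A h) = tgt h \<otimes>\<^sub>o L"
  using assms by (simp_all add: curr_def)

lemma uncurr_arr:
  assumes "arr C g" "tgt g = B \<otimes>\<^sub>o L" "B \<in> Obj C"
  shows "arr C (uncurr B g)" "src (uncurr B g) = src g \<otimes>\<^sub>o R" "tgt (uncurr B g) = B"
  using assms by (simp_all add: uncurr_def)

text \<open>Interchange slides h past the evaluation; what remains beside h is a zigzag identity of
  the dual pair.\<close>

lemma uncurl_curl: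
  assumes h: "arr C h" "src h = L \<otimes>\<^sub>o A" "tgt h = B" and A: "A \<in> Obj C"
  shows "uncurl B (curl A h) = h"
proof -
  have [simp]: "B \<in> Obj C" using h by auto
  have "uncurl B (curl A h) = (ev \<otimes>\<^sub>a \<iota> B) \<star> ((\<iota> (L \<otimes>\<^sub>o R) \<otimes>\<^sub>a h) \<star> (\<iota> L \<otimes>\<^sub>a coev \<otimes>\<^sub>a \<iota> A))"
    using h A by (simp add: uncurl_def curl_def tns_cmp_left)
  also have "\<dots> = (ev \<otimes>\<^sub>a h) \<star> (\<iota> L \<otimes>\<^sub>a coev \<otimes>\<^sub>a \<iota> A)"
    using h A by (subst interchange') simp_all
  also have "ev \<otimes>\<^sub>a h = (\<iota> (UnitO C) \<otimes>\<^sub>a h) \<star> (ev \<otimes>\<^sub>a \<iota> (L \<otimes>\<^sub>o A))"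
    using h by (intro tns_split2) simp_all
  also have "\<dots> \<star> (\<iota> L \<otimes>\<^sub>a coev \<otimes>\<^sub>a \<iota> A) = h"
    using h A zigzag2_tns[of "UnitO C" A] by simp
  finally show ?thesis .
qed

lemma curl_uncurl:
  assumes g: "arr C g" "src g = A" "tgt g = R \<otimes>\<^sub>o B" and B: "B \<in> Obj C"
  shows "curl A (uncurl B g) = g"
proof -
  have [simp]: "A \<in> Obj C" using g by auto
  have "curl A (uncurl B g) = (\<iota> R \<otimes>\<^sub>a ev \<otimes>\<^sub>a \<iota> B) \<star> ((\<iota> (R \<otimes>\<^sub>o L) \<otimes>\<^sub>a g) \<star> (coev \<otimes>\<^sub>a \<iota> A))"
    using g B by (simp add: uncurl_def curl_def tns_cmp_left)
  also have "(\<iota> (R \<otimes>\<^sub>o L) \<otimes>\<^sub>a g) \<star> (coev \<otimes>\<^sub>a \<iota> A) = coev \<otimes>\<^sub>a g"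
    using g by (subst interchange) simp_all
  also have "coev \<otimes>\<^sub>a g = (coev \<otimes>\<^sub>a \<iota> (R \<otimes>\<^sub>o B)) \<star> (\<iota> (UnitO C) \<otimes>\<^sub>a g)"
    using g by (intro tns_split1) simp_all
  also have "(\<iota> R \<otimes>\<^sub>a ev \<otimes>\<^sub>a \<iota> B) \<star> \<dots> = ((\<iota> R \<otimes>\<^sub>a ev \<otimes>\<^sub>a \<iota> B) \<star> (coev \<otimes>\<^sub>a \<iota> (R \<otimes>\<^sub>o B))) \<star> g"
    using g B by simp
  also have "\<dots> = g"
    using g B zigzag1_tns[of "UnitO C" B] by simp
  finally show ?thesis .
qed

lemma uncurr_curr:
  assumes h: "arr C h" "src h = A \<otimes>\<^sub>o R" "tgt h = B" and A: "A \<in> Obj C"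
  shows "uncurr B (curr A h) = h"
proof -
  have [simp]: "B \<in> Obj C" using h by auto
  have "uncurr B (curr A h) = (\<iota> B \<otimes>\<^sub>a ev) \<star> ((h \<otimes>\<^sub>a \<iota> (L \<otimes>\<^sub>o R)) \<star> (\<iota> A \<otimes>\<^sub>a coev \<otimes>\<^sub>a \<iota> R))"
    using h A by (simp add: uncurr_def curr_def tns_cmp_right)
  also have "\<dots> = (h \<otimes>\<^sub>a ev) \<star> (\<iota> A \<otimes>\<^sub>a coev \<otimes>\<^sub>a \<iota> R)"
    using h A by (subst interchange') simp_all
  also have "h \<otimes>\<^sub>a ev = (h \<otimes>\<^sub>a \<iota> (UnitO C)) \<star> (\<iota> (A \<otimes>\<^sub>o R) \<otimes>\<^sub>a ev)"
    using h by (intro tns_split1) simp_all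
  also have "\<dots> \<star> (\<iota> A \<otimes>\<^sub>a coev \<otimes>\<^sub>a \<iota> R) = h"
    using h A zigzag1_tns[of A "UnitO C"] by simp
  finally show ?thesis .
qed

lemma curl_cmp_left:
  "arr C h \<Longrightarrow> src h = L \<otimes>\<^sub>o A \<Longrightarrow> A \<in> Obj C \<Longrightarrow> arr C k \<Longrightarrow> src k = tgt h
   \<Longrightarrow> curl A (k \<star> h) = (\<iota> R \<otimes>\<^sub>a k) \<star> curl A h"
  by (simp add: curl_def tns_cmp_left)

lemma curl_cmp_right:
  assumes "arr C h" "src h = L \<otimes>\<^sub>o A" "arr C f" "tgt f = A" "src f = A'"
  shows "curl A' (h \<star> (\<iota> L \<otimes>\<^sub>a f)) = curl A h \<star> f"
proof -
  have [simp]: "A \<in> Obj C" "A' \<in> Obj C" using assms by auto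
  have "curl A' (h \<star> (\<iota> L \<otimes>\<^sub>a f)) = (\<iota> R \<otimes>\<^sub>a h) \<star> ((\<iota> (R \<otimes>\<^sub>o L) \<otimes>\<^sub>a f) \<star> (coev \<otimes>\<^sub>a \<iota> A'))"
    using assms by (simp add: curl_def tns_cmp_left)
  also have "(\<iota> (R \<otimes>\<^sub>o L) \<otimes>\<^sub>a f) \<star> (coev \<otimes>\<^sub>a \<iota> A') = (coev \<otimes>\<^sub>a \<iota> A) \<star> (\<iota> (UnitO C) \<otimes>\<^sub>a f)"
    using assms by (simp only: tns_split2[symmetric] tns_split1[symmetric] dual_simps)
  finally show ?thesis using assms by (simp add: curl_def)
qed

lemma curr_cmp_left:
  "arr C h \<Longrightarrow> src h = A \<otimes>\<^sub>o R \<Longrightarrow> A \<in> Obj C \<Longrightarrow> arr C k \<Longrightarrow> src k = tgt h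
   \<Longrightarrow> curr A (k \<star> h) = (k \<otimes>\<^sub>a \<iota> L) \<star> curr A h"
  by (simp add: curr_def tns_cmp_right)

lemma curr_cmp_right:
  assumes "arr C h" "src h = A \<otimes>\<^sub>o R" "arr C f" "tgt f = A" "src f = A'"
  shows "curr A' (h \<star> (f \<otimes>\<^sub>a \<iota> R)) = curr A h \<star> f"
proof -
  have [simp]: "A \<in> Obj C" "A' \<in> Obj C" using assms by auto
  have "curr A' (h \<star> (f \<otimes>\<^sub>a \<iota> R)) = (h \<otimes>\<^sub>a \<iota> L) \<star> ((f \<otimes>\<^sub>a \<iota> (R \<otimes>\<^sub>o L)) \<star> (\<iota> A' \<otimes>\<^sub>a coev))"
    using assms by (simp add: curr_def tns_cmp_right)
  also have "(f \<otimes>\<^sub>a \<iota> (R \<otimes>\<^sub>o L)) \<star> (\<iota> A' \<otimes>\<^sub>a coev) = (\<iota> A \<otimes>\<^sub>a coev) \<star> (f \<otimes>\<^sub>a \<iota> (UnitO C))"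
    using assms by (simp only: tns_split2[symmetric] tns_split1[symmetric] dual_simps)
  finally show ?thesis using assms by (simp add: curr_def)
qed

lemma uncurl_cmp_left:
  assumes "arr C g" "tgt g = R \<otimes>\<^sub>o B" "arr C k" "src k = B" "tgt k = B'"
  shows "uncurl B' ((\<iota> R \<otimes>\<^sub>a k) \<star> g) = k \<star> uncurl B g"
proof -
  have [simp]: "B \<in> Obj C" "B' \<in> Obj C" using assms by auto
  have "uncurl B' ((\<iota> R \<otimes>\<^sub>a k) \<star> g) = (ev \<otimes>\<^sub>a \<iota> B') \<star> ((\<iota> (L \<otimes>\<^sub>o R) \<otimes>\<^sub>a k) \<star> (\<iota> L \<otimes>\<^sub>a g))"
    using assms by (simp add: uncurl_def tns_cmp_left)
  also have "\<dots> = (ev \<otimes>\<^sub>a k) \<star> (\<iota> L \<otimes>\<^sub>a g)"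
    using assms by (subst interchange') simp_all
  also have "ev \<otimes>\<^sub>a k = (\<iota> (UnitO C) \<otimes>\<^sub>a k) \<star> (ev \<otimes>\<^sub>a \<iota> B)"
    using assms by (intro tns_split2) simp_all
  finally show ?thesis using assms by (simp add: uncurl_def)
qed

lemma curl_inj:
  assumes "curl A h = curl A h'" "arr C h" "arr C h'" "src h = L \<otimes>\<^sub>o A" "src h' = L \<otimes>\<^sub>o A" "tgt h = tgt h'" "A \<in> Obj C"
  shows "h = h'"
  using uncurl_curl[of h A "tgt h"] uncurl_curl[of h' A "tgt h"] assms by simp

lemma curr_inj:
  assumes "curr A h = curr A h'" "arr C h" "arr C h'" "src h = A \<otimes>\<^sub>o R" "src h' = A \<otimes>\<^sub>o R" "tgt h = tgt h'" "A \<in> Obj C"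
  shows "h = h'"
  using uncurr_curr[of h A "tgt h"] uncurr_curr[of h' A "tgt h"] assms by simp

text \<open>L \<otimes> - is left adjoint to R \<otimes> - by \<open>curl\<close> and
  \<open>uncurl\<close>, and left adjoints preserve cokernels.\<close>

lemma tns_coker:
  assumes p: "is_coker C f p"
  shows "is_coker C (\<iota> L \<otimes>\<^sub>a f) (\<iota> L \<otimes>\<^sub>a p)"
proof (rule is_cokerI)
  note a [simp] = is_coker_arr[OF p]
  show "arr C (\<iota> L \<otimes>\<^sub>a f)" "arr C (\<iota> L \<otimes>\<^sub>a p)" "src (\<iota> L \<otimes>\<^sub>a p) = tgt (\<iota> L \<otimes>\<^sub>a f)" by simp_all
  show "(\<iota> L \<otimes>\<^sub>a p) \<star> (\<iota> L \<otimes>\<^sub>a f) = zr C (src (\<iota> L \<otimes>\<^sub>a f)) (tgt (\<iota> L \<otimes>\<^sub>a p))"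
    by (simp add: interchange is_coker_eq[OF p])
  show "epi C (\<iota> L \<otimes>\<^sub>a p)"
    unfolding epi_def
  proof (intro conjI allI impI)
    fix g h assume gh: "arr C g" "arr C h" "src g = tgt (\<iota> L \<otimes>\<^sub>a p)" "src h = tgt (\<iota> L \<otimes>\<^sub>a p)" "tgt g = tgt h"
      "g \<star> (\<iota> L \<otimes>\<^sub>a p) = h \<star> (\<iota> L \<otimes>\<^sub>a p)"
    have "curl (tgt p) g \<star> p = curl (tgt p) h \<star> p"
      using gh curl_cmp_right[of g "tgt p" p] curl_cmp_right[of h "tgt p" p] by simp
    hence "curl (tgt p) g = curl (tgt p) h"
      by (rule epiD[OF is_coker_epi[OF p]]) (use gh in \<open>simp_all add: curl_arr\<close>)
    thus "g = h" by (rule curl_inj) (use gh in simp_all)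
  qed simp
  fix h assume h: "arr C h" "src h = tgt (\<iota> L \<otimes>\<^sub>a f)" "h \<star> (\<iota> L \<otimes>\<^sub>a f) = zr C (src (\<iota> L \<otimes>\<^sub>a f)) (tgt h)"
  have "curl (tgt f) h \<star> f = curl (src f) (h \<star> (\<iota> L \<otimes>\<^sub>a f))"
    using h by (intro curl_cmp_right[symmetric]) simp_all
  also have "\<dots> = zr C (src f) (R \<otimes>\<^sub>o tgt h)" using h by (simp add: curl_def)
  finally obtain w where w: "arr C w" "src w = tgt p" "tgt w = R \<otimes>\<^sub>o tgt h" "w \<star> p = curl (tgt f) h"
    using is_coker_factor[OF p, of "curl (tgt f) h"] h by (auto simp: curl_arr)
  have "uncurl (tgt h) w \<star> (\<iota> L \<otimes>\<^sub>a p) = uncurl (tgt h) (w \<star> p)"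
    using w(1-3) h by (simp add: uncurl_def interchange)
  also have "\<dots> = h" using w h uncurl_curl[of h "tgt f" "tgt h"] by simp
  finally show "\<exists>w. arr C w \<and> src w = tgt (\<iota> L \<otimes>\<^sub>a p) \<and> tgt w = tgt h \<and> w \<star> (\<iota> L \<otimes>\<^sub>a p) = h"
    using w(1-3) h uncurl_arr[of w "tgt h"] by (intro exI[of _ "uncurl (tgt h) w"]) simp
qed

end

lemma (in strict_tensor_category) tns_is_coker:
  assumes "M \<in> Obj C" "is_coker C f p" shows "is_coker C (\<iota> M \<otimes>\<^sub>a f) (\<iota> M \<otimes>\<^sub>a p)"
proof -
  obtain R ev coev where d: "dual C M R ev coev" using ex_dual(1)[OF assms(1)] by blast
  interpret dual_objects C M R ev coev by unfold_locales (rule d)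
  show ?thesis using assms(2) by (rule tns_coker)
qed

text \<open>Cokernels are taken one after the other: if \<pi> kills the earlier arrows, then
  following it by the cokernel of \<pi> \<star> r kills r as well. The universal property is kept as
  an epimorphism together with a factorization, a form that passes through the induction.\<close>

lemma (in abelian_category) ex_coker_list:
  assumes Q: "Q \<in> Obj C" and "\<And>r. r \<in> set rs \<Longrightarrow> arr C r \<and> src r = Q \<and> tgt r = Q"
  shows "\<exists>\<pi>. epi C \<pi> \<and> src \<pi> = Q \<and> (\<forall>r\<in>set rs. \<pi> \<star> r = zr C Q (tgt \<pi>)) \<and>
    (\<forall>h. arr C h \<longrightarrow> src h = Q \<longrightarrow> (\<forall>r\<in>set rs. h \<star> r = zr C Q (tgt h)) \<longrightarrow>
       (\<exists>w. arr C w \<and> src w = tgt \<pi> \<and> tgt w = tgt h \<and> w \<star> \<pi> = h))"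
  using assms(2)
proof (induction rs)
  case Nil
  have "epi C (\<iota> Q)" using Q by (intro split_epi[of _ "\<iota> Q"]) simp_all
  moreover have "\<exists>w. arr C w \<and> src w = Q \<and> tgt w = tgt h \<and> w \<star> \<iota> Q = h" if "arr C h" "src h = Q" for h
    using that by (intro exI[of _ h]) simp
  ultimately show ?case by (intro exI[of _ "\<iota> Q"]) simp
next
  case (Cons r rs)
  obtain \<pi> where \<pi>: "epi C \<pi>" "src \<pi> = Q" and \<pi>r: "\<forall>r\<in>set rs. \<pi> \<star> r = zr C Q (tgt \<pi>)"
    and fac: "\<And>h. arr C h \<Longrightarrow> src h = Q \<Longrightarrow> (\<forall>r\<in>set rs. h \<star> r = zr C Q (tgt h)) \<Longrightarrow>
       (\<exists>w. arr C w \<and> src w = tgt \<pi> \<and> tgt w = tgt h \<and> w \<star> \<pi> = h)"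
    using Cons by auto
  have \<pi>a: "arr C \<pi>" using \<pi> by (simp add: epi_def)
  have rs: "arr C s" "src s = Q" "tgt s = Q" if "s \<in> set (r # rs)" for s using Cons.prems[OF that] by auto
  have r: "arr C r" "src r = Q" "tgt r = Q" using rs[of r] by auto
  obtain p where p: "is_coker C (\<pi> \<star> r) p" using ex_coker[of "\<pi> \<star> r"] \<pi>a r \<pi> by auto
  have pa: "arr C p" "src p = tgt \<pi>" using is_coker_arr[OF p] by simp_all
  show ?case
  proof (rule exI[of _ "p \<star> \<pi>"], intro conjI ballI allI impI)
    show "epi C (p \<star> \<pi>)"
      unfolding epi_def
    proof (intro conjI allI impI)
      fix g h assume gh: "arr C g" "arr C h" "src g = tgt (p \<star> \<pi>)" "src h = tgt (p \<star> \<pi>)" "tgt g = tgt h"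
        "g \<star> (p \<star> \<pi>) = h \<star> (p \<star> \<pi>)"
      have "(g \<star> p) \<star> \<pi> = (h \<star> p) \<star> \<pi>" using gh pa \<pi>a by simp
      hence "g \<star> p = h \<star> p" by (rule epiD[OF \<pi>(1)]) (use gh pa in simp_all)
      thus "g = h" by (rule epiD[OF is_coker_epi[OF p]]) (use gh pa in simp_all)
    qed (use pa \<pi>a in simp)
    fix s assume s: "s \<in> set (r # rs)"
    show "(p \<star> \<pi>) \<star> s = zr C Q (tgt (p \<star> \<pi>))"
    proof (cases "s = r")
      case True
      thus ?thesis using is_coker_eq[OF p] pa \<pi>a r \<pi> by simp
    next
      case False
      thus ?thesis using \<pi>r s rs[OF s] pa \<pi>a \<pi> Q by simp
    qed
  next
    fix h assume h: "arr C h" "src h = Q" "\<forall>s\<in>set (r # rs). h \<star> s = zr C Q (tgt h)"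
    obtain w where w: "arr C w" "src w = tgt \<pi>" "tgt w = tgt h" "w \<star> \<pi> = h" using fac[OF h(1,2)] h(3) by auto
    have "w \<star> (\<pi> \<star> r) = h \<star> r" using cmp_assoc_eq[OF w(4), of r] w(1-3) \<pi>a r \<pi> by simp
    hence "w \<star> (\<pi> \<star> r) = zr C (src (\<pi> \<star> r)) (tgt w)" using h(3) w(3) r by simp
    then obtain w' where w': "arr C w'" "src w' = tgt p" "tgt w' = tgt w" "w' \<star> p = w"
      using is_coker_factor[OF p w(1)] w(2) by auto
    have "w' \<star> (p \<star> \<pi>) = h" using cmp_assoc_eq[OF w'(4), of \<pi>] w' w pa \<pi>a by simp
    thus "\<exists>w. arr C w \<and> src w = tgt (p \<star> \<pi>) \<and> tgt w = tgt h \<and> w \<star> (p \<star> \<pi>) = h"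
      using w' w by (intro exI[of _ w']) simp
  qed (use \<pi> in simp)
qed

lemma linear_map_comp:
  fixes U :: "('k::field, 'a) module" and V :: "('k, 'b) module" and W :: "('k, 'c) module"
  shows "linear_map class_ring U V S \<Longrightarrow> linear_map class_ring V W T \<Longrightarrow> linear_map class_ring U W (\<lambda>x. T (S x))"
  by (rule linear_mapI)
    (simp_all add: lm_vs_left lm_vs_right lm_closed[of U V S] lm_closed[of V W T] lm_add[of U V S] lm_add[of V W T]
      lm_scale[of U V S] lm_scale[of V W T])

section \<open>The free half-braided object\<close>

locale tensor_functor = C: finite_strict_tensor_category C + D: finite_strict_tensor_category D
  for C :: "('k::field, 'o, 'm) mon_cat" and D :: "('k, 'p, 'n) mon_cat" (structure) +
  fixes F :: "('o, 'm, 'p, 'n) functor_data"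
  assumes F_linear: "linear_functor C D F" and F_exact: "exact_functor C D F"
    and F_monoidal: "strict_monoidal_functor C D F"
begin

abbreviation "Fo \<equiv> obj_map F"
abbreviation "Fm \<equiv> fm F"

lemmas F_simps [simp] = fm_simps[OF F_linear]

lemma F_unit [simp]: "Fo (UnitO C) = UnitO D"
  using F_monoidal by (simp add: strict_monoidal_functor_def)

lemma F_tns_obj [simp]: "X \<in> Obj C \<Longrightarrow> Y \<in> Obj C \<Longrightarrow> Fo (X \<otimes>\<^sub>o\<^bsub>C\<^esub> Y) = Fo X \<otimes>\<^sub>o Fo Y"
  using F_monoidal by (simp add: strict_monoidal_functor_def)

lemma F_tns [simp]: "arr C f \<Longrightarrow> arr C g \<Longrightarrow> Fm (f \<otimes>\<^sub>a\<^bsub>C\<^esub> g) = Fm f \<otimes>\<^sub>a Fm g"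
  using F_monoidal by (simp add: strict_monoidal_functor_def fm_def tns_def arr_und)

lemma F_coker:
  assumes "is_ker C p k" "is_coker C k p" shows "is_coker D (Fm k) (Fm p)"
proof -
  have a: "arr C k" "arr C p" "tgt k = src p" using assms by (simp_all add: is_ker_def is_coker_def)
  hence "short_exact C (src k) (src p) (tgt p) (und k) (und p)"
    using assms by (simp add: is_ker_def is_coker_def short_exact_def)
  with F_exact a have "short_exact D (Fo (src k)) (Fo (src p)) (Fo (tgt p)) (und (Fm k)) (und (Fm p))"
    unfolding exact_functor_def by (simp add: fm_def)
  thus ?thesis using a by (simp add: is_coker_def short_exact_def)
qed

definition lmul :: "'p \<Rightarrow> ('o, 'm, 'p, 'n) functor_data" where
  "lmul M = \<lparr>obj_map = (\<lambda>X. M \<otimes>\<^sub>o Fo X), arr_map = (\<lambda>X Y f. Ident D M \<otimes>\<^sub>m arr_map F X Y f)\<rparr>"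

definition rmul :: "'p \<Rightarrow> ('o, 'm, 'p, 'n) functor_data" where
  "rmul W = \<lparr>obj_map = (\<lambda>X. Fo X \<otimes>\<^sub>o W), arr_map = (\<lambda>X Y f. arr_map F X Y f \<otimes>\<^sub>m Ident D W)\<rparr>"

lemma fm_lmul [simp]: "fm (lmul M) a = \<iota> M \<otimes>\<^sub>a Fm a" "obj_map (lmul M) X = M \<otimes>\<^sub>o Fo X"
  by (simp_all add: fm_def lmul_def tns_def idt_def)

lemma fm_rmul [simp]: "fm (rmul W) a = Fm a \<otimes>\<^sub>a \<iota> W" "obj_map (rmul W) X = Fo X \<otimes>\<^sub>o W"
  by (simp_all add: fm_def rmul_def tns_def idt_def)

lemma linear_functor_lmul:
  assumes M: "M \<in> Obj D" shows "linear_functor C D (lmul M)"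
  unfolding linear_functor_def
proof (intro conjI ballI)
  fix X assume X: "X \<in> Obj C"
  show "obj_map (lmul M) X \<in> Obj D" using M X by simp
  have "und (fm (lmul M) (idt C X)) = und (idt D (M \<otimes>\<^sub>o Fo X))" using M X by simp
  thus "arr_map (lmul M) X X (Ident C X) = Ident D (obj_map (lmul M) X)" by (simp add: fm_def idt_def del: fm_lmul(1))
  fix Y assume Y: "Y \<in> Obj C"
  show "linear_map class_ring (HomV C X Y) (HomV D (obj_map (lmul M) X) (obj_map (lmul M) Y)) (arr_map (lmul M) X Y)"
    using linear_map_comp[OF fm_linear[OF F_linear X Y] D.bil_tns(1)[of M M "Fo X" "Fo Y" "Ident D M"]] M X Y
    by (simp add: D.ident_in_hom) (simp add: lmul_def)
  fix Z f g assume Z: "Z \<in> Obj C" "f \<in> Mor C X Y" "g \<in> Mor C Y Z"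
  have "und (fm (lmul M) (mk Y g Z \<star>\<^bsub>C\<^esub> mk X f Y)) = und (fm (lmul M) (mk Y g Z) \<star> fm (lmul M) (mk X f Y))"
    using M X Y Z by (simp add: D.tns_cmp_left)
  thus "arr_map (lmul M) X Z (g \<cdot>\<^bsub>C\<^esub> f) = arr_map (lmul M) Y Z g \<cdot> arr_map (lmul M) X Y f"
    by (simp add: fm_def cmp_def del: fm_lmul(1))
qed

lemma linear_functor_rmul:
  assumes W: "W \<in> Obj D" shows "linear_functor C D (rmul W)"
  unfolding linear_functor_def
proof (intro conjI ballI)
  fix X assume X: "X \<in> Obj C"
  show "obj_map (rmul W) X \<in> Obj D" using W X by simp
  have "und (fm (rmul W) (idt C X)) = und (idt D (Fo X \<otimes>\<^sub>o W))" using W X by simp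
  thus "arr_map (rmul W) X X (Ident C X) = Ident D (obj_map (rmul W) X)" by (simp add: fm_def idt_def del: fm_rmul(1))
  fix Y assume Y: "Y \<in> Obj C"
  show "linear_map class_ring (HomV C X Y) (HomV D (obj_map (rmul W) X) (obj_map (rmul W) Y)) (arr_map (rmul W) X Y)"
    using linear_map_comp[OF fm_linear[OF F_linear X Y] D.bil_tns(2)[of "Fo X" "Fo Y" W W "Ident D W"]] W X Y
    by (simp add: D.ident_in_hom) (simp add: rmul_def)
  fix Z f g assume Z: "Z \<in> Obj C" "f \<in> Mor C X Y" "g \<in> Mor C Y Z"
  have "und (fm (rmul W) (mk Y g Z \<star>\<^bsub>C\<^esub> mk X f Y)) = und (fm (rmul W) (mk Y g Z) \<star> fm (rmul W) (mk X f Y))"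
    using W X Y Z by (simp add: D.tns_cmp_right)
  thus "arr_map (rmul W) X Z (g \<cdot>\<^bsub>C\<^esub> f) = arr_map (rmul W) Y Z g \<cdot> arr_map (rmul W) X Y f"
    by (simp add: fm_def cmp_def del: fm_rmul(1))
qed

text \<open>The factor A on the right serves the variables after the first: A is F(Y) in the
  half-braiding of \<open>Zo M\<close>, and a product of several F(Y) in the contracting
  homotopy.\<close>

definition ntr :: "'p \<Rightarrow> 'p \<Rightarrow> 'p \<Rightarrow> ('o \<Rightarrow> 'p \<times> 'n \<times> 'p) \<Rightarrow> bool" where
  "ntr M A W \<tau> \<longleftrightarrow>
     (\<forall>X\<in>Obj C. arr D (\<tau> X) \<and> src (\<tau> X) = M \<otimes>\<^sub>o Fo X \<otimes>\<^sub>o A \<and> tgt (\<tau> X) = Fo X \<otimes>\<^sub>o W) \<and>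
     (\<forall>f. arr C f \<longrightarrow> (Fm f \<otimes>\<^sub>a \<iota> W) \<star> \<tau> (src f) = \<tau> (tgt f) \<star> (\<iota> M \<otimes>\<^sub>a Fm f \<otimes>\<^sub>a \<iota> A))"

lemma ntrD:
  assumes "ntr M A W \<tau>" "W \<in> Obj D" "X \<in> Obj C"
  shows "arr D (\<tau> X)" "src (\<tau> X) = M \<otimes>\<^sub>o Fo X \<otimes>\<^sub>o A" "tgt (\<tau> X) = Fo X \<otimes>\<^sub>o W"
  using assms by (simp_all add: ntr_def)

lemma ntrD':
  assumes "ntr M A W \<tau>" "W \<in> Obj D" "arr C f"
  shows "(Fm f \<otimes>\<^sub>a \<iota> W) \<star> \<tau> (src f) = \<tau> (tgt f) \<star> (\<iota> M \<otimes>\<^sub>a Fm f \<otimes>\<^sub>a \<iota> A)"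
  using assms by (simp add: ntr_def)

lemma ntrI:
  assumes "W \<in> Obj D" "\<And>X. X \<in> Obj C \<Longrightarrow> arr D (\<tau> X)" "\<And>X. X \<in> Obj C \<Longrightarrow> src (\<tau> X) = M \<otimes>\<^sub>o Fo X \<otimes>\<^sub>o A"
    "\<And>X. X \<in> Obj C \<Longrightarrow> tgt (\<tau> X) = Fo X \<otimes>\<^sub>o W"
    "\<And>f. arr C f \<Longrightarrow> (Fm f \<otimes>\<^sub>a \<iota> W) \<star> \<tau> (src f) = \<tau> (tgt f) \<star> (\<iota> M \<otimes>\<^sub>a Fm f \<otimes>\<^sub>a \<iota> A)"
  shows "ntr M A W \<tau>"
  using assms by (simp add: ntr_def)

lemma natural_extension:
  assumes "M \<in> Obj D" "W \<in> Obj D" "separator C G"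
  shows "natural_extension C D (lmul M) (rmul W) G"
proof unfold_locales
  show "linear_functor C D (lmul M)" "linear_functor C D (rmul W)"
    using assms by (simp_all add: linear_functor_lmul linear_functor_rmul)
  show "is_coker D (fm (lmul M) k) (fm (lmul M) p)" if "is_ker C p k" "is_coker C k p" for k p
    using D.tns_is_coker[OF assms(1) F_coker[OF that]] by simp
qed (rule assms(3))

text \<open>Since Hom(M \<otimes> F(G), F(G) \<otimes> W) = Hom(L \<otimes> M \<otimes> F(G), W) for
  L left dual to F(G), a transformation amounts to an arrow out of Q = L \<otimes> M \<otimes> F(G)
  that satisfies a linear condition for each endomorphism of G. The representing object is the
  quotient of Q that imposes these conditions.\<close>

lemma ex_universal:
  assumes M: "M \<in> Obj D"
  shows "\<exists>Z u. Z \<in> Obj D \<and> ntr M (UnitO D) Z u \<and>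
    (\<forall>W\<in>Obj D. \<forall>\<tau>. ntr M (UnitO D) W \<tau> \<longrightarrow>
       (\<exists>w. arr D w \<and> src w = Z \<and> tgt w = W \<and> (\<forall>X\<in>Obj C. \<tau> X = (\<iota> (Fo X) \<otimes>\<^sub>a w) \<star> u X))) \<and>
    (\<forall>w w'. arr D w \<longrightarrow> arr D w' \<longrightarrow> src w = Z \<longrightarrow> src w' = Z \<longrightarrow> tgt w = tgt w' \<longrightarrow>
       (\<forall>X\<in>Obj C. (\<iota> (Fo X) \<otimes>\<^sub>a w) \<star> u X = (\<iota> (Fo X) \<otimes>\<^sub>a w') \<star> u X) \<longrightarrow> w = w')"
proof -
  obtain G where G: "separator C G" using ex_separator[OF C.linear_category_axioms C.finite] by blast
  have GO [simp]: "G \<in> Obj C" using G by (simp add: separator_def)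
  obtain L ev coev where d: "dual D L (Fo G) ev coev" using D.ex_dual(2)[of "Fo G"] by auto
  interpret d: dual_objects D L "Fo G" ev coev by unfold_locales (rule d)
  note [simp] = M
  let ?A = "M \<otimes>\<^sub>o Fo G" and ?Q = "L \<otimes>\<^sub>o M \<otimes>\<^sub>o Fo G"
  \<comment> \<open>The arrow that corresponds to the identity of Q. Every curried arrow is
    \<open>u0\<close> followed by F(G) \<otimes> h, see \<open>curl_h\<close>.\<close>
  define u0 where "u0 = d.curl ?A (\<iota> ?Q)"
  have u0 [simp]: "arr D u0" "src u0 = ?A" "tgt u0 = Fo G \<otimes>\<^sub>o ?Q"
    by (simp_all add: u0_def d.curl_arr)
  \<comment> \<open>The difference of two actions of e on Q: the transpose of F(e) on the factor L,
    and F(e) on the last factor. By \<open>key\<close>, an arrow h kills it exactly when the curried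
    form of h is natural at e.\<close>
  define r where "r e = d.uncurl ?Q ((Fm e \<otimes>\<^sub>a \<iota> ?Q) \<star> u0) \<boxplus> (- 1) \<boxdot> (\<iota> (L \<otimes>\<^sub>o M) \<otimes>\<^sub>a Fm e)" for e
  have r: "arr D (r e)" "src (r e) = ?Q" "tgt (r e) = ?Q" if "arr C e" "src e = G" "tgt e = G" for e
    using that by (simp_all add: r_def d.uncurl_arr)
  have curl_h: "d.curl ?A h = (\<iota> (Fo G) \<otimes>\<^sub>a h) \<star> u0" if "arr D h" "src h = ?Q" for h
    using d.curl_cmp_left[of "\<iota> ?Q" ?A h] that by (simp add: u0_def)
  have key: "(Fm e \<otimes>\<^sub>a \<iota> W) \<star> d.curl ?A h = d.curl ?A h \<star> (\<iota> M \<otimes>\<^sub>a Fm e) \<longleftrightarrow> h \<star> r e = zr D ?Q W"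
    if h: "arr D h" "src h = ?Q" "tgt h = W" and e: "arr C e" "src e = G" "tgt e = G" for h e W
  proof -
    have [simp]: "W \<in> Obj D" using h by auto
    have "(Fm e \<otimes>\<^sub>a \<iota> W) \<star> d.curl ?A h = (\<iota> (Fo G) \<otimes>\<^sub>a h) \<star> ((Fm e \<otimes>\<^sub>a \<iota> ?Q) \<star> u0)"
      using h e by (simp add: curl_h D.interchange')
    hence 1: "d.uncurl W ((Fm e \<otimes>\<^sub>a \<iota> W) \<star> d.curl ?A h) = h \<star> d.uncurl ?Q ((Fm e \<otimes>\<^sub>a \<iota> ?Q) \<star> u0)"
      using h e d.uncurl_cmp_left[of "(Fm e \<otimes>\<^sub>a \<iota> ?Q) \<star> u0" ?Q h W] by simp
    have "d.curl ?A h \<star> (\<iota> M \<otimes>\<^sub>a Fm e) = d.curl ?A (h \<star> (\<iota> L \<otimes>\<^sub>a (\<iota> M \<otimes>\<^sub>a Fm e)))"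
      using h e by (intro d.curl_cmp_right[symmetric]) simp_all
    hence 2: "d.uncurl W (d.curl ?A h \<star> (\<iota> M \<otimes>\<^sub>a Fm e)) = h \<star> (\<iota> (L \<otimes>\<^sub>o M) \<otimes>\<^sub>a Fm e)"
      using h e d.uncurl_curl[of "h \<star> (\<iota> (L \<otimes>\<^sub>o M) \<otimes>\<^sub>a Fm e)" ?A W] by simp
    have inj: "x = y \<longleftrightarrow> d.uncurl W x = d.uncurl W y"
      if "arr D x" "arr D y" "src x = ?A" "src y = ?A" "tgt x = Fo G \<otimes>\<^sub>o W" "tgt y = Fo G \<otimes>\<^sub>o W" for x y
    proof
      assume "d.uncurl W x = d.uncurl W y"
      hence "d.curl ?A (d.uncurl W x) = d.curl ?A (d.uncurl W y)" by simp
      thus "x = y" using that by (simp add: d.curl_uncurl)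
    qed simp
    have "(Fm e \<otimes>\<^sub>a \<iota> W) \<star> d.curl ?A h = d.curl ?A h \<star> (\<iota> M \<otimes>\<^sub>a Fm e) \<longleftrightarrow>
        h \<star> d.uncurl ?Q ((Fm e \<otimes>\<^sub>a \<iota> ?Q) \<star> u0) = h \<star> (\<iota> (L \<otimes>\<^sub>o M) \<otimes>\<^sub>a Fm e)"
      using h e by (subst inj) (simp_all add: d.curl_arr 1 2)
    also have "\<dots> \<longleftrightarrow> h \<star> r e = zr D ?Q W"
      using h e D.pls_neg_eq_zr_iff[of "h \<star> d.uncurl ?Q ((Fm e \<otimes>\<^sub>a \<iota> ?Q) \<star> u0)" "h \<star> (\<iota> (L \<otimes>\<^sub>o M) \<otimes>\<^sub>a Fm e)"]
      by (simp add: r_def D.cmp_pls_right d.uncurl_arr)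
    finally show ?thesis .
  qed
  have "finitely_spanned C G G" using G by (simp add: separator_def)
  then obtain bs where bs: "\<forall>b\<in>set bs. arr C b \<and> src b = G \<and> tgt b = G"
    and ind: "\<forall>P. P (zr C G G) \<longrightarrow>
        (\<forall>f g. arr C f \<longrightarrow> src f = G \<longrightarrow> tgt f = G \<longrightarrow> arr C g \<longrightarrow> src g = G \<longrightarrow> tgt g = G
           \<longrightarrow> P f \<longrightarrow> P g \<longrightarrow> P (pls C f g)) \<longrightarrow>
        (\<forall>c f. arr C f \<longrightarrow> src f = G \<longrightarrow> tgt f = G \<longrightarrow> P f \<longrightarrow> P (scl C c f)) \<longrightarrow>
        (\<forall>b\<in>set bs. P b) \<longrightarrow>
        (\<forall>h. arr C h \<longrightarrow> src h = G \<longrightarrow> tgt h = G \<longrightarrow> P h)"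
    unfolding finitely_spanned_def by blast
  have "\<exists>\<pi>. epi D \<pi> \<and> src \<pi> = ?Q \<and> (\<forall>s\<in>set (map r bs). \<pi> \<star> s = zr D ?Q (tgt \<pi>)) \<and>
    (\<forall>h. arr D h \<longrightarrow> src h = ?Q \<longrightarrow> (\<forall>s\<in>set (map r bs). h \<star> s = zr D ?Q (tgt h)) \<longrightarrow>
       (\<exists>w. arr D w \<and> src w = tgt \<pi> \<and> tgt w = tgt h \<and> w \<star> \<pi> = h))"
    by (rule D.ex_coker_list) (use r bs in auto)
  then obtain \<pi> where \<pi>: "epi D \<pi>" "src \<pi> = ?Q" and \<pi>r: "\<forall>b\<in>set bs. \<pi> \<star> r b = zr D ?Q (tgt \<pi>)"
    and fac: "\<And>h. arr D h \<Longrightarrow> src h = ?Q \<Longrightarrow> (\<forall>b\<in>set bs. h \<star> r b = zr D ?Q (tgt h)) \<Longrightarrow>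
       (\<exists>w. arr D w \<and> src w = tgt \<pi> \<and> tgt w = tgt h \<and> w \<star> \<pi> = h)"
    by auto
  define Z where "Z = tgt \<pi>"
  have \<pi>a: "arr D \<pi>" "src \<pi> = ?Q" "tgt \<pi> = Z" using \<pi> by (simp_all add: epi_def Z_def)
  have Z [simp]: "Z \<in> Obj D" using \<pi>a by auto
  let ?t = "d.curl ?A \<pi>"
  have t: "arr D ?t" "src ?t = ?A" "tgt ?t = Fo G \<otimes>\<^sub>o Z" using \<pi>a by (simp_all add: d.curl_arr)
  \<comment> \<open>Naturality at e is linear in e, so the relations imposed for the finite spanning
    list give it for all endomorphisms of G.\<close>
  have t_comm: "(Fm e \<otimes>\<^sub>a \<iota> Z) \<star> ?t = ?t \<star> (\<iota> M \<otimes>\<^sub>a Fm e)" if e: "arr C e" "src e = G" "tgt e = G" for e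
  proof (rule ind[THEN spec[of _ "\<lambda>e. (Fm e \<otimes>\<^sub>a \<iota> Z) \<star> ?t = ?t \<star> (\<iota> M \<otimes>\<^sub>a Fm e)"],
        THEN mp, THEN mp, THEN mp, THEN mp, THEN spec, THEN mp, THEN mp, THEN mp, OF _ _ _ _ e])
    show "(Fm (zr C G G) \<otimes>\<^sub>a \<iota> Z) \<star> ?t = ?t \<star> (\<iota> M \<otimes>\<^sub>a Fm (zr C G G))" using t by simp
    show "\<forall>f g. arr C f \<longrightarrow> src f = G \<longrightarrow> tgt f = G \<longrightarrow> arr C g \<longrightarrow> src g = G \<longrightarrow> tgt g = G
           \<longrightarrow> (Fm f \<otimes>\<^sub>a \<iota> Z) \<star> ?t = ?t \<star> (\<iota> M \<otimes>\<^sub>a Fm f) \<longrightarrow> (Fm g \<otimes>\<^sub>a \<iota> Z) \<star> ?t = ?t \<star> (\<iota> M \<otimes>\<^sub>a Fm g)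
           \<longrightarrow> (Fm (pls C f g) \<otimes>\<^sub>a \<iota> Z) \<star> ?t = ?t \<star> (\<iota> M \<otimes>\<^sub>a Fm (pls C f g))"
      using t by (simp add: D.tns_pls_left D.tns_pls_right D.cmp_pls_left D.cmp_pls_right)
    show "\<forall>c f. arr C f \<longrightarrow> src f = G \<longrightarrow> tgt f = G \<longrightarrow> (Fm f \<otimes>\<^sub>a \<iota> Z) \<star> ?t = ?t \<star> (\<iota> M \<otimes>\<^sub>a Fm f)
           \<longrightarrow> (Fm (scl C c f) \<otimes>\<^sub>a \<iota> Z) \<star> ?t = ?t \<star> (\<iota> M \<otimes>\<^sub>a Fm (scl C c f))"
      using t by simp
    show "\<forall>b\<in>set bs. (Fm b \<otimes>\<^sub>a \<iota> Z) \<star> ?t = ?t \<star> (\<iota> M \<otimes>\<^sub>a Fm b)"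
      using key[OF \<pi>a] \<pi>r bs \<pi>a by auto
  qed
  interpret E: natural_extension C D "lmul M" "rmul Z" G by (rule natural_extension) (use G in simp_all)
  obtain u where u: "\<And>X. X \<in> Obj C \<Longrightarrow> arr D (u X) \<and> src (u X) = M \<otimes>\<^sub>o Fo X \<and> tgt (u X) = Fo X \<otimes>\<^sub>o Z"
    and un: "\<And>f. arr C f \<Longrightarrow> (Fm f \<otimes>\<^sub>a \<iota> Z) \<star> u (src f) = u (tgt f) \<star> (\<iota> M \<otimes>\<^sub>a Fm f)" and uG: "u G = ?t"
    using E.extend_natural[of ?t] t t_comm by (auto simp: t_comm)
  have nu: "ntr M (UnitO D) Z u"
    by (rule ntrI) (use u un in simp_all)
  have ex: "\<exists>w. arr D w \<and> src w = Z \<and> tgt w = W \<and> (\<forall>X\<in>Obj C. \<tau> X = (\<iota> (Fo X) \<otimes>\<^sub>a w) \<star> u X)"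
    if W [simp]: "W \<in> Obj D" and \<tau>: "ntr M (UnitO D) W \<tau>" for W \<tau>
  proof -
    note n = ntrD[OF \<tau> W]
    define h where "h = d.uncurl W (\<tau> G)"
    have h: "arr D h" "src h = ?Q" "tgt h = W" using n by (simp_all add: h_def d.uncurl_arr)
    have hc: "d.curl ?A h = \<tau> G" unfolding h_def by (rule d.curl_uncurl) (use n in simp_all)
    have "\<forall>b\<in>set bs. h \<star> r b = zr D ?Q (tgt h)"
    proof
      fix b assume b: "b \<in> set bs"
      have "(Fm b \<otimes>\<^sub>a \<iota> W) \<star> \<tau> G = \<tau> G \<star> (\<iota> M \<otimes>\<^sub>a Fm b)" using ntrD'[OF \<tau> W, of b] bs b by simp
      thus "h \<star> r b = zr D ?Q (tgt h)" using key[OF h, of b] bs b h hc by simp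
    qed
    then obtain w where w: "arr D w" "src w = Z" "tgt w = W" "w \<star> \<pi> = h"
      using fac[OF h(1,2)] h(3) by (auto simp: Z_def)
    \<comment> \<open>This is the factorization at the separator alone. Both sides are natural, and
      arrows out of M \<otimes> F(X) are determined by their composites with arrows from G, so it
      spreads to all X.\<close>
    have "\<tau> G = (\<iota> (Fo G) \<otimes>\<^sub>a w) \<star> u G"
      using d.curl_cmp_left[of \<pi> ?A w] \<pi>a w hc uG by simp
    interpret E': natural_extension C D "lmul M" "rmul W" G by (rule natural_extension) (use G in simp_all)
    have "\<tau> X = (\<iota> (Fo X) \<otimes>\<^sub>a w) \<star> u X" if X [simp]: "X \<in> Obj C" for X
    proof (rule E'.joint_epi[of X])
      fix h assume h: "arr C h" "src h = G" "tgt h = X"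
      have "\<tau> X \<star> (\<iota> M \<otimes>\<^sub>a Fm h) = (Fm h \<otimes>\<^sub>a \<iota> W) \<star> \<tau> G" using ntrD'[OF \<tau> W, of h] h by simp
      also have "\<dots> = (Fm h \<otimes>\<^sub>a \<iota> W) \<star> ((\<iota> (Fo G) \<otimes>\<^sub>a w) \<star> u G)" by (simp add: \<open>\<tau> G = _\<close>)
      also have "\<dots> = (\<iota> (Fo X) \<otimes>\<^sub>a w) \<star> ((Fm h \<otimes>\<^sub>a \<iota> Z) \<star> u G)"
        using h w u[of G] by (simp add: D.interchange')
      also have "(Fm h \<otimes>\<^sub>a \<iota> Z) \<star> u G = u X \<star> (\<iota> M \<otimes>\<^sub>a Fm h)" using un[of h] h by simp
      finally show "\<tau> X \<star> fm (lmul M) h = ((\<iota> (Fo X) \<otimes>\<^sub>a w) \<star> u X) \<star> fm (lmul M) h"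
        using h w u[of X] by simp
    qed (use n u w in simp_all)
    thus ?thesis using w by blast
  qed
  have uniq: "w = w'" if w: "arr D w" "arr D w'" "src w = Z" "src w' = Z" "tgt w = tgt w'"
    and eq: "\<forall>X\<in>Obj C. (\<iota> (Fo X) \<otimes>\<^sub>a w) \<star> u X = (\<iota> (Fo X) \<otimes>\<^sub>a w') \<star> u X" for w w'
  proof -
    have "d.curl ?A (w \<star> \<pi>) = d.curl ?A (w' \<star> \<pi>)"
      using d.curl_cmp_left[of \<pi> ?A w] d.curl_cmp_left[of \<pi> ?A w'] \<pi>a w
        eq[rule_format, OF GO] by (simp add: uG)
    hence "w \<star> \<pi> = w' \<star> \<pi>" by (rule d.curl_inj) (use w \<pi>a in simp_all)
    thus ?thesis by (rule epiD[OF \<pi>(1)]) (use w \<pi>a in simp_all)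
  qed
  show ?thesis using nu ex uniq Z by (intro exI[of _ Z] exI[of _ u]) blast
qed

definition univ :: "'p \<Rightarrow> 'p \<times> ('o \<Rightarrow> 'p \<times> 'n \<times> 'p)" where
  "univ M = (SOME (Z, u). Z \<in> Obj D \<and> ntr M (UnitO D) Z u \<and>
    (\<forall>W\<in>Obj D. \<forall>\<tau>. ntr M (UnitO D) W \<tau> \<longrightarrow>
       (\<exists>w. arr D w \<and> src w = Z \<and> tgt w = W \<and> (\<forall>X\<in>Obj C. \<tau> X = (\<iota> (Fo X) \<otimes>\<^sub>a w) \<star> u X))) \<and>
    (\<forall>w w'. arr D w \<longrightarrow> arr D w' \<longrightarrow> src w = Z \<longrightarrow> src w' = Z \<longrightarrow> tgt w = tgt w' \<longrightarrow>
       (\<forall>X\<in>Obj C. (\<iota> (Fo X) \<otimes>\<^sub>a w) \<star> u X = (\<iota> (Fo X) \<otimes>\<^sub>a w') \<star> u X) \<longrightarrow> w = w'))"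

definition Zo where "Zo M = fst (univ M)"
definition uni where "uni M = snd (univ M)"

lemma univ_props:
  assumes M: "M \<in> Obj D"
  shows Zo_obj [simp]: "Zo M \<in> Obj D" and uni_nat: "ntr M (UnitO D) (Zo M) (uni M)"
    and uni_factor: "W \<in> Obj D \<Longrightarrow> ntr M (UnitO D) W \<tau> \<Longrightarrow>
       (\<exists>w. arr D w \<and> src w = Zo M \<and> tgt w = W \<and> (\<forall>X\<in>Obj C. \<tau> X = (\<iota> (Fo X) \<otimes>\<^sub>a w) \<star> uni M X))"
    and uni_unique: "arr D w \<Longrightarrow> arr D w' \<Longrightarrow> src w = Zo M \<Longrightarrow> src w' = Zo M \<Longrightarrow> tgt w = tgt w' \<Longrightarrow>
       (\<And>X. X \<in> Obj C \<Longrightarrow> (\<iota> (Fo X) \<otimes>\<^sub>a w) \<star> uni M X = (\<iota> (Fo X) \<otimes>\<^sub>a w') \<star> uni M X) \<Longrightarrow> w = w'"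
proof -
  let ?P = "\<lambda>(Z, u). Z \<in> Obj D \<and> ntr M (UnitO D) Z u \<and>
    (\<forall>W\<in>Obj D. \<forall>\<tau>. ntr M (UnitO D) W \<tau> \<longrightarrow>
       (\<exists>w. arr D w \<and> src w = Z \<and> tgt w = W \<and> (\<forall>X\<in>Obj C. \<tau> X = (\<iota> (Fo X) \<otimes>\<^sub>a w) \<star> u X))) \<and>
    (\<forall>w w'. arr D w \<longrightarrow> arr D w' \<longrightarrow> src w = Z \<longrightarrow> src w' = Z \<longrightarrow> tgt w = tgt w' \<longrightarrow>
       (\<forall>X\<in>Obj C. (\<iota> (Fo X) \<otimes>\<^sub>a w) \<star> u X = (\<iota> (Fo X) \<otimes>\<^sub>a w') \<star> u X) \<longrightarrow> w = w')"
  obtain Z u where "?P (Z, u)" using ex_universal[OF M] by auto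
  hence "?P (univ M)" unfolding univ_def by (rule someI)
  hence *: "?P (Zo M, uni M)" by (simp add: Zo_def uni_def split_beta)
  show "Zo M \<in> Obj D" "ntr M (UnitO D) (Zo M) (uni M)" using * by simp_all
  show "W \<in> Obj D \<Longrightarrow> ntr M (UnitO D) W \<tau> \<Longrightarrow>
       (\<exists>w. arr D w \<and> src w = Zo M \<and> tgt w = W \<and> (\<forall>X\<in>Obj C. \<tau> X = (\<iota> (Fo X) \<otimes>\<^sub>a w) \<star> uni M X))"
    using * by simp
  show "arr D w \<Longrightarrow> arr D w' \<Longrightarrow> src w = Zo M \<Longrightarrow> src w' = Zo M \<Longrightarrow> tgt w = tgt w' \<Longrightarrow>
       (\<And>X. X \<in> Obj C \<Longrightarrow> (\<iota> (Fo X) \<otimes>\<^sub>a w) \<star> uni M X = (\<iota> (Fo X) \<otimes>\<^sub>a w') \<star> uni M X) \<Longrightarrow> w = w'"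
    using * by simp
qed

lemma uni_simps [simp]:
  assumes "M \<in> Obj D" "X \<in> Obj C"
  shows "arr D (uni M X)" "src (uni M X) = M \<otimes>\<^sub>o Fo X" "tgt (uni M X) = Fo X \<otimes>\<^sub>o Zo M"
  using ntrD[OF uni_nat[OF assms(1)] Zo_obj[OF assms(1)] assms(2)] assms by simp_all

lemma uni_natural:
  assumes "M \<in> Obj D" "arr C f"
  shows "(Fm f \<otimes>\<^sub>a \<iota> (Zo M)) \<star> uni M (src f) = uni M (tgt f) \<star> (\<iota> M \<otimes>\<^sub>a Fm f)"
  using ntrD'[OF uni_nat[OF assms(1)] Zo_obj[OF assms(1)] assms(2)] assms by simp

text \<open>The additional tensor factor \<open>A\<close> is moved to the other side by duality.\<close>

lemma uni_factor_tns:
  assumes M: "M \<in> Obj D" and A: "A \<in> Obj D" and B: "B \<in> Obj D" and \<tau>: "ntr M A B \<tau>"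
  shows "\<exists>w. arr D w \<and> src w = Zo M \<otimes>\<^sub>o A \<and> tgt w = B \<and> (\<forall>X\<in>Obj C. \<tau> X = (\<iota> (Fo X) \<otimes>\<^sub>a w) \<star> (uni M X \<otimes>\<^sub>a \<iota> A))"
proof -
  obtain A' ev coev where d: "dual D A' A ev coev" using D.ex_dual(2)[OF A] by blast
  interpret d: dual_objects D A' A ev coev by unfold_locales (rule d)
  note [simp] = M A B and n = ntrD[OF \<tau> B]
  define \<sigma> where "\<sigma> X = d.curr (M \<otimes>\<^sub>o Fo X) (\<tau> X)" for X
  have \<sigma>a: "arr D (\<sigma> X)" "src (\<sigma> X) = M \<otimes>\<^sub>o Fo X" "tgt (\<sigma> X) = Fo X \<otimes>\<^sub>o B \<otimes>\<^sub>o A'" if "X \<in> Obj C" for X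
    using that n by (simp_all add: \<sigma>_def d.curr_arr)
  have "ntr M (UnitO D) (B \<otimes>\<^sub>o A') \<sigma>"
  proof (rule ntrI)
    fix f assume f: "arr C f"
    have "(Fm f \<otimes>\<^sub>a \<iota> (B \<otimes>\<^sub>o A')) \<star> \<sigma> (src f) = ((Fm f \<otimes>\<^sub>a \<iota> B) \<otimes>\<^sub>a \<iota> A') \<star> \<sigma> (src f)" using f by simp
    also have "\<dots> = d.curr (M \<otimes>\<^sub>o Fo (src f)) ((Fm f \<otimes>\<^sub>a \<iota> B) \<star> \<tau> (src f))"
      unfolding \<sigma>_def using f n by (intro d.curr_cmp_left[symmetric]) simp_all
    also have "(Fm f \<otimes>\<^sub>a \<iota> B) \<star> \<tau> (src f) = \<tau> (tgt f) \<star> ((\<iota> M \<otimes>\<^sub>a Fm f) \<otimes>\<^sub>a \<iota> A)"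
      using ntrD'[OF \<tau> B f] f by simp
    also have "d.curr (M \<otimes>\<^sub>o Fo (src f)) \<dots> = \<sigma> (tgt f) \<star> (\<iota> M \<otimes>\<^sub>a Fm f)"
      unfolding \<sigma>_def using f n by (intro d.curr_cmp_right) simp_all
    finally show "(Fm f \<otimes>\<^sub>a \<iota> (B \<otimes>\<^sub>o A')) \<star> \<sigma> (src f) = \<sigma> (tgt f) \<star> (\<iota> M \<otimes>\<^sub>a Fm f \<otimes>\<^sub>a \<iota> (UnitO D))"
      using f by simp
  qed (use \<sigma>a in simp_all)
  then obtain w0 where w0: "arr D w0" "src w0 = Zo M" "tgt w0 = B \<otimes>\<^sub>o A'"
    and fac: "\<And>X. X \<in> Obj C \<Longrightarrow> \<sigma> X = (\<iota> (Fo X) \<otimes>\<^sub>a w0) \<star> uni M X"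
    using uni_factor[of M "B \<otimes>\<^sub>o A'" \<sigma>] by auto
  let ?w = "d.uncurr B w0"
  have "\<tau> X = (\<iota> (Fo X) \<otimes>\<^sub>a ?w) \<star> (uni M X \<otimes>\<^sub>a \<iota> A)" if X: "X \<in> Obj C" for X
  proof -
    have "\<tau> X = d.uncurr (Fo X \<otimes>\<^sub>o B) (\<sigma> X)"
      unfolding \<sigma>_def using X n by (intro d.uncurr_curr[symmetric]) simp_all
    also have "\<dots> = (\<iota> (Fo X) \<otimes>\<^sub>a ?w) \<star> (uni M X \<otimes>\<^sub>a \<iota> A)"
      using X w0 by (simp add: fac d.uncurr_def D.tns_cmp_left D.tns_cmp_right)
    finally show ?thesis .
  qed
  thus ?thesis using w0 by (intro exI[of _ ?w]) (simp add: d.uncurr_arr)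
qed

lemma uni_unique_tns:
  assumes M: "M \<in> Obj D" and A: "A \<in> Obj D" and w: "arr D w" "arr D w'" "src w = Zo M \<otimes>\<^sub>o A" "src w' = Zo M \<otimes>\<^sub>o A" "tgt w = tgt w'"
    and eq: "\<And>X. X \<in> Obj C \<Longrightarrow> (\<iota> (Fo X) \<otimes>\<^sub>a w) \<star> (uni M X \<otimes>\<^sub>a \<iota> A) = (\<iota> (Fo X) \<otimes>\<^sub>a w') \<star> (uni M X \<otimes>\<^sub>a \<iota> A)"
  shows "w = w'"
proof -
  obtain A' ev coev where d: "dual D A' A ev coev" using D.ex_dual(2)[OF A] by blast
  interpret d: dual_objects D A' A ev coev by unfold_locales (rule d)
  note [simp] = M A
  have *: "(\<iota> (Fo X) \<otimes>\<^sub>a d.curr (Zo M) v) \<star> uni M X = d.curr (M \<otimes>\<^sub>o Fo X) ((\<iota> (Fo X) \<otimes>\<^sub>a v) \<star> (uni M X \<otimes>\<^sub>a \<iota> A))"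
    if v: "arr D v" "src v = Zo M \<otimes>\<^sub>o A" and X: "X \<in> Obj C" for X v
  proof -
    have "d.curr (M \<otimes>\<^sub>o Fo X) ((\<iota> (Fo X) \<otimes>\<^sub>a v) \<star> (uni M X \<otimes>\<^sub>a \<iota> A)) = d.curr (Fo X \<otimes>\<^sub>o Zo M) (\<iota> (Fo X) \<otimes>\<^sub>a v) \<star> uni M X"
      using X v by (intro d.curr_cmp_right) simp_all
    also have "d.curr (Fo X \<otimes>\<^sub>o Zo M) (\<iota> (Fo X) \<otimes>\<^sub>a v) = \<iota> (Fo X) \<otimes>\<^sub>a d.curr (Zo M) v"
      using X v by (simp add: d.curr_def D.tns_cmp_left)
    finally show ?thesis by simp
  qed
  have "d.curr (Zo M) w = d.curr (Zo M) w'"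
    by (rule uni_unique[OF M]) (use w in \<open>simp_all add: d.curr_arr * eq\<close>)
  thus ?thesis by (rule d.curr_inj) (use w in simp_all)
qed

end

section \<open>Half-braidings\<close>

context tensor_functor
begin

text \<open>Invertibility of the components is traded for the value at the unit. For the objects
  constructed below that value is easy to compute, while an inverse is not at hand;
  \<open>hb_iso\<close> and \<open>obj_hb\<close> show that the two descriptions agree.\<close>

definition hb :: "'p \<Rightarrow> ('o \<Rightarrow> 'p \<times> 'n \<times> 'p) \<Rightarrow> bool" where
  "hb V r \<longleftrightarrow> V \<in> Obj D \<and>
     (\<forall>X\<in>Obj C. arr D (r X) \<and> src (r X) = V \<otimes>\<^sub>o Fo X \<and> tgt (r X) = Fo X \<otimes>\<^sub>o V) \<and>
     (\<forall>f. arr C f \<longrightarrow> (Fm f \<otimes>\<^sub>a \<iota> V) \<star> r (src f) = r (tgt f) \<star> (\<iota> V \<otimes>\<^sub>a Fm f)) \<and>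
     (\<forall>X\<in>Obj C. \<forall>Y\<in>Obj C. r (X \<otimes>\<^sub>o\<^bsub>C\<^esub> Y) = (\<iota> (Fo X) \<otimes>\<^sub>a r Y) \<star> (r X \<otimes>\<^sub>a \<iota> (Fo Y))) \<and>
     r (UnitO C) = \<iota> V"

lemma hbD:
  assumes "hb V r"
  shows "V \<in> Obj D" "X \<in> Obj C \<Longrightarrow> arr D (r X)" "X \<in> Obj C \<Longrightarrow> src (r X) = V \<otimes>\<^sub>o Fo X"
    "X \<in> Obj C \<Longrightarrow> tgt (r X) = Fo X \<otimes>\<^sub>o V"
    "r (UnitO C) = \<iota> V"
  using assms by (simp_all add: hb_def)

lemma hb_natural: "hb V r \<Longrightarrow> arr C f \<Longrightarrow> src f = X \<Longrightarrow> tgt f = Y \<Longrightarrow> (Fm f \<otimes>\<^sub>a \<iota> V) \<star> r X = r Y \<star> (\<iota> V \<otimes>\<^sub>a Fm f)"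
  by (auto simp: hb_def)

lemma hb_mult: "hb V r \<Longrightarrow> X \<in> Obj C \<Longrightarrow> Y \<in> Obj C \<Longrightarrow>
    r (X \<otimes>\<^sub>o\<^bsub>C\<^esub> Y) = (\<iota> (Fo X) \<otimes>\<^sub>a r Y) \<star> (r X \<otimes>\<^sub>a \<iota> (Fo Y))"
  by (simp add: hb_def)

lemma hbI:
  assumes "V \<in> Obj D" "\<And>X. X \<in> Obj C \<Longrightarrow> arr D (r X)" "\<And>X. X \<in> Obj C \<Longrightarrow> src (r X) = V \<otimes>\<^sub>o Fo X"
    "\<And>X. X \<in> Obj C \<Longrightarrow> tgt (r X) = Fo X \<otimes>\<^sub>o V"
    "\<And>f. arr C f \<Longrightarrow> (Fm f \<otimes>\<^sub>a \<iota> V) \<star> r (src f) = r (tgt f) \<star> (\<iota> V \<otimes>\<^sub>a Fm f)"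
    "\<And>X Y. X \<in> Obj C \<Longrightarrow> Y \<in> Obj C \<Longrightarrow> r (X \<otimes>\<^sub>o\<^bsub>C\<^esub> Y) = (\<iota> (Fo X) \<otimes>\<^sub>a r Y) \<star> (r X \<otimes>\<^sub>a \<iota> (Fo Y))"
    "r (UnitO C) = \<iota> V"
  shows "hb V r"
  using assms by (simp add: hb_def)

text \<open>Invertibility is automatic, since the objects of \<open>C\<close> have duals.\<close>

lemma hb_iso:
  assumes r: "hb V r" and X: "X \<in> Obj C"
  shows "\<exists>s. arr D s \<and> src s = Fo X \<otimes>\<^sub>o V \<and> tgt s = V \<otimes>\<^sub>o Fo X \<and>
    s \<star> r X = \<iota> (V \<otimes>\<^sub>o Fo X) \<and> r X \<star> s = \<iota> (Fo X \<otimes>\<^sub>o V)"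
proof -
  obtain X' ev coev where d: "dual C X X' ev coev" using C.ex_dual(1)[OF X] by blast
  interpret d: dual_objects C X X' ev coev by unfold_locales (rule d)
  have e: "dual D (Fo X) (Fo X') (Fm ev) (Fm coev)"
    using arg_cong[OF d.zigzag1, of Fm] arg_cong[OF d.zigzag2, of Fm] by (simp add: dual_def)
  interpret e: dual_objects D "Fo X" "Fo X'" "Fm ev" "Fm coev" by unfold_locales (rule e)
  note [simp] = hbD[OF r]
  let ?x = "Fo X" and ?x' = "Fo X'"
  \<comment> \<open>The candidate inverse is the half-braiding at the dual X', rotated by evaluation
    and coevaluation: create X' \<otimes> X on the right, braid V past X', and cancel X against X'
    on the left.\<close>
  define s where "s = (Fm ev \<otimes>\<^sub>a \<iota> (V \<otimes>\<^sub>o ?x)) \<star> (\<iota> ?x \<otimes>\<^sub>a r X' \<otimes>\<^sub>a \<iota> ?x) \<star> (\<iota> (?x \<otimes>\<^sub>o V) \<otimes>\<^sub>a Fm coev)"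
  have s: "arr D s" "src s = ?x \<otimes>\<^sub>o V" "tgt s = V \<otimes>\<^sub>o ?x" by (simp_all add: s_def)
  have "s \<star> r X = (Fm ev \<otimes>\<^sub>a \<iota> (V \<otimes>\<^sub>o ?x)) \<star> ((\<iota> ?x \<otimes>\<^sub>a r X' \<otimes>\<^sub>a \<iota> ?x) \<star> ((\<iota> (?x \<otimes>\<^sub>o V) \<otimes>\<^sub>a Fm coev) \<star> (r X \<otimes>\<^sub>a \<iota> (UnitO D))))"
    by (simp add: s_def)
  also have "(\<iota> (?x \<otimes>\<^sub>o V) \<otimes>\<^sub>a Fm coev) \<star> (r X \<otimes>\<^sub>a \<iota> (UnitO D)) = (r X \<otimes>\<^sub>a \<iota> (?x' \<otimes>\<^sub>o ?x)) \<star> (\<iota> (V \<otimes>\<^sub>o ?x) \<otimes>\<^sub>a Fm coev)"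
    by (simp only: D.tns_split2[symmetric] D.tns_split1[symmetric] e.dual_simps hbD[OF r] X)
  also have "(\<iota> ?x \<otimes>\<^sub>a r X' \<otimes>\<^sub>a \<iota> ?x) \<star> ((r X \<otimes>\<^sub>a \<iota> (?x' \<otimes>\<^sub>o ?x)) \<star> (\<iota> (V \<otimes>\<^sub>o ?x) \<otimes>\<^sub>a Fm coev))
      = (r (X \<otimes>\<^sub>o\<^bsub>C\<^esub> X') \<otimes>\<^sub>a \<iota> ?x) \<star> (\<iota> (V \<otimes>\<^sub>o ?x) \<otimes>\<^sub>a Fm coev)"
    by (simp add: hb_mult[OF r] D.tns_cmp_right)
  also have "(Fm ev \<otimes>\<^sub>a \<iota> (V \<otimes>\<^sub>o ?x)) \<star> \<dots> = (((Fm ev \<otimes>\<^sub>a \<iota> V) \<star> r (X \<otimes>\<^sub>o\<^bsub>C\<^esub> X')) \<otimes>\<^sub>a \<iota> ?x) \<star> (\<iota> (V \<otimes>\<^sub>o ?x) \<otimes>\<^sub>a Fm coev)"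
    by (simp add: D.tns_cmp_right)
  \<comment> \<open>Here the value at the unit enters: naturality along ev : X \<otimes> X' -> 1
    replaces the half-braiding at X \<otimes> X' by the identity of V.\<close>
  also have "(Fm ev \<otimes>\<^sub>a \<iota> V) \<star> r (X \<otimes>\<^sub>o\<^bsub>C\<^esub> X') = \<iota> V \<otimes>\<^sub>a Fm ev"
    using hb_natural[OF r, of ev "X \<otimes>\<^sub>o\<^bsub>C\<^esub> X'" "UnitO C"] by simp
  also have "((\<iota> V \<otimes>\<^sub>a Fm ev) \<otimes>\<^sub>a \<iota> ?x) \<star> (\<iota> (V \<otimes>\<^sub>o ?x) \<otimes>\<^sub>a Fm coev) = \<iota> (V \<otimes>\<^sub>o ?x)"
    using e.zigzag2_tns[of V "UnitO D"] by simp
  finally have 1: "s \<star> r X = \<iota> (V \<otimes>\<^sub>o ?x)" .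
  have "r X \<star> s = ((\<iota> (UnitO D) \<otimes>\<^sub>a r X) \<star> (Fm ev \<otimes>\<^sub>a \<iota> (V \<otimes>\<^sub>o ?x))) \<star> ((\<iota> ?x \<otimes>\<^sub>a r X' \<otimes>\<^sub>a \<iota> ?x) \<star> (\<iota> (?x \<otimes>\<^sub>o V) \<otimes>\<^sub>a Fm coev))"
    by (simp add: s_def)
  also have "(\<iota> (UnitO D) \<otimes>\<^sub>a r X) \<star> (Fm ev \<otimes>\<^sub>a \<iota> (V \<otimes>\<^sub>o ?x)) = (Fm ev \<otimes>\<^sub>a \<iota> (?x \<otimes>\<^sub>o V)) \<star> (\<iota> (?x \<otimes>\<^sub>o ?x') \<otimes>\<^sub>a r X)"
    by (simp only: D.tns_split2[symmetric] D.tns_split1[symmetric] e.dual_simps hbD[OF r] X)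
  also have "\<dots> \<star> ((\<iota> ?x \<otimes>\<^sub>a r X' \<otimes>\<^sub>a \<iota> ?x) \<star> (\<iota> (?x \<otimes>\<^sub>o V) \<otimes>\<^sub>a Fm coev))
      = (Fm ev \<otimes>\<^sub>a \<iota> (?x \<otimes>\<^sub>o V)) \<star> (\<iota> ?x \<otimes>\<^sub>a (r (X' \<otimes>\<^sub>o\<^bsub>C\<^esub> X) \<star> (\<iota> V \<otimes>\<^sub>a Fm coev)))"
    by (simp add: hb_mult[OF r] D.tns_cmp_left)
  also have "r (X' \<otimes>\<^sub>o\<^bsub>C\<^esub> X) \<star> (\<iota> V \<otimes>\<^sub>a Fm coev) = Fm coev \<otimes>\<^sub>a \<iota> V"
    using hb_natural[OF r, of coev "UnitO C" "X' \<otimes>\<^sub>o\<^bsub>C\<^esub> X"] by simp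
  also have "(Fm ev \<otimes>\<^sub>a \<iota> (?x \<otimes>\<^sub>o V)) \<star> (\<iota> ?x \<otimes>\<^sub>a (Fm coev \<otimes>\<^sub>a \<iota> V)) = \<iota> (?x \<otimes>\<^sub>o V)"
    using e.zigzag2_tns[of "UnitO D" V] by simp
  finally have 2: "r X \<star> s = \<iota> (?x \<otimes>\<^sub>o V)" .
  show ?thesis using s 1 2 by blast
qed

section \<open>The centralizer in terms of arrows with endpoints\<close>

abbreviation "ZF \<equiv> centralizer C D F"

definition br :: "'p \<times> ('o \<Rightarrow> 'n) \<Rightarrow> 'o \<Rightarrow> 'p \<times> 'n \<times> 'p" where
  "br V X = mk (fst V \<otimes>\<^sub>o Fo X) (snd V X) (Fo X \<otimes>\<^sub>o fst V)"

definition zob :: "'p \<Rightarrow> ('o \<Rightarrow> 'p \<times> 'n \<times> 'p) \<Rightarrow> 'p \<times> ('o \<Rightarrow> 'n)" where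
  "zob V r = (V, \<lambda>X\<in>Obj C. und (r X))"

lemma fst_zob [simp]: "fst (zob V r) = V" by (simp add: zob_def)

lemma br_zob: "hb V r \<Longrightarrow> X \<in> Obj C \<Longrightarrow> br (zob V r) X = r X"
  using hbD(2-4)[of V r X] by (simp add: br_def zob_def mk_und')

lemma zob_obj:
  assumes r: "hb V r" shows "zob V r \<in> Obj ZF"
proof -
  note h = hbD[OF r]
  have "isomorphism D (V \<otimes>\<^sub>o Fo X) (Fo X \<otimes>\<^sub>o V) (und (r X))" if X: "X \<in> Obj C" for X
  proof -
    obtain s where s: "arr D s" "src s = Fo X \<otimes>\<^sub>o V" "tgt s = V \<otimes>\<^sub>o Fo X"
      "s \<star> r X = \<iota> (V \<otimes>\<^sub>o Fo X)" "r X \<star> s = \<iota> (Fo X \<otimes>\<^sub>o V)" using hb_iso[OF r X] by blast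
    have "und s \<cdot> und (r X) = Ident D (V \<otimes>\<^sub>o Fo X)" "und (r X) \<cdot> und s = Ident D (Fo X \<otimes>\<^sub>o V)"
      using s(4,5) by (simp_all add: cmp_def idt_def)
    thus ?thesis
      unfolding isomorphism_def using arr_und[OF h(2)[OF X] h(3)[OF X] h(4)[OF X]] arr_und[OF s(1-3)] by blast
  qed
  moreover have "(arr_map F X Y f \<otimes>\<^sub>m Ident D V) \<cdot> und (r X) = und (r Y) \<cdot> (Ident D V \<otimes>\<^sub>m arr_map F X Y f)"
    if X: "X \<in> Obj C" and Y: "Y \<in> Obj C" and f: "f \<in> Mor C X Y" for X Y f
    using arg_cong[OF hb_natural[OF r, of "mk X f Y" X Y], of und] X Y f by (simp add: cmp_def tns_def fm_def idt_def)
  moreover have "und (r (X \<otimes>\<^sub>o\<^bsub>C\<^esub> Y)) = (Ident D (Fo X) \<otimes>\<^sub>m und (r Y)) \<cdot> (und (r X) \<otimes>\<^sub>m Ident D (Fo Y))"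
    if X: "X \<in> Obj C" and Y: "Y \<in> Obj C" for X Y
    using arg_cong[OF hb_mult[OF r X Y], of und] by (simp add: cmp_def tns_def idt_def)
  ultimately show ?thesis
    using h(1) by (simp add: centralizer_def zob_def half_braiding_def)
qed

lemma obj_hb:
  assumes V: "V \<in> Obj ZF" shows "hb (fst V) (br V)"
proof -
  obtain v \<rho> where V': "V = (v, \<rho>)" by (cases V)
  have hb: "half_braiding C D F v \<rho>" and v: "v \<in> Obj D" using V V' by (auto simp: centralizer_def)
  have iso: "\<And>X. X \<in> Obj C \<Longrightarrow> isomorphism D (v \<otimes>\<^sub>o Fo X) (Fo X \<otimes>\<^sub>o v) (\<rho> X)"
    and nat: "\<And>X Y f. X \<in> Obj C \<Longrightarrow> Y \<in> Obj C \<Longrightarrow> f \<in> Mor C X Y \<Longrightarrow>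
        (arr_map F X Y f \<otimes>\<^sub>m Ident D v) \<cdot> \<rho> X = \<rho> Y \<cdot> (Ident D v \<otimes>\<^sub>m arr_map F X Y f)"
    and mult: "\<And>X Y. X \<in> Obj C \<Longrightarrow> Y \<in> Obj C \<Longrightarrow>
        \<rho> (X \<otimes>\<^sub>o\<^bsub>C\<^esub> Y) = (Ident D (Fo X) \<otimes>\<^sub>m \<rho> Y) \<cdot> (\<rho> X \<otimes>\<^sub>m Ident D (Fo Y))"
    using hb by (simp_all add: half_braiding_def)
  have b: "br V = (\<lambda>X. mk (v \<otimes>\<^sub>o Fo X) (\<rho> X) (Fo X \<otimes>\<^sub>o v))" by (simp add: V' br_def fun_eq_iff)
  have fv: "fst V = v" by (simp add: V')
  have arr: "arr D (br V X)" if "X \<in> Obj C" for X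
    using iso[OF that] v that by (simp add: b isomorphism_def)
  show ?thesis
  proof (rule hbI)
    show "fst V \<in> Obj D" using V' v by simp
    show "arr D (br V X)" "src (br V X) = fst V \<otimes>\<^sub>o Fo X" "tgt (br V X) = Fo X \<otimes>\<^sub>o fst V" if "X \<in> Obj C" for X
      using arr[OF that] by (simp_all add: br_def)
    show "(Fm f \<otimes>\<^sub>a \<iota> (fst V)) \<star> br V (src f) = br V (tgt f) \<star> (\<iota> (fst V) \<otimes>\<^sub>a Fm f)" if f: "arr C f" for f
      using nat[of "src f" "tgt f" "und f"] f fv by (simp add: b cmp_def tns_def fm_def idt_def arr_und)
    show m: "br V (X \<otimes>\<^sub>o\<^bsub>C\<^esub> Y) = (\<iota> (Fo X) \<otimes>\<^sub>a br V Y) \<star> (br V X \<otimes>\<^sub>a \<iota> (Fo Y))"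
      if "X \<in> Obj C" "Y \<in> Obj C" for X Y
      using mult[OF that] v that by (simp add: b cmp_def tns_def idt_def)
    let ?r = "br V (UnitO C)"
    have ra: "arr D ?r" "src ?r = v" "tgt ?r = v" using arr[of "UnitO C"] v by (simp_all add: b)
    \<comment> \<open>Multiplicativity at 1 \<otimes> 1 = 1 makes the component at the unit
      idempotent, and an invertible idempotent is the identity.\<close>
    have "?r = ?r \<star> ?r" using m[of "UnitO C" "UnitO C"] ra by simp
    obtain g where g: "g \<in> Mor D v v" "g \<cdot> \<rho> (UnitO C) = Ident D v"
      using iso[of "UnitO C"] v by (auto simp: isomorphism_def)
    hence gr: "mk v g v \<star> ?r = \<iota> v" "arr D (mk v g v)" using v by (simp_all add: b cmp_def idt_def)
    have "mk v g v \<star> (?r \<star> ?r) = ?r" using D.cmp_assoc_eq[OF gr(1) ra(1) gr(2) ra(1)] ra by simp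
    thus "br V (UnitO C) = \<iota> (fst V)" using \<open>?r = ?r \<star> ?r\<close> gr V' by simp
  qed
qed

definition zmor :: "'p \<times> ('o \<Rightarrow> 'n) \<Rightarrow> 'p \<times> ('o \<Rightarrow> 'n) \<Rightarrow> 'p \<times> 'n \<times> 'p \<Rightarrow> bool" where
  "zmor V W f \<longleftrightarrow> arr D f \<and> src f = fst V \<and> tgt f = fst W \<and>
     (\<forall>X\<in>Obj C. (\<iota> (Fo X) \<otimes>\<^sub>a f) \<star> br V X = br W X \<star> (f \<otimes>\<^sub>a \<iota> (Fo X)))"

lemma zmorD:
  assumes "zmor V W f" shows "arr D f" "src f = fst V" "tgt f = fst W"
    "X \<in> Obj C \<Longrightarrow> (\<iota> (Fo X) \<otimes>\<^sub>a f) \<star> br V X = br W X \<star> (f \<otimes>\<^sub>a \<iota> (Fo X))"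
  using assms by (simp_all add: zmor_def)

lemma zmorI:
  assumes "arr D f" "src f = fst V" "tgt f = fst W"
    "\<And>X. X \<in> Obj C \<Longrightarrow> (\<iota> (Fo X) \<otimes>\<^sub>a f) \<star> br V X = br W X \<star> (f \<otimes>\<^sub>a \<iota> (Fo X))"
  shows "zmor V W f"
  using assms by (simp add: zmor_def)

lemma Obj_fst [simp]: "V \<in> Obj ZF \<Longrightarrow> fst V \<in> Obj D"
  by (auto simp: centralizer_def)

lemma br_simps [simp]:
  assumes "V \<in> Obj ZF" "X \<in> Obj C"
  shows "arr D (br V X)" "src (br V X) = fst V \<otimes>\<^sub>o Fo X" "tgt (br V X) = Fo X \<otimes>\<^sub>o fst V"
  using hbD(2-4)[OF obj_hb[OF assms(1)] assms(2)] .

lemma br_unit [simp]: "V \<in> Obj ZF \<Longrightarrow> br V (UnitO C) = \<iota> (fst V)"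
  using hbD(5)[OF obj_hb] .

lemmas br_natural = hb_natural[OF obj_hb]
lemmas br_mult = hb_mult[OF obj_hb]

lemma Mor_ZF:
  assumes "V \<in> Obj ZF" "W \<in> Obj ZF"
  shows "g \<in> Mor ZF V W \<longleftrightarrow> zmor V W (mk (fst V) g (fst W))"
proof -
  obtain v \<rho> w \<sigma> where VW: "V = (v, \<rho>)" "W = (w, \<sigma>)" by (cases V, cases W)
  show ?thesis using assms Obj_fst[OF assms(1)] Obj_fst[OF assms(2)]
    by (auto simp: VW centralizer_def zmor_def br_def cmp_def tns_def idt_def)
qed

lemma Mor_ZF_und: "V \<in> Obj ZF \<Longrightarrow> W \<in> Obj ZF \<Longrightarrow> zmor V W f \<Longrightarrow> und f \<in> Mor ZF V W"
  by (simp add: Mor_ZF zmorD mk_und')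

lemma HomV_ZF:
  "add (HomV ZF V W) = add (HomV D (fst V) (fst W))" "zero (HomV ZF V W) = zero (HomV D (fst V) (fst W))"
  "smult (HomV ZF V W) = smult (HomV D (fst V) (fst W))"
  by (cases V, cases W, simp add: centralizer_def)+

lemma Comp_ZF: "g \<cdot>\<^bsub>ZF\<^esub> f = g \<cdot> f" by (simp add: centralizer_def)

lemma zmor_cmp:
  assumes f: "zmor U V f" and g: "zmor V W g" and "U \<in> Obj ZF" "V \<in> Obj ZF" "W \<in> Obj ZF"
  shows "zmor U W (g \<star> f)"
proof (rule zmorI)
  note f' = zmorD[OF f] and g' = zmorD[OF g]
  note [simp] = assms(3-5) f'(1-3) g'(1-3)
  show "arr D (g \<star> f)" "src (g \<star> f) = fst U" "tgt (g \<star> f) = fst W" by simp_all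
  fix X assume X: "X \<in> Obj C"
  have "(\<iota> (Fo X) \<otimes>\<^sub>a (g \<star> f)) \<star> br U X = (\<iota> (Fo X) \<otimes>\<^sub>a g) \<star> ((\<iota> (Fo X) \<otimes>\<^sub>a f) \<star> br U X)"
    using X by (simp add: D.tns_cmp_left)
  also have "\<dots> = ((\<iota> (Fo X) \<otimes>\<^sub>a g) \<star> br V X) \<star> (f \<otimes>\<^sub>a \<iota> (Fo X))"
    using X by (simp add: f'(4))
  also have "\<dots> = br W X \<star> ((g \<star> f) \<otimes>\<^sub>a \<iota> (Fo X))"
    using X by (simp add: g'(4) D.tns_cmp_right)
  finally show "(\<iota> (Fo X) \<otimes>\<^sub>a (g \<star> f)) \<star> br U X = br W X \<star> ((g \<star> f) \<otimes>\<^sub>a \<iota> (Fo X))" .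
qed

lemma zmor_idt: "V \<in> Obj ZF \<Longrightarrow> zmor V V (\<iota> (fst V))"
  by (rule zmorI) simp_all

lemma zmor_zr: "V \<in> Obj ZF \<Longrightarrow> W \<in> Obj ZF \<Longrightarrow> zmor V W (zr D (fst V) (fst W))"
  by (rule zmorI) simp_all

lemma zmor_pls: "V \<in> Obj ZF \<Longrightarrow> W \<in> Obj ZF \<Longrightarrow> zmor V W f \<Longrightarrow> zmor V W g \<Longrightarrow> zmor V W (f \<boxplus> g)"
  using zmorD[of V W f] zmorD[of V W g]
  by (intro zmorI) (simp_all add: D.tns_pls_left D.tns_pls_right D.cmp_pls_left D.cmp_pls_right)

lemma zmor_scl: "V \<in> Obj ZF \<Longrightarrow> W \<in> Obj ZF \<Longrightarrow> zmor V W f \<Longrightarrow> zmor V W (c \<boxdot> f)"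
  using zmorD[of V W f] by (intro zmorI) simp_all

text \<open>Kernels and cokernels of allowable morphisms are split idempotents of \<open>D\<close>.\<close>

context
  fixes V K k q
  assumes V: "V \<in> Obj ZF" and k: "arr D k" "src k = K" "tgt k = fst V"
    and q: "arr D q" "src q = fst V" "tgt q = K" and qk: "q \<star> k = \<iota> K"
begin

text \<open>The half-braiding of V compressed to its retract K. It is always natural and equal to
  the identity at the unit; multiplicativity follows once k (for a subobject) or q (for a quotient)
  commutes with the braidings.\<close>

definition induced_br where "induced_br X = (\<iota> (Fo X) \<otimes>\<^sub>a q) \<star> br V X \<star> (k \<otimes>\<^sub>a \<iota> (Fo X))"

lemma K_obj: "K \<in> Obj D" using k by auto

lemmas induced_br_simps = V k q K_obj

lemma induced_br_arr: "X \<in> Obj C \<Longrightarrow> arr D (induced_br X)" "X \<in> Obj C \<Longrightarrow> src (induced_br X) = K \<otimes>\<^sub>o Fo X"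
    "X \<in> Obj C \<Longrightarrow> tgt (induced_br X) = Fo X \<otimes>\<^sub>o K"
  by (simp_all add: induced_br_def induced_br_simps)

lemma induced_br_natural:
  assumes f: "arr C f"
  shows "(Fm f \<otimes>\<^sub>a \<iota> K) \<star> induced_br (src f) = induced_br (tgt f) \<star> (\<iota> K \<otimes>\<^sub>a Fm f)"
proof -
  have "(Fm f \<otimes>\<^sub>a \<iota> K) \<star> induced_br (src f) = (\<iota> (Fo (tgt f)) \<otimes>\<^sub>a q) \<star> ((Fm f \<otimes>\<^sub>a \<iota> (fst V)) \<star> (br V (src f) \<star> (k \<otimes>\<^sub>a \<iota> (Fo (src f)))))"
    using f by (simp add: induced_br_def induced_br_simps D.interchange')
  also have "(Fm f \<otimes>\<^sub>a \<iota> (fst V)) \<star> (br V (src f) \<star> (k \<otimes>\<^sub>a \<iota> (Fo (src f)))) = ((Fm f \<otimes>\<^sub>a \<iota> (fst V)) \<star> br V (src f)) \<star> (k \<otimes>\<^sub>a \<iota> (Fo (src f)))"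
    using f by (simp add: induced_br_simps)
  also have "\<dots> = br V (tgt f) \<star> ((\<iota> (fst V) \<otimes>\<^sub>a Fm f) \<star> (k \<otimes>\<^sub>a \<iota> (Fo (src f))))"
    using f by (simp add: induced_br_simps br_natural[OF V])
  also have "(\<iota> (fst V) \<otimes>\<^sub>a Fm f) \<star> (k \<otimes>\<^sub>a \<iota> (Fo (src f))) = (k \<otimes>\<^sub>a \<iota> (Fo (tgt f))) \<star> (\<iota> K \<otimes>\<^sub>a Fm f)"
    using f by (simp add: induced_br_simps D.interchange)
  finally show ?thesis using f by (simp add: induced_br_def induced_br_simps)
qed

lemma induced_br_unit: "induced_br (UnitO C) = \<iota> K"
  by (simp add: induced_br_def induced_br_simps qk)

text \<open>The split monomorphism k can be cancelled, and after composing with it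
  \<open>inv\<close> turns both sides of multiplicativity into the same equation for V.\<close>

lemma hb_sub:
  assumes inv: "\<And>X. X \<in> Obj C \<Longrightarrow> (\<iota> (Fo X) \<otimes>\<^sub>a k) \<star> induced_br X = br V X \<star> (k \<otimes>\<^sub>a \<iota> (Fo X))"
  shows "zob K induced_br \<in> Obj ZF" "zmor (zob K induced_br) V k"
proof -
  have h: "hb K induced_br"
  proof (rule hbI[OF K_obj induced_br_arr induced_br_natural _ induced_br_unit])
    fix X Y assume [simp]: "X \<in> Obj C" "Y \<in> Obj C"
    note [simp] = induced_br_simps induced_br_arr
    let ?s = "(\<iota> (Fo X) \<otimes>\<^sub>a induced_br Y) \<star> (induced_br X \<otimes>\<^sub>a \<iota> (Fo Y))"
    have invX: "(\<iota> (Fo X) \<otimes>\<^sub>a k \<otimes>\<^sub>a \<iota> (Fo Y)) \<star> (induced_br X \<otimes>\<^sub>a \<iota> (Fo Y)) = (br V X \<otimes>\<^sub>a \<iota> (Fo Y)) \<star> (k \<otimes>\<^sub>a \<iota> (Fo X \<otimes>\<^sub>o Fo Y))"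
      using arg_cong[OF inv[of X], of "\<lambda>z. z \<otimes>\<^sub>a \<iota> (Fo Y)"] by (simp add: D.tns_cmp_right)
    have "(\<iota> (Fo X \<otimes>\<^sub>o Fo Y) \<otimes>\<^sub>a k) \<star> ?s = (\<iota> (Fo X) \<otimes>\<^sub>a ((\<iota> (Fo Y) \<otimes>\<^sub>a k) \<star> induced_br Y)) \<star> (induced_br X \<otimes>\<^sub>a \<iota> (Fo Y))"
      by (simp add: D.tns_cmp_left)
    also have "\<dots> = br V (X \<otimes>\<^sub>o\<^bsub>C\<^esub> Y) \<star> (k \<otimes>\<^sub>a \<iota> (Fo X \<otimes>\<^sub>o Fo Y))"
      by (simp add: inv invX br_mult D.tns_cmp_left)
    finally have "(\<iota> (Fo X \<otimes>\<^sub>o Fo Y) \<otimes>\<^sub>a q) \<star> ((\<iota> (Fo X \<otimes>\<^sub>o Fo Y) \<otimes>\<^sub>a k) \<star> ?s) = induced_br (X \<otimes>\<^sub>o\<^bsub>C\<^esub> Y)"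
      by (simp add: induced_br_def)
    thus "induced_br (X \<otimes>\<^sub>o\<^bsub>C\<^esub> Y) = ?s" by (simp add: D.interchange' qk)
  qed
  show "zob K induced_br \<in> Obj ZF" by (rule zob_obj[OF h])
  show "zmor (zob K induced_br) V k" by (rule zmorI) (simp_all add: induced_br_simps br_zob[OF h] inv)
qed

text \<open>Dual to \<open>hb_sub\<close>: the split epimorphism q is cancelled on the other
  side.\<close>

lemma hb_quot:
  assumes inv: "\<And>X. X \<in> Obj C \<Longrightarrow> induced_br X \<star> (q \<otimes>\<^sub>a \<iota> (Fo X)) = (\<iota> (Fo X) \<otimes>\<^sub>a q) \<star> br V X"
  shows "zob K induced_br \<in> Obj ZF" "zmor V (zob K induced_br) q"
proof -
  have h: "hb K induced_br"
  proof (rule hbI[OF K_obj induced_br_arr induced_br_natural _ induced_br_unit])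
    fix X Y assume [simp]: "X \<in> Obj C" "Y \<in> Obj C"
    note [simp] = induced_br_simps induced_br_arr
    let ?s = "(\<iota> (Fo X) \<otimes>\<^sub>a induced_br Y) \<star> (induced_br X \<otimes>\<^sub>a \<iota> (Fo Y))"
    have invY: "(\<iota> (Fo X) \<otimes>\<^sub>a induced_br Y) \<star> ((\<iota> (Fo X) \<otimes>\<^sub>a q \<otimes>\<^sub>a \<iota> (Fo Y)) \<star> (br V X \<otimes>\<^sub>a \<iota> (Fo Y)))
        = (\<iota> (Fo X \<otimes>\<^sub>o Fo Y) \<otimes>\<^sub>a q) \<star> ((\<iota> (Fo X) \<otimes>\<^sub>a br V Y) \<star> (br V X \<otimes>\<^sub>a \<iota> (Fo Y)))"
      using arg_cong[OF inv[of Y], of "\<lambda>z. (\<iota> (Fo X) \<otimes>\<^sub>a z) \<star> (br V X \<otimes>\<^sub>a \<iota> (Fo Y))"] by (simp add: D.tns_cmp_left)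
    have "?s \<star> (q \<otimes>\<^sub>a \<iota> (Fo X \<otimes>\<^sub>o Fo Y)) = (\<iota> (Fo X) \<otimes>\<^sub>a induced_br Y) \<star> ((induced_br X \<star> (q \<otimes>\<^sub>a \<iota> (Fo X))) \<otimes>\<^sub>a \<iota> (Fo Y))"
      by (simp add: D.tns_cmp_right)
    also have "\<dots> = (\<iota> (Fo X \<otimes>\<^sub>o Fo Y) \<otimes>\<^sub>a q) \<star> br V (X \<otimes>\<^sub>o\<^bsub>C\<^esub> Y)"
      by (simp add: inv invY br_mult D.tns_cmp_right)
    finally have "(?s \<star> (q \<otimes>\<^sub>a \<iota> (Fo X \<otimes>\<^sub>o Fo Y))) \<star> (k \<otimes>\<^sub>a \<iota> (Fo X \<otimes>\<^sub>o Fo Y)) = induced_br (X \<otimes>\<^sub>o\<^bsub>C\<^esub> Y)"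
      by (simp add: induced_br_def)
    moreover have "(?s \<star> (q \<otimes>\<^sub>a \<iota> (Fo X \<otimes>\<^sub>o Fo Y))) \<star> (k \<otimes>\<^sub>a \<iota> (Fo X \<otimes>\<^sub>o Fo Y)) = ?s \<star> ((q \<star> k) \<otimes>\<^sub>a \<iota> (Fo X \<otimes>\<^sub>o Fo Y))"
      by (simp add: D.tns_cmp_right del: qk)
    ultimately show "induced_br (X \<otimes>\<^sub>o\<^bsub>C\<^esub> Y) = ?s" by (simp add: qk)
  qed
  show "zob K induced_br \<in> Obj ZF" by (rule zob_obj[OF h])
  show "zmor V (zob K induced_br) q" by (rule zmorI) (simp_all add: induced_br_simps br_zob[OF h] inv)
qed

end

text \<open>On the kernel k of 1 - e the idempotent acts as the identity, and e itself factors
  through k because (1 - e) e = 0. The factor q is the retraction.\<close>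

lemma split_idempotent:
  assumes e: "arr D e" "src e = V" "tgt e = V" "e \<star> e = e"
  shows "\<exists>k q. arr D k \<and> arr D q \<and> src k = tgt q \<and> tgt k = V \<and> src q = V \<and> q \<star> k = \<iota> (tgt q) \<and> k \<star> q = e"
proof -
  have V [simp]: "V \<in> Obj D" using e by auto
  let ?f = "\<iota> V \<boxplus> (- 1) \<boxdot> e"
  obtain k where "is_ker D ?f k" using D.ex_ker[of ?f] e by auto
  hence k: "arr D k" "tgt k = V" "?f \<star> k = zr D (src k) V"
    and fac: "\<And>h. arr D h \<Longrightarrow> tgt h = V \<Longrightarrow> ?f \<star> h = zr D (src h) V \<Longrightarrow>
        \<exists>!w. arr D w \<and> tgt w = src k \<and> src w = src h \<and> k \<star> w = h"
    using e by (simp_all add: D.is_ker_iff)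
  have ek: "e \<star> k = k"
    using k e D.pls_neg_eq_zr_iff[of k "e \<star> k"] by (simp add: D.cmp_pls_left)
  have "?f \<star> e = zr D (src e) V" using e by (simp add: D.cmp_pls_left)
  then obtain q where q: "arr D q" "tgt q = src k" "src q = V" "k \<star> q = e" using fac[of e] e by auto
  have "k \<star> (q \<star> k) = k" using D.cmp_assoc_eq[OF q(4), of k] q k ek by simp
  hence "q \<star> k = \<iota> (src k)"
    using fac[of k] k q(1-3) by (metis D.arr_cmp D.arr_idt D.cmp_idt_right arr_objs(1) src_ops(1,2) tgt_ops(1,2))
  thus ?thesis using k q by (intro exI[of _ k] exI[of _ q]) simp
qed

text \<open>1 - s g is an idempotent of \<open>D\<close> whose image is the kernel of g. It need not
  be a morphism of the centralizer, but g is one: moving g past the braiding produces g k = 0, so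
  the correction term s g disappears and the image is stable under the half-braiding.\<close>

lemma zker_split:
  assumes V: "V \<in> Obj ZF" "W \<in> Obj ZF" and g: "zmor V W g"
    and s: "arr D s" "src s = fst W" "tgt s = fst V" "g \<star> s \<star> g = g"
  shows "\<exists>K k q. K \<in> Obj ZF \<and> zmor K V k \<and> arr D q \<and> src q = fst V \<and> tgt q = fst K \<and>
    q \<star> k = \<iota> (fst K) \<and> k \<star> q = \<iota> (fst V) \<boxplus> (- 1) \<boxdot> (s \<star> g) \<and> g \<star> k = zr D (fst K) (fst W)"
proof -
  note [simp] = V zmorD(1-3)[OF g] s(1-3)
  let ?e = "\<iota> (fst V) \<boxplus> (- 1) \<boxdot> (s \<star> g)"
  have ee: "?e \<star> ?e = ?e"
    by (simp add: D.cmp_pls_left D.cmp_pls_right D.scl_pls s(4) D.pls_assoc)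
  obtain k q where kq: "arr D k" "arr D q" "src k = tgt q" "tgt k = fst V" "src q = fst V" "q \<star> k = \<iota> (tgt q)" "k \<star> q = ?e"
    using split_idempotent[OF _ _ _ ee] by auto
  note [simp] = kq(1-6)
  have "g \<star> ?e = zr D (fst V) (fst W)" by (simp add: D.cmp_pls_right s(4))
  hence "(g \<star> ?e) \<star> k = zr D (tgt q) (fst W)" by simp
  moreover have "(g \<star> ?e) \<star> k = g \<star> k"
    unfolding kq(7)[symmetric] by simp
  ultimately have gk: "g \<star> k = zr D (tgt q) (fst W)" by simp
  let ?c = "induced_br V k q"
  note 1 = V(1) kq(1,3,4,2,5) refl kq(6)
  have inv: "(\<iota> (Fo X) \<otimes>\<^sub>a k) \<star> ?c X = br V X \<star> (k \<otimes>\<^sub>a \<iota> (Fo X))" if [simp]: "X \<in> Obj C" for X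
  proof -
    have "(\<iota> (Fo X) \<otimes>\<^sub>a k) \<star> ?c X = (\<iota> (Fo X) \<otimes>\<^sub>a (k \<star> q)) \<star> (br V X \<star> (k \<otimes>\<^sub>a \<iota> (Fo X)))"
      by (simp add: induced_br_def[OF 1] D.tns_cmp_left del: kq(7))
    also have "\<dots> = br V X \<star> (k \<otimes>\<^sub>a \<iota> (Fo X)) \<boxplus> (- 1) \<boxdot> (\<iota> (Fo X) \<otimes>\<^sub>a s) \<star> (((\<iota> (Fo X) \<otimes>\<^sub>a g) \<star> br V X) \<star> (k \<otimes>\<^sub>a \<iota> (Fo X)))"
      unfolding kq(7) by (simp add: D.tns_pls_right D.cmp_pls_left D.tns_cmp_left)
    also have "((\<iota> (Fo X) \<otimes>\<^sub>a g) \<star> br V X) \<star> (k \<otimes>\<^sub>a \<iota> (Fo X)) = br W X \<star> ((g \<star> k) \<otimes>\<^sub>a \<iota> (Fo X))"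
      unfolding zmorD(4)[OF g that] by (simp add: D.tns_cmp_right)
    finally show ?thesis by (simp add: gk)
  qed
  have K: "zob (tgt q) ?c \<in> Obj ZF" "zmor (zob (tgt q) ?c) V k" by (rule hb_sub[OF 1 inv], simp)+
  show ?thesis
    by (rule exI[of _ "zob (tgt q) ?c"], rule exI[of _ k], rule exI[of _ q]) (simp add: K gk kq(7))
qed

text \<open>Dual to \<open>zker_split\<close>: the image of 1 - f s is the cokernel of f, and the
  correction term f s disappears because q f = 0.\<close>

lemma zcoker_split:
  assumes V: "U \<in> Obj ZF" "V \<in> Obj ZF" and f: "zmor U V f"
    and s: "arr D s" "src s = fst V" "tgt s = fst U" "f \<star> s \<star> f = f"
  shows "\<exists>Q q k. Q \<in> Obj ZF \<and> zmor V Q q \<and> arr D k \<and> src k = fst Q \<and> tgt k = fst V \<and>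
    q \<star> k = \<iota> (fst Q) \<and> k \<star> q = \<iota> (fst V) \<boxplus> (- 1) \<boxdot> (f \<star> s) \<and> q \<star> f = zr D (fst U) (fst Q)"
proof -
  note [simp] = V zmorD(1-3)[OF f] s(1-3)
  let ?e = "\<iota> (fst V) \<boxplus> (- 1) \<boxdot> (f \<star> s)"
  have fs: "(f \<star> s) \<star> (f \<star> s) = f \<star> s" using arg_cong[OF s(4), of "\<lambda>x. x \<star> s"] by simp
  have ee: "?e \<star> ?e = ?e"
    using fs by (simp add: D.cmp_pls_left D.cmp_pls_right D.scl_pls D.pls_assoc)
  obtain k q where kq: "arr D k" "arr D q" "src k = tgt q" "tgt k = fst V" "src q = fst V" "q \<star> k = \<iota> (tgt q)" "k \<star> q = ?e"
    using split_idempotent[OF _ _ _ ee] by auto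
  note [simp] = kq(1-6)
  have "?e \<star> f = zr D (fst U) (fst V)" by (simp add: D.cmp_pls_left s(4))
  hence "q \<star> (?e \<star> f) = zr D (fst U) (tgt q)" by simp
  moreover have "q \<star> (?e \<star> f) = (q \<star> k) \<star> (q \<star> f)"
    unfolding kq(7)[symmetric] by (simp del: kq(6))
  ultimately have qf: "q \<star> f = zr D (fst U) (tgt q)" by simp
  let ?c = "induced_br V k q"
  note 1 = V(2) kq(1,3,4,2,5) refl kq(6)
  have inv: "?c X \<star> (q \<otimes>\<^sub>a \<iota> (Fo X)) = (\<iota> (Fo X) \<otimes>\<^sub>a q) \<star> br V X" if [simp]: "X \<in> Obj C" for X
  proof -
    have "?c X \<star> (q \<otimes>\<^sub>a \<iota> (Fo X)) = (\<iota> (Fo X) \<otimes>\<^sub>a q) \<star> (br V X \<star> ((k \<star> q) \<otimes>\<^sub>a \<iota> (Fo X)))"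
      by (simp add: induced_br_def[OF 1] D.tns_cmp_right del: kq(7))
    also have "\<dots> = (\<iota> (Fo X) \<otimes>\<^sub>a q) \<star> br V X \<boxplus> (- 1) \<boxdot> ((\<iota> (Fo X) \<otimes>\<^sub>a q) \<star> ((br V X \<star> (f \<otimes>\<^sub>a \<iota> (Fo X))) \<star> (s \<otimes>\<^sub>a \<iota> (Fo X))))"
      unfolding kq(7) by (simp add: D.tns_pls_left D.cmp_pls_right D.tns_cmp_right)
    also have "(\<iota> (Fo X) \<otimes>\<^sub>a q) \<star> ((br V X \<star> (f \<otimes>\<^sub>a \<iota> (Fo X))) \<star> (s \<otimes>\<^sub>a \<iota> (Fo X))) = (\<iota> (Fo X) \<otimes>\<^sub>a (q \<star> f)) \<star> (br U X \<star> (s \<otimes>\<^sub>a \<iota> (Fo X)))"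
      unfolding zmorD(4)[OF f that, symmetric] by (simp add: D.tns_cmp_left)
    finally show ?thesis by (simp add: qf)
  qed
  have Q: "zob (tgt q) ?c \<in> Obj ZF" "zmor V (zob (tgt q) ?c) q" by (rule hb_quot[OF 1 inv], simp)+
  show ?thesis
    by (rule exI[of _ "zob (tgt q) ?c"], rule exI[of _ q], rule exI[of _ k]) (simp add: Q qf kq(7))
qed

section \<open>The left adjoint of the forgetful functor\<close>

lemma ntr_shift:
  assumes M: "M \<in> Obj D" and Y: "Y \<in> Obj C"
  shows "ntr M (Fo Y) (Fo Y \<otimes>\<^sub>o Zo M) (\<lambda>X. uni M (X \<otimes>\<^sub>o\<^bsub>C\<^esub> Y))"
proof (rule ntrI)
  fix f assume f: "arr C f"
  show "(Fm f \<otimes>\<^sub>a \<iota> (Fo Y \<otimes>\<^sub>o Zo M)) \<star> uni M (src f \<otimes>\<^sub>o\<^bsub>C\<^esub> Y) = uni M (tgt f \<otimes>\<^sub>o\<^bsub>C\<^esub> Y) \<star> (\<iota> M \<otimes>\<^sub>a Fm f \<otimes>\<^sub>a \<iota> (Fo Y))"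
    using uni_natural[OF M, of "f \<otimes>\<^sub>a\<^bsub>C\<^esub> idt C Y"] f Y M by simp
qed (use M Y in simp_all)

text \<open>The half-braiding of the free object is forced by the demand that the universal
  transformation at X \<otimes> Y be the one at X followed by a braiding past Y. Such an arrow is
  supplied by \<open>uni_factor_tns\<close>.\<close>

definition fbr :: "'p \<Rightarrow> 'o \<Rightarrow> 'p \<times> 'n \<times> 'p" where
  "fbr M Y = (SOME w. arr D w \<and> src w = Zo M \<otimes>\<^sub>o Fo Y \<and> tgt w = Fo Y \<otimes>\<^sub>o Zo M \<and>
    (\<forall>X\<in>Obj C. uni M (X \<otimes>\<^sub>o\<^bsub>C\<^esub> Y) = (\<iota> (Fo X) \<otimes>\<^sub>a w) \<star> (uni M X \<otimes>\<^sub>a \<iota> (Fo Y))))"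

lemma fbr_props:
  assumes M: "M \<in> Obj D" and Y: "Y \<in> Obj C"
  shows fbr_simps [simp]: "arr D (fbr M Y)" "src (fbr M Y) = Zo M \<otimes>\<^sub>o Fo Y" "tgt (fbr M Y) = Fo Y \<otimes>\<^sub>o Zo M"
    and fbr_uni: "X \<in> Obj C \<Longrightarrow> (\<iota> (Fo X) \<otimes>\<^sub>a fbr M Y) \<star> (uni M X \<otimes>\<^sub>a \<iota> (Fo Y)) = uni M (X \<otimes>\<^sub>o\<^bsub>C\<^esub> Y)"
proof -
  let ?P = "\<lambda>w. arr D w \<and> src w = Zo M \<otimes>\<^sub>o Fo Y \<and> tgt w = Fo Y \<otimes>\<^sub>o Zo M \<and>
    (\<forall>X\<in>Obj C. uni M (X \<otimes>\<^sub>o\<^bsub>C\<^esub> Y) = (\<iota> (Fo X) \<otimes>\<^sub>a w) \<star> (uni M X \<otimes>\<^sub>a \<iota> (Fo Y)))"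
  have "\<exists>w. ?P w"
    by (rule uni_factor_tns[OF M _ _ ntr_shift[OF M Y]]) (use M Y in simp_all)
  hence "?P (fbr M Y)" unfolding fbr_def by (rule someI_ex)
  thus "arr D (fbr M Y)" "src (fbr M Y) = Zo M \<otimes>\<^sub>o Fo Y" "tgt (fbr M Y) = Fo Y \<otimes>\<^sub>o Zo M"
    "X \<in> Obj C \<Longrightarrow> (\<iota> (Fo X) \<otimes>\<^sub>a fbr M Y) \<star> (uni M X \<otimes>\<^sub>a \<iota> (Fo Y)) = uni M (X \<otimes>\<^sub>o\<^bsub>C\<^esub> Y)"
    by simp_all
qed

text \<open>Each axiom is an equation between arrows out of \<open>Zo M\<close>, possibly tensored
  with some F(Y), and is tested after \<open>uni M X\<close>. There it becomes naturality of
  \<open>uni M\<close>, associativity of \<otimes> in \<open>C\<close>, or X \<otimes> 1 =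
  X.\<close>

lemma fbr_hb:
  assumes M [simp]: "M \<in> Obj D" shows "hb (Zo M) (fbr M)"
proof (rule hbI)
  fix f assume f [simp]: "arr C f"
  show "(Fm f \<otimes>\<^sub>a \<iota> (Zo M)) \<star> fbr M (src f) = fbr M (tgt f) \<star> (\<iota> (Zo M) \<otimes>\<^sub>a Fm f)"
  proof (rule uni_unique_tns[OF M, of "Fo (src f)"])
    fix X assume X [simp]: "X \<in> Obj C"
    have "(\<iota> (Fo X) \<otimes>\<^sub>a ((Fm f \<otimes>\<^sub>a \<iota> (Zo M)) \<star> fbr M (src f))) \<star> (uni M X \<otimes>\<^sub>a \<iota> (Fo (src f)))
        = (Fm (idt C X \<otimes>\<^sub>a\<^bsub>C\<^esub> f) \<otimes>\<^sub>a \<iota> (Zo M)) \<star> uni M (X \<otimes>\<^sub>o\<^bsub>C\<^esub> src f)"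
      by (simp add: D.tns_cmp_left fbr_uni)
    also have "\<dots> = uni M (X \<otimes>\<^sub>o\<^bsub>C\<^esub> tgt f) \<star> (\<iota> (M \<otimes>\<^sub>o Fo X) \<otimes>\<^sub>a Fm f)"
      using uni_natural[OF M, of "idt C X \<otimes>\<^sub>a\<^bsub>C\<^esub> f"] by simp
    also have "\<dots> = (\<iota> (Fo X) \<otimes>\<^sub>a fbr M (tgt f)) \<star> ((uni M X \<otimes>\<^sub>a \<iota> (Fo (tgt f))) \<star> (\<iota> (M \<otimes>\<^sub>o Fo X) \<otimes>\<^sub>a Fm f))"
      by (simp flip: fbr_uni)
    also have "(uni M X \<otimes>\<^sub>a \<iota> (Fo (tgt f))) \<star> (\<iota> (M \<otimes>\<^sub>o Fo X) \<otimes>\<^sub>a Fm f) = (\<iota> (Fo X \<otimes>\<^sub>o Zo M) \<otimes>\<^sub>a Fm f) \<star> (uni M X \<otimes>\<^sub>a \<iota> (Fo (src f)))"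
      by (simp add: D.interchange)
    finally show "(\<iota> (Fo X) \<otimes>\<^sub>a ((Fm f \<otimes>\<^sub>a \<iota> (Zo M)) \<star> fbr M (src f))) \<star> (uni M X \<otimes>\<^sub>a \<iota> (Fo (src f)))
        = (\<iota> (Fo X) \<otimes>\<^sub>a (fbr M (tgt f) \<star> (\<iota> (Zo M) \<otimes>\<^sub>a Fm f))) \<star> (uni M X \<otimes>\<^sub>a \<iota> (Fo (src f)))"
      by (simp add: D.tns_cmp_left)
  qed simp_all
next
  fix Y Y' assume Y [simp]: "Y \<in> Obj C" "Y' \<in> Obj C"
  show "fbr M (Y \<otimes>\<^sub>o\<^bsub>C\<^esub> Y') = (\<iota> (Fo Y) \<otimes>\<^sub>a fbr M Y') \<star> (fbr M Y \<otimes>\<^sub>a \<iota> (Fo Y'))"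
  proof (rule uni_unique_tns[OF M, of "Fo Y \<otimes>\<^sub>o Fo Y'"])
    fix X assume X [simp]: "X \<in> Obj C"
    have "(\<iota> (Fo X) \<otimes>\<^sub>a ((\<iota> (Fo Y) \<otimes>\<^sub>a fbr M Y') \<star> (fbr M Y \<otimes>\<^sub>a \<iota> (Fo Y')))) \<star> (uni M X \<otimes>\<^sub>a \<iota> (Fo Y \<otimes>\<^sub>o Fo Y'))
        = (\<iota> (Fo X \<otimes>\<^sub>o Fo Y) \<otimes>\<^sub>a fbr M Y') \<star> (((\<iota> (Fo X) \<otimes>\<^sub>a fbr M Y) \<star> (uni M X \<otimes>\<^sub>a \<iota> (Fo Y))) \<otimes>\<^sub>a \<iota> (Fo Y'))"
      by (simp add: D.tns_cmp_left D.tns_cmp_right)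
    also have "\<dots> = uni M (X \<otimes>\<^sub>o\<^bsub>C\<^esub> (Y \<otimes>\<^sub>o\<^bsub>C\<^esub> Y'))"
      using fbr_uni[OF M Y(2), of "X \<otimes>\<^sub>o\<^bsub>C\<^esub> Y"] by (simp add: fbr_uni)
    also have "\<dots> = (\<iota> (Fo X) \<otimes>\<^sub>a fbr M (Y \<otimes>\<^sub>o\<^bsub>C\<^esub> Y')) \<star> (uni M X \<otimes>\<^sub>a \<iota> (Fo Y \<otimes>\<^sub>o Fo Y'))"
      using fbr_uni[OF M, of "Y \<otimes>\<^sub>o\<^bsub>C\<^esub> Y'" X] by simp
    finally show "(\<iota> (Fo X) \<otimes>\<^sub>a fbr M (Y \<otimes>\<^sub>o\<^bsub>C\<^esub> Y')) \<star> (uni M X \<otimes>\<^sub>a \<iota> (Fo Y \<otimes>\<^sub>o Fo Y'))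
        = (\<iota> (Fo X) \<otimes>\<^sub>a ((\<iota> (Fo Y) \<otimes>\<^sub>a fbr M Y') \<star> (fbr M Y \<otimes>\<^sub>a \<iota> (Fo Y')))) \<star> (uni M X \<otimes>\<^sub>a \<iota> (Fo Y \<otimes>\<^sub>o Fo Y'))" by simp
  qed simp_all
next
  show "fbr M (UnitO C) = \<iota> (Zo M)"
  proof (rule uni_unique[OF M])
    fix X assume X [simp]: "X \<in> Obj C"
    show "(\<iota> (Fo X) \<otimes>\<^sub>a fbr M (UnitO C)) \<star> uni M X = (\<iota> (Fo X) \<otimes>\<^sub>a \<iota> (Zo M)) \<star> uni M X"
      using fbr_uni[OF M, of "UnitO C" X] by simp
  qed simp_all
qed simp_all

definition free :: "'p \<Rightarrow> 'p \<times> ('o \<Rightarrow> 'n)" where "free M = zob (Zo M) (fbr M)"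
definition unt :: "'p \<Rightarrow> 'p \<times> 'n \<times> 'p" where "unt M = uni M (UnitO C)"

lemma free_obj [simp]: "M \<in> Obj D \<Longrightarrow> free M \<in> Obj ZF"
  by (simp add: free_def zob_obj fbr_hb)

lemma fst_free [simp]: "fst (free M) = Zo M" by (simp add: free_def)

lemma br_free: "M \<in> Obj D \<Longrightarrow> X \<in> Obj C \<Longrightarrow> br (free M) X = fbr M X"
  by (simp add: free_def br_zob fbr_hb)

lemma unt_simps [simp]:
  "M \<in> Obj D \<Longrightarrow> arr D (unt M)" "M \<in> Obj D \<Longrightarrow> src (unt M) = M" "M \<in> Obj D \<Longrightarrow> tgt (unt M) = Zo M"
  by (simp_all add: unt_def)

text \<open>Take the first variable of \<open>fbr_uni\<close> to be the unit object: the universal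
  transformation is the unit of the adjunction followed by the half-braiding, so
  \<open>unt M\<close> alone recovers \<open>uni M\<close>.\<close>

lemma br_free_unt:
  "M \<in> Obj D \<Longrightarrow> X \<in> Obj C \<Longrightarrow> br (free M) X \<star> (unt M \<otimes>\<^sub>a \<iota> (Fo X)) = uni M X"
  using fbr_uni[of M X "UnitO C"] by (simp add: br_free unt_def)

lemma uni_unt: "M \<in> Obj D \<Longrightarrow> W \<in> Obj ZF \<Longrightarrow> zmor (free M) W g \<Longrightarrow> X \<in> Obj C \<Longrightarrow>
    (\<iota> (Fo X) \<otimes>\<^sub>a g) \<star> uni M X = br W X \<star> ((g \<star> unt M) \<otimes>\<^sub>a \<iota> (Fo X))"
proof -
  assume [simp]: "M \<in> Obj D" "W \<in> Obj ZF" "X \<in> Obj C" and g: "zmor (free M) W g"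
  note [simp] = zmorD(1-3)[OF g]
  have "(\<iota> (Fo X) \<otimes>\<^sub>a g) \<star> uni M X = ((\<iota> (Fo X) \<otimes>\<^sub>a g) \<star> br (free M) X) \<star> (unt M \<otimes>\<^sub>a \<iota> (Fo X))"
    by (simp add: br_free_unt)
  also have "\<dots> = br W X \<star> ((g \<star> unt M) \<otimes>\<^sub>a \<iota> (Fo X))"
    by (simp add: zmorD(4)[OF g] D.tns_cmp_right)
  finally show ?thesis .
qed

text \<open>By \<open>uni_unt\<close>, the composite of a morphism with \<open>uni M\<close> depends
  only on its composite with the unit.\<close>

lemma free_unique:
  assumes M: "M \<in> Obj D" and W: "W \<in> Obj ZF" and g: "zmor (free M) W g" "zmor (free M) W g'" and eq: "g \<star> unt M = g' \<star> unt M"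
  shows "g = g'"
proof (rule uni_unique[OF M])
  fix X assume "X \<in> Obj C"
  thus "(\<iota> (Fo X) \<otimes>\<^sub>a g) \<star> uni M X = (\<iota> (Fo X) \<otimes>\<^sub>a g') \<star> uni M X"
    using uni_unt[OF M W g(1)] uni_unt[OF M W g(2)] by (simp only: eq)
qed (use zmorD(1-3)[OF g(1)] zmorD(1-3)[OF g(2)] in simp_all)

text \<open>An arrow h : M -> W gives the transformation h followed by the half-braiding of W, and
  the extension g is its factor through \<open>uni M\<close>. That g is a morphism of the
  centralizer is tested after \<open>uni M X\<close>, where it becomes multiplicativity of the
  half-braiding of W.\<close>

lemma free_extend:
  assumes M [simp]: "M \<in> Obj D" and W [simp]: "W \<in> Obj ZF" and h [simp]: "arr D h" "src h = M" "tgt h = fst W"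
  shows "\<exists>g. zmor (free M) W g \<and> g \<star> unt M = h"
proof -
  let ?t = "\<lambda>X. br W X \<star> (h \<otimes>\<^sub>a \<iota> (Fo X))"
  have t: "ntr M (UnitO D) (fst W) ?t"
  proof (rule ntrI)
    fix f assume f [simp]: "arr C f"
    have "(Fm f \<otimes>\<^sub>a \<iota> (fst W)) \<star> ?t (src f) = ((Fm f \<otimes>\<^sub>a \<iota> (fst W)) \<star> br W (src f)) \<star> (h \<otimes>\<^sub>a \<iota> (Fo (src f)))" by simp
    also have "\<dots> = br W (tgt f) \<star> ((\<iota> (fst W) \<otimes>\<^sub>a Fm f) \<star> (h \<otimes>\<^sub>a \<iota> (Fo (src f))))" by (simp add: br_natural[OF W])
    also have "(\<iota> (fst W) \<otimes>\<^sub>a Fm f) \<star> (h \<otimes>\<^sub>a \<iota> (Fo (src f))) = (h \<otimes>\<^sub>a \<iota> (Fo (tgt f))) \<star> (\<iota> M \<otimes>\<^sub>a Fm f)"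
      by (simp add: D.interchange)
    finally show "(Fm f \<otimes>\<^sub>a \<iota> (fst W)) \<star> ?t (src f) = ?t (tgt f) \<star> (\<iota> M \<otimes>\<^sub>a Fm f \<otimes>\<^sub>a \<iota> (UnitO D))" by simp
  qed simp_all
  obtain g where g [simp]: "arr D g" "src g = Zo M" "tgt g = fst W"
    and "\<forall>X\<in>Obj C. ?t X = (\<iota> (Fo X) \<otimes>\<^sub>a g) \<star> uni M X"
    using uni_factor[OF M Obj_fst[OF W] t] by blast
  hence fac: "\<And>X. X \<in> Obj C \<Longrightarrow> (\<iota> (Fo X) \<otimes>\<^sub>a g) \<star> uni M X = ?t X" by simp
  have "g \<star> unt M = h" using fac[of "UnitO C"] by (simp add: unt_def)
  moreover have "zmor (free M) W g"
  proof (rule zmorI)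
    fix Y assume Y [simp]: "Y \<in> Obj C"
    show "(\<iota> (Fo Y) \<otimes>\<^sub>a g) \<star> br (free M) Y = br W Y \<star> (g \<otimes>\<^sub>a \<iota> (Fo Y))"
    proof (rule uni_unique_tns[OF M, of "Fo Y"])
      fix X assume X [simp]: "X \<in> Obj C"
      have "(\<iota> (Fo X) \<otimes>\<^sub>a ((\<iota> (Fo Y) \<otimes>\<^sub>a g) \<star> br (free M) Y)) \<star> (uni M X \<otimes>\<^sub>a \<iota> (Fo Y))
          = (\<iota> (Fo X \<otimes>\<^sub>o Fo Y) \<otimes>\<^sub>a g) \<star> uni M (X \<otimes>\<^sub>o\<^bsub>C\<^esub> Y)"
        by (simp add: D.tns_cmp_left br_free fbr_uni)
      also have "\<dots> = br W (X \<otimes>\<^sub>o\<^bsub>C\<^esub> Y) \<star> (h \<otimes>\<^sub>a \<iota> (Fo X \<otimes>\<^sub>o Fo Y))"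
        using fac[of "X \<otimes>\<^sub>o\<^bsub>C\<^esub> Y"] by simp
      also have "\<dots> = (\<iota> (Fo X) \<otimes>\<^sub>a br W Y) \<star> (?t X \<otimes>\<^sub>a \<iota> (Fo Y))"
        by (simp add: br_mult[OF W] D.tns_cmp_right)
      also have "\<dots> = (\<iota> (Fo X) \<otimes>\<^sub>a br W Y) \<star> (((\<iota> (Fo X) \<otimes>\<^sub>a g) \<star> uni M X) \<otimes>\<^sub>a \<iota> (Fo Y))"
        by (simp add: fac)
      also have "\<dots> = (\<iota> (Fo X) \<otimes>\<^sub>a (br W Y \<star> (g \<otimes>\<^sub>a \<iota> (Fo Y)))) \<star> (uni M X \<otimes>\<^sub>a \<iota> (Fo Y))"
        by (simp add: D.tns_cmp_left D.tns_cmp_right)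
      finally show "(\<iota> (Fo X) \<otimes>\<^sub>a ((\<iota> (Fo Y) \<otimes>\<^sub>a g) \<star> br (free M) Y)) \<star> (uni M X \<otimes>\<^sub>a \<iota> (Fo Y))
        = (\<iota> (Fo X) \<otimes>\<^sub>a (br W Y \<star> (g \<otimes>\<^sub>a \<iota> (Fo Y)))) \<star> (uni M X \<otimes>\<^sub>a \<iota> (Fo Y))" .
    qed simp_all
  qed simp_all
  ultimately show ?thesis by blast
qed

end

section \<open>Relative homological algebra in the centralizer\<close>

context tensor_functor
begin

section \<open>Kernels, cokernels and allowability in the centralizer\<close>

definition zt :: "'p \<times> ('o \<Rightarrow> 'n) \<Rightarrow> 'n \<Rightarrow> 'p \<times> ('o \<Rightarrow> 'n) \<Rightarrow> 'p \<times> 'n \<times> 'p" where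
  "zt V e W = mk (fst V) e (fst W)"

lemma zt_simps [simp]: "src (zt V e W) = fst V" "tgt (zt V e W) = fst W" "und (zt V e W) = e"
  by (simp_all add: zt_def)

lemma zt_und: "zmor V W f \<Longrightarrow> zt V (und f) W = f"
  using zmorD(2,3)[of V W f] by (intro arrow_eqI) simp_all

lemma zt_cmp: "zt V (g \<cdot> f) W = zt U g W \<star> zt V f U"
  by (simp add: zt_def cmp_def)

lemma zt_eq_iff: "zt V f W = zt V g W \<longleftrightarrow> f = g"
  by (simp add: zt_def)

lemma zt_zero: "zt V \<zero>\<^bsub>HomV ZF V W\<^esub> W = zr D (fst V) (fst W)"
  by (simp add: zt_def zr_def HomV_ZF)

lemma Mor_ZF': "V \<in> Obj ZF \<Longrightarrow> W \<in> Obj ZF \<Longrightarrow> g \<in> Mor ZF V W \<longleftrightarrow> zmor V W (zt V g W)"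
  by (simp add: Mor_ZF zt_def)

text \<open>An inner inverse of f in \<open>D\<close>, the witness that allowability asks
  for.\<close>

definition regular :: "'p \<times> 'n \<times> 'p \<Rightarrow> 'p \<times> 'n \<times> 'p \<Rightarrow> bool" where
  "regular f s \<longleftrightarrow> arr D s \<and> src s = tgt f \<and> tgt s = src f \<and> f \<star> s \<star> f = f"

lemma allowable_iff:
  assumes "V \<in> Obj ZF" "W \<in> Obj ZF"
  shows "allowable ZF D forgetful V W e \<longleftrightarrow> zmor V W (zt V e W) \<and> (\<exists>s. regular (zt V e W) s)"
proof -
  have *: "(\<exists>s\<in>Mor D (fst W) (fst V). (e \<cdot> s) \<cdot> e = e) \<longleftrightarrow> (\<exists>s. regular (zt V e W) s)"
    if z: "zmor V W (zt V e W)"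
  proof
    assume "\<exists>s\<in>Mor D (fst W) (fst V). (e \<cdot> s) \<cdot> e = e"
    then obtain s where s: "s \<in> Mor D (fst W) (fst V)" "(e \<cdot> s) \<cdot> e = e" by blast
    let ?s = "mk (fst W) s (fst V)"
    have "(zt V e W \<star> ?s) \<star> zt V e W = zt V e W" using s by (simp add: zt_def cmp_def)
    moreover have "(zt V e W \<star> ?s) \<star> zt V e W = zt V e W \<star> ?s \<star> zt V e W"
      using s assms zmorD(1)[OF z] by (intro D.cmp_assoc) simp_all
    ultimately have "regular (zt V e W) ?s" using s assms by (simp add: regular_def)
    thus "\<exists>s. regular (zt V e W) s" by blast
  next
    assume "\<exists>s. regular (zt V e W) s"
    then obtain s where s: "arr D s" "src s = fst W" "tgt s = fst V" "zt V e W \<star> s \<star> zt V e W = zt V e W"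
      by (auto simp: regular_def)
    have "(zt V e W \<star> s) \<star> zt V e W = zt V e W"
      using s assms zmorD(1)[OF z] by simp
    hence "(e \<cdot> und s) \<cdot> e = e" by (simp add: zt_def cmp_def)
    thus "\<exists>s\<in>Mor D (fst W) (fst V). (e \<cdot> s) \<cdot> e = e" using arr_und[OF s(1-3)] by blast
  qed
  show ?thesis
    using * unfolding allowable_def Mor_ZF'[OF assms] by (auto simp: forgetful_def)
qed

lemma epic_iff:
  assumes V: "V \<in> Obj ZF" "W \<in> Obj ZF"
  shows "epic ZF V W e \<longleftrightarrow> zmor V W (zt V e W) \<and>
    (\<forall>T\<in>Obj ZF. \<forall>g h. zmor W T g \<longrightarrow> zmor W T h \<longrightarrow> g \<star> zt V e W = h \<star> zt V e W \<longrightarrow> g = h)"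
proof -
  have *: "(\<forall>g\<in>Mor ZF W T. \<forall>h\<in>Mor ZF W T. g \<cdot> e = h \<cdot> e \<longrightarrow> g = h) \<longleftrightarrow>
      (\<forall>g h. zmor W T g \<longrightarrow> zmor W T h \<longrightarrow> g \<star> zt V e W = h \<star> zt V e W \<longrightarrow> g = h)" (is "?L \<longleftrightarrow> ?R")
    if T: "T \<in> Obj ZF" for T
  proof
    assume L: ?L
    show ?R
    proof (intro allI impI)
      fix g h assume z: "zmor W T g" "zmor W T h" and eq: "g \<star> zt V e W = h \<star> zt V e W"
      have "und g \<cdot> e = und h \<cdot> e" using arg_cong[OF eq, of und] by (simp add: cmp_def)
      hence "und g = und h" using L z V T by (simp add: Mor_ZF_und)
      thus "g = h" using z by (metis zt_und)
    qed
  next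
    assume R: ?R
    show ?L
    proof (intro ballI impI)
      fix g h assume z: "g \<in> Mor ZF W T" "h \<in> Mor ZF W T" and eq: "g \<cdot> e = h \<cdot> e"
      have "zt W g T \<star> zt V e W = zt W h T \<star> zt V e W" using eq by (simp flip: zt_cmp)
      hence "zt W g T = zt W h T" using R z V T by (simp add: Mor_ZF')
      thus "g = h" by (simp add: zt_eq_iff)
    qed
  qed
  show ?thesis unfolding epic_def Comp_ZF Mor_ZF'[OF V] using * by auto
qed

lemma is_kernel_iff:
  assumes V: "X \<in> Obj ZF" "Y \<in> Obj ZF"
  shows "is_kernel ZF X Y f K i \<longleftrightarrow> zmor X Y (zt X f Y) \<and> K \<in> Obj ZF \<and> zmor K X (zt K i X) \<and>
    zt X f Y \<star> zt K i X = zr D (fst K) (fst Y) \<and>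
    (\<forall>T\<in>Obj ZF. \<forall>h. zmor T X h \<longrightarrow> zt X f Y \<star> h = zr D (fst T) (fst Y) \<longrightarrow>
       (\<exists>!u. zmor T K u \<and> zt K i X \<star> u = h))"
proof (cases "K \<in> Obj ZF")
  case K: True
  have *: "(\<forall>h\<in>Mor ZF T X. f \<cdot> h = \<zero>\<^bsub>HomV ZF T Y\<^esub> \<longrightarrow> (\<exists>!u. u \<in> Mor ZF T K \<and> i \<cdot> u = h)) \<longleftrightarrow>
      (\<forall>h. zmor T X h \<longrightarrow> zt X f Y \<star> h = zr D (fst T) (fst Y) \<longrightarrow> (\<exists>!u. zmor T K u \<and> zt K i X \<star> u = h))" (is "?L \<longleftrightarrow> ?R")
    if T: "T \<in> Obj ZF" for T
  proof -
    have bij: "(\<exists>!u. u \<in> Mor ZF T K \<and> i \<cdot> u = h) \<longleftrightarrow> (\<exists>!u. zmor T K u \<and> zt K i X \<star> u = zt T h X)" for h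
    proof
      assume "\<exists>!u. u \<in> Mor ZF T K \<and> i \<cdot> u = h"
      then obtain u where u: "u \<in> Mor ZF T K" "i \<cdot> u = h" and uniq: "\<And>v. v \<in> Mor ZF T K \<Longrightarrow> i \<cdot> v = h \<Longrightarrow> v = u" by blast
      show "\<exists>!u. zmor T K u \<and> zt K i X \<star> u = zt T h X"
      proof (rule ex1I[of _ "zt T u K"], goal_cases)
        case 1 show ?case using u T K by (simp add: Mor_ZF' flip: zt_cmp)
      next
        case (2 v)
        hence "und v \<in> Mor ZF T K" using T K by (simp add: Mor_ZF_und)
        moreover have "i \<cdot> und v = h" using 2 arg_cong[of "zt K i X \<star> v" "zt T h X" und] by (simp add: cmp_def zt_def)
        ultimately show ?case using uniq[of "und v"] 2 zt_und by metis
      qed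
    next
      assume "\<exists>!u. zmor T K u \<and> zt K i X \<star> u = zt T h X"
      then obtain u where u: "zmor T K u" "zt K i X \<star> u = zt T h X"
        and uniq: "\<And>v. zmor T K v \<Longrightarrow> zt K i X \<star> v = zt T h X \<Longrightarrow> v = u" by blast
      show "\<exists>!u. u \<in> Mor ZF T K \<and> i \<cdot> u = h"
      proof (rule ex1I[of _ "und u"], goal_cases)
        case 1 show ?case using u T K arg_cong[OF u(2), of und] by (simp add: Mor_ZF_und cmp_def zt_def)
      next
        case (2 v)
        hence "zt T v K = u" using T K by (intro uniq) (auto simp: Mor_ZF' simp flip: zt_cmp)
        thus ?case by (metis zt_simps(3))
      qed
    qed
    have zero: "f \<cdot> h = \<zero>\<^bsub>HomV ZF T Y\<^esub> \<longleftrightarrow> zt X f Y \<star> zt T h X = zr D (fst T) (fst Y)" for h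
      unfolding zt_zero[symmetric] zt_cmp[symmetric] by (simp add: zt_eq_iff)
    show ?thesis
    proof
      assume L: ?L
      show ?R
      proof (intro allI impI)
        fix h assume h: "zmor T X h" "zt X f Y \<star> h = zr D (fst T) (fst Y)"
        show "\<exists>!u. zmor T K u \<and> zt K i X \<star> u = h"
          using L[rule_format, of "und h"] h T V zero[of "und h"] bij[of "und h"] by (simp add: Mor_ZF_und zt_und)
      qed
    next
      assume R: ?R
      show ?L using R T V zero bij by (simp add: Mor_ZF')
    qed
  qed
  have zero: "f \<cdot> i = \<zero>\<^bsub>HomV ZF K Y\<^esub> \<longleftrightarrow> zt X f Y \<star> zt K i X = zr D (fst K) (fst Y)"
    unfolding zt_zero[symmetric] zt_cmp[symmetric] by (simp add: zt_eq_iff)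
  show ?thesis unfolding is_kernel_def Comp_ZF Mor_ZF'[OF V] Mor_ZF'[OF K V(1)] zero using * K by auto
next
  case False
  thus ?thesis by (simp add: is_kernel_def)
qed

lemma is_cokernel_iff:
  assumes V: "X \<in> Obj ZF" "Y \<in> Obj ZF"
  shows "is_cokernel ZF X Y f Q p \<longleftrightarrow> zmor X Y (zt X f Y) \<and> Q \<in> Obj ZF \<and> zmor Y Q (zt Y p Q) \<and>
    zt Y p Q \<star> zt X f Y = zr D (fst X) (fst Q) \<and>
    (\<forall>T\<in>Obj ZF. \<forall>h. zmor Y T h \<longrightarrow> h \<star> zt X f Y = zr D (fst X) (fst T) \<longrightarrow>
       (\<exists>!u. zmor Q T u \<and> u \<star> zt Y p Q = h))"
proof (cases "Q \<in> Obj ZF")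
  case K: True
  have *: "(\<forall>h\<in>Mor ZF Y T. h \<cdot> f = \<zero>\<^bsub>HomV ZF X T\<^esub> \<longrightarrow> (\<exists>!u. u \<in> Mor ZF Q T \<and> u \<cdot> p = h)) \<longleftrightarrow>
      (\<forall>h. zmor Y T h \<longrightarrow> h \<star> zt X f Y = zr D (fst X) (fst T) \<longrightarrow> (\<exists>!u. zmor Q T u \<and> u \<star> zt Y p Q = h))" (is "?L \<longleftrightarrow> ?R")
    if T: "T \<in> Obj ZF" for T
  proof -
    have bij: "(\<exists>!u. u \<in> Mor ZF Q T \<and> u \<cdot> p = h) \<longleftrightarrow> (\<exists>!u. zmor Q T u \<and> u \<star> zt Y p Q = zt Y h T)" for h
    proof
      assume "\<exists>!u. u \<in> Mor ZF Q T \<and> u \<cdot> p = h"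
      then obtain u where u: "u \<in> Mor ZF Q T" "u \<cdot> p = h" and uniq: "\<And>v. v \<in> Mor ZF Q T \<Longrightarrow> v \<cdot> p = h \<Longrightarrow> v = u" by blast
      show "\<exists>!u. zmor Q T u \<and> u \<star> zt Y p Q = zt Y h T"
      proof (rule ex1I[of _ "zt Q u T"], goal_cases)
        case 1 show ?case using u T K by (simp add: Mor_ZF' flip: zt_cmp)
      next
        case (2 v)
        hence "und v \<in> Mor ZF Q T" using T K by (simp add: Mor_ZF_und)
        moreover have "und v \<cdot> p = h" using 2 arg_cong[of "v \<star> zt Y p Q" "zt Y h T" und] by (simp add: cmp_def zt_def)
        ultimately show ?case using uniq[of "und v"] 2 zt_und by metis
      qed
    next
      assume "\<exists>!u. zmor Q T u \<and> u \<star> zt Y p Q = zt Y h T"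
      then obtain u where u: "zmor Q T u" "u \<star> zt Y p Q = zt Y h T"
        and uniq: "\<And>v. zmor Q T v \<Longrightarrow> v \<star> zt Y p Q = zt Y h T \<Longrightarrow> v = u" by blast
      show "\<exists>!u. u \<in> Mor ZF Q T \<and> u \<cdot> p = h"
      proof (rule ex1I[of _ "und u"], goal_cases)
        case 1 show ?case using u T K arg_cong[OF u(2), of und] by (simp add: Mor_ZF_und cmp_def zt_def)
      next
        case (2 v)
        hence "zt Q v T = u" using T K by (intro uniq) (auto simp: Mor_ZF' simp flip: zt_cmp)
        thus ?case by (metis zt_simps(3))
      qed
    qed
    have zero: "h \<cdot> f = \<zero>\<^bsub>HomV ZF X T\<^esub> \<longleftrightarrow> zt Y h T \<star> zt X f Y = zr D (fst X) (fst T)" for h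
      unfolding zt_zero[symmetric] zt_cmp[symmetric] by (simp add: zt_eq_iff)
    show ?thesis
    proof
      assume L: ?L
      show ?R
      proof (intro allI impI)
        fix h assume h: "zmor Y T h" "h \<star> zt X f Y = zr D (fst X) (fst T)"
        show "\<exists>!u. zmor Q T u \<and> u \<star> zt Y p Q = h"
          using L[rule_format, of "und h"] h T V zero[of "und h"] bij[of "und h"] by (simp add: Mor_ZF_und zt_und)
      qed
    next
      assume R: ?R
      show ?L using R T V zero bij by (simp add: Mor_ZF')
    qed
  qed
  have zero: "p \<cdot> f = \<zero>\<^bsub>HomV ZF X Q\<^esub> \<longleftrightarrow> zt Y p Q \<star> zt X f Y = zr D (fst X) (fst Q)"
    unfolding zt_zero[symmetric] zt_cmp[symmetric] by (simp add: zt_eq_iff)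
  show ?thesis unfolding is_cokernel_def Comp_ZF Mor_ZF'[OF V] Mor_ZF'[OF V(2) K] zero using * K by auto
next
  case False
  thus ?thesis by (simp add: is_cokernel_def)
qed

text \<open>Being epic is tested only against objects of the centralizer. The split cokernel of e is
  such an object; its projection q satisfies q e = 0, so q = 0, and the idempotent k q = 1 - e s
  vanishes in \<open>D\<close>.\<close>

lemma epic_allowable_split:
  assumes V [simp]: "V \<in> Obj ZF" "W \<in> Obj ZF" and e: "epic ZF V W e" and a: "allowable ZF D forgetful V W e"
  shows "\<exists>s. arr D s \<and> src s = fst W \<and> tgt s = fst V \<and> zt V e W \<star> s = \<iota> (fst W)"
proof -
  let ?e = "zt V e W"
  obtain s where z: "zmor V W ?e" and s: "arr D s" "src s = fst W" "tgt s = fst V" "?e \<star> s \<star> ?e = ?e"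
    using a by (auto simp: allowable_iff regular_def)
  note [simp] = zmorD(1)[OF z] s(1-3)
  obtain Q q k where Q: "Q \<in> Obj ZF" "zmor W Q q" and k: "arr D k" "src k = fst Q" "tgt k = fst W"
    and kq: "k \<star> q = \<iota> (fst W) \<boxplus> (- 1) \<boxdot> (?e \<star> s)" and qe: "q \<star> ?e = zr D (fst V) (fst Q)"
    using zcoker_split[OF V z s] by auto
  have "q \<star> ?e = zr D (fst W) (fst Q) \<star> ?e" using qe Q by simp
  hence "q = zr D (fst W) (fst Q)"
    using e Q zmor_zr[OF V(2) Q(1)] unfolding epic_iff[OF V] by blast
  hence "\<iota> (fst W) \<boxplus> (- 1) \<boxdot> (?e \<star> s) = zr D (fst W) (fst W)" using kq k Q by simp
  hence "?e \<star> s = \<iota> (fst W)" using D.pls_neg_eq_zr_iff[of "\<iota> (fst W)" "?e \<star> s"] by simp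
  thus ?thesis using s by blast
qed

section \<open>Free objects and relative projectivity\<close>

lemma split_epic_allowable:
  assumes V [simp]: "V \<in> Obj ZF" "W \<in> Obj ZF" and z: "zmor V W e"
    and s: "arr D s" "src s = fst W" "tgt s = fst V" "e \<star> s = \<iota> (fst W)"
  shows "epic ZF V W (und e)" "allowable ZF D forgetful V W (und e)"
proof -
  note [simp] = zmorD(1-3)[OF z] s(1-3)
  have "g = h" if "zmor W T g" "zmor W T h" "g \<star> e = h \<star> e" for g h T
    by (rule arr_eq_cmp[OF that(3) D.linear_category_axioms, of s]) (use zmorD(1-3)[OF that(1)] zmorD(1-3)[OF that(2)] s in simp_all)
  thus "epic ZF V W (und e)" using z by (auto simp: epic_iff zt_und)
  have "e \<star> s \<star> e = e" using D.cmp_assoc_eq[OF s(4), of e] by simp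
  thus "allowable ZF D forgetful V W (und e)" using z by (auto simp: allowable_iff zt_und regular_def intro!: exI[of _ s])
qed

text \<open>A lift exists in \<open>D\<close> because e has a section s there. Restricted to M along
  the unit and extended by freeness it becomes a morphism h, and e h agrees with g on the
  unit.\<close>

lemma free_rel_projective:
  assumes M [simp]: "M \<in> Obj D" shows "rel_projective ZF D forgetful (free M)"
  unfolding rel_projective_def
proof (intro conjI ballI allI impI)
  fix V W e g
  assume V [simp]: "V \<in> Obj ZF" "W \<in> Obj ZF" and "epic ZF V W e \<and> allowable ZF D forgetful V W e"
  hence e: "epic ZF V W e" "allowable ZF D forgetful V W e" by simp_all
  assume g: "g \<in> Mor ZF (free M) W"
  have z: "zmor V W (zt V e W)" using e(2) by (simp add: allowable_iff)
  have gz: "zmor (free M) W (zt (free M) g W)" using g by (simp add: Mor_ZF')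
  note [simp] = zmorD(1)[OF z] zmorD(1)[OF gz]
  obtain s where s [simp]: "arr D s" "src s = fst W" "tgt s = fst V" and es: "zt V e W \<star> s = \<iota> (fst W)"
    using epic_allowable_split[OF V e] by blast
  obtain h where h: "zmor (free M) V h" "h \<star> unt M = s \<star> zt (free M) g W \<star> unt M"
    using free_extend[of M V "s \<star> zt (free M) g W \<star> unt M"] by auto
  note [simp] = zmorD(1-3)[OF h(1)]
  have "(zt V e W \<star> h) \<star> unt M = zt (free M) g W \<star> unt M"
    using D.cmp_assoc_eq[OF es, of "zt (free M) g W \<star> unt M"] by (simp add: h(2))
  hence "zt V e W \<star> h = zt (free M) g W"
    by (rule free_unique[OF M V(2) zmor_cmp[OF h(1) z] gz, rotated 3]) simp_all
  hence "e \<cdot>\<^bsub>ZF\<^esub> und h = g" using arg_cong[of "zt V e W \<star> h" "zt (free M) g W" und] by (simp add: Comp_ZF cmp_def zt_def)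
  thus "\<exists>h\<in>Mor ZF (free M) V. e \<cdot>\<^bsub>ZF\<^esub> h = g" using h(1) by (intro bexI[of _ "und h"]) (simp_all add: Mor_ZF_und)
qed simp

definition counit :: "'p \<times> ('o \<Rightarrow> 'n) \<Rightarrow> 'p \<times> 'n \<times> 'p" where
  "counit V = (SOME e. zmor (free (fst V)) V e \<and> e \<star> unt (fst V) = \<iota> (fst V))"

lemma counit:
  assumes "V \<in> Obj ZF"
  shows "zmor (free (fst V)) V (counit V)" "counit V \<star> unt (fst V) = \<iota> (fst V)"
proof -
  have "\<exists>e. zmor (free (fst V)) V e \<and> e \<star> unt (fst V) = \<iota> (fst V)"
    using assms by (intro free_extend) simp_all
  hence "zmor (free (fst V)) V (counit V) \<and> counit V \<star> unt (fst V) = \<iota> (fst V)"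
    unfolding counit_def by (rule someI_ex)
  thus "zmor (free (fst V)) V (counit V)" "counit V \<star> unt (fst V) = \<iota> (fst V)" by simp_all
qed

lemma counit_simps [simp]:
  "V \<in> Obj ZF \<Longrightarrow> arr D (counit V)" "V \<in> Obj ZF \<Longrightarrow> src (counit V) = Zo (fst V)" "V \<in> Obj ZF \<Longrightarrow> tgt (counit V) = fst V"
  using zmorD(1-3)[OF counit(1)] by simp_all

text \<open>The unit splits the counit in \<open>D\<close>, so the counit is an allowable
  epimorphism onto P and the identity of P lifts along it.\<close>

lemma rel_projective_retract:
  assumes P: "rel_projective ZF D forgetful P"
  shows "\<exists>i. zmor P (free (fst P)) i \<and> counit P \<star> i = \<iota> (fst P)"
proof -
  have PO [simp]: "P \<in> Obj ZF" using P by (simp add: rel_projective_def)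
  have "epic ZF (free (fst P)) P (und (counit P))" "allowable ZF D forgetful (free (fst P)) P (und (counit P))"
    by (rule split_epic_allowable[OF _ PO counit(1), of "unt (fst P)"]; simp add: counit)+
  moreover have "Ident D (fst P) \<in> Mor ZF P P"
    using zmor_idt[OF PO] by (simp add: Mor_ZF idt_def)
  ultimately obtain h where h: "h \<in> Mor ZF P (free (fst P))" "und (counit P) \<cdot> h = Ident D (fst P)"
    using P unfolding rel_projective_def Comp_ZF by (metis Obj_fst PO free_obj)
  have "counit P \<star> zt P h (free (fst P)) = \<iota> (fst P)"
    using h(2) by (intro arrow_eqI) (simp_all add: cmp_def idt_def)
  thus ?thesis using h(1) by (auto simp: Mor_ZF')
qed

text \<open>A retraction in \<open>D\<close> is enough to cancel k in the intertwining condition; q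
  itself need not be a morphism of the centralizer.\<close>

lemma zmor_cancel_mono:
  assumes T [simp]: "T \<in> Obj ZF" "K \<in> Obj ZF" "P \<in> Obj ZF" and k: "zmor K P k" and q [simp]: "arr D q" "src q = fst P" "tgt q = fst K"
    and qk: "q \<star> k = \<iota> (fst K)" and u [simp]: "arr D u" "src u = fst T" "tgt u = fst K" and ku: "zmor T P (k \<star> u)"
  shows "zmor T K u"
proof (rule zmorI)
  fix X assume X [simp]: "X \<in> Obj C"
  note [simp] = zmorD(1-3)[OF k]
  have "(\<iota> (Fo X) \<otimes>\<^sub>a k) \<star> ((\<iota> (Fo X) \<otimes>\<^sub>a u) \<star> br T X) = (\<iota> (Fo X) \<otimes>\<^sub>a (k \<star> u)) \<star> br T X"
    by (simp add: D.tns_cmp_left)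
  also have "\<dots> = br P X \<star> ((k \<otimes>\<^sub>a \<iota> (Fo X)) \<star> (u \<otimes>\<^sub>a \<iota> (Fo X)))"
    unfolding zmorD(4)[OF ku X] by (simp add: D.tns_cmp_right)
  also have "\<dots> = ((\<iota> (Fo X) \<otimes>\<^sub>a k) \<star> br K X) \<star> (u \<otimes>\<^sub>a \<iota> (Fo X))"
    unfolding zmorD(4)[OF k X] by simp
  finally have "(\<iota> (Fo X) \<otimes>\<^sub>a q) \<star> ((\<iota> (Fo X) \<otimes>\<^sub>a k) \<star> ((\<iota> (Fo X) \<otimes>\<^sub>a u) \<star> br T X))
      = (\<iota> (Fo X) \<otimes>\<^sub>a q) \<star> ((\<iota> (Fo X) \<otimes>\<^sub>a k) \<star> (br K X \<star> (u \<otimes>\<^sub>a \<iota> (Fo X))))" by simp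
  thus "(\<iota> (Fo X) \<otimes>\<^sub>a u) \<star> br T X = br K X \<star> (u \<otimes>\<^sub>a \<iota> (Fo X))"
    by (simp add: D.interchange' qk D.cmp_assoc_eq[OF qk])
qed simp_all

lemma zmor_cancel_epi:
  assumes T [simp]: "T \<in> Obj ZF" "K \<in> Obj ZF" "P \<in> Obj ZF" and e: "zmor P K e" and c [simp]: "arr D c" "src c = fst K" "tgt c = fst P"
    and ec: "e \<star> c = \<iota> (fst K)" and u [simp]: "arr D u" "src u = fst K" "tgt u = fst T" and ue: "zmor P T (u \<star> e)"
  shows "zmor K T u"
proof (rule zmorI)
  fix X assume X [simp]: "X \<in> Obj C"
  note [simp] = zmorD(1-3)[OF e]
  have "((\<iota> (Fo X) \<otimes>\<^sub>a u) \<star> br K X) \<star> (e \<otimes>\<^sub>a \<iota> (Fo X)) = (\<iota> (Fo X) \<otimes>\<^sub>a u) \<star> (br K X \<star> (e \<otimes>\<^sub>a \<iota> (Fo X)))"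
    by simp
  also have "\<dots> = (\<iota> (Fo X) \<otimes>\<^sub>a (u \<star> e)) \<star> br P X"
    unfolding zmorD(4)[OF e X, symmetric] by (simp add: D.tns_cmp_left)
  also have "\<dots> = (br T X \<star> (u \<otimes>\<^sub>a \<iota> (Fo X))) \<star> (e \<otimes>\<^sub>a \<iota> (Fo X))"
    unfolding zmorD(4)[OF ue X] by (simp add: D.tns_cmp_right)
  finally have eq: "((\<iota> (Fo X) \<otimes>\<^sub>a u) \<star> br K X) \<star> (e \<otimes>\<^sub>a \<iota> (Fo X)) = (br T X \<star> (u \<otimes>\<^sub>a \<iota> (Fo X))) \<star> (e \<otimes>\<^sub>a \<iota> (Fo X))" .
  show "(\<iota> (Fo X) \<otimes>\<^sub>a u) \<star> br K X = br T X \<star> (u \<otimes>\<^sub>a \<iota> (Fo X))"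
    by (rule arr_eq_cmp[OF eq D.linear_category_axioms, of "c \<otimes>\<^sub>a \<iota> (Fo X)"]) (simp_all add: D.interchange ec)
qed simp_all

text \<open>One step of the canonical resolution: \<open>syz K\<close> is the kernel of \<open>counit K\<close>.\<close>

lemma ex_syzygy:
  assumes K [simp]: "K \<in> Obj ZF"
  shows "\<exists>L k q. L \<in> Obj ZF \<and> zmor L (free (fst K)) k \<and> arr D q \<and> src q = Zo (fst K) \<and> tgt q = fst L \<and>
    q \<star> k = \<iota> (fst L) \<and> k \<star> q = \<iota> (Zo (fst K)) \<boxplus> (- 1) \<boxdot> (unt (fst K) \<star> counit K) \<and> counit K \<star> k = zr D (fst L) (fst K)"
proof -
  have "counit K \<star> unt (fst K) \<star> counit K = counit K"
    using D.cmp_assoc_eq[OF counit(2)[OF K], of "counit K"] by simp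
  thus ?thesis using zker_split[of "free (fst K)" K "counit K" "unt (fst K)"] counit(1)[OF K] by simp
qed

definition syz_step where
  "syz_step K = (SOME (L, k, q). L \<in> Obj ZF \<and> zmor L (free (fst K)) k \<and> arr D q \<and> src q = Zo (fst K) \<and> tgt q = fst L \<and>
    q \<star> k = \<iota> (fst L) \<and> k \<star> q = \<iota> (Zo (fst K)) \<boxplus> (- 1) \<boxdot> (unt (fst K) \<star> counit K) \<and> counit K \<star> k = zr D (fst L) (fst K))"

definition "syz K = fst (syz_step K)"
definition "syz_in K = fst (snd (syz_step K))"
definition "syz_pr K = snd (snd (syz_step K))"

lemma syz:
  assumes K [simp]: "K \<in> Obj ZF"
  shows "syz K \<in> Obj ZF" "zmor (syz K) (free (fst K)) (syz_in K)"
    "arr D (syz_pr K)" "src (syz_pr K) = Zo (fst K)" "tgt (syz_pr K) = fst (syz K)"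
    "syz_pr K \<star> syz_in K = \<iota> (fst (syz K))"
    "syz_in K \<star> syz_pr K = \<iota> (Zo (fst K)) \<boxplus> (- 1) \<boxdot> (unt (fst K) \<star> counit K)"
    "counit K \<star> syz_in K = zr D (fst (syz K)) (fst K)"
proof -
  let ?P = "\<lambda>(L, k, q). L \<in> Obj ZF \<and> zmor L (free (fst K)) k \<and> arr D q \<and> src q = Zo (fst K) \<and> tgt q = fst L \<and>
    q \<star> k = \<iota> (fst L) \<and> k \<star> q = \<iota> (Zo (fst K)) \<boxplus> (- 1) \<boxdot> (unt (fst K) \<star> counit K) \<and> counit K \<star> k = zr D (fst L) (fst K)"
  obtain L k q where "?P (L, k, q)" using ex_syzygy[OF K] by auto
  hence "?P (syz_step K)" unfolding syz_step_def by (rule someI)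
  hence "?P (syz K, syz_in K, syz_pr K)" by (simp add: syz_def syz_in_def syz_pr_def split_beta)
  thus "syz K \<in> Obj ZF" "zmor (syz K) (free (fst K)) (syz_in K)"
    "arr D (syz_pr K)" "src (syz_pr K) = Zo (fst K)" "tgt (syz_pr K) = fst (syz K)"
    "syz_pr K \<star> syz_in K = \<iota> (fst (syz K))"
    "syz_in K \<star> syz_pr K = \<iota> (Zo (fst K)) \<boxplus> (- 1) \<boxdot> (unt (fst K) \<star> counit K)"
    "counit K \<star> syz_in K = zr D (fst (syz K)) (fst K)"
    by simp_all
qed

lemma syz_simps [simp]:
  assumes "K \<in> Obj ZF"
  shows "syz K \<in> Obj ZF" "arr D (syz_in K)" "src (syz_in K) = fst (syz K)" "tgt (syz_in K) = Zo (fst K)"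
    "arr D (syz_pr K)" "src (syz_pr K) = Zo (fst K)" "tgt (syz_pr K) = fst (syz K)"
  using syz[OF assms] zmorD(1-3)[OF syz(2)[OF assms]] by simp_all

text \<open>A split monomorphism m after the counit does not change the kernel. In the resolution m
  is the identity where the kernel of a counit is wanted, and the inclusion of the previous syzygy
  where that of a differential is.\<close>

lemma syz_kernel:
  assumes K [simp]: "K \<in> Obj ZF" and W [simp]: "W \<in> Obj ZF" and m: "zmor K W m"
    and l: "arr D l" "src l = fst W" "tgt l = fst K" "l \<star> m = \<iota> (fst K)"
  shows "is_kernel ZF (free (fst K)) W (und (m \<star> counit K)) (syz K) (und (syz_in K))"
proof -
  note [simp] = zmorD(1-3)[OF m] l(1-3)
  have z: "zmor (free (fst K)) W (m \<star> counit K)" by (rule zmor_cmp[OF counit(1) m]) simp_all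
  have uni: "\<exists>!u. zmor T (syz K) u \<and> syz_in K \<star> u = h"
    if T [simp]: "T \<in> Obj ZF" and h: "zmor T (free (fst K)) h" "(m \<star> counit K) \<star> h = zr D (fst T) (fst W)" for T h
  proof -
    note [simp] = zmorD(1-3)[OF h(1)]
    have "l \<star> ((m \<star> counit K) \<star> h) = counit K \<star> h"
      using D.cmp_assoc_eq[OF l(4), of "counit K \<star> h"] by simp
    hence 0: "counit K \<star> h = zr D (fst T) (fst K)" by (simp add: h(2))
    have eq: "syz_in K \<star> (syz_pr K \<star> h) = h"
      using D.cmp_assoc_eq[OF syz(7)[OF K], of h] by (simp add: D.cmp_pls_left 0)
    show ?thesis
    proof (rule ex1I[of _ "syz_pr K \<star> h"], goal_cases)
      case 1
      have "zmor T (syz K) (syz_pr K \<star> h)"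
        by (rule zmor_cancel_mono[OF T _ _ syz(2)[OF K], of "syz_pr K"]) (simp_all add: syz eq h(1))
      thus ?case using eq by simp
    next
      case (2 v)
      note [simp] = zmorD(1-3)[OF conjunct1[OF 2]]
      show ?case using D.cmp_assoc_eq[OF syz(6)[OF K], of v] 2 by simp
    qed
  qed
  show ?thesis
    unfolding is_kernel_iff[OF free_obj[OF Obj_fst[OF K]] W]
    using z uni syz(1,2)[OF K] by (simp add: zt_und syz(8))
qed

text \<open>If h kills the differential, precomposition with the unit shows that h kills
  \<open>syz_in K\<close>. Hence it kills \<open>syz_in K \<star> syz_pr K\<close>, which is 1 minus
  unit after counit, and h factors through the counit with factor h after the unit.\<close>

lemma syz_cokernel:
  assumes K [simp]: "K \<in> Obj ZF"
  shows "is_cokernel ZF (free (fst (syz K))) (free (fst K)) (und (syz_in K \<star> counit (syz K))) K (und (counit K))"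
proof -
  have z: "zmor (free (fst (syz K))) (free (fst K)) (syz_in K \<star> counit (syz K))"
    by (rule zmor_cmp[OF counit(1) syz(2)]) simp_all
  have 0: "counit K \<star> syz_in K \<star> counit (syz K) = zr D (Zo (fst (syz K))) (fst K)"
    using D.cmp_assoc_eq[OF syz(8)[OF K], of "counit (syz K)"] by simp
  have uni: "\<exists>!u. zmor K T u \<and> u \<star> counit K = h"
    if T [simp]: "T \<in> Obj ZF" and h: "zmor (free (fst K)) T h" "h \<star> syz_in K \<star> counit (syz K) = zr D (Zo (fst (syz K))) (fst T)" for T h
  proof -
    note [simp] = zmorD(1-3)[OF h(1)]
    have "(h \<star> syz_in K \<star> counit (syz K)) \<star> unt (fst (syz K)) = h \<star> syz_in K"
      by (simp add: counit)
    hence hk: "h \<star> syz_in K = zr D (fst (syz K)) (fst T)" unfolding h(2) by simp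
    have "h \<star> (syz_in K \<star> syz_pr K) = zr D (Zo (fst K)) (fst T)"
      using D.cmp_assoc_eq[OF hk, of "syz_pr K"] by simp
    hence "h \<boxplus> (- 1) \<boxdot> (h \<star> unt (fst K) \<star> counit K) = zr D (Zo (fst K)) (fst T)"
      by (simp add: syz(7) D.cmp_pls_right)
    hence eq: "(h \<star> unt (fst K)) \<star> counit K = h"
      using D.pls_neg_eq_zr_iff[of h "h \<star> unt (fst K) \<star> counit K"] by simp
    show ?thesis
    proof (rule ex1I[of _ "h \<star> unt (fst K)"], goal_cases)
      case 1
      have "zmor K T (h \<star> unt (fst K))"
        by (rule zmor_cancel_epi[OF T _ _ counit(1)[OF K], of "unt (fst K)"])
          (use eq h(1) in \<open>simp_all add: counit\<close>)
      thus ?case using eq by simp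
    next
      case (2 v)
      note [simp] = zmorD(1-3)[OF conjunct1[OF 2]]
      have "(v \<star> counit K) \<star> unt (fst K) = v" by (simp add: counit)
      thus ?case using 2 by simp
    qed
  qed
  show ?thesis
    unfolding is_cokernel_iff[OF free_obj[OF Obj_fst[OF syz(1)[OF K]]] free_obj[OF Obj_fst[OF K]]]
    using z uni counit(1)[OF K] 0 by (simp add: zt_und)
qed

lemma ex_resolution:
  assumes V [simp]: "V \<in> Obj ZF"
  shows "\<exists>P d \<epsilon>. rel_projective_resolution ZF D forgetful V P d \<epsilon>"
proof -
  define K where "K n = (syz ^^ n) V" for n
  have K [simp]: "K n \<in> Obj ZF" for n by (induction n) (simp_all add: K_def)
  have KS: "K (Suc n) = syz (K n)" for n by (simp add: K_def)
  have K0: "K 0 = V" by (simp add: K_def)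
  define P where "P n = free (fst (K n))" for n
  have P [simp]: "P n \<in> Obj ZF" for n by (simp add: P_def)
  define d where "d n = und (syz_in (K n) \<star> counit (K (Suc n)))" for n
  have dz: "zmor (P (Suc n)) (P n) (syz_in (K n) \<star> counit (syz (K n)))" for n
    unfolding P_def KS by (rule zmor_cmp[OF counit(1) syz(2)]) simp_all
  have ker0: "is_kernel ZF (P n) (K n) (und (counit (K n))) (K (Suc n)) (und (syz_in (K n)))" for n
    using syz_kernel[OF K[of n] K[of n] zmor_idt[OF K[of n]], of "\<iota> (fst (K n))"] by (simp add: P_def KS)
  have ker1: "is_kernel ZF (P (Suc n)) (P n) (d n) (K (Suc (Suc n))) (und (syz_in (K (Suc n))))" for n
    using syz_kernel[OF syz(1)[OF K[of n]] free_obj[OF Obj_fst[OF K[of n]]] syz(2)[OF K[of n]], of "syz_pr (K n)"]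
    by (simp add: P_def KS d_def syz)
  have coker: "is_cokernel ZF (P (Suc n)) (P n) (d n) (K n) (und (counit (K n)))" for n
    using syz_cokernel[OF K[of n]] by (simp add: P_def KS d_def)
  have eps: "epic ZF (P 0) V (und (counit V))" "allowable ZF D forgetful (P 0) V (und (counit V))"
    using split_epic_allowable[OF P V, of 0 "counit V" "unt (fst V)"] counit[OF V] by (simp_all add: P_def K0)
  have "rel_projective_resolution ZF D forgetful V P d (und (counit V))"
    unfolding rel_projective_resolution_def
  proof (intro conjI allI)
    show "rel_projective ZF D forgetful (P n)" for n by (simp add: P_def free_rel_projective)
    show "allowable ZF D forgetful (P 0) V (und (counit V))" "epic ZF (P 0) V (und (counit V))" by (rule eps)+
    show "allowable ZF D forgetful (P (Suc n)) (P n) (d n)" for n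
    proof -
      \<comment> \<open>The differential is a split epimorphism followed by a split monomorphism,
        and the two splittings compose to an inner inverse.\<close>
      let ?f = "syz_in (K n) \<star> counit (syz (K n))" and ?s = "unt (fst (syz (K n))) \<star> syz_pr (K n)"
      have "?f \<star> ?s \<star> ?f = syz_in (K n) \<star> ((counit (syz (K n)) \<star> unt (fst (syz (K n)))) \<star> ((syz_pr (K n) \<star> syz_in (K n)) \<star> counit (syz (K n))))"
        by simp
      also have "\<dots> = ?f" unfolding counit(2)[OF syz(1)[OF K]] syz(6)[OF K] by simp
      finally have "regular ?f ?s" by (simp add: regular_def)
      thus ?thesis using dz[of n] by (auto simp: allowable_iff zt_und d_def KS)
    qed
    \<comment> \<open>Witnesses for exactness: the counit is the cokernel of the incoming arrow, and
      \<open>syz_in\<close> is a kernel both of that counit and of the outgoing arrow.\<close>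
    show "exact_at ZF (P 1) (P 0) V (d 0) (und (counit V))"
      using coker[of 0] ker0[of 0] unfolding exact_at_def K0 by auto
    show "exact_at ZF (P (Suc (Suc n))) (P (Suc n)) (P n) (d (Suc n)) (d n)" for n
      using coker[of "Suc n"] ker0[of "Suc n"] ker1[of n] unfolding exact_at_def by blast
  qed
  thus ?thesis by blast
qed

text \<open>1 - t g projects onto the split kernel k of g, and 1 - f s onto the split cokernel r of
  f. By exactness k factors through the image i and r through the cokernel p of f, where p i = 0; so
  r k = 0. These equations in \<open>D\<close> are what \<open>row_exact\<close> draws from
  exactness.\<close>

lemma exact_split:
  assumes X [simp]: "X \<in> Obj ZF" "Y \<in> Obj ZF" "Z \<in> Obj ZF" and ex: "exact_at ZF X Y Z f g"
    and s: "regular (zt X f Y) s" and t: "regular (zt Y g Z) t"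
  shows "zt Y g Z \<star> zt X f Y = zr D (fst X) (fst Z)"
    "(\<iota> (fst Y) \<boxplus> (- 1) \<boxdot> (zt X f Y \<star> s)) \<star> (\<iota> (fst Y) \<boxplus> (- 1) \<boxdot> (t \<star> zt Y g Z)) = zr D (fst Y) (fst Y)"
proof -
  let ?f = "zt X f Y" and ?g = "zt Y g Z"
  obtain Q p I i where co: "is_cokernel ZF X Y f Q p" and kp: "is_kernel ZF Y Q p I i" and kg: "is_kernel ZF Y Z g I i"
    using ex by (auto simp: exact_at_def)
  have Q [simp]: "Q \<in> Obj ZF" and zf: "zmor X Y ?f" and zp: "zmor Y Q (zt Y p Q)" and pf: "zt Y p Q \<star> ?f = zr D (fst X) (fst Q)"
    using co by (simp_all add: is_cokernel_iff)
  have I [simp]: "I \<in> Obj ZF" and zi: "zmor I Y (zt I i Y)" and pi: "zt Y p Q \<star> zt I i Y = zr D (fst I) (fst Q)"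
    using kp by (simp_all add: is_kernel_iff)
  have zg: "zmor Y Z ?g" and gi: "?g \<star> zt I i Y = zr D (fst I) (fst Z)"
    using kg by (simp_all add: is_kernel_iff)
  note [simp] = zmorD(1)[OF zf] zmorD(1)[OF zg] zmorD(1)[OF zp] zmorD(1)[OF zi]
  have st [simp]: "arr D s" "src s = fst Y" "tgt s = fst X" "arr D t" "src t = fst Z" "tgt t = fst Y"
    and st': "?f \<star> s \<star> ?f = ?f" "?g \<star> t \<star> ?g = ?g"
    using s t by (simp_all add: regular_def)
  obtain u where u: "zmor X I u" "zt I i Y \<star> u = ?f" using kp zf pf unfolding is_kernel_iff[OF X(2) Q] by (metis X(1))
  have "?g \<star> (zt I i Y \<star> u) = zr D (fst X) (fst Z)"
    using D.cmp_assoc_eq[OF gi, of u] zmorD(1-3)[OF u(1)] by simp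
  thus "?g \<star> ?f = zr D (fst X) (fst Z)" by (simp add: u(2))
  obtain K k q where K [simp]: "K \<in> Obj ZF" and k: "zmor K Y k" and q [simp]: "arr D q" "src q = fst Y" "tgt q = fst K"
    and kq: "k \<star> q = \<iota> (fst Y) \<boxplus> (- 1) \<boxdot> (t \<star> ?g)" and gk: "?g \<star> k = zr D (fst K) (fst Z)"
    using zker_split[OF X(2,3) zg st(4,5,6) st'(2)] by auto
  obtain R r j where R [simp]: "R \<in> Obj ZF" and r: "zmor Y R r" and j [simp]: "arr D j" "src j = fst R" "tgt j = fst Y"
    and jr: "j \<star> r = \<iota> (fst Y) \<boxplus> (- 1) \<boxdot> (?f \<star> s)" and rf: "r \<star> ?f = zr D (fst X) (fst R)"
    using zcoker_split[OF X(1,2) zf st(1,2,3) st'(1)] by auto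
  note [simp] = zmorD(1-3)[OF k] zmorD(1-3)[OF r]
  obtain v where v: "zmor K I v" "zt I i Y \<star> v = k" using kg k gk unfolding is_kernel_iff[OF X(2,3)] by (metis K)
  obtain w where w: "zmor Q R w" "w \<star> zt Y p Q = r" using co r rf unfolding is_cokernel_iff[OF X(1,2)] by (metis R)
  note [simp] = zmorD(1-3)[OF v(1)] zmorD(1-3)[OF w(1)]
  have "r \<star> k = (w \<star> zt Y p Q) \<star> (zt I i Y \<star> v)" by (simp only: v w)
  also have "\<dots> = w \<star> ((zt Y p Q \<star> zt I i Y) \<star> v)" by simp
  also have "\<dots> = zr D (fst K) (fst R)" unfolding pi by simp
  finally have rk: "r \<star> k = zr D (fst K) (fst R)" .
  have "(j \<star> r) \<star> (k \<star> q) = j \<star> ((r \<star> k) \<star> q)" by simp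
  also have "\<dots> = zr D (fst Y) (fst Y)" unfolding rk by simp
  finally show "(\<iota> (fst Y) \<boxplus> (- 1) \<boxdot> (?f \<star> s)) \<star> (\<iota> (fst Y) \<boxplus> (- 1) \<boxdot> (t \<star> ?g)) = zr D (fst Y) (fst Y)"
    unfolding kq jr .
qed

end

section \<open>Davydov--Yetter cochains\<close>

text \<open>The endpoints are arguments because the empty sum must know which zero arrow it
  is.\<close>

primrec arr_sum :: "('k, 'o, 'm, 'z) lin_cat_scheme \<Rightarrow> 'o \<Rightarrow> 'o \<Rightarrow> nat \<Rightarrow> (nat \<Rightarrow> 'o \<times> 'm \<times> 'o) \<Rightarrow> 'o \<times> 'm \<times> 'o" where
  "arr_sum C A B 0 g = zr C A B"
| "arr_sum C A B (Suc n) g = arr_sum C A B n g \<boxplus>\<^bsub>C\<^esub> g n"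

definition homs :: "('k, 'o, 'm, 'z) lin_cat_scheme \<Rightarrow> 'o \<Rightarrow> 'o \<Rightarrow> nat \<Rightarrow> (nat \<Rightarrow> 'o \<times> 'm \<times> 'o) \<Rightarrow> bool" where
  "homs C A B n g \<longleftrightarrow> A \<in> Obj C \<and> B \<in> Obj C \<and> (\<forall>i<n. arr C (g i) \<and> src (g i) = A \<and> tgt (g i) = B)"

lemma homsI: "A \<in> Obj C \<Longrightarrow> B \<in> Obj C \<Longrightarrow> (\<And>i. i < n \<Longrightarrow> arr C (g i)) \<Longrightarrow> (\<And>i. i < n \<Longrightarrow> src (g i) = A) \<Longrightarrow>
    (\<And>i. i < n \<Longrightarrow> tgt (g i) = B) \<Longrightarrow> homs C A B n g"
  by (simp add: homs_def)

lemma arr_sum_src_tgt [simp]: "src (arr_sum C A B n g) = A" "tgt (arr_sum C A B n g) = B"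
  by (induction n) simp_all

lemma arr_sum_cong: "(\<And>i. i < n \<Longrightarrow> g i = h i) \<Longrightarrow> arr_sum C A B n g = arr_sum C A B n h"
  by (induction n) simp_all

context linear_category
begin

lemma arr_arr_sum: "homs C A B n g \<Longrightarrow> arr C (arr_sum C A B n g)"
  by (induction n) (simp_all add: homs_def)

lemma cmp_arr_sum_right: "homs C A B n g \<Longrightarrow> arr C h \<Longrightarrow> src h = B \<Longrightarrow> h \<star> arr_sum C A B n g = arr_sum C A (tgt h) n (\<lambda>i. h \<star> g i)"
proof (induction n)
  case (Suc n)
  hence "homs C A B n g" by (simp add: homs_def)
  thus ?case using Suc arr_arr_sum[of A B n g] by (simp add: homs_def cmp_pls_right)
qed (simp add: homs_def)

lemma cmp_arr_sum_left: "homs C A B n g \<Longrightarrow> arr C h \<Longrightarrow> tgt h = A \<Longrightarrow> arr_sum C A B n g \<star> h = arr_sum C (src h) B n (\<lambda>i. g i \<star> h)"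
proof (induction n)
  case (Suc n)
  hence "homs C A B n g" by (simp add: homs_def)
  thus ?case using Suc arr_arr_sum[of A B n g] by (simp add: homs_def cmp_pls_left)
qed (simp add: homs_def)

lemma scl_arr_sum: "homs C A B n g \<Longrightarrow> c \<boxdot> arr_sum C A B n g = arr_sum C A B n (\<lambda>i. c \<boxdot> g i)"
proof (induction n)
  case (Suc n)
  hence "homs C A B n g" by (simp add: homs_def)
  thus ?case using Suc arr_arr_sum[of A B n g] by (simp add: homs_def scl_pls)
qed (simp add: homs_def)

lemma pls_swap:
  assumes "arr C a" "arr C b" "arr C c" "arr C d" "src a = A" "src b = A" "src c = A" "src d = A"
    "tgt a = B" "tgt b = B" "tgt c = B" "tgt d = B"
  shows "(a \<boxplus> b) \<boxplus> (c \<boxplus> d) = (a \<boxplus> c) \<boxplus> (b \<boxplus> d)"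
  using assms by (simp add: pls_assoc pls_lcomm[of b c d])

lemma arr_sum_pls: "homs C A B n g \<Longrightarrow> homs C A B n h \<Longrightarrow> arr_sum C A B n (\<lambda>i. g i \<boxplus> h i) = arr_sum C A B n g \<boxplus> arr_sum C A B n h"
proof (induction n)
  case (Suc n)
  hence "homs C A B n g" "homs C A B n h" by (simp_all add: homs_def)
  thus ?case using Suc arr_arr_sum[of A B n g] arr_arr_sum[of A B n h]
    by (simp add: homs_def pls_swap[of "arr_sum C A B n g" _ _ _ A B])
qed (simp add: homs_def)

lemma arr_sum_shift: "homs C A B (Suc n) g \<Longrightarrow> arr_sum C A B (Suc n) g = g 0 \<boxplus> arr_sum C A B n (\<lambda>i. g (Suc i))"
proof (induction n)
  case 0
  thus ?case by (simp add: homs_def)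
next
  case (Suc n)
  hence h: "homs C A B (Suc n) g" "homs C A B n (\<lambda>i. g (Suc i))" by (simp_all add: homs_def)
  have "arr_sum C A B (Suc (Suc n)) g = (g 0 \<boxplus> arr_sum C A B n (\<lambda>i. g (Suc i))) \<boxplus> g (Suc n)"
    using Suc.IH[OF h(1)] by simp
  also have "\<dots> = g 0 \<boxplus> (arr_sum C A B n (\<lambda>i. g (Suc i)) \<boxplus> g (Suc n))"
    using Suc.prems arr_arr_sum[OF h(2)] by (intro pls_assoc) (simp_all add: homs_def)
  finally show ?case by simp
qed

text \<open>The middle terms of the differential are numbered from 1 to n, those of
  \<open>arr_sum\<close> from 0; hence the \<open>Suc i\<close>.\<close>

lemma finsum_arr_sum:
  assumes A: "A \<in> Obj C" "B \<in> Obj C" and h: "\<And>i. i < n \<Longrightarrow> h (Suc i) \<in> Mor C A B"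
  shows "mk A (\<Oplus>\<^bsub>HomV C A B\<^esub>i\<in>{1..n}. h i) B = arr_sum C A B n (\<lambda>i. mk A (h (Suc i)) B)"
  using h
proof (induction n)
  interpret vectorspace class_ring "HomV C A B" using A by simp
  {
    case 0
    show ?case by (simp add: zr_def)
  next
    case (Suc n)
    have in': "h i \<in> Mor C A B" if "i \<in> {1..Suc n}" for i
      using that Suc.prems[of "i - 1"] by (cases i) auto
    have s: "{1..Suc n} = insert (Suc n) {1..n}" by auto
    have "(\<Oplus>\<^bsub>HomV C A B\<^esub>i\<in>{1..Suc n}. h i) = h (Suc n) \<oplus>\<^bsub>HomV C A B\<^esub> (\<Oplus>\<^bsub>HomV C A B\<^esub>i\<in>{1..n}. h i)"
      unfolding s using in' by (intro finsum_insert) auto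
    also have "\<dots> = (\<Oplus>\<^bsub>HomV C A B\<^esub>i\<in>{1..n}. h i) \<oplus>\<^bsub>HomV C A B\<^esub> h (Suc n)"
      using in' by (intro a_comm finsum_closed) auto
    finally show ?case using Suc by (simp add: pls_def flip: Suc.IH)
  }
qed

end

lemma (in strict_monoidal_category) tns_arr_sum_right:
  "homs C A B n g \<Longrightarrow> arr C h \<Longrightarrow> h \<otimes>\<^sub>a arr_sum C A B n g = arr_sum C (src h \<otimes>\<^sub>o A) (tgt h \<otimes>\<^sub>o B) n (\<lambda>i. h \<otimes>\<^sub>a g i)"
proof (induction n)
  case (Suc n)
  hence "homs C A B n g" by (simp add: homs_def)
  thus ?case using Suc arr_arr_sum[of A B n g] by (simp add: homs_def tns_pls_right)
qed (simp add: homs_def)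

section \<open>Lists of objects and of arrows\<close>

lemma obj_lists_Nil [simp]: "Xs \<in> obj_lists C 0 \<longleftrightarrow> Xs = []"
  by (auto simp: obj_lists_def)

lemma obj_lists_Cons [simp]: "X # Xs \<in> obj_lists C (Suc n) \<longleftrightarrow> X \<in> Obj C \<and> Xs \<in> obj_lists C n"
  by (auto simp: obj_lists_def)

lemma obj_lists_snoc [simp]: "Xs @ [X] \<in> obj_lists C (Suc n) \<longleftrightarrow> X \<in> Obj C \<and> Xs \<in> obj_lists C n"
  by (auto simp: obj_lists_def)

lemma obj_lists_SucE:
  assumes "Xs \<in> obj_lists C (Suc n)"
  obtains X Ys where "Xs = X # Ys" "X \<in> Obj C" "Ys \<in> obj_lists C n"
  using assms by (cases Xs) (auto simp: obj_lists_def)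

lemma obj_lists_snocE:
  assumes "Xs \<in> obj_lists C (Suc n)"
  obtains X Ys where "Xs = Ys @ [X]" "X \<in> Obj C" "Ys \<in> obj_lists C n"
  using assms by (cases Xs rule: rev_cases) (auto simp: obj_lists_def)

lemma obj_lists_length: "Xs \<in> obj_lists C n \<Longrightarrow> length Xs = n"
  by (simp add: obj_lists_def)

lemma split_two:
  assumes "Suc i < length xs"
  shows "\<exists>as x y bs. xs = as @ x # y # bs \<and> length as = i"
proof -
  have "xs = take i xs @ xs ! i # xs ! Suc i # drop (Suc (Suc i)) xs"
    using assms by (metis Cons_nth_drop_Suc Suc_lessD append_take_drop_id)
  thus ?thesis using assms by (metis Suc_lessD length_take min.absorb4)
qed

lemma merge_at_split: "length as = i \<Longrightarrow> merge_at C (Suc i) (as @ x # y # bs) = as @ (x \<otimes>\<^sub>o\<^bsub>C\<^esub> y) # bs"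
  by (simp add: merge_at_def nth_append)

lemma merge_at_Cons: "merge_at C (Suc (Suc i)) (X # Xs) = X # merge_at C (Suc i) Xs"
  by (simp add: merge_at_def)

context tensor_functor
begin

abbreviation "T \<equiv> F_objs D F"

lemma T_simps [simp]: "T [] = UnitO D" "T (X # Xs) = Fo X \<otimes>\<^sub>o T Xs"
  by (simp_all add: F_objs_def tensor_objs_def)

lemma T_obj: "set Xs \<subseteq> Obj C \<Longrightarrow> T Xs \<in> Obj D"
  by (induction Xs) simp_all

lemma T_obj' [simp]: "Xs \<in> obj_lists C n \<Longrightarrow> T Xs \<in> Obj D"
  by (rule T_obj) (simp add: obj_lists_def)

lemma T_append: "set Xs \<subseteq> Obj C \<Longrightarrow> set Ys \<subseteq> Obj C \<Longrightarrow> T (Xs @ Ys) = T Xs \<otimes>\<^sub>o T Ys"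
  by (induction Xs) (simp_all add: T_obj)

lemma T_snoc [simp]: "Xs \<in> obj_lists C n \<Longrightarrow> X \<in> Obj C \<Longrightarrow> T (Xs @ [X]) = T Xs \<otimes>\<^sub>o Fo X"
  by (subst T_append) (auto simp: obj_lists_def)

lemma merge_at_obj:
  assumes Xs: "Xs \<in> obj_lists C (Suc n)" and i: "i < n"
  shows "merge_at C (Suc i) Xs \<in> obj_lists C n" "T (merge_at C (Suc i) Xs) = T Xs"
proof -
  have l: "Suc i < length Xs" using obj_lists_length[OF Xs] i by simp
  obtain as x y bs where s: "Xs = as @ x # y # bs" "length as = i" using split_two[OF l] by blast
  have o: "x \<in> Obj C" "y \<in> Obj C" "set as \<subseteq> Obj C" "set bs \<subseteq> Obj C" using Xs s by (auto simp: obj_lists_def)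
  show "merge_at C (Suc i) Xs \<in> obj_lists C n"
    using Xs o by (simp add: s merge_at_split) (simp add: obj_lists_def)
  show "T (merge_at C (Suc i) Xs) = T Xs"
    using o by (simp add: s merge_at_split T_append T_obj)
qed

text \<open>A family of arrows between the entries of two lists is held as one list of triples, in
  place of the three parallel lists \<open>Xs\<close>, \<open>Ys\<close>, \<open>gs\<close> in
  \<open>DY_cochains\<close>.\<close>

definition arrs :: "nat \<Rightarrow> ('o \<times> 'm \<times> 'o) list \<Rightarrow> bool" where
  "arrs n \<alpha> \<longleftrightarrow> length \<alpha> = n \<and> (\<forall>a\<in>set \<alpha>. arr C a)"

definition TM :: "('o \<times> 'm \<times> 'o) list \<Rightarrow> 'p \<times> 'n \<times> 'p" where
  "TM \<alpha> = foldr (\<lambda>a g. Fm a \<otimes>\<^sub>a g) \<alpha> (\<iota> (UnitO D))"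

lemma TM_simps [simp]: "TM [] = \<iota> (UnitO D)" "TM (a # \<alpha>) = Fm a \<otimes>\<^sub>a TM \<alpha>"
  by (simp_all add: TM_def)

lemma arrs_simps [simp]: "arrs 0 \<alpha> \<longleftrightarrow> \<alpha> = []" "arrs (Suc n) (a # \<alpha>) \<longleftrightarrow> arr C a \<and> arrs n \<alpha>"
  "arrs (Suc n) (\<alpha> @ [a]) \<longleftrightarrow> arr C a \<and> arrs n \<alpha>"
  by (auto simp: arrs_def)

lemma arrs_SucE:
  assumes "arrs (Suc n) \<alpha>" obtains a \<beta> where "\<alpha> = a # \<beta>" "arr C a" "arrs n \<beta>"
  using assms by (cases \<alpha>) (auto simp: arrs_def)

lemma arrs_snocE:
  assumes "arrs (Suc n) \<alpha>" obtains a \<beta> where "\<alpha> = \<beta> @ [a]" "arr C a" "arrs n \<beta>"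
  using assms by (cases \<alpha> rule: rev_cases) (auto simp: arrs_def)

lemma TM_arr: "\<forall>a\<in>set \<alpha>. arr C a \<Longrightarrow> arr D (TM \<alpha>) \<and> src (TM \<alpha>) = T (map src \<alpha>) \<and> tgt (TM \<alpha>) = T (map tgt \<alpha>)"
  by (induction \<alpha>) simp_all

lemma TM_arr' [simp]: "arrs n \<alpha> \<Longrightarrow> arr D (TM \<alpha>)" "arrs n \<alpha> \<Longrightarrow> src (TM \<alpha>) = T (map src \<alpha>)" "arrs n \<alpha> \<Longrightarrow> tgt (TM \<alpha>) = T (map tgt \<alpha>)"
  using TM_arr by (auto simp: arrs_def)

lemma arrs_objs [simp]: "arrs n \<alpha> \<Longrightarrow> map src \<alpha> \<in> obj_lists C n" "arrs n \<alpha> \<Longrightarrow> map tgt \<alpha> \<in> obj_lists C n"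
  by (auto simp: arrs_def obj_lists_def)

lemma arrs_rules:
  assumes "arrs n \<alpha>"
  shows "map src \<alpha> \<in> obj_lists C n" "map tgt \<alpha> \<in> obj_lists C n" "T (map src \<alpha>) \<in> Obj D" "T (map tgt \<alpha>) \<in> Obj D"
    "arr D (TM \<alpha>)" "src (TM \<alpha>) = T (map src \<alpha>)" "tgt (TM \<alpha>) = T (map tgt \<alpha>)"
  using arrs_objs[OF assms] T_obj' TM_arr'[OF assms] by blast+

lemma TM_append: "\<forall>a\<in>set \<alpha>. arr C a \<Longrightarrow> \<forall>a\<in>set \<beta>. arr C a \<Longrightarrow> TM (\<alpha> @ \<beta>) = TM \<alpha> \<otimes>\<^sub>a TM \<beta>"
  by (induction \<alpha>) (simp_all add: TM_arr)

lemma TM_snoc [simp]: "arrs n \<alpha> \<Longrightarrow> arr C a \<Longrightarrow> TM (\<alpha> @ [a]) = TM \<alpha> \<otimes>\<^sub>a Fm a"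
  by (subst TM_append) (auto simp: arrs_def)

lemma TM_idt: "set Xs \<subseteq> Obj C \<Longrightarrow> TM (map (idt C) Xs) = \<iota> (T Xs)"
  by (induction Xs) (simp_all add: T_obj)

lemma arrs_idt: "Xs \<in> obj_lists C n \<Longrightarrow> arrs n (map (idt C) Xs)"
  by (auto simp: obj_lists_def arrs_def)

lemma F_mors_Cons: "F_mors D F (X # Xs) (Y # Ys) (g # gs) = arr_map F X Y g \<otimes>\<^sub>m F_mors D F Xs Ys gs"
proof -
  have *: "[0..<Suc (length gs)] = 0 # map Suc [0..<length gs]" by (simp add: upt_conv_Cons map_Suc_upt del: upt_Suc)
  show ?thesis unfolding F_mors_def by (simp only: list.size(4) add_Suc_right add_0_right * list.map map_map) (simp add: tensor_mors_def comp_def)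
qed

lemma F_mors_TM: "mk (T (map src \<alpha>)) (F_mors D F (map src \<alpha>) (map tgt \<alpha>) (map und \<alpha>)) (T (map tgt \<alpha>)) = TM \<alpha>"
proof (induction \<alpha>)
  case Nil
  show ?case by (simp add: F_mors_def tensor_mors_def idt_def)
next
  case (Cons a \<alpha>)
  show ?case unfolding TM_simps Cons.IH[symmetric] by (simp add: F_mors_Cons tns_def fm_def)
qed

text \<open>A merged summand of the differential must be natural for arrows given on the unmerged
  list. Tensoring two neighbours gives arrows on the merged list, and as F is strictly monoidal the
  product \<open>TM\<close> stays the same.\<close>

lemma arrs_merge:
  assumes \<alpha>: "arrs (Suc n) \<alpha>" and i: "i < n"
  shows "\<exists>\<beta>. arrs n \<beta> \<and> TM \<beta> = TM \<alpha> \<and> map src \<beta> = merge_at C (Suc i) (map src \<alpha>) \<and> map tgt \<beta> = merge_at C (Suc i) (map tgt \<alpha>)"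
proof -
  have l: "Suc i < length \<alpha>" using \<alpha> i by (simp add: arrs_def)
  obtain as x y bs where s: "\<alpha> = as @ x # y # bs" "length as = i" using split_two[OF l] by blast
  have o: "arr C x" "arr C y" "\<forall>a\<in>set as. arr C a" "\<forall>a\<in>set bs. arr C a" using \<alpha> s by (auto simp: arrs_def)
  show ?thesis
    by (rule exI[of _ "as @ (x \<otimes>\<^sub>a\<^bsub>C\<^esub> y) # bs"])
      (use \<alpha> o s(2) in \<open>simp add: s(1) merge_at_split TM_append TM_arr; simp add: arrs_def\<close>)
qed

section \<open>Cochains and their differential\<close>

definition cochain :: "nat \<Rightarrow> 'p \<Rightarrow> 'p \<Rightarrow> ('o list \<Rightarrow> 'p \<times> 'n \<times> 'p) \<Rightarrow> bool" where
  "cochain n V W \<phi> \<longleftrightarrow> \<phi> \<in> extensional (obj_lists C n) \<and>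
     (\<forall>Xs\<in>obj_lists C n. arr D (\<phi> Xs) \<and> src (\<phi> Xs) = V \<otimes>\<^sub>o T Xs \<and> tgt (\<phi> Xs) = T Xs \<otimes>\<^sub>o W) \<and>
     (\<forall>\<alpha>. arrs n \<alpha> \<longrightarrow> (TM \<alpha> \<otimes>\<^sub>a \<iota> W) \<star> \<phi> (map src \<alpha>) = \<phi> (map tgt \<alpha>) \<star> (\<iota> V \<otimes>\<^sub>a TM \<alpha>))"

lemma cochainD:
  assumes "cochain n V W \<phi>"
  shows "\<phi> \<in> extensional (obj_lists C n)" "Xs \<in> obj_lists C n \<Longrightarrow> arr D (\<phi> Xs)"
    "Xs \<in> obj_lists C n \<Longrightarrow> src (\<phi> Xs) = V \<otimes>\<^sub>o T Xs" "Xs \<in> obj_lists C n \<Longrightarrow> tgt (\<phi> Xs) = T Xs \<otimes>\<^sub>o W"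
    "arrs n \<alpha> \<Longrightarrow> (TM \<alpha> \<otimes>\<^sub>a \<iota> W) \<star> \<phi> (map src \<alpha>) = \<phi> (map tgt \<alpha>) \<star> (\<iota> V \<otimes>\<^sub>a TM \<alpha>)"
  using assms by (simp_all add: cochain_def)

lemma cochainI:
  assumes "\<And>Xs. Xs \<in> obj_lists C n \<Longrightarrow> arr D (\<phi> Xs)"
    "\<And>Xs. Xs \<in> obj_lists C n \<Longrightarrow> src (\<phi> Xs) = V \<otimes>\<^sub>o T Xs" "\<And>Xs. Xs \<in> obj_lists C n \<Longrightarrow> tgt (\<phi> Xs) = T Xs \<otimes>\<^sub>o W"
    "\<And>\<alpha>. arrs n \<alpha> \<Longrightarrow> (TM \<alpha> \<otimes>\<^sub>a \<iota> W) \<star> \<phi> (map src \<alpha>) = \<phi> (map tgt \<alpha>) \<star> (\<iota> V \<otimes>\<^sub>a TM \<alpha>)"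
  shows "cochain n V W (restrict \<phi> (obj_lists C n))"
  using assms by (simp add: cochain_def)

lemma cochain_eqI:
  assumes "cochain n V W \<phi>" "cochain n V' W' \<psi>" "\<And>Xs. Xs \<in> obj_lists C n \<Longrightarrow> \<phi> Xs = \<psi> Xs"
  shows "\<phi> = \<psi>"
  using assms(3) extensionalityI[OF cochainD(1)[OF assms(1)] cochainD(1)[OF assms(2)]] by blast

definition czero where "czero n V W = (\<lambda>Xs\<in>obj_lists C n. zr D (V \<otimes>\<^sub>o T Xs) (T Xs \<otimes>\<^sub>o W))"
definition cadd where "cadd n \<phi> \<psi> = (\<lambda>Xs\<in>obj_lists C n. \<phi> Xs \<boxplus> \<psi> Xs)"
definition cscale where "cscale n c \<phi> = (\<lambda>Xs\<in>obj_lists C n. c \<boxdot> \<phi> Xs)"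
definition pull where "pull n g \<phi> = (\<lambda>Xs\<in>obj_lists C n. \<phi> Xs \<star> (g \<otimes>\<^sub>a \<iota> (T Xs)))"

lemma czero_cochain: "V \<in> Obj D \<Longrightarrow> W \<in> Obj D \<Longrightarrow> cochain n V W (czero n V W)"
  unfolding czero_def by (rule cochainI) (simp_all add: arrs_rules)

lemma cadd_cochain: "V \<in> Obj D \<Longrightarrow> W \<in> Obj D \<Longrightarrow> cochain n V W \<phi> \<Longrightarrow> cochain n V W \<psi> \<Longrightarrow> cochain n V W (cadd n \<phi> \<psi>)"
  unfolding cadd_def by (rule cochainI) (simp_all add: cochainD[of n V W] D.cmp_pls_left D.cmp_pls_right)

lemma cscale_cochain: "V \<in> Obj D \<Longrightarrow> W \<in> Obj D \<Longrightarrow> cochain n V W \<phi> \<Longrightarrow> cochain n V W (cscale n c \<phi>)"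
  unfolding cscale_def by (rule cochainI) (simp_all add: cochainD[of n V W])

lemma pull_cochain:
  assumes V: "V \<in> Obj D" "W \<in> Obj D" and \<phi>: "cochain n V W \<phi>" and g: "arr D g" "src g = V'" "tgt g = V"
  shows "cochain n V' W (pull n g \<phi>)"
  unfolding pull_def
proof (rule cochainI)
  have V' [simp]: "V' \<in> Obj D" using g by auto
  {
  fix Xs assume Xs: "Xs \<in> obj_lists C n"
  note [simp] = V cochainD(2-4)[OF \<phi> Xs] g T_obj'[OF Xs]
  show "arr D (\<phi> Xs \<star> (g \<otimes>\<^sub>a \<iota> (T Xs)))" "src (\<phi> Xs \<star> (g \<otimes>\<^sub>a \<iota> (T Xs))) = V' \<otimes>\<^sub>o T Xs"
    "tgt (\<phi> Xs \<star> (g \<otimes>\<^sub>a \<iota> (T Xs))) = T Xs \<otimes>\<^sub>o W" by simp_all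
  }
  fix \<alpha> assume \<alpha>: "arrs n \<alpha>"
  note [simp] = V cochainD(2-4)[OF \<phi>] g \<alpha> arrs_rules[OF \<alpha>]
  have "(TM \<alpha> \<otimes>\<^sub>a \<iota> W) \<star> (\<phi> (map src \<alpha>) \<star> (g \<otimes>\<^sub>a \<iota> (T (map src \<alpha>)))) = ((TM \<alpha> \<otimes>\<^sub>a \<iota> W) \<star> \<phi> (map src \<alpha>)) \<star> (g \<otimes>\<^sub>a \<iota> (T (map src \<alpha>)))"
    by simp
  also have "\<dots> = \<phi> (map tgt \<alpha>) \<star> ((\<iota> V \<otimes>\<^sub>a TM \<alpha>) \<star> (g \<otimes>\<^sub>a \<iota> (T (map src \<alpha>))))"
    by (simp add: cochainD(5)[OF \<phi> \<alpha>])
  also have "(\<iota> V \<otimes>\<^sub>a TM \<alpha>) \<star> (g \<otimes>\<^sub>a \<iota> (T (map src \<alpha>))) = (g \<otimes>\<^sub>a \<iota> (T (map tgt \<alpha>))) \<star> (\<iota> V' \<otimes>\<^sub>a TM \<alpha>)"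
    by (simp add: D.interchange)
  finally show "(TM \<alpha> \<otimes>\<^sub>a \<iota> W) \<star> (\<phi> (map src \<alpha>) \<star> (g \<otimes>\<^sub>a \<iota> (T (map src \<alpha>)))) = (\<phi> (map tgt \<alpha>) \<star> (g \<otimes>\<^sub>a \<iota> (T (map tgt \<alpha>)))) \<star> (\<iota> V' \<otimes>\<^sub>a TM \<alpha>)"
    by simp
qed

text \<open>The parts of the differential are kept apart because the half-braiding of V enters only
  the first and that of W only the last, and because the homotopy treats each part by a different
  argument.\<close>

definition diff_first where "diff_first V \<phi> Xs = (\<iota> (Fo (hd Xs)) \<otimes>\<^sub>a \<phi> (tl Xs)) \<star> (br V (hd Xs) \<otimes>\<^sub>a \<iota> (T (tl Xs)))"
definition diff_last where "diff_last W \<phi> Xs = (\<iota> (T (butlast Xs)) \<otimes>\<^sub>a br W (last Xs)) \<star> (\<phi> (butlast Xs) \<otimes>\<^sub>a \<iota> (Fo (last Xs)))"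
definition diff_middle where "diff_middle V W n \<phi> Xs = arr_sum D (fst V \<otimes>\<^sub>o T Xs) (T Xs \<otimes>\<^sub>o fst W) n (\<lambda>i. ((- 1) ^ Suc i) \<boxdot> \<phi> (merge_at C (Suc i) Xs))"

definition cdiff where
  "cdiff V W n \<phi> = (\<lambda>Xs\<in>obj_lists C (Suc n). diff_first V \<phi> Xs \<boxplus> diff_middle V W n \<phi> Xs \<boxplus> ((- 1) ^ Suc n) \<boxdot> diff_last W \<phi> Xs)"

context
  fixes V W n \<phi>
  assumes V [simp]: "V \<in> Obj ZF" and W [simp]: "W \<in> Obj ZF" and \<phi>: "cochain n (fst V) (fst W) \<phi>"
begin

lemma cochain_simps [simp]: "Xs \<in> obj_lists C n \<Longrightarrow> arr D (\<phi> Xs)" "Xs \<in> obj_lists C n \<Longrightarrow> src (\<phi> Xs) = fst V \<otimes>\<^sub>o T Xs"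
  "Xs \<in> obj_lists C n \<Longrightarrow> tgt (\<phi> Xs) = T Xs \<otimes>\<^sub>o fst W"
  using cochainD(2-4)[OF \<phi>] by blast+

lemma diff_first_arr:
  assumes "Xs \<in> obj_lists C (Suc n)"
  shows "arr D (diff_first V \<phi> Xs)" "src (diff_first V \<phi> Xs) = fst V \<otimes>\<^sub>o T Xs" "tgt (diff_first V \<phi> Xs) = T Xs \<otimes>\<^sub>o fst W"
  by (insert assms, erule obj_lists_SucE, simp add: diff_first_def)+

lemma diff_last_arr:
  assumes "Xs \<in> obj_lists C (Suc n)"
  shows "arr D (diff_last W \<phi> Xs)" "src (diff_last W \<phi> Xs) = fst V \<otimes>\<^sub>o T Xs" "tgt (diff_last W \<phi> Xs) = T Xs \<otimes>\<^sub>o fst W"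
  by (insert assms, erule obj_lists_snocE, simp add: diff_last_def)+

lemma diff_middle_homs:
  assumes "Xs \<in> obj_lists C (Suc n)"
  shows "homs D (fst V \<otimes>\<^sub>o T Xs) (T Xs \<otimes>\<^sub>o fst W) n (\<lambda>i. ((- 1) ^ Suc i) \<boxdot> \<phi> (merge_at C (Suc i) Xs))"
  using merge_at_obj[OF assms] assms by (intro homsI) simp_all

lemma diff_middle_arr:
  assumes "Xs \<in> obj_lists C (Suc n)"
  shows "arr D (diff_middle V W n \<phi> Xs)" "src (diff_middle V W n \<phi> Xs) = fst V \<otimes>\<^sub>o T Xs" "tgt (diff_middle V W n \<phi> Xs) = T Xs \<otimes>\<^sub>o fst W"
  using D.arr_arr_sum[OF diff_middle_homs[OF assms]] by (simp_all add: diff_middle_def)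

lemmas d_arrs = diff_first_arr diff_last_arr diff_middle_arr

text \<open>Naturality of \<phi> in the tail and of the half-braiding in the head, joined by the
  interchange law. For the last part the roles of head and tail are exchanged.\<close>

lemma diff_first_natural:
  assumes \<alpha>: "arrs (Suc n) \<alpha>"
  shows "(TM \<alpha> \<otimes>\<^sub>a \<iota> (fst W)) \<star> diff_first V \<phi> (map src \<alpha>) = diff_first V \<phi> (map tgt \<alpha>) \<star> (\<iota> (fst V) \<otimes>\<^sub>a TM \<alpha>)"
proof -
  obtain a \<beta> where s: "\<alpha> = a # \<beta>" and a [simp]: "arr C a" and \<beta> [simp]: "arrs n \<beta>" using \<alpha> by (rule arrs_SucE)
  note [simp] = arrs_rules[OF \<beta>] TM_snoc[OF \<beta> a]
  let ?v = "fst V" and ?w = "fst W" and ?X = "src a" and ?Y = "tgt a" and ?Xs = "map src \<beta>" and ?Ys = "map tgt \<beta>"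
  have "(TM \<alpha> \<otimes>\<^sub>a \<iota> ?w) \<star> diff_first V \<phi> (map src \<alpha>) = (Fm a \<otimes>\<^sub>a ((TM \<beta> \<otimes>\<^sub>a \<iota> ?w) \<star> \<phi> ?Xs)) \<star> (br V ?X \<otimes>\<^sub>a \<iota> (T ?Xs))"
    by (simp add: s diff_first_def D.interchange')
  also have "Fm a \<otimes>\<^sub>a ((TM \<beta> \<otimes>\<^sub>a \<iota> ?w) \<star> \<phi> ?Xs) = (\<iota> (Fo ?Y) \<otimes>\<^sub>a \<phi> ?Ys) \<star> (Fm a \<otimes>\<^sub>a \<iota> ?v \<otimes>\<^sub>a TM \<beta>)"
    unfolding cochainD(5)[OF \<phi> \<beta>] by (simp add: D.interchange)
  also have "((\<iota> (Fo ?Y) \<otimes>\<^sub>a \<phi> ?Ys) \<star> (Fm a \<otimes>\<^sub>a \<iota> ?v \<otimes>\<^sub>a TM \<beta>)) \<star> (br V ?X \<otimes>\<^sub>a \<iota> (T ?Xs))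
      = (\<iota> (Fo ?Y) \<otimes>\<^sub>a \<phi> ?Ys) \<star> (((Fm a \<otimes>\<^sub>a \<iota> ?v) \<otimes>\<^sub>a TM \<beta>) \<star> (br V ?X \<otimes>\<^sub>a \<iota> (T ?Xs)))"
    by simp
  also have "((Fm a \<otimes>\<^sub>a \<iota> ?v) \<otimes>\<^sub>a TM \<beta>) \<star> (br V ?X \<otimes>\<^sub>a \<iota> (T ?Xs)) = ((Fm a \<otimes>\<^sub>a \<iota> ?v) \<star> br V ?X) \<otimes>\<^sub>a TM \<beta>"
    by (subst D.interchange) simp_all
  also have "(Fm a \<otimes>\<^sub>a \<iota> ?v) \<star> br V ?X = br V ?Y \<star> (\<iota> ?v \<otimes>\<^sub>a Fm a)" by (rule br_natural[OF V]) simp_all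
  also have "(br V ?Y \<star> (\<iota> ?v \<otimes>\<^sub>a Fm a)) \<otimes>\<^sub>a TM \<beta> = (br V ?Y \<otimes>\<^sub>a \<iota> (T ?Ys)) \<star> ((\<iota> ?v \<otimes>\<^sub>a Fm a) \<otimes>\<^sub>a TM \<beta>)"
    by (subst D.interchange) simp_all
  finally show ?thesis by (simp add: s diff_first_def)
qed

lemma diff_last_natural:
  assumes \<alpha>: "arrs (Suc n) \<alpha>"
  shows "(TM \<alpha> \<otimes>\<^sub>a \<iota> (fst W)) \<star> diff_last W \<phi> (map src \<alpha>) = diff_last W \<phi> (map tgt \<alpha>) \<star> (\<iota> (fst V) \<otimes>\<^sub>a TM \<alpha>)"
proof -
  obtain a \<beta> where s: "\<alpha> = \<beta> @ [a]" and a [simp]: "arr C a" and \<beta> [simp]: "arrs n \<beta>" using \<alpha> by (rule arrs_snocE)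
  note [simp] = arrs_rules[OF \<beta>] TM_snoc[OF \<beta> a]
  let ?v = "fst V" and ?w = "fst W" and ?X = "src a" and ?Y = "tgt a" and ?Xs = "map src \<beta>" and ?Ys = "map tgt \<beta>"
  have "(TM \<alpha> \<otimes>\<^sub>a \<iota> ?w) \<star> diff_last W \<phi> (map src \<alpha>) = (TM \<beta> \<otimes>\<^sub>a ((Fm a \<otimes>\<^sub>a \<iota> ?w) \<star> br W ?X)) \<star> (\<phi> ?Xs \<otimes>\<^sub>a \<iota> (Fo ?X))"
    by (simp add: s diff_last_def D.interchange')
  also have "(Fm a \<otimes>\<^sub>a \<iota> ?w) \<star> br W ?X = br W ?Y \<star> (\<iota> ?w \<otimes>\<^sub>a Fm a)" by (rule br_natural[OF W]) simp_all
  also have "TM \<beta> \<otimes>\<^sub>a (br W ?Y \<star> (\<iota> ?w \<otimes>\<^sub>a Fm a)) = (\<iota> (T ?Ys) \<otimes>\<^sub>a br W ?Y) \<star> ((TM \<beta> \<otimes>\<^sub>a \<iota> ?w) \<otimes>\<^sub>a Fm a)"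
    by (simp add: D.interchange)
  also have "\<dots> \<star> (\<phi> ?Xs \<otimes>\<^sub>a \<iota> (Fo ?X)) = (\<iota> (T ?Ys) \<otimes>\<^sub>a br W ?Y) \<star> (((TM \<beta> \<otimes>\<^sub>a \<iota> ?w) \<otimes>\<^sub>a Fm a) \<star> (\<phi> ?Xs \<otimes>\<^sub>a \<iota> (Fo ?X)))"
    by simp
  also have "((TM \<beta> \<otimes>\<^sub>a \<iota> ?w) \<otimes>\<^sub>a Fm a) \<star> (\<phi> ?Xs \<otimes>\<^sub>a \<iota> (Fo ?X)) = ((TM \<beta> \<otimes>\<^sub>a \<iota> ?w) \<star> \<phi> ?Xs) \<otimes>\<^sub>a Fm a"
    by (subst D.interchange) simp_all
  also have "(TM \<beta> \<otimes>\<^sub>a \<iota> ?w) \<star> \<phi> ?Xs = \<phi> ?Ys \<star> (\<iota> ?v \<otimes>\<^sub>a TM \<beta>)" by (rule cochainD(5)[OF \<phi> \<beta>])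
  also have "(\<phi> ?Ys \<star> (\<iota> ?v \<otimes>\<^sub>a TM \<beta>)) \<otimes>\<^sub>a Fm a = (\<phi> ?Ys \<otimes>\<^sub>a \<iota> (Fo ?Y)) \<star> ((\<iota> ?v \<otimes>\<^sub>a TM \<beta>) \<otimes>\<^sub>a Fm a)"
    by (subst D.interchange) simp_all
  finally show ?thesis by (simp add: s diff_last_def)
qed

lemma diff_middle_natural:
  assumes \<alpha>: "arrs (Suc n) \<alpha>"
  shows "(TM \<alpha> \<otimes>\<^sub>a \<iota> (fst W)) \<star> diff_middle V W n \<phi> (map src \<alpha>) = diff_middle V W n \<phi> (map tgt \<alpha>) \<star> (\<iota> (fst V) \<otimes>\<^sub>a TM \<alpha>)"
proof -
  note [simp] = \<alpha> arrs_rules[OF \<alpha>]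
  note m = merge_at_obj[OF arrs_objs(1)[OF \<alpha>]] merge_at_obj[OF arrs_objs(2)[OF \<alpha>]]
  have "(TM \<alpha> \<otimes>\<^sub>a \<iota> (fst W)) \<star> (((- 1) ^ Suc i) \<boxdot> \<phi> (merge_at C (Suc i) (map src \<alpha>)))
      = (((- 1) ^ Suc i) \<boxdot> \<phi> (merge_at C (Suc i) (map tgt \<alpha>))) \<star> (\<iota> (fst V) \<otimes>\<^sub>a TM \<alpha>)" if i: "i < n" for i
  proof -
    obtain \<beta> where \<beta>: "arrs n \<beta>" "TM \<beta> = TM \<alpha>" "map src \<beta> = merge_at C (Suc i) (map src \<alpha>)" "map tgt \<beta> = merge_at C (Suc i) (map tgt \<alpha>)"
      using arrs_merge[OF \<alpha> i] by blast
    show ?thesis using cochainD(5)[OF \<phi> \<beta>(1)] m i by (simp add: \<beta>(2-4))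
  qed
  note e = arr_sum_cong[OF this]
  have 1: "(TM \<alpha> \<otimes>\<^sub>a \<iota> (fst W)) \<star> diff_middle V W n \<phi> (map src \<alpha>) = arr_sum D (fst V \<otimes>\<^sub>o T (map src \<alpha>)) (T (map tgt \<alpha>) \<otimes>\<^sub>o fst W) n
      (\<lambda>i. (TM \<alpha> \<otimes>\<^sub>a \<iota> (fst W)) \<star> (((- 1) ^ Suc i) \<boxdot> \<phi> (merge_at C (Suc i) (map src \<alpha>))))"
    unfolding diff_middle_def by (subst D.cmp_arr_sum_right[OF diff_middle_homs]) simp_all
  have 2: "diff_middle V W n \<phi> (map tgt \<alpha>) \<star> (\<iota> (fst V) \<otimes>\<^sub>a TM \<alpha>) = arr_sum D (fst V \<otimes>\<^sub>o T (map src \<alpha>)) (T (map tgt \<alpha>) \<otimes>\<^sub>o fst W) n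
      (\<lambda>i. (((- 1) ^ Suc i) \<boxdot> \<phi> (merge_at C (Suc i) (map tgt \<alpha>))) \<star> (\<iota> (fst V) \<otimes>\<^sub>a TM \<alpha>))"
    unfolding diff_middle_def by (subst D.cmp_arr_sum_left[OF diff_middle_homs]) simp_all
  show ?thesis unfolding 1 2 by (rule e)
qed

lemma cdiff_cochain: "cochain (Suc n) (fst V) (fst W) (cdiff V W n \<phi>)"
  unfolding cdiff_def
proof (rule cochainI)
  fix \<alpha> assume \<alpha>: "arrs (Suc n) \<alpha>"
  note [simp] = \<alpha> arrs_rules[OF \<alpha>]
  show "(TM \<alpha> \<otimes>\<^sub>a \<iota> (fst W)) \<star> (diff_first V \<phi> (map src \<alpha>) \<boxplus> diff_middle V W n \<phi> (map src \<alpha>) \<boxplus> ((- 1) ^ Suc n) \<boxdot> diff_last W \<phi> (map src \<alpha>))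
      = (diff_first V \<phi> (map tgt \<alpha>) \<boxplus> diff_middle V W n \<phi> (map tgt \<alpha>) \<boxplus> ((- 1) ^ Suc n) \<boxdot> diff_last W \<phi> (map tgt \<alpha>)) \<star> (\<iota> (fst V) \<otimes>\<^sub>a TM \<alpha>)"
    by (simp add: d_arrs D.cmp_pls_right D.cmp_pls_left diff_first_natural diff_middle_natural diff_last_natural)
qed (simp_all add: d_arrs)

end

section \<open>Precomposition in the first coefficient\<close>

lemma pull_app [simp]: "Xs \<in> obj_lists C n \<Longrightarrow> pull n g \<phi> Xs = \<phi> Xs \<star> (g \<otimes>\<^sub>a \<iota> (T Xs))"
  by (simp add: pull_def)
lemma cadd_app [simp]: "Xs \<in> obj_lists C n \<Longrightarrow> cadd n \<phi> \<psi> Xs = \<phi> Xs \<boxplus> \<psi> Xs"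
  by (simp add: cadd_def)
lemma cscale_app [simp]: "Xs \<in> obj_lists C n \<Longrightarrow> cscale n c \<phi> Xs = c \<boxdot> \<phi> Xs"
  by (simp add: cscale_def)
lemma czero_app [simp]: "Xs \<in> obj_lists C n \<Longrightarrow> czero n V W Xs = zr D (V \<otimes>\<^sub>o T Xs) (T Xs \<otimes>\<^sub>o W)"
  by (simp add: czero_def)

lemma pull_extensional [simp]: "pull n g \<phi> \<in> extensional (obj_lists C n)"
  "cadd n \<phi> \<psi> \<in> extensional (obj_lists C n)" "cscale n c \<phi> \<in> extensional (obj_lists C n)" "czero n V' W' \<in> extensional (obj_lists C n)"
  "cdiff V W n \<phi> \<in> extensional (obj_lists C (Suc n))"
  by (simp_all add: pull_def cadd_def cscale_def czero_def cdiff_def)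

lemma pull_pull:
  assumes \<phi>: "cochain n V W \<phi>" and V: "V \<in> Obj D" and g: "arr D g" "tgt g = V" and h: "arr D h" "tgt h = src g"
  shows "pull n h (pull n g \<phi>) = pull n (g \<star> h) \<phi>"
proof (rule extensionalityI[of _ "obj_lists C n"])
  fix Xs assume Xs [simp]: "Xs \<in> obj_lists C n"
  note [simp] = T_obj'[OF Xs] cochainD(2-4)[OF \<phi> Xs] V g h
  show "pull n h (pull n g \<phi>) Xs = pull n (g \<star> h) \<phi> Xs" by (simp add: D.tns_cmp_right)
qed simp_all

lemma pull_idt:
  assumes \<phi>: "cochain n V W \<phi>" and V: "V \<in> Obj D" 
  shows "pull n (\<iota> V) \<phi> = \<phi>"
proof (rule extensionalityI[of _ "obj_lists C n"])
  fix Xs assume Xs [simp]: "Xs \<in> obj_lists C n"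
  note [simp] = T_obj'[OF Xs] cochainD(2-4)[OF \<phi> Xs] V
  show "pull n (\<iota> V) \<phi> Xs = \<phi> Xs" by (simp add: D.tns_idt)
qed (simp_all add: cochainD(1)[OF \<phi>])

lemma pull_cadd:
  assumes \<phi>: "cochain n V W \<phi>" "cochain n V W \<psi>" and V: "V \<in> Obj D" and g: "arr D g" "tgt g = V"
  shows "pull n g (cadd n \<phi> \<psi>) = cadd n (pull n g \<phi>) (pull n g \<psi>)"
proof (rule extensionalityI[of _ "obj_lists C n"])
  fix Xs assume Xs [simp]: "Xs \<in> obj_lists C n"
  note [simp] = T_obj'[OF Xs] cochainD(2-4)[OF \<phi>(1) Xs] cochainD(2-4)[OF \<phi>(2) Xs] V g
  show "pull n g (cadd n \<phi> \<psi>) Xs = cadd n (pull n g \<phi>) (pull n g \<psi>) Xs" by (simp add: D.cmp_pls_left)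
qed simp_all

lemma pull_cscale:
  assumes \<phi>: "cochain n V W \<phi>" and V: "V \<in> Obj D" and g: "arr D g" "tgt g = V"
  shows "pull n g (cscale n c \<phi>) = cscale n c (pull n g \<phi>)"
proof (rule extensionalityI[of _ "obj_lists C n"])
  fix Xs assume Xs [simp]: "Xs \<in> obj_lists C n"
  note [simp] = T_obj'[OF Xs] cochainD(2-4)[OF \<phi> Xs] V g
  show "pull n g (cscale n c \<phi>) Xs = cscale n c (pull n g \<phi>) Xs" by simp
qed simp_all

lemma pull_czero:
  assumes V: "V \<in> Obj D" "W \<in> Obj D" and g: "arr D g" "tgt g = V" "src g = V'"
  shows "pull n g (czero n V W) = czero n V' W"
proof (rule extensionalityI[of _ "obj_lists C n"])
  fix Xs assume Xs [simp]: "Xs \<in> obj_lists C n"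
  note [simp] = T_obj'[OF Xs] V g
  show "pull n g (czero n V W) Xs = czero n V' W Xs" by simp
qed simp_all

lemma pull_neg:
  assumes \<phi>: "cochain n V W \<phi>" and V: "V \<in> Obj D" and g: "arr D g" "arr D h" "tgt g = V" "tgt h = V" "src g = src h"
  shows "pull n (g \<boxplus> (- 1) \<boxdot> h) \<phi> = cadd n (pull n g \<phi>) (cscale n (- 1) (pull n h \<phi>))"
proof (rule extensionalityI[of _ "obj_lists C n"])
  fix Xs assume Xs [simp]: "Xs \<in> obj_lists C n"
  note [simp] = T_obj'[OF Xs] cochainD(2-4)[OF \<phi> Xs] V g
  show "pull n (g \<boxplus> (- 1) \<boxdot> h) \<phi> Xs = cadd n (pull n g \<phi>) (cscale n (- 1) (pull n h \<phi>)) Xs"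
    by (simp add: D.tns_pls_left D.cmp_pls_right)
qed simp_all

lemma pull_zr:
  assumes \<phi>: "cochain n V W \<phi>" and V: "V \<in> Obj D" "V' \<in> Obj D"
  shows "pull n (zr D V' V) \<phi> = czero n V' W"
proof (rule extensionalityI[of _ "obj_lists C n"])
  fix Xs assume Xs [simp]: "Xs \<in> obj_lists C n"
  note [simp] = T_obj'[OF Xs] cochainD(2-4)[OF \<phi> Xs] V
  show "pull n (zr D V' V) \<phi> Xs = czero n V' W Xs" by simp
qed simp_all

lemma cadd_neg_eq_czero:
  assumes \<phi>: "cochain n V W \<phi>" "cochain n V W \<psi>" and e: "cadd n \<phi> (cscale n (- 1) \<psi>) = czero n V W"
  shows "\<phi> = \<psi>"
proof (rule cochain_eqI[OF \<phi>])
  fix Xs assume Xs [simp]: "Xs \<in> obj_lists C n"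
  note [simp] = T_obj'[OF Xs] cochainD(2-4)[OF \<phi>(1) Xs] cochainD(2-4)[OF \<phi>(2) Xs]
  have "cadd n \<phi> (cscale n (- 1) \<psi>) Xs = czero n V W Xs" by (simp only: e)
  thus "\<phi> Xs = \<psi> Xs" using D.pls_neg_eq_zr_iff[of "\<phi> Xs" "\<psi> Xs"] by simp
qed

lemma cadd_neg_czero:
  assumes \<phi>: "cochain n V W \<phi>" and V: "V \<in> Obj D" "W \<in> Obj D" 
  shows "cadd n \<phi> (cscale n (- 1) (czero n V W)) = \<phi>" "cadd n \<phi> (cscale n (- 1) \<phi>) = czero n V W"
proof -
  {
    fix Xs assume Xs [simp]: "Xs \<in> obj_lists C n"
    note [simp] = T_obj'[OF Xs] cochainD(2-4)[OF \<phi> Xs] V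
    have "cadd n \<phi> (cscale n (- 1) (czero n V W)) Xs = \<phi> Xs" "cadd n \<phi> (cscale n (- 1) \<phi>) Xs = czero n V W Xs" by simp_all
  }
  thus "cadd n \<phi> (cscale n (- 1) (czero n V W)) = \<phi>" "cadd n \<phi> (cscale n (- 1) \<phi>) = czero n V W"
    by (auto intro!: extensionalityI[of _ "obj_lists C n"] simp: cochainD(1)[OF \<phi>])
qed

lemma cdiff_app: "Xs \<in> obj_lists C (Suc n) \<Longrightarrow>
    cdiff V W n \<phi> Xs = diff_first V \<phi> Xs \<boxplus> diff_middle V W n \<phi> Xs \<boxplus> ((- 1) ^ Suc n) \<boxdot> diff_last W \<phi> Xs"
  by (simp add: cdiff_def)

text \<open>Only the first part of the differential involves the half-braiding of the coefficient
  that changes, and the intertwining property of g is what moves g past it.\<close>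

lemma cdiff_pull:
  assumes V [simp]: "V \<in> Obj ZF" "V' \<in> Obj ZF" "W \<in> Obj ZF" and \<phi>: "cochain n (fst V) (fst W) \<phi>" and g: "zmor V' V g"
  shows "cdiff V' W n (pull n g \<phi>) = pull (Suc n) g (cdiff V W n \<phi>)"
proof (rule extensionalityI[of _ "obj_lists C (Suc n)"])
  fix Xs assume Xs [simp]: "Xs \<in> obj_lists C (Suc n)"
  note [simp] = T_obj'[OF Xs] zmorD(1-3)[OF g] cochainD(2-4)[OF \<phi>]
  let ?g = "g \<otimes>\<^sub>a \<iota> (T Xs)"
  have 1: "diff_first V' (pull n g \<phi>) Xs = diff_first V \<phi> Xs \<star> ?g"
  proof -
    obtain X Ys where s: "Xs = X # Ys" and X [simp]: "X \<in> Obj C" and Ys [simp]: "Ys \<in> obj_lists C n" using Xs by (rule obj_lists_SucE)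
    note [simp] = T_obj'[OF Ys]
    have "diff_first V' (pull n g \<phi>) Xs = (\<iota> (Fo X) \<otimes>\<^sub>a \<phi> Ys) \<star> (((\<iota> (Fo X) \<otimes>\<^sub>a g) \<star> br V' X) \<otimes>\<^sub>a \<iota> (T Ys))"
      by (simp add: s diff_first_def D.tns_cmp_left D.tns_cmp_right)
    also have "\<dots> = diff_first V \<phi> Xs \<star> ?g"
      by (simp add: zmorD(4)[OF g X] s diff_first_def D.tns_cmp_right D.tns_idt)
    finally show ?thesis .
  qed
  have 2: "diff_last W (pull n g \<phi>) Xs = diff_last W \<phi> Xs \<star> ?g"
  proof -
    obtain X Ys where s: "Xs = Ys @ [X]" and X [simp]: "X \<in> Obj C" and Ys [simp]: "Ys \<in> obj_lists C n" using Xs by (rule obj_lists_snocE)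
    note [simp] = T_obj'[OF Ys] T_snoc[OF Ys X]
    show ?thesis by (simp add: s diff_last_def D.tns_cmp_right D.tns_idt)
  qed
  have 3: "diff_middle V' W n (pull n g \<phi>) Xs = diff_middle V W n \<phi> Xs \<star> ?g"
  proof -
    have "((- 1) ^ Suc i) \<boxdot> pull n g \<phi> (merge_at C (Suc i) Xs) = (((- 1) ^ Suc i) \<boxdot> \<phi> (merge_at C (Suc i) Xs)) \<star> ?g" if i: "i < n" for i
      using merge_at_obj[OF Xs i] by simp
    note e = arr_sum_cong[OF this]
    have "diff_middle V W n \<phi> Xs \<star> ?g = arr_sum D (fst V' \<otimes>\<^sub>o T Xs) (T Xs \<otimes>\<^sub>o fst W) n (\<lambda>i. (((- 1) ^ Suc i) \<boxdot> \<phi> (merge_at C (Suc i) Xs)) \<star> ?g)"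
      unfolding diff_middle_def by (subst D.cmp_arr_sum_left[OF diff_middle_homs[OF V(1,3) \<phi> Xs]]) simp_all
    thus ?thesis unfolding diff_middle_def[of V'] using e by simp
  qed
  show "cdiff V' W n (pull n g \<phi>) Xs = pull (Suc n) g (cdiff V W n \<phi>) Xs"
    using d_arrs[OF V(1,3) \<phi> Xs] by (simp add: cdiff_app 1 2 3 D.cmp_pls_left)
qed simp_all

lemma cdiff_linear:
  assumes V [simp]: "V \<in> Obj ZF" "W \<in> Obj ZF" and \<phi>: "cochain n (fst V) (fst W) \<phi>" and \<psi>: "cochain n (fst V) (fst W) \<psi>"
  shows cdiff_cadd: "cdiff V W n (cadd n \<phi> \<psi>) = cadd (Suc n) (cdiff V W n \<phi>) (cdiff V W n \<psi>)" (is ?A)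
    and cdiff_cscale: "cdiff V W n (cscale n c \<phi>) = cscale (Suc n) c (cdiff V W n \<phi>)" (is ?B)
proof -
  {
  fix Xs assume Xs [simp]: "Xs \<in> obj_lists C (Suc n)"
  note [simp] = T_obj'[OF Xs] cochainD(2-4)[OF \<phi>] cochainD(2-4)[OF \<psi>]
  have 1: "diff_first V (cadd n \<phi> \<psi>) Xs = diff_first V \<phi> Xs \<boxplus> diff_first V \<psi> Xs" "diff_first V (cscale n c \<phi>) Xs = c \<boxdot> diff_first V \<phi> Xs"
  proof -
    obtain X Ys where s: "Xs = X # Ys" and X [simp]: "X \<in> Obj C" and Ys [simp]: "Ys \<in> obj_lists C n" using Xs by (rule obj_lists_SucE)
    note [simp] = T_obj'[OF Ys]
    show "diff_first V (cadd n \<phi> \<psi>) Xs = diff_first V \<phi> Xs \<boxplus> diff_first V \<psi> Xs" by (simp add: s diff_first_def D.tns_pls_right D.cmp_pls_left)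
    show "diff_first V (cscale n c \<phi>) Xs = c \<boxdot> diff_first V \<phi> Xs" by (simp add: s diff_first_def)
  qed
  have 2: "diff_last W (cadd n \<phi> \<psi>) Xs = diff_last W \<phi> Xs \<boxplus> diff_last W \<psi> Xs" "diff_last W (cscale n c \<phi>) Xs = c \<boxdot> diff_last W \<phi> Xs"
  proof -
    obtain X Ys where s: "Xs = Ys @ [X]" and X [simp]: "X \<in> Obj C" and Ys [simp]: "Ys \<in> obj_lists C n" using Xs by (rule obj_lists_snocE)
    note [simp] = T_obj'[OF Ys] T_snoc[OF Ys X]
    show "diff_last W (cadd n \<phi> \<psi>) Xs = diff_last W \<phi> Xs \<boxplus> diff_last W \<psi> Xs" by (simp add: s diff_last_def D.tns_pls_left D.cmp_pls_right)
    show "diff_last W (cscale n c \<phi>) Xs = c \<boxdot> diff_last W \<phi> Xs" by (simp add: s diff_last_def)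
  qed
  let ?h = "\<lambda>\<phi> i. ((- 1) ^ Suc i) \<boxdot> \<phi> (merge_at C (Suc i) Xs)"
  note h = diff_middle_homs[OF V \<phi> Xs] diff_middle_homs[OF V \<psi> Xs]
  have 3: "diff_middle V W n (cadd n \<phi> \<psi>) Xs = diff_middle V W n \<phi> Xs \<boxplus> diff_middle V W n \<psi> Xs"
  proof -
    have "?h (cadd n \<phi> \<psi>) i = ?h \<phi> i \<boxplus> ?h \<psi> i" if i: "i < n" for i
      using merge_at_obj[OF Xs i] by (simp add: D.scl_pls)
    from arr_sum_cong[OF this] show ?thesis unfolding diff_middle_def D.arr_sum_pls[OF h, symmetric] .
  qed
  have 4: "diff_middle V W n (cscale n c \<phi>) Xs = c \<boxdot> diff_middle V W n \<phi> Xs"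
  proof -
    have "?h (cscale n c \<phi>) i = c \<boxdot> ?h \<phi> i" if i: "i < n" for i
      using merge_at_obj[OF Xs i] by (simp add: mult.commute)
    from arr_sum_cong[OF this] show ?thesis unfolding diff_middle_def D.scl_arr_sum[OF h(1)] .
  qed
  note a = d_arrs[OF V \<phi> Xs] d_arrs[OF V \<psi> Xs]
  let ?A = "fst V \<otimes>\<^sub>o T Xs" and ?B = "T Xs \<otimes>\<^sub>o fst W"
  have "(p \<boxplus> p') \<boxplus> (q \<boxplus> q') \<boxplus> (r \<boxplus> r') = (p \<boxplus> q \<boxplus> r) \<boxplus> (p' \<boxplus> q' \<boxplus> r')"
    if [simp]: "arr D p" "arr D q" "arr D r" "arr D p'" "arr D q'" "arr D r'"
      "src p = ?A" "src q = ?A" "src r = ?A" "src p' = ?A" "src q' = ?A" "src r' = ?A"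
      "tgt p = ?B" "tgt q = ?B" "tgt r = ?B" "tgt p' = ?B" "tgt q' = ?B" "tgt r' = ?B" for p q r p' q' r'
    by (simp add: D.pls_swap[of p p' q q' ?A ?B] D.pls_swap[of "p \<boxplus> q" "p' \<boxplus> q'" r r' ?A ?B])
  note sw = this[of "diff_first V \<phi> Xs" "diff_middle V W n \<phi> Xs" "((- 1) ^ Suc n) \<boxdot> diff_last W \<phi> Xs"
    "diff_first V \<psi> Xs" "diff_middle V W n \<psi> Xs" "((- 1) ^ Suc n) \<boxdot> diff_last W \<psi> Xs"]
  have "cdiff V W n (cadd n \<phi> \<psi>) Xs = cadd (Suc n) (cdiff V W n \<phi>) (cdiff V W n \<psi>) Xs"
    unfolding cdiff_app[OF Xs] cadd_app[OF Xs] 1 2 3 using a sw by (simp add: D.scl_pls)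
  moreover have "cdiff V W n (cscale n c \<phi>) Xs = cscale (Suc n) c (cdiff V W n \<phi>) Xs"
    unfolding cdiff_app[OF Xs] cscale_app[OF Xs] 1 2 4 using a by (simp add: D.scl_pls mult.commute)
  ultimately have "cdiff V W n (cadd n \<phi> \<psi>) Xs = cadd (Suc n) (cdiff V W n \<phi>) (cdiff V W n \<psi>) Xs"
    "cdiff V W n (cscale n c \<phi>) Xs = cscale (Suc n) c (cdiff V W n \<phi>) Xs" by blast+
  }
  thus ?A ?B by (auto intro!: extensionalityI[of _ "obj_lists C (Suc n)"])
qed

lemma cdiff_0_app:
  assumes [simp]: "V \<in> Obj ZF" "W \<in> Obj ZF" and \<phi>: "cochain 0 (fst V) (fst W) \<phi>" and [simp]: "X \<in> Obj C"
  shows "cdiff V W 0 \<phi> [X] = (\<iota> (Fo X) \<otimes>\<^sub>a \<phi> []) \<star> br V X \<boxplus> (- 1) \<boxdot> (br W X \<star> (\<phi> [] \<otimes>\<^sub>a \<iota> (Fo X)))"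
proof -
  have X: "[X] \<in> obj_lists C (Suc 0)" by simp
  note [simp] = cochainD(2-4)[OF \<phi>]
  show ?thesis by (simp add: cdiff_app[OF X] diff_first_def diff_middle_def diff_last_def)
qed

text \<open>The two terms of the differential in degree 0 are the two sides of the intertwining
  condition. So the closed 0-cochains are the morphisms V -> W of the centralizer, which yields the
  edge Hom(P, W) of the double complex.\<close>

lemma cdiff_0_closed_iff:
  assumes V [simp]: "V \<in> Obj ZF" "W \<in> Obj ZF" and \<phi>: "cochain 0 (fst V) (fst W) \<phi>"
  shows "cdiff V W 0 \<phi> = czero (Suc 0) (fst V) (fst W) \<longleftrightarrow> zmor V W (\<phi> [])"
proof -
  note [simp] = cochainD(2-4)[OF \<phi>]
  have *: "cdiff V W 0 \<phi> [X] = czero (Suc 0) (fst V) (fst W) [X] \<longleftrightarrow> (\<iota> (Fo X) \<otimes>\<^sub>a \<phi> []) \<star> br V X = br W X \<star> (\<phi> [] \<otimes>\<^sub>a \<iota> (Fo X))"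
    if [simp]: "X \<in> Obj C" for X
    unfolding cdiff_0_app[OF V \<phi> that]
    using D.pls_neg_eq_zr_iff[of "(\<iota> (Fo X) \<otimes>\<^sub>a \<phi> []) \<star> br V X" "br W X \<star> (\<phi> [] \<otimes>\<^sub>a \<iota> (Fo X))"] by simp
  show ?thesis
  proof
    assume "cdiff V W 0 \<phi> = czero (Suc 0) (fst V) (fst W)"
    thus "zmor V W (\<phi> [])" using * by (intro zmorI) simp_all
  next
    assume z: "zmor V W (\<phi> [])"
    show "cdiff V W 0 \<phi> = czero (Suc 0) (fst V) (fst W)"
    proof (rule extensionalityI[of _ "obj_lists C (Suc 0)"])
      fix Xs assume "Xs \<in> obj_lists C (Suc 0)"
      then obtain X where "X \<in> Obj C" "Xs = [X]" by (auto simp: obj_lists_def length_Suc_conv)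
      thus "cdiff V W 0 \<phi> Xs = czero (Suc 0) (fst V) (fst W) Xs" using * zmorD(4)[OF z] by simp
    qed simp_all
  qed
qed

text \<open>Two ways to a transformation that starts at M \<otimes> F(X) \<otimes>
  \<open>T Xs\<close>: restrict a cochain with coefficient \<open>Zo M\<close> along the unit, or
  spread an arrow u in the remaining variables over \<open>uni M X\<close>. By the universal
  property each transformation of the first kind, with X varying, is of the second kind for exactly
  one u.\<close>

definition along_unt where "along_unt M \<phi> X Xs = \<phi> (X # Xs) \<star> (unt M \<otimes>\<^sub>a \<iota> (T (X # Xs)))"
definition along_uni where "along_uni M u X Xs = (\<iota> (Fo X) \<otimes>\<^sub>a u) \<star> (uni M X \<otimes>\<^sub>a \<iota> (T Xs))"

text \<open>The contracting homotopy: \<open>homotopy M w n \<phi>\<close> is the transformation through which \<open>\<phi>\<close>, restricted along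
  the unit \<open>M \<rightarrow> Z M\<close>, factors by the universal property in its first argument.\<close>

definition homotopy where "homotopy M w n \<phi> = (\<lambda>Xs\<in>obj_lists C n. SOME u. arr D u \<and> src u = Zo M \<otimes>\<^sub>o T Xs \<and> tgt u = T Xs \<otimes>\<^sub>o w \<and>
    (\<forall>X\<in>Obj C. along_unt M \<phi> X Xs = along_uni M u X Xs))"

lemma along_uni_unique:
  assumes M: "M \<in> Obj D" and Xs: "Xs \<in> obj_lists C n" and u: "arr D u" "arr D v" "src u = Zo M \<otimes>\<^sub>o T Xs" "src v = Zo M \<otimes>\<^sub>o T Xs" "tgt u = tgt v"
    and eq: "\<And>X. X \<in> Obj C \<Longrightarrow> along_uni M u X Xs = along_uni M v X Xs"
  shows "u = v"
  using eq unfolding along_uni_def by (intro uni_unique_tns[OF M T_obj'[OF Xs] u])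

lemma along_uni_lin:
  assumes [simp]: "M \<in> Obj D" and Xs: "Xs \<in> obj_lists C n" and [simp]: "X \<in> Obj C" and u [simp]: "arr D u" "arr D v" "src u = Zo M \<otimes>\<^sub>o T Xs" "src v = Zo M \<otimes>\<^sub>o T Xs" "tgt u = tgt v"
  shows along_uni_pls: "along_uni M (u \<boxplus> v) X Xs = along_uni M u X Xs \<boxplus> along_uni M v X Xs" and along_uni_scl: "along_uni M (c \<boxdot> u) X Xs = c \<boxdot> along_uni M u X Xs"
    and along_uni_arr: "arr D (along_uni M u X Xs)" "src (along_uni M u X Xs) = M \<otimes>\<^sub>o Fo X \<otimes>\<^sub>o T Xs" "tgt (along_uni M u X Xs) = Fo X \<otimes>\<^sub>o tgt u"
  using T_obj'[OF Xs] by (simp_all add: along_uni_def D.tns_pls_right D.cmp_pls_left)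

context
  fixes M w n \<phi>
  assumes M [simp]: "M \<in> Obj D" and w [simp]: "w \<in> Obj D" and \<phi>: "cochain (Suc n) (Zo M) w \<phi>"
begin

text \<open>Restricted along the unit, \<phi> is natural in its first variable while the others are
  held fixed; the fixed variables form the right-hand factor A of
  \<open>uni_factor_tns\<close>.\<close>

lemma homotopy_ex:
  assumes Xs [simp]: "Xs \<in> obj_lists C n"
  shows "\<exists>u. arr D u \<and> src u = Zo M \<otimes>\<^sub>o T Xs \<and> tgt u = T Xs \<otimes>\<^sub>o w \<and> (\<forall>X\<in>Obj C. along_unt M \<phi> X Xs = along_uni M u X Xs)"
  unfolding along_uni_def
proof (rule uni_factor_tns[OF M])
  note [simp] = T_obj'[OF Xs] cochainD(2-4)[OF \<phi>]
  show "T Xs \<in> Obj D" "T Xs \<otimes>\<^sub>o w \<in> Obj D" by simp_all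
  show "ntr M (T Xs) (T Xs \<otimes>\<^sub>o w) (\<lambda>X. along_unt M \<phi> X Xs)"
  proof (rule ntrI)
    fix f assume f [simp]: "arr C f"
    have o: "set Xs \<subseteq> Obj C" using Xs by (simp add: obj_lists_def)
    have \<alpha>: "arrs (Suc n) (f # map (idt C) Xs)" using arrs_idt[OF Xs] by simp
    have m: "map src (map (idt C) Xs) = Xs" "map tgt (map (idt C) Xs) = Xs" by (simp_all add: map_idI)
    have n: "(Fm f \<otimes>\<^sub>a \<iota> (T Xs \<otimes>\<^sub>o w)) \<star> \<phi> (src f # Xs) = \<phi> (tgt f # Xs) \<star> (\<iota> (Zo M) \<otimes>\<^sub>a Fm f \<otimes>\<^sub>a \<iota> (T Xs))"
      using cochainD(5)[OF \<phi> \<alpha>] unfolding list.map m by (simp add: TM_idt[OF o] D.tns_idt del: map_map)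
    have "(Fm f \<otimes>\<^sub>a \<iota> (T Xs \<otimes>\<^sub>o w)) \<star> along_unt M \<phi> (src f) Xs = ((Fm f \<otimes>\<^sub>a \<iota> (T Xs \<otimes>\<^sub>o w)) \<star> \<phi> (src f # Xs)) \<star> (unt M \<otimes>\<^sub>a \<iota> (T (src f # Xs)))"
      by (simp add: along_unt_def)
    also have "\<dots> = \<phi> (tgt f # Xs) \<star> ((\<iota> (Zo M) \<otimes>\<^sub>a (Fm f \<otimes>\<^sub>a \<iota> (T Xs))) \<star> (unt M \<otimes>\<^sub>a \<iota> (Fo (src f) \<otimes>\<^sub>o T Xs)))"
      unfolding n by simp
    also have "(\<iota> (Zo M) \<otimes>\<^sub>a (Fm f \<otimes>\<^sub>a \<iota> (T Xs))) \<star> (unt M \<otimes>\<^sub>a \<iota> (Fo (src f) \<otimes>\<^sub>o T Xs))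
        = (unt M \<otimes>\<^sub>a \<iota> (Fo (tgt f) \<otimes>\<^sub>o T Xs)) \<star> (\<iota> M \<otimes>\<^sub>a (Fm f \<otimes>\<^sub>a \<iota> (T Xs)))"
      by (simp add: D.interchange)
    also have "\<phi> (tgt f # Xs) \<star> \<dots> = along_unt M \<phi> (tgt f) Xs \<star> (\<iota> M \<otimes>\<^sub>a Fm f \<otimes>\<^sub>a \<iota> (T Xs))"
      by (simp add: along_unt_def)
    finally show "(Fm f \<otimes>\<^sub>a \<iota> (T Xs \<otimes>\<^sub>o w)) \<star> along_unt M \<phi> (src f) Xs = along_unt M \<phi> (tgt f) Xs \<star> (\<iota> M \<otimes>\<^sub>a Fm f \<otimes>\<^sub>a \<iota> (T Xs))" .
  qed (simp_all add: along_unt_def)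
qed

lemma homotopy:
  assumes Xs: "Xs \<in> obj_lists C n"
  shows "arr D (homotopy M w n \<phi> Xs)" "src (homotopy M w n \<phi> Xs) = Zo M \<otimes>\<^sub>o T Xs" "tgt (homotopy M w n \<phi> Xs) = T Xs \<otimes>\<^sub>o w"
    "X \<in> Obj C \<Longrightarrow> along_unt M \<phi> X Xs = along_uni M (homotopy M w n \<phi> Xs) X Xs"
  unfolding homotopy_def restrict_apply'[OF Xs] using someI_ex[OF homotopy_ex[OF Xs]] by blast+

text \<open>Naturality in the remaining variables is tested by uniqueness: after
  \<open>uni M X\<close> it is naturality of \<phi> along families that are the identity on
  X.\<close>

lemma homotopy_cochain: "cochain n (Zo M) w (homotopy M w n \<phi>)"
proof -
  let ?h = "homotopy M w n \<phi>"
  have "cochain n (Zo M) w (restrict ?h (obj_lists C n))"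
  proof (rule cochainI)
    fix \<alpha> assume \<alpha>: "arrs n \<alpha>"
    let ?Xs = "map src \<alpha>" and ?Ys = "map tgt \<alpha>"
    note [simp] = \<alpha> arrs_rules[OF \<alpha>] homotopy(1-3) cochainD(2-4)[OF \<phi>]
    show "(TM \<alpha> \<otimes>\<^sub>a \<iota> w) \<star> ?h ?Xs = ?h ?Ys \<star> (\<iota> (Zo M) \<otimes>\<^sub>a TM \<alpha>)"
    proof (rule uni_unique_tns[OF M arrs_rules(3)[OF \<alpha>]])
      fix X assume X [simp]: "X \<in> Obj C"
      have \<beta>: "arrs (Suc n) (idt C X # \<alpha>)" by simp
      have n: "(\<iota> (Fo X) \<otimes>\<^sub>a TM \<alpha> \<otimes>\<^sub>a \<iota> w) \<star> \<phi> (X # ?Xs) = \<phi> (X # ?Ys) \<star> (\<iota> (Zo M) \<otimes>\<^sub>a \<iota> (Fo X) \<otimes>\<^sub>a TM \<alpha>)"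
        using cochainD(5)[OF \<phi> \<beta>] by simp
      have "(\<iota> (Fo X) \<otimes>\<^sub>a ((TM \<alpha> \<otimes>\<^sub>a \<iota> w) \<star> ?h ?Xs)) \<star> (uni M X \<otimes>\<^sub>a \<iota> (T ?Xs)) = (\<iota> (Fo X) \<otimes>\<^sub>a TM \<alpha> \<otimes>\<^sub>a \<iota> w) \<star> along_uni M (?h ?Xs) X ?Xs"
        by (simp add: along_uni_def D.tns_cmp_left)
      also have "along_uni M (?h ?Xs) X ?Xs = along_unt M \<phi> X ?Xs" by (rule homotopy(4)[symmetric]) simp_all
      also have "(\<iota> (Fo X) \<otimes>\<^sub>a TM \<alpha> \<otimes>\<^sub>a \<iota> w) \<star> \<dots> = ((\<iota> (Fo X) \<otimes>\<^sub>a TM \<alpha> \<otimes>\<^sub>a \<iota> w) \<star> \<phi> (X # ?Xs)) \<star> (unt M \<otimes>\<^sub>a \<iota> (Fo X \<otimes>\<^sub>o T ?Xs))"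
        by (simp add: along_unt_def)
      also have "\<dots> = \<phi> (X # ?Ys) \<star> ((\<iota> (Zo M) \<otimes>\<^sub>a (\<iota> (Fo X) \<otimes>\<^sub>a TM \<alpha>)) \<star> (unt M \<otimes>\<^sub>a \<iota> (Fo X \<otimes>\<^sub>o T ?Xs)))"
        unfolding n by simp
      also have "(\<iota> (Zo M) \<otimes>\<^sub>a (\<iota> (Fo X) \<otimes>\<^sub>a TM \<alpha>)) \<star> (unt M \<otimes>\<^sub>a \<iota> (Fo X \<otimes>\<^sub>o T ?Xs)) = (unt M \<otimes>\<^sub>a \<iota> (Fo X \<otimes>\<^sub>o T ?Ys)) \<star> (\<iota> M \<otimes>\<^sub>a (\<iota> (Fo X) \<otimes>\<^sub>a TM \<alpha>))"
        (is "?l = ?r")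
      proof -
        have "?l = unt M \<otimes>\<^sub>a (\<iota> (Fo X) \<otimes>\<^sub>a TM \<alpha>)" by (subst D.interchange) simp_all
        moreover have "?r = unt M \<otimes>\<^sub>a (\<iota> (Fo X) \<otimes>\<^sub>a TM \<alpha>)" by (subst D.interchange) simp_all
        ultimately show ?thesis by simp
      qed
      also have "\<phi> (X # ?Ys) \<star> \<dots> = along_unt M \<phi> X ?Ys \<star> (\<iota> M \<otimes>\<^sub>a (\<iota> (Fo X) \<otimes>\<^sub>a TM \<alpha>))" by (simp add: along_unt_def)
      also have "along_unt M \<phi> X ?Ys = along_uni M (?h ?Ys) X ?Ys" by (rule homotopy(4)) simp_all
      also have "\<dots> \<star> (\<iota> M \<otimes>\<^sub>a (\<iota> (Fo X) \<otimes>\<^sub>a TM \<alpha>)) = (\<iota> (Fo X) \<otimes>\<^sub>a ?h ?Ys) \<star> ((uni M X \<otimes>\<^sub>a \<iota> (T ?Ys)) \<star> (\<iota> (M \<otimes>\<^sub>o Fo X) \<otimes>\<^sub>a TM \<alpha>))"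
        by (simp add: along_uni_def)
      also have "(uni M X \<otimes>\<^sub>a \<iota> (T ?Ys)) \<star> (\<iota> (M \<otimes>\<^sub>o Fo X) \<otimes>\<^sub>a TM \<alpha>) = (\<iota> (Fo X \<otimes>\<^sub>o Zo M) \<otimes>\<^sub>a TM \<alpha>) \<star> (uni M X \<otimes>\<^sub>a \<iota> (T ?Xs))"
        by (simp add: D.interchange)
      also have "(\<iota> (Fo X) \<otimes>\<^sub>a ?h ?Ys) \<star> \<dots> = (\<iota> (Fo X) \<otimes>\<^sub>a (?h ?Ys \<star> (\<iota> (Zo M) \<otimes>\<^sub>a TM \<alpha>))) \<star> (uni M X \<otimes>\<^sub>a \<iota> (T ?Xs))"
        by (simp add: D.tns_cmp_left)
      finally show "(\<iota> (Fo X) \<otimes>\<^sub>a ((TM \<alpha> \<otimes>\<^sub>a \<iota> w) \<star> ?h ?Xs)) \<star> (uni M X \<otimes>\<^sub>a \<iota> (T ?Xs))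
          = (\<iota> (Fo X) \<otimes>\<^sub>a (?h ?Ys \<star> (\<iota> (Zo M) \<otimes>\<^sub>a TM \<alpha>))) \<star> (uni M X \<otimes>\<^sub>a \<iota> (T ?Xs))" .
    qed simp_all
  qed (simp_all add: homotopy)
  thus ?thesis by (simp add: homotopy_def)
qed

end

text \<open>The homotopy is given by choice; uniqueness in the universal property allows it to be
  computed from its defining equation.\<close>

lemma homotopy_eqI:
  assumes M: "M \<in> Obj D" "w \<in> Obj D" and \<phi>: "cochain (Suc n) (Zo M) w \<phi>" and \<psi>: "cochain n (Zo M) w \<psi>"
    and eq: "\<And>X Xs. X \<in> Obj C \<Longrightarrow> Xs \<in> obj_lists C n \<Longrightarrow> along_unt M \<phi> X Xs = along_uni M (\<psi> Xs) X Xs"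
  shows "homotopy M w n \<phi> = \<psi>"
proof (rule cochain_eqI[OF homotopy_cochain[OF M \<phi>] \<psi>])
  fix Xs assume Xs: "Xs \<in> obj_lists C n"
  show "homotopy M w n \<phi> Xs = \<psi> Xs"
    by (rule along_uni_unique[OF M(1) Xs]) (use homotopy[OF M \<phi> Xs] cochainD(2-4)[OF \<psi> Xs] eq[OF _ Xs] in simp_all)
qed

lemma homotopy_czero:
  assumes M [simp]: "M \<in> Obj D" "w \<in> Obj D"
  shows "homotopy M w n (czero (Suc n) (Zo M) w) = czero n (Zo M) w"
proof (rule homotopy_eqI[OF M])
  fix X Xs assume [simp]: "X \<in> Obj C" and Xs [simp]: "Xs \<in> obj_lists C n"
  note [simp] = T_obj'[OF Xs]
  show "along_unt M (czero (Suc n) (Zo M) w) X Xs = along_uni M (czero n (Zo M) w Xs) X Xs" by (simp add: along_unt_def along_uni_def)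
qed (simp_all add: czero_cochain)

context
  fixes M W n \<phi>
  assumes M [simp]: "M \<in> Obj D" and W [simp]: "W \<in> Obj ZF" and \<phi>: "cochain (Suc n) (Zo M) (fst W) \<phi>"
begin

abbreviation (input) "h\<phi> \<equiv> homotopy M (fst W) n \<phi>"

lemma w: "fst W \<in> Obj D" by simp

lemmas h\<phi>_cochain = homotopy_cochain[OF M w \<phi>] and h\<phi>_spec = homotopy[OF M w \<phi>]

text \<open>The unit followed by the half-braiding of the free object is \<open>uni M\<close>, so
  the first part of \<delta>\<phi> reproduces \<phi> itself. This is the identity term of the
  homotopy formula.\<close>

lemma homotopy_diff_first:
  assumes X [simp]: "X \<in> Obj C" and Xs [simp]: "Xs \<in> obj_lists C (Suc n)"
  shows "along_unt M (\<lambda>Xs. diff_first (free M) \<phi> Xs) X Xs = along_uni M (\<phi> Xs) X Xs"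
proof -
  note [simp] = T_obj'[OF Xs] cochainD(2-4)[OF \<phi>]
  have "along_unt M (\<lambda>Xs. diff_first (free M) \<phi> Xs) X Xs = (\<iota> (Fo X) \<otimes>\<^sub>a \<phi> Xs) \<star> ((br (free M) X \<star> (unt M \<otimes>\<^sub>a \<iota> (Fo X))) \<otimes>\<^sub>a \<iota> (T Xs))"
    by (simp add: along_unt_def diff_first_def D.tns_cmp_right)
  thus ?thesis by (simp add: br_free_unt along_uni_def)
qed

text \<open>The last part acts at the right end, away from the first variable, and so commutes with
  the homotopy.\<close>

lemma homotopy_diff_last:
  assumes X [simp]: "X \<in> Obj C" and Xs [simp]: "Xs \<in> obj_lists C (Suc n)"
  shows "along_unt M (\<lambda>Xs. diff_last W \<phi> Xs) X Xs = along_uni M (diff_last W h\<phi> Xs) X Xs"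
proof -
  obtain Y Ys where s: "Xs = Ys @ [Y]" and Y [simp]: "Y \<in> Obj C" and Ys [simp]: "Ys \<in> obj_lists C n" using Xs by (rule obj_lists_snocE)
  note [simp] = T_obj'[OF Ys] T_snoc[OF Ys Y] cochainD(2-4)[OF \<phi>] h\<phi>_spec(1-3)
  have "along_unt M (\<lambda>Xs. diff_last W \<phi> Xs) X Xs = (\<iota> (Fo X \<otimes>\<^sub>o T Ys) \<otimes>\<^sub>a br W Y) \<star> (along_unt M \<phi> X Ys \<otimes>\<^sub>a \<iota> (Fo Y))"
    by (simp add: along_unt_def diff_last_def s D.tns_cmp_right)
  also have "along_unt M \<phi> X Ys = along_uni M (h\<phi> Ys) X Ys" by (rule h\<phi>_spec(4)) simp_all
  also have "(\<iota> (Fo X \<otimes>\<^sub>o T Ys) \<otimes>\<^sub>a br W Y) \<star> (\<dots> \<otimes>\<^sub>a \<iota> (Fo Y)) = along_uni M (diff_last W h\<phi> Xs) X Xs"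
    by (simp add: along_uni_def diff_last_def s D.tns_cmp_right D.tns_cmp_left)
  finally show ?thesis .
qed

text \<open>By \<open>fbr_uni\<close>, \<open>uni M\<close> at X \<otimes> Y is
  \<open>uni M X\<close> followed by the half-braiding of the free object at Y. So merging X with
  the next variable becomes the first part of the differential of the homotopy.\<close>

lemma homotopy_merge_first:
  assumes X [simp]: "X \<in> Obj C" and Xs [simp]: "Xs \<in> obj_lists C (Suc n)"
  shows "\<phi> (merge_at C (Suc 0) (X # Xs)) \<star> (unt M \<otimes>\<^sub>a \<iota> (T (X # Xs))) = along_uni M (diff_first (free M) h\<phi> Xs) X Xs"
proof -
  obtain Y Ys where s: "Xs = Y # Ys" and Y [simp]: "Y \<in> Obj C" and Ys [simp]: "Ys \<in> obj_lists C n" using Xs by (rule obj_lists_SucE)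
  note [simp] = T_obj'[OF Ys] cochainD(2-4)[OF \<phi>] h\<phi>_spec(1-3)
  have m: "merge_at C (Suc 0) (X # Xs) = (X \<otimes>\<^sub>o\<^bsub>C\<^esub> Y) # Ys" by (simp add: s merge_at_def)
  have "\<phi> (merge_at C (Suc 0) (X # Xs)) \<star> (unt M \<otimes>\<^sub>a \<iota> (T (X # Xs))) = along_unt M \<phi> (X \<otimes>\<^sub>o\<^bsub>C\<^esub> Y) Ys"
    unfolding m along_unt_def by (simp add: s)
  also have "\<dots> = along_uni M (h\<phi> Ys) (X \<otimes>\<^sub>o\<^bsub>C\<^esub> Y) Ys" by (rule h\<phi>_spec(4)) simp_all
  also have "\<dots> = (\<iota> (Fo X \<otimes>\<^sub>o Fo Y) \<otimes>\<^sub>a h\<phi> Ys) \<star> (((\<iota> (Fo X) \<otimes>\<^sub>a br (free M) Y) \<star> (uni M X \<otimes>\<^sub>a \<iota> (Fo Y))) \<otimes>\<^sub>a \<iota> (T Ys))"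
    by (simp add: along_uni_def br_free fbr_uni)
  also have "\<dots> = along_uni M (diff_first (free M) h\<phi> Xs) X Xs"
    by (simp add: along_uni_def diff_first_def s D.tns_cmp_right D.tns_cmp_left)
  finally show ?thesis .
qed

lemma homotopy_merge:
  assumes X [simp]: "X \<in> Obj C" and Xs [simp]: "Xs \<in> obj_lists C (Suc n)" and i: "i < n"
  shows "\<phi> (merge_at C (Suc (Suc i)) (X # Xs)) \<star> (unt M \<otimes>\<^sub>a \<iota> (T (X # Xs))) = along_uni M (h\<phi> (merge_at C (Suc i) Xs)) X Xs"
proof -
  note m = merge_at_obj[OF Xs i]
  have "\<phi> (merge_at C (Suc (Suc i)) (X # Xs)) \<star> (unt M \<otimes>\<^sub>a \<iota> (T (X # Xs))) = along_unt M \<phi> X (merge_at C (Suc i) Xs)"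
    by (simp add: merge_at_Cons along_unt_def m(2))
  also have "\<dots> = along_uni M (h\<phi> (merge_at C (Suc i) Xs)) X (merge_at C (Suc i) Xs)" by (rule h\<phi>_spec(4)[OF m(1) X])
  finally show ?thesis by (simp add: along_uni_def m(2))
qed

text \<open>Removing X shifts every merge position by one, whence the factor -1. The merge that
  involves X itself has no counterpart among the middle terms; it supplies the first part
  instead.\<close>

lemma homotopy_diff_middle:
  assumes X [simp]: "X \<in> Obj C" and Xs [simp]: "Xs \<in> obj_lists C (Suc n)"
  shows "along_unt M (\<lambda>Xs. diff_middle (free M) W (Suc n) \<phi> Xs) X Xs
    = (- 1) \<boxdot> (along_uni M (diff_first (free M) h\<phi> Xs) X Xs \<boxplus> along_uni M (diff_middle (free M) W n h\<phi> Xs) X Xs)"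
proof -
  note [simp] = T_obj'[OF Xs] cochainD(2-4)[OF \<phi>] h\<phi>_spec(1-3)
  have XX [simp]: "X # Xs \<in> obj_lists C (Suc (Suc n))" by simp
  let ?f = "free M" and ?u = "unt M \<otimes>\<^sub>a \<iota> (T (X # Xs))" and ?g = "\<lambda>i. ((- 1) ^ Suc i) \<boxdot> \<phi> (merge_at C (Suc i) (X # Xs))"
  let ?A = "fst ?f \<otimes>\<^sub>o T (X # Xs)" and ?A' = "M \<otimes>\<^sub>o T (X # Xs)" and ?B = "T (X # Xs) \<otimes>\<^sub>o fst W"
  have \<phi>': "cochain (Suc n) (fst ?f) (fst W) \<phi>" and \<psi>': "cochain n (fst ?f) (fst W) h\<phi>" using \<phi> h\<phi>_cochain by simp_all
  have h: "homs D ?A ?B (Suc n) ?g" by (rule diff_middle_homs[OF free_obj[OF M] W \<phi>' XX])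
  \<comment> \<open>The summand with index 0 is the merge of X with the head of Xs. It is split off,
    and only the others are compared term by term.\<close>
  have h': "homs D ?A ?B n (\<lambda>i. ?g (Suc i))" using h unfolding homs_def by (meson Suc_mono)
  have h0: "arr D (?g 0)" "src (?g 0) = ?A" "tgt (?g 0) = ?B" using h unfolding homs_def by blast+
  note g0 = merge_at_obj[OF XX, of 0, simplified]
  note k = diff_middle_homs[OF free_obj[OF M] W \<psi>' Xs] and da = diff_first_arr[OF free_obj[OF M] W \<psi>' Xs] diff_middle_arr[OF free_obj[OF M] W \<psi>' Xs]
  have "along_unt M (\<lambda>Xs. diff_middle ?f W (Suc n) \<phi> Xs) X Xs = (?g 0 \<boxplus> arr_sum D ?A ?B n (\<lambda>i. ?g (Suc i))) \<star> ?u"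
    unfolding along_unt_def diff_middle_def D.arr_sum_shift[OF h] by simp
  also have "\<dots> = ?g 0 \<star> ?u \<boxplus> arr_sum D ?A ?B n (\<lambda>i. ?g (Suc i)) \<star> ?u"
    using h0 D.arr_arr_sum[OF h'] by (intro D.cmp_pls_left) simp_all
  also have "?g 0 \<star> ?u = (- 1) \<boxdot> (\<phi> (merge_at C (Suc 0) (X # Xs)) \<star> ?u)"
    using g0 by simp
  also have "\<dots> = (- 1) \<boxdot> along_uni M (diff_first ?f h\<phi> Xs) X Xs" unfolding homotopy_merge_first[OF X Xs] ..
  also have "arr_sum D ?A ?B n (\<lambda>i. ?g (Suc i)) \<star> ?u = arr_sum D ?A' ?B n (\<lambda>i. ?g (Suc i) \<star> ?u)"
    by (subst D.cmp_arr_sum_left[OF h']) simp_all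
  also have "\<dots> = arr_sum D ?A' ?B n (\<lambda>i. (- 1) \<boxdot> (((\<iota> (Fo X) \<otimes>\<^sub>a (((- 1) ^ Suc i) \<boxdot> h\<phi> (merge_at C (Suc i) Xs)))) \<star> (uni M X \<otimes>\<^sub>a \<iota> (T Xs))))"
  proof (rule arr_sum_cong)
    fix i assume i: "i < n"
    note m = merge_at_obj[OF Xs i] merge_at_obj[OF XX, of "Suc i"]
    have "?g (Suc i) \<star> ?u = ((- 1) ^ Suc (Suc i)) \<boxdot> (\<phi> (merge_at C (Suc (Suc i)) (X # Xs)) \<star> ?u)"
      using m i by simp
    also have "\<dots> = ((- 1) ^ Suc (Suc i)) \<boxdot> along_uni M (h\<phi> (merge_at C (Suc i) Xs)) X Xs" unfolding homotopy_merge[OF X Xs i] ..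
    also have "\<dots> = (- 1) \<boxdot> (((\<iota> (Fo X) \<otimes>\<^sub>a (((- 1) ^ Suc i) \<boxdot> h\<phi> (merge_at C (Suc i) Xs)))) \<star> (uni M X \<otimes>\<^sub>a \<iota> (T Xs)))"
      using m(1,2) by (simp add: along_uni_def)
    finally show "?g (Suc i) \<star> ?u = \<dots>" .
  qed
  also have "\<dots> = (- 1) \<boxdot> along_uni M (diff_middle ?f W n h\<phi> Xs) X Xs"
  proof -
    let ?k = "\<lambda>i. ((- 1) ^ Suc i) \<boxdot> h\<phi> (merge_at C (Suc i) Xs)"
    have k1: "homs D (Fo X \<otimes>\<^sub>o Zo M \<otimes>\<^sub>o T Xs) ?B n (\<lambda>i. \<iota> (Fo X) \<otimes>\<^sub>a ?k i)" using k by (simp add: homs_def)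
    have k2: "homs D ?A' ?B n (\<lambda>i. (\<iota> (Fo X) \<otimes>\<^sub>a ?k i) \<star> (uni M X \<otimes>\<^sub>a \<iota> (T Xs)))" using k by (simp add: homs_def)
    have e: "\<iota> (Fo X) \<otimes>\<^sub>a diff_middle ?f W n h\<phi> Xs = arr_sum D (Fo X \<otimes>\<^sub>o Zo M \<otimes>\<^sub>o T Xs) ?B n (\<lambda>i. \<iota> (Fo X) \<otimes>\<^sub>a ?k i)"
      unfolding diff_middle_def by (subst D.tns_arr_sum_right[OF k]) simp_all
    have "along_uni M (diff_middle ?f W n h\<phi> Xs) X Xs = arr_sum D ?A' ?B n (\<lambda>i. (\<iota> (Fo X) \<otimes>\<^sub>a ?k i) \<star> (uni M X \<otimes>\<^sub>a \<iota> (T Xs)))"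
      unfolding along_uni_def e by (subst D.cmp_arr_sum_left[OF k1]) simp_all
    thus ?thesis by (simp only: D.scl_arr_sum[OF k2])
  qed
  also have "(- 1) \<boxdot> along_uni M (diff_first ?f h\<phi> Xs) X Xs \<boxplus> (- 1) \<boxdot> along_uni M (diff_middle ?f W n h\<phi> Xs) X Xs
      = (- 1) \<boxdot> (along_uni M (diff_first ?f h\<phi> Xs) X Xs \<boxplus> along_uni M (diff_middle ?f W n h\<phi> Xs) X Xs)"
    using along_uni_arr[OF M Xs X, of "diff_first ?f h\<phi> Xs" "diff_middle ?f W n h\<phi> Xs"] along_uni_arr[OF M Xs X, of "diff_middle ?f W n h\<phi> Xs" "diff_first ?f h\<phi> Xs"] da
    by (simp add: D.scl_pls)
  finally show ?thesis .
qed

text \<open>The first part of \<delta>\<phi> gives \<phi>, and the others give minus the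
  differential of the homotopy; for the last part this rests on (-1)^(n+2) = -(-1)^(n+1).\<close>

lemma homotopy_cdiff: "homotopy M (fst W) (Suc n) (cdiff (free M) W (Suc n) \<phi>) = cadd (Suc n) \<phi> (cscale (Suc n) (- 1) (cdiff (free M) W n h\<phi>))"
proof (rule homotopy_eqI[OF M w])
  let ?f = "free M"
  have \<phi>': "cochain (Suc n) (fst ?f) (fst W) \<phi>" and \<psi>': "cochain n (fst ?f) (fst W) h\<phi>" using \<phi> h\<phi>_cochain by simp_all
  show "cochain (Suc (Suc n)) (Zo M) (fst W) (cdiff ?f W (Suc n) \<phi>)" using cdiff_cochain[OF free_obj[OF M] W \<phi>'] by simp
  show "cochain (Suc n) (Zo M) (fst W) (cadd (Suc n) \<phi> (cscale (Suc n) (- 1) (cdiff ?f W n h\<phi>)))"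
    using cdiff_cochain[OF free_obj[OF M] W \<psi>'] \<phi> by (intro cadd_cochain cscale_cochain) simp_all
  fix X Xs assume X [simp]: "X \<in> Obj C" and Xs [simp]: "Xs \<in> obj_lists C (Suc n)"
  have XX [simp]: "X # Xs \<in> obj_lists C (Suc (Suc n))" by simp
  note a = d_arrs[OF free_obj[OF M] W \<phi>' XX] and b = d_arrs[OF free_obj[OF M] W \<psi>' Xs] and c = cochainD(2-4)[OF \<phi> Xs]
  let ?e = "\<lambda>u. along_uni M u X Xs" and ?s = "(- 1) ^ Suc n :: 'k"
  let ?p = "diff_first ?f h\<phi> Xs" and ?q = "diff_middle ?f W n h\<phi> Xs" and ?r = "diff_last W h\<phi> Xs"
  note [simp] = a b c T_obj'[OF Xs]
  note el = along_uni_arr[OF M Xs X, of _ "\<phi> Xs"] along_uni_pls[OF M Xs X] along_uni_scl[OF M Xs X, of _ "\<phi> Xs"]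
  have "along_unt M (cdiff ?f W (Suc n) \<phi>) X Xs = along_unt M (\<lambda>Xs. diff_first ?f \<phi> Xs) X Xs \<boxplus> along_unt M (\<lambda>Xs. diff_middle ?f W (Suc n) \<phi> Xs) X Xs
      \<boxplus> ((- 1) ^ Suc (Suc n)) \<boxdot> along_unt M (\<lambda>Xs. diff_last W \<phi> Xs) X Xs"
    unfolding along_unt_def cdiff_app[OF XX] using a by (simp add: D.cmp_pls_left)
  also have "\<dots> = ?e (\<phi> Xs) \<boxplus> (- 1) \<boxdot> (?e ?p \<boxplus> ?e ?q) \<boxplus> ((- 1) ^ Suc (Suc n)) \<boxdot> ?e ?r"
    unfolding homotopy_diff_first[OF X Xs] homotopy_diff_middle[OF X Xs] homotopy_diff_last[OF X Xs] ..
  also have "\<dots> = ?e (\<phi> Xs) \<boxplus> (- 1) \<boxdot> (?e ?p \<boxplus> ?e ?q \<boxplus> ?s \<boxdot> ?e ?r)"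
    by (simp add: el D.scl_pls D.pls_assoc)
  also have "\<dots> = ?e (\<phi> Xs \<boxplus> (- 1) \<boxdot> (?p \<boxplus> ?q \<boxplus> ?s \<boxdot> ?r))"
    by (simp add: el)
  finally show "along_unt M (cdiff ?f W (Suc n) \<phi>) X Xs = ?e (cadd (Suc n) \<phi> (cscale (Suc n) (- 1) (cdiff ?f W n h\<phi>)) Xs)"
    by (simp add: cdiff_app)
qed

end

lemma cdiff_0_zmor:
  assumes "V \<in> Obj ZF" "W \<in> Obj ZF" and g: "zmor V W g"
  shows "cochain 0 (fst V) (fst W) (\<lambda>Xs\<in>obj_lists C 0. g)" "cdiff V W 0 (\<lambda>Xs\<in>obj_lists C 0. g) = czero (Suc 0) (fst V) (fst W)"
proof -
  note [simp] = assms(1,2) zmorD(1-3)[OF g]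
  show cochain: "cochain 0 (fst V) (fst W) (\<lambda>Xs\<in>obj_lists C 0. g)"
    by (rule cochainI) (simp_all)
  show "cdiff V W 0 (\<lambda>Xs\<in>obj_lists C 0. g) = czero (Suc 0) (fst V) (fst W)"
    using g by (simp add: cdiff_0_closed_iff[OF assms(1,2) cochain])
qed

text \<open>There is no lower homotopy in degree 0. The place of \<delta>h is taken by a projection
  onto the morphisms of the centralizer: g is the morphism that agrees with \<phi> on the
  unit.\<close>

lemma homotopy_cdiff_0:
  assumes M [simp]: "M \<in> Obj D" and W [simp]: "W \<in> Obj ZF" and \<phi>: "cochain 0 (Zo M) (fst W) \<phi>"
  shows "\<exists>g. zmor (free M) W g \<and> homotopy M (fst W) 0 (cdiff (free M) W 0 \<phi>) = cadd 0 \<phi> (cscale 0 (- 1) (\<lambda>Xs\<in>obj_lists C 0. g))"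
proof -
  note [simp] = cochainD(2-4)[OF \<phi>]
  have \<phi>': "cochain 0 (fst (free M)) (fst W) \<phi>" using \<phi> by simp
  obtain g where g: "zmor (free M) W g" "g \<star> unt M = \<phi> [] \<star> unt M"
    using free_extend[OF M W, of "\<phi> [] \<star> unt M"] by auto
  note [simp] = zmorD(1-3)[OF g(1)]
  have "homotopy M (fst W) 0 (cdiff (free M) W 0 \<phi>) = cadd 0 \<phi> (cscale 0 (- 1) (\<lambda>Xs\<in>obj_lists C 0. g))"
  proof (rule homotopy_eqI)
    show "cochain (Suc 0) (Zo M) (fst W) (cdiff (free M) W 0 \<phi>)" using cdiff_cochain[OF free_obj[OF M] W \<phi>'] by simp
    show "cochain 0 (Zo M) (fst W) (cadd 0 \<phi> (cscale 0 (- 1) (\<lambda>Xs\<in>obj_lists C 0. g)))"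
      using cdiff_0_zmor(1)[OF free_obj[OF M] W g(1)] \<phi> by (intro cadd_cochain cscale_cochain) simp_all
    fix X Xs assume X [simp]: "X \<in> Obj C" and "Xs \<in> obj_lists C 0"
    hence s: "Xs = []" by simp
    have "along_unt M (cdiff (free M) W 0 \<phi>) X [] = ((\<iota> (Fo X) \<otimes>\<^sub>a \<phi> []) \<star> br (free M) X \<boxplus> (- 1) \<boxdot> (br W X \<star> (\<phi> [] \<otimes>\<^sub>a \<iota> (Fo X)))) \<star> (unt M \<otimes>\<^sub>a \<iota> (Fo X))"
      unfolding along_unt_def cdiff_0_app[OF free_obj[OF M] W \<phi>' X] by simp
    also have "\<dots> = (\<iota> (Fo X) \<otimes>\<^sub>a \<phi> []) \<star> uni M X \<boxplus> (- 1) \<boxdot> (br W X \<star> ((\<phi> [] \<star> unt M) \<otimes>\<^sub>a \<iota> (Fo X)))"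
      by (simp add: D.cmp_pls_left br_free_unt D.tns_cmp_right)
    also have "br W X \<star> ((\<phi> [] \<star> unt M) \<otimes>\<^sub>a \<iota> (Fo X)) = (\<iota> (Fo X) \<otimes>\<^sub>a g) \<star> uni M X"
      using uni_unt[OF M W g(1) X] g(2) by simp
    also have "(\<iota> (Fo X) \<otimes>\<^sub>a \<phi> []) \<star> uni M X \<boxplus> (- 1) \<boxdot> \<dots> = along_uni M (\<phi> [] \<boxplus> (- 1) \<boxdot> g) X []"
      by (simp add: along_uni_def D.tns_pls_right D.cmp_pls_left)
    finally show "along_unt M (cdiff (free M) W 0 \<phi>) X Xs = along_uni M (cadd 0 \<phi> (cscale 0 (- 1) (\<lambda>Xs\<in>obj_lists C 0. g)) Xs) X Xs"
      by (simp add: s)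
  qed simp_all
  thus ?thesis using g(1) by blast
qed

section \<open>The square of the differential\<close>

lemma cdiff_neg:
  assumes V [simp]: "V \<in> Obj ZF" "W \<in> Obj ZF" and \<phi>: "cochain n (fst V) (fst W) \<phi>" and \<psi>: "cochain n (fst V) (fst W) \<psi>"
    and z: "cdiff V W n \<psi> = czero (Suc n) (fst V) (fst W)"
  shows "cdiff V W n (cadd n \<phi> (cscale n (- 1) \<psi>)) = cdiff V W n \<phi>"
  using cadd_neg_czero(1)[OF cdiff_cochain[OF V \<phi>]] cscale_cochain[OF _ _ \<psi>]
  by (simp add: cdiff_cadd[OF V \<phi>] cdiff_cscale[OF V \<psi> \<psi>] z)

text \<open>The unit is a section of the counit in \<open>D\<close>. Hence pulling back along the
  counit loses nothing, and questions about an arbitrary V move to a free object.\<close>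

lemma pull_unt_counit:
  assumes V [simp]: "V \<in> Obj ZF" and \<phi>: "cochain n (fst V) w \<phi>"
  shows "pull n (unt (fst V)) (pull n (counit V) \<phi>) = \<phi>"
  using pull_pull[OF \<phi>, of "counit V" "unt (fst V)"] pull_idt[OF \<phi>] by (simp add: counit)

lemma pull_unt_eq_czero:
  assumes M [simp]: "M \<in> Obj D" "w \<in> Obj D" and \<phi>: "cochain (Suc n) (Zo M) w \<phi>" and h: "homotopy M w n \<phi> = czero n (Zo M) w"
  shows "pull (Suc n) (unt M) \<phi> = czero (Suc n) M w"
proof (rule extensionalityI[of _ "obj_lists C (Suc n)"])
  fix XXs assume XXs: "XXs \<in> obj_lists C (Suc n)"
  then obtain X Xs where s: "XXs = X # Xs" and X [simp]: "X \<in> Obj C" and Xs [simp]: "Xs \<in> obj_lists C n" by (rule obj_lists_SucE)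
  note [simp] = T_obj'[OF Xs]
  have "along_unt M \<phi> X Xs = zr D (M \<otimes>\<^sub>o T (X # Xs)) (T (X # Xs) \<otimes>\<^sub>o w)"
    using homotopy(4)[OF M \<phi> Xs X] by (simp add: h along_uni_def)
  thus "pull (Suc n) (unt M) \<phi> XXs = czero (Suc n) M w XXs" by (simp add: s along_unt_def)
qed simp_all

text \<open>On the free object, h\<delta>(\<delta>\<psi>) = \<delta>\<psi> - \<delta>h\<delta>\<psi>
  = 0 by \<open>homotopy_cdiff\<close> and the hypothesis, so \<delta>\<delta>\<psi> vanishes along
  the unit. For \<psi> the pullback of \<phi> along the counit, \<delta>\<delta>\<psi> is the
  pullback of \<delta>\<delta>\<phi>, and restricting it along the unit returns
  \<delta>\<delta>\<phi>.\<close>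

lemma cdiff_cdiff_step:
  assumes V [simp]: "V \<in> Obj ZF" and W [simp]: "W \<in> Obj ZF" and \<phi>: "cochain n (fst V) (fst W) \<phi>"
    and h: "\<And>\<psi>. cochain n (Zo (fst V)) (fst W) \<psi> \<Longrightarrow>
      cdiff (free (fst V)) W n (homotopy (fst V) (fst W) n (cdiff (free (fst V)) W n \<psi>)) = cdiff (free (fst V)) W n \<psi>"
  shows "cdiff V W (Suc n) (cdiff V W n \<phi>) = czero (Suc (Suc n)) (fst V) (fst W)"
proof -
  let ?v = "fst V" and ?f = "free (fst V)" and ?w = "fst W"
  let ?c = "counit V" and ?d = "cdiff V W n \<phi>"
  have c: "zmor ?f V ?c" by (simp add: counit)
  have f [simp]: "?f \<in> Obj ZF" by simp
  define \<psi> where "\<psi> = pull n ?c \<phi>"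
  have \<psi>: "cochain n (fst ?f) ?w \<psi>" unfolding \<psi>_def by (rule pull_cochain[OF _ _ \<phi>]) simp_all
  let ?e = "cdiff ?f W n \<psi>"
  have d: "cochain (Suc n) ?v ?w ?d" by (rule cdiff_cochain[OF V W \<phi>])
  have e: "cochain (Suc n) (Zo ?v) ?w ?e" using cdiff_cochain[OF f W \<psi>] by simp
  have de: "cochain (Suc (Suc n)) (Zo ?v) ?w (cdiff ?f W (Suc n) ?e)" using cdiff_cochain[OF f W, of "Suc n" ?e] e by simp
  have "homotopy ?v ?w (Suc n) (cdiff ?f W (Suc n) ?e) = czero (Suc n) (Zo ?v) ?w"
    unfolding homotopy_cdiff[OF Obj_fst[OF V] W e] using h[of \<psi>] \<psi> cadd_neg_czero(2)[OF e] by simp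
  from pull_unt_eq_czero[OF Obj_fst[OF V] Obj_fst[OF W] de this]
  have z: "pull (Suc (Suc n)) (unt ?v) (cdiff ?f W (Suc n) ?e) = czero (Suc (Suc n)) ?v ?w" .
  have "?e = pull (Suc n) ?c ?d" unfolding \<psi>_def by (rule cdiff_pull[OF V f W \<phi> c])
  hence "cdiff ?f W (Suc n) ?e = pull (Suc (Suc n)) ?c (cdiff V W (Suc n) ?d)"
    using cdiff_pull[OF V f W d c] by simp
  thus ?thesis using z pull_unt_counit[OF V cdiff_cochain[OF V W d]] by simp
qed

text \<open>The hypothesis \<delta>h\<delta> = \<delta> of the step holds because h\<delta>\<psi>
  differs from \<psi> by a closed cochain: a morphism in degree 0, and \<delta>h\<psi> in degree n +
  1, which is closed by the induction hypothesis. The latter is applied to a free object, hence the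
  induction generalizes V.\<close>

lemma cdiff_cdiff:
  assumes W [simp]: "W \<in> Obj ZF"
  shows "V \<in> Obj ZF \<Longrightarrow> cochain n (fst V) (fst W) \<phi> \<Longrightarrow> cdiff V W (Suc n) (cdiff V W n \<phi>) = czero (Suc (Suc n)) (fst V) (fst W)"
proof (induction n arbitrary: V \<phi>)
  case 0
  note V = 0(1)
  have f: "free (fst V) \<in> Obj ZF" using V by simp
  show ?case
  proof (rule cdiff_cdiff_step[OF V W 0(2)])
    fix \<psi> assume \<psi>: "cochain 0 (Zo (fst V)) (fst W) \<psi>"
    hence \<psi>': "cochain 0 (fst (free (fst V))) (fst W) \<psi>" by simp
    obtain g where g: "zmor (free (fst V)) W g"
      "homotopy (fst V) (fst W) 0 (cdiff (free (fst V)) W 0 \<psi>) = cadd 0 \<psi> (cscale 0 (- 1) (\<lambda>Xs\<in>obj_lists C 0. g))"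
      using homotopy_cdiff_0[OF Obj_fst[OF V] W \<psi>] by blast
    show "cdiff (free (fst V)) W 0 (homotopy (fst V) (fst W) 0 (cdiff (free (fst V)) W 0 \<psi>)) = cdiff (free (fst V)) W 0 \<psi>"
      unfolding g(2) by (rule cdiff_neg[OF f W \<psi>' cdiff_0_zmor[OF f W g(1)]])
  qed
next
  case (Suc n)
  note V = Suc.prems(1)
  have f: "free (fst V) \<in> Obj ZF" using V by simp
  show ?case
  proof (rule cdiff_cdiff_step[OF V W Suc.prems(2)])
    fix \<psi> assume \<psi>: "cochain (Suc n) (Zo (fst V)) (fst W) \<psi>"
    hence \<psi>': "cochain (Suc n) (fst (free (fst V))) (fst W) \<psi>" by simp
    let ?h = "homotopy (fst V) (fst W) n \<psi>"
    have h: "cochain n (fst (free (fst V))) (fst W) ?h" using homotopy_cochain[OF Obj_fst[OF V] Obj_fst[OF W] \<psi>] by simp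
    show "cdiff (free (fst V)) W (Suc n) (homotopy (fst V) (fst W) (Suc n) (cdiff (free (fst V)) W (Suc n) \<psi>)) = cdiff (free (fst V)) W (Suc n) \<psi>"
      unfolding homotopy_cdiff[OF Obj_fst[OF V] W \<psi>] by (rule cdiff_neg[OF f W \<psi>' cdiff_cochain[OF f W h] Suc.IH[OF f h]])
  qed
qed

text \<open>On the free object over P the relation h\<delta> + \<delta>h = 1 makes the pullback of a
  closed \<phi> along the counit equal to \<delta> of its homotopy. A section i of the counit leads
  back to P, and since i is a morphism of the centralizer, pulling back along it commutes with
  \<delta>.\<close>

lemma rel_projective_acyclic:
  assumes P: "rel_projective ZF D forgetful P" and W [simp]: "W \<in> Obj ZF" and \<phi>: "cochain (Suc n) (fst P) (fst W) \<phi>"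
    and closed: "cdiff P W (Suc n) \<phi> = czero (Suc (Suc n)) (fst P) (fst W)"
  shows "\<exists>\<psi>. cochain n (fst P) (fst W) \<psi> \<and> \<phi> = cdiff P W n \<psi>"
proof -
  have V [simp]: "P \<in> Obj ZF" using P by (simp add: rel_projective_def)
  let ?p = "fst P" and ?f = "free (fst P)" and ?w = "fst W" and ?c = "counit P"
  have f [simp]: "?f \<in> Obj ZF" by simp
  obtain i where i: "zmor P ?f i" "?c \<star> i = \<iota> ?p" using rel_projective_retract[OF P] by blast
  note [simp] = zmorD(1-3)[OF i(1)]
  have c: "zmor ?f P ?c" by (simp add: counit)
  let ?\<phi> = "pull (Suc n) ?c \<phi>"
  have \<phi>': "cochain (Suc n) (Zo ?p) ?w ?\<phi>" by (rule pull_cochain[OF _ _ \<phi>]) simp_all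
  let ?h = "homotopy ?p ?w n ?\<phi>"
  have h: "cochain n (fst ?f) ?w ?h" using homotopy_cochain[OF _ _ \<phi>'] by simp
  have "cdiff ?f W (Suc n) ?\<phi> = czero (Suc (Suc n)) (Zo ?p) ?w"
    unfolding cdiff_pull[OF V f W \<phi> c] closed by (rule pull_czero) simp_all
  hence "homotopy ?p ?w (Suc n) (cdiff ?f W (Suc n) ?\<phi>) = czero (Suc n) (Zo ?p) ?w" by (simp add: homotopy_czero)
  hence "cadd (Suc n) ?\<phi> (cscale (Suc n) (- 1) (cdiff ?f W n ?h)) = czero (Suc n) (Zo ?p) ?w"
    by (simp add: homotopy_cdiff[OF _ W \<phi>'])
  from cadd_neg_eq_czero[OF \<phi>' _ this] have "?\<phi> = cdiff ?f W n ?h" using cdiff_cochain[OF f W h] by simp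
  hence "pull (Suc n) i ?\<phi> = cdiff P W n (pull n i ?h)" using cdiff_pull[OF f V W h i(1)] by simp
  moreover have "pull (Suc n) i ?\<phi> = \<phi>" using pull_pull[OF \<phi>, of ?c i] pull_idt[OF \<phi>] i(2) by simp
  moreover have "cochain n ?p ?w (pull n i ?h)" by (rule pull_cochain[OF _ _ h]) simp_all
  ultimately show ?thesis by metis
qed

end

text \<open>An equation in V holds as soon as it holds after the injective map t. The operations of
  \<open>DY_cochains\<close> obtain their laws in this way from
  \<open>cochain_space\<close>.\<close>

lemma vectorspace_pullback:
  fixes V :: "('k::field, 'a) module" and V' :: "('k, 'b) module"
  assumes V': "vectorspace class_ring V'" and t: "\<And>x. x \<in> carrier V \<Longrightarrow> t x \<in> carrier V'" "inj_on t (carrier V)"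
    and c: "\<zero>\<^bsub>V\<^esub> \<in> carrier V" "\<And>x y. x \<in> carrier V \<Longrightarrow> y \<in> carrier V \<Longrightarrow> x \<oplus>\<^bsub>V\<^esub> y \<in> carrier V"
      "\<And>c x. x \<in> carrier V \<Longrightarrow> c \<odot>\<^bsub>V\<^esub> x \<in> carrier V"
    and h: "t \<zero>\<^bsub>V\<^esub> = \<zero>\<^bsub>V'\<^esub>" "\<And>x y. x \<in> carrier V \<Longrightarrow> y \<in> carrier V \<Longrightarrow> t (x \<oplus>\<^bsub>V\<^esub> y) = t x \<oplus>\<^bsub>V'\<^esub> t y"
      "\<And>c x. x \<in> carrier V \<Longrightarrow> t (c \<odot>\<^bsub>V\<^esub> x) = c \<odot>\<^bsub>V'\<^esub> t x"
  shows "vectorspace class_ring V"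
proof -
  have e: "x = y" if "t x = t y" "x \<in> carrier V" "y \<in> carrier V" for x y using that t(2) by (auto simp: inj_on_def)
  note [simp] = c h t(1) vs_closed[OF V'] vs_zero_left[OF V'] vs_zero_right[OF V'] vs_scale_add[OF V'] vs_add_scale[OF V'] vs_scale_scale[OF V'] vs_one[OF V'] vs_neg_right[OF V'] vs_neg_left[OF V'] vs_zero_scale[OF V']
  show ?thesis
    by (rule vectorspaceI; (simp; fail)?; rule e; simp add: vs_ac[OF V'])
qed

context tensor_functor
begin

section \<open>Comparison with the Davydov--Yetter complex\<close>

definition cochain_space :: "'p \<Rightarrow> 'p \<Rightarrow> nat \<Rightarrow> ('k, 'o list \<Rightarrow> 'p \<times> 'n \<times> 'p) module" where
  "cochain_space V W n = \<lparr>carrier = {\<phi>. cochain n V W \<phi>}, mult = undefined, one = undefined, zero = czero n V W, add = cadd n, smult = cscale n\<rparr>"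

lemma cochain_space_simps [simp]: "carrier (cochain_space V W n) = {\<phi>. cochain n V W \<phi>}" "zero (cochain_space V W n) = czero n V W" "add (cochain_space V W n) = cadd n" "smult (cochain_space V W n) = cscale n"
  by (simp_all add: cochain_space_def)

text \<open>Attaches to each component its source and target. The linear structure and the
  differential are compared through this map, which is injective on extensional families and reaches
  every cochain.\<close>

definition to_cochain where "to_cochain V W n f = (\<lambda>Xs\<in>obj_lists C n. mk (V \<otimes>\<^sub>o T Xs) (f Xs) (T Xs \<otimes>\<^sub>o W))"

lemma to_cochain_inj: "f \<in> extensional (obj_lists C n) \<Longrightarrow> g \<in> extensional (obj_lists C n) \<Longrightarrow> to_cochain V W n f = to_cochain V W n g \<Longrightarrow> f = g"
proof (rule extensionalityI)
  fix Xs assume e: "to_cochain V W n f = to_cochain V W n g" and Xs: "Xs \<in> obj_lists C n"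
  have "to_cochain V W n f Xs = to_cochain V W n g Xs" by (simp only: e)
  thus "f Xs = g Xs" using Xs by (simp add: to_cochain_def)
qed

lemma to_cochain_surj: "cochain n V W \<phi> \<Longrightarrow> \<exists>f\<in>extensional (obj_lists C n). to_cochain V W n f = \<phi>"
proof (intro bexI[of _ "\<lambda>Xs\<in>obj_lists C n. und (\<phi> Xs)"] extensionalityI[of _ "obj_lists C n"])
  assume \<phi>: "cochain n V W \<phi>"
  show "\<phi> \<in> extensional (obj_lists C n)" by (rule cochainD(1)[OF \<phi>])
  fix Xs assume Xs: "Xs \<in> obj_lists C n"
  thus "to_cochain V W n (\<lambda>Xs\<in>obj_lists C n. und (\<phi> Xs)) Xs = \<phi> Xs"
    using cochainD(3,4)[OF \<phi> Xs] by (simp add: to_cochain_def mk_und')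
qed (simp_all add: to_cochain_def)

context
  fixes V W
  assumes V [simp]: "V \<in> Obj ZF" and W [simp]: "W \<in> Obj ZF"
begin

lemma DY_simps:
  "\<zero>\<^bsub>DY_cochains C D F V W n\<^esub> = (\<lambda>Xs\<in>obj_lists C n. \<zero>\<^bsub>DY_hom D F (fst V) (fst W) Xs\<^esub>)"
  "f \<oplus>\<^bsub>DY_cochains C D F V W n\<^esub> g = (\<lambda>Xs\<in>obj_lists C n. f Xs \<oplus>\<^bsub>DY_hom D F (fst V) (fst W) Xs\<^esub> g Xs)"
  "c \<odot>\<^bsub>DY_cochains C D F V W n\<^esub> f = (\<lambda>Xs\<in>obj_lists C n. c \<odot>\<^bsub>DY_hom D F (fst V) (fst W) Xs\<^esub> f Xs)"
  by (simp_all add: DY_cochains_def case_prod_beta)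

lemma to_cochain_ops:
  "to_cochain (fst V) (fst W) n \<zero>\<^bsub>DY_cochains C D F V W n\<^esub> = czero n (fst V) (fst W)"
  "to_cochain (fst V) (fst W) n (f \<oplus>\<^bsub>DY_cochains C D F V W n\<^esub> g) = cadd n (to_cochain (fst V) (fst W) n f) (to_cochain (fst V) (fst W) n g)"
  "to_cochain (fst V) (fst W) n (c \<odot>\<^bsub>DY_cochains C D F V W n\<^esub> f) = cscale n c (to_cochain (fst V) (fst W) n f)"
  by (auto intro!: extensionalityI[of _ "obj_lists C n"] simp: DY_simps to_cochain_def czero_def cadd_def cscale_def DY_hom_def zr_def pls_def scl_def)

lemma to_cochain_natural_iff:
  assumes \<alpha>: "arrs n \<alpha>"
  shows "(TM \<alpha> \<otimes>\<^sub>a \<iota> (fst W)) \<star> to_cochain (fst V) (fst W) n f (map src \<alpha>) = to_cochain (fst V) (fst W) n f (map tgt \<alpha>) \<star> (\<iota> (fst V) \<otimes>\<^sub>a TM \<alpha>) \<longleftrightarrow>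
    (F_mors D F (map src \<alpha>) (map tgt \<alpha>) (map und \<alpha>) \<otimes>\<^sub>m Ident D (fst W)) \<cdot> f (map src \<alpha>) =
    f (map tgt \<alpha>) \<cdot> (Ident D (fst V) \<otimes>\<^sub>m F_mors D F (map src \<alpha>) (map tgt \<alpha>) (map und \<alpha>))"
  unfolding F_mors_TM[symmetric] using arrs_rules(1,2)[OF \<alpha>]
  by (simp add: to_cochain_def cmp_def tns_def idt_def)

lemma DY_carrier: "f \<in> carrier (DY_cochains C D F V W n) \<longleftrightarrow> f \<in> extensional (obj_lists C n) \<and> cochain n (fst V) (fst W) (to_cochain (fst V) (fst W) n f)"
proof -
  let ?nat = "\<lambda>Xs Ys gs. (F_mors D F Xs Ys gs \<otimes>\<^sub>m Ident D (fst W)) \<cdot> f Xs = f Ys \<cdot> (Ident D (fst V) \<otimes>\<^sub>m F_mors D F Xs Ys gs)"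
  have "(\<forall>Xs\<in>obj_lists C n. \<forall>Ys\<in>obj_lists C n. \<forall>gs. length gs = n \<and> (\<forall>i<n. gs ! i \<in> Mor C (Xs ! i) (Ys ! i)) \<longrightarrow> ?nat Xs Ys gs)
      \<longleftrightarrow> (\<forall>\<alpha>. arrs n \<alpha> \<longrightarrow> ?nat (map src \<alpha>) (map tgt \<alpha>) (map und \<alpha>))" (is "?L \<longleftrightarrow> ?R")
  proof
    assume L: ?L
    show ?R
    proof (intro allI impI)
      fix \<alpha> assume \<alpha>: "arrs n \<alpha>"
      have "length (map und \<alpha>) = n \<and> (\<forall>i<n. map und \<alpha> ! i \<in> Mor C (map src \<alpha> ! i) (map tgt \<alpha> ! i))"
        using \<alpha> arr_und[of C, OF _ refl refl] by (simp add: arrs_def)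
      thus "?nat (map src \<alpha>) (map tgt \<alpha>) (map und \<alpha>)" using L arrs_rules(1,2)[OF \<alpha>] by blast
    qed
  next
    assume R: ?R
    show ?L
    proof (intro ballI allI impI, elim conjE)
      fix Xs Ys gs assume Xs: "Xs \<in> obj_lists C n" and Ys: "Ys \<in> obj_lists C n" and gs: "length gs = n" "\<forall>i<n. gs ! i \<in> Mor C (Xs ! i) (Ys ! i)"
      \<comment> \<open>The three parallel lists are zipped into one list of arrows; the converse
        direction above unzips by \<open>src\<close>, \<open>tgt\<close> and
        \<open>und\<close>.\<close>
      define \<alpha> where "\<alpha> = map (\<lambda>i. mk (Xs ! i) (gs ! i) (Ys ! i)) [0..<n]"
      have m: "map src \<alpha> = Xs" "map tgt \<alpha> = Ys" "map und \<alpha> = gs"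
        using obj_lists_length[OF Xs] obj_lists_length[OF Ys] gs(1) by (auto simp: \<alpha>_def intro!: nth_equalityI)
      have "Xs ! i \<in> Obj C" "Ys ! i \<in> Obj C" if "i < n" for i
        using that Xs Ys by (auto simp: obj_lists_def)
      hence "arrs n \<alpha>" using gs by (auto simp: arrs_def \<alpha>_def)
      thus "?nat Xs Ys gs" using R m by metis
    qed
  qed
  hence n: "?L \<longleftrightarrow> (\<forall>\<alpha>. arrs n \<alpha> \<longrightarrow> (TM \<alpha> \<otimes>\<^sub>a \<iota> (fst W)) \<star> to_cochain (fst V) (fst W) n f (map src \<alpha>) = to_cochain (fst V) (fst W) n f (map tgt \<alpha>) \<star> (\<iota> (fst V) \<otimes>\<^sub>a TM \<alpha>))"
    using to_cochain_natural_iff by simp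
  have c: "(\<forall>Xs\<in>obj_lists C n. f Xs \<in> carrier (DY_hom D F (fst V) (fst W) Xs)) \<longleftrightarrow>
    (\<forall>Xs\<in>obj_lists C n. arr D (to_cochain (fst V) (fst W) n f Xs) \<and> src (to_cochain (fst V) (fst W) n f Xs) = fst V \<otimes>\<^sub>o T Xs \<and> tgt (to_cochain (fst V) (fst W) n f Xs) = T Xs \<otimes>\<^sub>o fst W)"
    by (auto simp: to_cochain_def DY_hom_def)
  show ?thesis
    unfolding cochain_def n[symmetric] c[symmetric] by (auto simp: DY_cochains_def case_prod_beta to_cochain_def)
qed

lemma br_mk: "br V X = mk (fst V \<otimes>\<^sub>o Fo X) (snd V X) (Fo X \<otimes>\<^sub>o fst V)"
  by (simp add: br_def)

lemma to_cochain_diff: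
  assumes f: "f \<in> carrier (DY_cochains C D F V W n)"
  shows "to_cochain (fst V) (fst W) (Suc n) (DY_diff C D F V W n f) = cdiff V W n (to_cochain (fst V) (fst W) n f)"
proof (rule extensionalityI[of _ "obj_lists C (Suc n)"])
  let ?\<phi> = "to_cochain (fst V) (fst W) n f"
  have \<phi>: "cochain n (fst V) (fst W) ?\<phi>" using f by (simp add: DY_carrier)
  fix Xs assume Xs: "Xs \<in> obj_lists C (Suc n)"
  let ?A = "fst V \<otimes>\<^sub>o T Xs" and ?B = "T Xs \<otimes>\<^sub>o fst W"
  let ?h = "\<lambda>i. (- 1) ^ i \<odot>\<^bsub>HomV D ?A ?B\<^esub> f (merge_at C i Xs)"
  have o: "?A \<in> Obj D" "?B \<in> Obj D" using T_obj'[OF Xs] by simp_all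
  note a = d_arrs[OF V W \<phi> Xs]
  have tl: "tl Xs \<in> obj_lists C n" "butlast Xs \<in> obj_lists C n" using Xs by (cases Xs; auto simp: obj_lists_def dest: in_set_butlastD)+
  have m: "mk ?A (?h (Suc i)) ?B = ((- 1) ^ Suc i) \<boxdot> ?\<phi> (merge_at C (Suc i) Xs)" if "i < n" for i
    using merge_at_obj[OF Xs that] by (simp add: to_cochain_def scl_def)
  have hM: "?h (Suc i) \<in> Mor D ?A ?B" if "i < n" for i
  proof -
    have "arr D (mk ?A (?h (Suc i)) ?B)"
      unfolding m[OF that] by (rule D.arr_scl[OF cochainD(2)[OF \<phi> merge_at_obj(1)[OF Xs that]]])
    thus ?thesis unfolding arr_mk by blast
  qed
  have 1: "diff_first V ?\<phi> Xs = mk ?A ((Ident D (Fo (hd Xs)) \<otimes>\<^sub>m f (tl Xs)) \<cdot> (snd V (hd Xs) \<otimes>\<^sub>m Ident D (T (tl Xs)))) ?B"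
    by (rule arrow_eqI) (use a tl in \<open>simp_all add: diff_first_def to_cochain_def cmp_def tns_def idt_def br_mk\<close>)
  have 2: "diff_last W ?\<phi> Xs = mk ?A ((Ident D (T (butlast Xs)) \<otimes>\<^sub>m snd W (last Xs)) \<cdot> (f (butlast Xs) \<otimes>\<^sub>m Ident D (Fo (last Xs)))) ?B"
    by (rule arrow_eqI) (use a tl in \<open>simp_all add: diff_last_def to_cochain_def cmp_def tns_def idt_def br_def\<close>)
  have 3: "diff_middle V W n ?\<phi> Xs = mk ?A (\<Oplus>\<^bsub>HomV D ?A ?B\<^esub>i\<in>{1..n}. ?h i) ?B"
  proof -
    have "mk ?A (\<Oplus>\<^bsub>HomV D ?A ?B\<^esub>i\<in>{1..n}. ?h i) ?B = arr_sum D ?A ?B n (\<lambda>i. mk ?A (?h (Suc i)) ?B)"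
      by (rule D.finsum_arr_sum[OF o]) (rule hM)
    also have "\<dots> = diff_middle V W n ?\<phi> Xs" unfolding diff_middle_def by (rule arr_sum_cong) (rule m)
    finally show ?thesis ..
  qed
  show "to_cochain (fst V) (fst W) (Suc n) (DY_diff C D F V W n f) Xs = cdiff V W n ?\<phi> Xs"
    unfolding cdiff_app[OF Xs] 1 2 3 using Xs
    by (simp add: to_cochain_def DY_diff_def case_prod_beta Let_def DY_hom_def pls_def scl_def)
qed (simp_all add: to_cochain_def)

end

lemma vectorspace_cochain_space: "V \<in> Obj D \<Longrightarrow> W \<in> Obj D \<Longrightarrow> vectorspace class_ring (cochain_space V W n)"
proof (rule vectorspaceI, unfold cochain_space_simps mem_Collect_eq)
  assume V [simp]: "V \<in> Obj D" "W \<in> Obj D"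
  have e: "\<phi> = \<psi>" if "cochain n V W \<phi>" "cochain n V W \<psi>" "\<And>Xs. Xs \<in> obj_lists C n \<Longrightarrow> T Xs \<in> Obj D \<Longrightarrow> \<phi> Xs = \<psi> Xs" for \<phi> \<psi>
    using cochain_eqI[OF that(1,2)] that(3) T_obj' by blast
  note t = cadd_cochain[OF V] cscale_cochain[OF V] czero_cochain[OF V]
  show "cochain n V W (czero n V W)" by (rule t)
  fix \<phi> assume \<phi>: "cochain n V W \<phi>"
  note [simp] = cochainD(2-4)[OF \<phi>]
  show s: "cochain n V W (cscale n c \<phi>)" for c by (rule cscale_cochain[OF V \<phi>])
  show "cadd n \<phi> (czero n V W) = \<phi>" by (rule e) (simp_all add: t \<phi>)
  show "cadd n \<phi> (cscale n (- 1) \<phi>) = czero n V W" by (rule e) (simp_all add: t \<phi>)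
  show "cscale n (a + b) \<phi> = cadd n (cscale n a \<phi>) (cscale n b \<phi>)" for a b
    by (rule e) (simp_all add: t \<phi> vs_add_scale[OF D.hom_vs] scl_def pls_def arr_und)
  show "cscale n a (cscale n b \<phi>) = cscale n (a * b) \<phi>" for a b by (rule e) (simp_all add: t \<phi>)
  show "cscale n 1 \<phi> = \<phi>" by (rule e) (simp_all add: t \<phi>)
  fix \<psi> assume \<psi>: "cochain n V W \<psi>"
  note [simp] = cochainD(2-4)[OF \<psi>]
  show "cochain n V W (cadd n \<phi> \<psi>)" by (rule cadd_cochain[OF V \<phi> \<psi>])
  show "cadd n \<phi> \<psi> = cadd n \<psi> \<phi>" by (rule e) (simp_all add: t \<phi> \<psi> D.pls_comm)
  show "cscale n c (cadd n \<phi> \<psi>) = cadd n (cscale n c \<phi>) (cscale n c \<psi>)" for c by (rule e) (simp_all add: t \<phi> \<psi> D.scl_pls)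
  fix \<chi> assume \<chi>: "cochain n V W \<chi>"
  note [simp] = cochainD(2-4)[OF \<chi>]
  show "cadd n (cadd n \<phi> \<psi>) \<chi> = cadd n \<phi> (cadd n \<psi> \<chi>)" by (rule e) (simp_all add: t \<phi> \<psi> \<chi> D.pls_assoc)
qed

lemma vectorspace_DY:
  assumes V [simp]: "V \<in> Obj ZF" "W \<in> Obj ZF"
  shows "vectorspace class_ring (DY_cochains C D F V W n)"
proof (rule vectorspace_pullback[OF vectorspace_cochain_space[OF Obj_fst[OF V(1)] Obj_fst[OF V(2)], of n], of _ "to_cochain (fst V) (fst W) n"])
  let ?K = "DY_cochains C D F V W n" and ?t = "to_cochain (fst V) (fst W) n"
  note w = Obj_fst[OF V(1)] Obj_fst[OF V(2)]
  have ext: "\<zero>\<^bsub>?K\<^esub> \<in> extensional (obj_lists C n)" "f \<oplus>\<^bsub>?K\<^esub> g \<in> extensional (obj_lists C n)" "c \<odot>\<^bsub>?K\<^esub> f \<in> extensional (obj_lists C n)" for f g c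
    unfolding DY_simps[OF V] by simp_all
  have cl: "f \<in> carrier ?K" if "f \<in> extensional (obj_lists C n)" "cochain n (fst V) (fst W) (?t f)" for f
    using that unfolding DY_carrier[OF V] by blast
  have cD: "f \<in> extensional (obj_lists C n)" "cochain n (fst V) (fst W) (?t f)" if "f \<in> carrier ?K" for f
    using that unfolding DY_carrier[OF V] by blast+
  show "inj_on ?t (carrier ?K)" by (rule inj_onI, rule to_cochain_inj[OF cD(1) cD(1)])
  show "?t \<zero>\<^bsub>?K\<^esub> = \<zero>\<^bsub>cochain_space (fst V) (fst W) n\<^esub>" unfolding cochain_space_simps by (rule to_cochain_ops[OF V])
  show "\<zero>\<^bsub>?K\<^esub> \<in> carrier ?K" using cl[OF ext(1)] czero_cochain[OF w] unfolding to_cochain_ops[OF V] by blast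
  fix f assume f: "f \<in> carrier ?K"
  show "?t f \<in> carrier (cochain_space (fst V) (fst W) n)" unfolding cochain_space_simps mem_Collect_eq by (rule cD(2)[OF f])
  show "?t (c \<odot>\<^bsub>?K\<^esub> f) = c \<odot>\<^bsub>cochain_space (fst V) (fst W) n\<^esub> ?t f" for c unfolding cochain_space_simps by (rule to_cochain_ops[OF V])
  show "c \<odot>\<^bsub>?K\<^esub> f \<in> carrier ?K" for c
    using cl[OF ext(3)] cscale_cochain[OF w cD(2)[OF f]] unfolding to_cochain_ops[OF V] by blast
  fix g assume g: "g \<in> carrier ?K"
  show "?t (f \<oplus>\<^bsub>?K\<^esub> g) = ?t f \<oplus>\<^bsub>cochain_space (fst V) (fst W) n\<^esub> ?t g" unfolding cochain_space_simps by (rule to_cochain_ops[OF V])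
  show "f \<oplus>\<^bsub>?K\<^esub> g \<in> carrier ?K"
    using cl[OF ext(2)] cadd_cochain[OF w cD(2)[OF f] cD(2)[OF g]] unfolding to_cochain_ops[OF V] by blast
qed

lemma DY_diff_linear:
  assumes V [simp]: "V \<in> Obj ZF" "W \<in> Obj ZF"
  shows "linear_map class_ring (DY_cochains C D F V W n) (DY_cochains C D F V W (Suc n)) (DY_diff C D F V W n)"
proof (rule linear_mapI[OF vectorspace_DY[OF V] vectorspace_DY[OF V]])
  let ?K = "DY_cochains C D F V W n" and ?K' = "DY_cochains C D F V W (Suc n)" and ?d = "DY_diff C D F V W n"
  note vs = vs_closed[OF vectorspace_DY[OF V]]
  have ext: "?d f \<in> extensional (obj_lists C (Suc n))" for f by (simp add: DY_diff_def case_prod_beta)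
  show cl: "?d f \<in> carrier ?K'" if "f \<in> carrier ?K" for f
    using that ext by (simp add: DY_carrier[OF V] to_cochain_diff[OF V that] cdiff_cochain[OF V])
  have e: "f = g" if "f \<in> carrier ?K'" "g \<in> carrier ?K'" "to_cochain (fst V) (fst W) (Suc n) f = to_cochain (fst V) (fst W) (Suc n) g" for f g
    using that to_cochain_inj by (auto simp: DY_carrier[OF V])
  fix f assume f: "f \<in> carrier ?K"
  hence f': "cochain n (fst V) (fst W) (to_cochain (fst V) (fst W) n f)" by (simp add: DY_carrier[OF V])
  show "?d (c \<odot>\<^bsub>?K\<^esub> f) = c \<odot>\<^bsub>?K'\<^esub> ?d f" for c
    by (rule e) (use f f' in \<open>simp_all only: cl vs to_cochain_diff[OF V] to_cochain_ops[OF V] cdiff_cscale[OF V]\<close>)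
  fix g assume g: "g \<in> carrier ?K"
  hence g': "cochain n (fst V) (fst W) (to_cochain (fst V) (fst W) n g)" by (simp add: DY_carrier[OF V])
  show "?d (f \<oplus>\<^bsub>?K\<^esub> g) = ?d f \<oplus>\<^bsub>?K'\<^esub> ?d g"
    by (rule e) (use f f' g g' in \<open>simp_all only: cl vs to_cochain_diff[OF V] to_cochain_ops[OF V] cdiff_cadd[OF V]\<close>)
qed

section \<open>The double complex of a relatively projective resolution\<close>

lemma vectorspace_ZF:
  assumes V [simp]: "V \<in> Obj ZF" "W \<in> Obj ZF"
  shows "vectorspace class_ring (HomV ZF V W)"
proof -
  have "HomV ZF V W = HomV D (fst V) (fst W)\<lparr>carrier := Mor ZF V W\<rparr>"
    by (cases V, cases W) (simp add: centralizer_def)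
  moreover have "lin_closed (HomV D (fst V) (fst W)) (Mor ZF V W)"
  proof (rule lin_closedI)
    note m = Mor_ZF'[OF V]
    show "\<zero>\<^bsub>HomV D (fst V) (fst W)\<^esub> \<in> Mor ZF V W" unfolding m using zmor_zr[OF V] by (simp add: zt_def zr_def)
    fix f assume f: "f \<in> Mor ZF V W"
    show "f \<in> Mor D (fst V) (fst W)" using zmorD(1)[of V W "zt V f W"] f by (simp add: m zt_def)
    show "c \<odot>\<^bsub>HomV D (fst V) (fst W)\<^esub> f \<in> Mor ZF V W" for c
      using zmor_scl[OF V, of "zt V f W" c] f by (simp add: m zt_def scl_def)
    fix g assume g: "g \<in> Mor ZF V W"
    show "f \<oplus>\<^bsub>HomV D (fst V) (fst W)\<^esub> g \<in> Mor ZF V W"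
      using zmor_pls[OF V, of "zt V f W" "zt V g W"] f g by (simp add: m zt_def pls_def)
  qed
  ultimately show ?thesis using vectorspace_restrict[OF D.hom_vs, of "fst V" "fst W" "Mor ZF V W"] by simp
qed

lemma zt_pls: "zt V (f \<oplus>\<^bsub>HomV ZF V W\<^esub> g) W = zt V f W \<boxplus> zt V g W"
  by (simp add: zt_def pls_def HomV_ZF)
lemma zt_scl: "zt V (c \<odot>\<^bsub>HomV ZF V W\<^esub> f) W = c \<boxdot> zt V f W"
  by (simp add: zt_def scl_def HomV_ZF)

text \<open>If precomposition with f kills \<phi>, then \<phi> is unchanged by precomposition with 1
  - f s. Precomposition with 1 - t g therefore acts on \<phi> as precomposition with (1 - f s)(1 - t
  g) = 0, which says that \<phi> = \<phi> t g and exhibits \<phi> t as the preimage.\<close>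

lemma row_exact:
  assumes X [simp]: "X \<in> Obj ZF" "Y \<in> Obj ZF" "Z \<in> Obj ZF" and W [simp]: "W \<in> Obj ZF" and ex: "exact_at ZF X Y Z f g"
    and af: "allowable ZF D forgetful X Y f" and ag: "allowable ZF D forgetful Y Z g" and \<phi>: "cochain q (fst Y) (fst W) \<phi>"
  shows "pull q (zt X f Y) \<phi> = czero q (fst X) (fst W) \<longleftrightarrow> (\<exists>\<psi>. cochain q (fst Z) (fst W) \<psi> \<and> \<phi> = pull q (zt Y g Z) \<psi>)"
proof -
  let ?f = "zt X f Y" and ?g = "zt Y g Z" and ?y = "fst Y"
  obtain s where s: "zmor X Y ?f" "regular ?f s" using af by (auto simp: allowable_iff)
  obtain t where t: "zmor Y Z ?g" "regular ?g t" using ag by (auto simp: allowable_iff)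
  note [simp] = zmorD(1)[OF s(1)] zmorD(1)[OF t(1)]
  have [simp]: "arr D s" "src s = ?y" "tgt s = fst X" "arr D t" "src t = fst Z" "tgt t = ?y"
    using s(2) t(2) by (simp_all add: regular_def)
  note gf = exact_split[OF X ex s(2) t(2)]
  note pp = pull_pull[OF \<phi> Obj_fst[OF X(2)]] and pn = pull_neg[OF \<phi> Obj_fst[OF X(2)]]
  show ?thesis
  proof
    assume z: "pull q ?f \<phi> = czero q (fst X) (fst W)"
    let ?a = "\<iota> ?y \<boxplus> (- 1) \<boxdot> (?f \<star> s)" and ?b = "\<iota> ?y \<boxplus> (- 1) \<boxdot> (t \<star> ?g)"
    have "pull q (?f \<star> s) \<phi> = czero q ?y (fst W)"
      using pp[of ?f s] by (simp add: z pull_czero)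
    hence a: "pull q ?a \<phi> = \<phi>"
      using pn[of "\<iota> ?y" "?f \<star> s"] by (simp add: pull_idt[OF \<phi>] cadd_neg_czero(1)[OF \<phi>])
    have "pull q ?b \<phi> = pull q ?b (pull q ?a \<phi>)" by (simp only: a)
    also have "\<dots> = pull q (?a \<star> ?b) \<phi>" by (rule pp) simp_all
    also have "\<dots> = czero q ?y (fst W)" unfolding gf(2) by (rule pull_zr[OF \<phi>]) simp_all
    finally have "cadd q \<phi> (cscale q (- 1) (pull q (t \<star> ?g) \<phi>)) = czero q ?y (fst W)"
      using pn[of "\<iota> ?y" "t \<star> ?g"] by (simp add: pull_idt[OF \<phi>])
    moreover have "cochain q ?y (fst W) (pull q (t \<star> ?g) \<phi>)" by (rule pull_cochain[OF _ _ \<phi>]) simp_all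
    ultimately have "\<phi> = pull q (t \<star> ?g) \<phi>" by (metis cadd_neg_eq_czero[OF \<phi>])
    hence "\<phi> = pull q ?g (pull q t \<phi>)" using pp[of t ?g] by simp
    moreover have "cochain q (fst Z) (fst W) (pull q t \<phi>)" by (rule pull_cochain[OF _ _ \<phi>]) simp_all
    ultimately show "\<exists>\<psi>. cochain q (fst Z) (fst W) \<psi> \<and> \<phi> = pull q ?g \<psi>" by blast
  next
    assume "\<exists>\<psi>. cochain q (fst Z) (fst W) \<psi> \<and> \<phi> = pull q ?g \<psi>"
    then obtain \<psi> where \<psi>: "cochain q (fst Z) (fst W) \<psi>" "\<phi> = pull q ?g \<psi>" by blast
    have "pull q ?f \<phi> = pull q (?g \<star> ?f) \<psi>" unfolding \<psi>(2) by (rule pull_pull[OF \<psi>(1)]) simp_all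
    also have "\<dots> = czero q (fst X) (fst W)" unfolding gf(1) by (rule pull_zr[OF \<psi>(1)]) simp_all
    finally show "pull q ?f \<phi> = czero q (fst X) (fst W)" .
  qed
qed

text \<open>Bidegree (p, q) holds the q-cochains whose first coefficient is \<open>P p\<close>. The
  augmentation \<open>i\<close> is precomposition with \<epsilon>, and \<open>j\<close> reads a
  morphism \<open>P p\<close> -> W as a closed 0-cochain.\<close>

lemma resolution_double_complex:
  assumes V [simp]: "V \<in> Obj ZF" and W [simp]: "W \<in> Obj ZF" and res: "rel_projective_resolution ZF D forgetful V P d \<epsilon>"
  shows "double_complex (DY_cochains C D F V W) (\<lambda>p. HomV ZF (P p) W) (\<lambda>p q. cochain_space (fst (P p)) (fst W) q)
    (DY_diff C D F V W) (\<lambda>p f. f \<cdot>\<^bsub>ZF\<^esub> d p) (\<lambda>p q. pull q (zt (P (Suc p)) (d p) (P p))) (\<lambda>p q. cdiff (P p) W q)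
    (\<lambda>q f. pull q (zt (P 0) \<epsilon> V) (to_cochain (fst V) (fst W) q f)) (\<lambda>p f. \<lambda>Xs\<in>obj_lists C 0. zt (P p) f W)"
proof -
  have proj: "rel_projective ZF D forgetful (P n)" for n using res by (simp add: rel_projective_resolution_def)
  have al: "allowable ZF D forgetful (P (Suc n)) (P n) (d n)" "allowable ZF D forgetful (P 0) V \<epsilon>" for n
    using res by (simp_all add: rel_projective_resolution_def)
  have ep: "epic ZF (P 0) V \<epsilon>" using res by (simp add: rel_projective_resolution_def)
  have ex: "exact_at ZF (P (Suc (Suc n))) (P (Suc n)) (P n) (d (Suc n)) (d n)" "exact_at ZF (P (Suc 0)) (P 0) V (d 0) \<epsilon>" for n
    using res by (simp_all add: rel_projective_resolution_def)
  have P [simp]: "P n \<in> Obj ZF" for n using proj by (simp add: rel_projective_def)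
  note w = Obj_fst[OF W]
  let ?g = "\<lambda>p. zt (P (Suc p)) (d p) (P p)" and ?e = "zt (P 0) \<epsilon> V" and ?t = "\<lambda>q. to_cochain (fst V) (fst W) q"
  have zg: "zmor (P (Suc p)) (P p) (?g p)" for p using al(1)[of p] by (simp add: allowable_iff)
  have ze: "zmor (P 0) V ?e" using al(2) by (simp add: allowable_iff)
  \<comment> \<open>A section of \<epsilon> in \<open>D\<close>. Precomposition with s undoes
    precomposition with \<epsilon>, which gives injectivity of the augmentation of the rows.\<close>
  obtain s where s: "arr D s" "src s = fst V" "tgt s = fst (P 0)" "?e \<star> s = \<iota> (fst V)"
    using epic_allowable_split[OF P V ep al(2)] by blast
  have g [simp]: "arr D (?g p)" for p by (rule zmorD(1)[OF zg])
  have e [simp]: "arr D ?e" by (rule zmorD(1)[OF ze])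
  have tD: "cochain q (fst V) (fst W) (?t q f)" if "f \<in> carrier (DY_cochains C D F V W q)" for q f
    using that unfolding DY_carrier[OF V W] by blast
  have tS: "\<exists>f\<in>carrier (DY_cochains C D F V W q). ?t q f = \<phi>" if h: "cochain q (fst V) (fst W) \<phi>" for q \<phi>
  proof -
    obtain f where f: "f \<in> extensional (obj_lists C q)" "?t q f = \<phi>" using to_cochain_surj[OF h] by blast
    have "f \<in> carrier (DY_cochains C D F V W q)" unfolding DY_carrier[OF V W] f(2) using f(1) h by blast
    with f(2) show ?thesis by (rule bexI)
  qed
  have zm: "f \<in> Mor ZF (P p) W \<longleftrightarrow> zmor (P p) W (zt (P p) f W)" for p f by (rule Mor_ZF'[OF P W])
  note vsT = vectorspace_cochain_space[OF Obj_fst[OF P] w]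
  show ?thesis
  proof (rule double_complex.intro, unfold cochain_space_simps mem_Collect_eq)
    show "linear_map class_ring (DY_cochains C D F V W n) (DY_cochains C D F V W (Suc n)) (DY_diff C D F V W n)" for n
      by (rule DY_diff_linear[OF V W])
    show "linear_map class_ring (HomV ZF (P p) W) (HomV ZF (P (Suc p)) W) (\<lambda>f. f \<cdot>\<^bsub>ZF\<^esub> d p)" for p
    proof (rule linear_mapI[OF vectorspace_ZF[OF P W] vectorspace_ZF[OF P W]])
      have z: "zt (P (Suc p)) (f \<cdot>\<^bsub>ZF\<^esub> d p) W = zt (P p) f W \<star> ?g p" for f unfolding Comp_ZF by (rule zt_cmp)
      fix f assume "f \<in> Mor ZF (P p) W"
      hence f: "zmor (P p) W (zt (P p) f W)" by (simp only: zm)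
      show "f \<cdot>\<^bsub>ZF\<^esub> d p \<in> Mor ZF (P (Suc p)) W" unfolding zm z by (rule zmor_cmp[OF zg f]) simp_all
      show "(c \<odot>\<^bsub>HomV ZF (P p) W\<^esub> f) \<cdot>\<^bsub>ZF\<^esub> d p = c \<odot>\<^bsub>HomV ZF (P (Suc p)) W\<^esub> (f \<cdot>\<^bsub>ZF\<^esub> d p)" for c
        by (subst zt_eq_iff[of "P (Suc p)" _ W, symmetric]) (use zmorD(1)[OF f] in \<open>simp add: z zt_scl\<close>)
      fix h assume "h \<in> Mor ZF (P p) W"
      hence h: "zmor (P p) W (zt (P p) h W)" by (simp only: zm)
      show "(f \<oplus>\<^bsub>HomV ZF (P p) W\<^esub> h) \<cdot>\<^bsub>ZF\<^esub> d p = (f \<cdot>\<^bsub>ZF\<^esub> d p) \<oplus>\<^bsub>HomV ZF (P (Suc p)) W\<^esub> (h \<cdot>\<^bsub>ZF\<^esub> d p)"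
        by (subst zt_eq_iff[of "P (Suc p)" _ W, symmetric])
          (use zmorD(1)[OF f] zmorD(1)[OF h] in \<open>simp add: z zt_pls D.cmp_pls_left\<close>)
    qed
    show "linear_map class_ring (DY_cochains C D F V W q) (cochain_space (fst (P 0)) (fst W) q) (\<lambda>f. pull q ?e (?t q f))" for q
    proof (rule linear_mapI[OF vectorspace_DY[OF V W] vsT], unfold cochain_space_simps mem_Collect_eq to_cochain_ops[OF V W])
      fix f assume "f \<in> carrier (DY_cochains C D F V W q)"
      note f = tD[OF this]
      show "cochain q (fst (P 0)) (fst W) (pull q ?e (?t q f))" by (rule pull_cochain[OF _ _ f]) simp_all
      show "pull q ?e (cscale q c (?t q f)) = cscale q c (pull q ?e (?t q f))" for c by (rule pull_cscale[OF f]) simp_all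
      fix h assume "h \<in> carrier (DY_cochains C D F V W q)"
      note h = tD[OF this]
      show "pull q ?e (cadd q (?t q f) (?t q h)) = cadd q (pull q ?e (?t q f)) (pull q ?e (?t q h))"
        by (rule pull_cadd[OF f h]) simp_all
    qed
    show "linear_map class_ring (HomV ZF (P p) W) (cochain_space (fst (P p)) (fst W) 0) (\<lambda>f. \<lambda>Xs\<in>obj_lists C 0. zt (P p) f W)" for p
    proof (rule linear_mapI[OF vectorspace_ZF[OF P W] vsT], unfold cochain_space_simps mem_Collect_eq)
      fix f assume "f \<in> Mor ZF (P p) W"
      hence f: "zmor (P p) W (zt (P p) f W)" by (simp only: zm)
      show "cochain 0 (fst (P p)) (fst W) (\<lambda>Xs\<in>obj_lists C 0. zt (P p) f W)" by (rule cdiff_0_zmor(1)[OF P W f])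
    qed (auto intro!: extensionalityI[of _ "obj_lists C 0"] simp: zt_scl zt_pls)
    show "linear_map class_ring (cochain_space (fst (P p)) (fst W) q) (cochain_space (fst (P (Suc p))) (fst W) q) (pull q (?g p))" for p q
    proof (rule linear_mapI[OF vsT vsT], unfold cochain_space_simps mem_Collect_eq)
      fix \<phi> assume f: "cochain q (fst (P p)) (fst W) \<phi>"
      show "cochain q (fst (P (Suc p))) (fst W) (pull q (?g p) \<phi>)" by (rule pull_cochain[OF _ _ f]) simp_all
      show "pull q (?g p) (cscale q c \<phi>) = cscale q c (pull q (?g p) \<phi>)" for c by (rule pull_cscale[OF f]) simp_all
      fix \<psi> assume h: "cochain q (fst (P p)) (fst W) \<psi>"
      show "pull q (?g p) (cadd q \<phi> \<psi>) = cadd q (pull q (?g p) \<phi>) (pull q (?g p) \<psi>)" by (rule pull_cadd[OF f h]) simp_all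
    qed
    show "linear_map class_ring (cochain_space (fst (P p)) (fst W) q) (cochain_space (fst (P p)) (fst W) (Suc q)) (cdiff (P p) W q)" for p q
    proof (rule linear_mapI[OF vsT vsT], unfold cochain_space_simps mem_Collect_eq)
      fix \<phi> assume f: "cochain q (fst (P p)) (fst W) \<phi>"
      show "cochain (Suc q) (fst (P p)) (fst W) (cdiff (P p) W q \<phi>)" by (rule cdiff_cochain[OF P W f])
      show "cdiff (P p) W q (cscale q c \<phi>) = cscale (Suc q) c (cdiff (P p) W q \<phi>)" for c by (rule cdiff_cscale[OF P W f f])
      fix \<psi> assume h: "cochain q (fst (P p)) (fst W) \<psi>"
      show "cdiff (P p) W q (cadd q \<phi> \<psi>) = cadd (Suc q) (cdiff (P p) W q \<phi>) (cdiff (P p) W q \<psi>)" by (rule cdiff_cadd[OF P W f h])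
    qed
    show "pull (Suc q) (?g p) (cdiff (P p) W q x) = cdiff (P (Suc p)) W q (pull q (?g p) x)" if "cochain q (fst (P p)) (fst W) x" for x p q
      by (rule cdiff_pull[OF P P W that zg, symmetric])
    show "cdiff (P 0) W q (pull q ?e (?t q a)) = pull (Suc q) ?e (?t (Suc q) (DY_diff C D F V W q a))"
      if "a \<in> carrier (DY_cochains C D F V W q)" for a q
      unfolding to_cochain_diff[OF V W that] by (rule cdiff_pull[OF V P W tD[OF that] ze])
    show "pull 0 (?g p) (\<lambda>Xs\<in>obj_lists C 0. zt (P p) b W) = (\<lambda>Xs\<in>obj_lists C 0. zt (P (Suc p)) (b \<cdot>\<^bsub>ZF\<^esub> d p) W)" for b p
      by (auto intro!: extensionalityI[of _ "obj_lists C 0"] simp: Comp_ZF zt_cmp[of "P (Suc p)" b "d p" W "P p"])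
    show "a = \<zero>\<^bsub>DY_cochains C D F V W q\<^esub>"
      if a: "a \<in> carrier (DY_cochains C D F V W q)" and z: "pull q ?e (?t q a) = czero q (fst (P 0)) (fst W)" for a q
    proof -
      have "?t q a = pull q s (pull q ?e (?t q a))"
        using pull_pull[OF tD[OF a], of ?e s] pull_idt[OF tD[OF a]] s by simp
      also have "\<dots> = czero q (fst V) (fst W)" unfolding z by (rule pull_czero) (use s in simp_all)
      also have "\<dots> = ?t q \<zero>\<^bsub>DY_cochains C D F V W q\<^esub>" by (rule to_cochain_ops(1)[OF V W, symmetric])
      finally show ?thesis
        using a vs_zero[OF vectorspace_DY[OF V W, of q]] unfolding DY_carrier[OF V W] by (blast intro: to_cochain_inj)
    qed
    show "b = \<zero>\<^bsub>HomV ZF (P p) W\<^esub>" if "(\<lambda>Xs\<in>obj_lists C 0. zt (P p) b W) = czero 0 (fst (P p)) (fst W)" for b p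
    proof -
      have "zt (P p) b W = zt (P p) \<zero>\<^bsub>HomV ZF (P p) W\<^esub> W"
        using fun_cong[OF that, of "[]"] by (simp add: zt_zero)
      thus ?thesis by (simp only: zt_eq_iff)
    qed
    show "pull q (?g 0) x = czero q (fst (P (Suc 0))) (fst W) \<longleftrightarrow>
        x \<in> (\<lambda>f. pull q ?e (?t q f)) ` carrier (DY_cochains C D F V W q)" if x: "cochain q (fst (P 0)) (fst W) x" for x q
      unfolding row_exact[OF P P V W ex(2) al x] using tS tD by blast
    show "pull q (?g (Suc p)) x = czero q (fst (P (Suc (Suc p)))) (fst W) \<longleftrightarrow> x \<in> pull q (?g p) ` {\<phi>. cochain q (fst (P p)) (fst W) \<phi>}"
      if x: "cochain q (fst (P (Suc p))) (fst W) x" for x p q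
      unfolding row_exact[OF P P P W ex(1) al(1) al(1) x] by blast
    show "cdiff (P p) W 0 x = czero (Suc 0) (fst (P p)) (fst W) \<longleftrightarrow> x \<in> (\<lambda>f. \<lambda>Xs\<in>obj_lists C 0. zt (P p) f W) ` Mor ZF (P p) W"
      if x: "cochain 0 (fst (P p)) (fst W) x" for x p
      unfolding cdiff_0_closed_iff[OF P W x]
    proof
      assume z: "zmor (P p) W (x [])"
      show "x \<in> (\<lambda>f. \<lambda>Xs\<in>obj_lists C 0. zt (P p) f W) ` Mor ZF (P p) W"
      proof (rule image_eqI)
        show "und (x []) \<in> Mor ZF (P p) W" by (rule Mor_ZF_und[OF P W z])
        show "x = (\<lambda>Xs\<in>obj_lists C 0. zt (P p) (und (x [])) W)"
          using cochainD(1)[OF x] by (auto intro!: extensionalityI[of _ "obj_lists C 0"] simp: zt_und[OF z])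
      qed
    next
      assume "x \<in> (\<lambda>f. \<lambda>Xs\<in>obj_lists C 0. zt (P p) f W) ` Mor ZF (P p) W"
      thus "zmor (P p) W (x [])" using zm by auto
    qed
    show "cdiff (P p) W (Suc q) x = czero (Suc (Suc q)) (fst (P p)) (fst W) \<longleftrightarrow> x \<in> cdiff (P p) W q ` {\<phi>. cochain q (fst (P p)) (fst W) \<phi>}"
      if x: "cochain (Suc q) (fst (P p)) (fst W) x" for x p q
      using rel_projective_acyclic[OF proj W x] cdiff_cdiff[OF W P] by blast
  qed
qed

text \<open>\<open>rel_Ext\<close> takes its resolution by choice. Existence, from
  \<open>ex_resolution\<close>, guarantees that the chosen data form a resolution, and the double
  complex is built on exactly these data.\<close>

lemma DY_cohomology_rel_Ext:
  assumes V: "V \<in> Obj ZF" and W: "W \<in> Obj ZF"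
  shows "lin_isomorphic (DY_cohomology C D F V W n) (rel_Ext ZF D forgetful V W n)"
proof -
  define Pd where "Pd = (SOME (P, d). \<exists>\<epsilon>. rel_projective_resolution ZF D forgetful V P d \<epsilon>)"
  obtain P d where Pd: "Pd = (P, d)" by (cases Pd)
  have "case Pd of (P, d) \<Rightarrow> \<exists>\<epsilon>. rel_projective_resolution ZF D forgetful V P d \<epsilon>"
    unfolding Pd_def by (rule someI_ex) (use ex_resolution[OF V] in auto)
  then obtain \<epsilon> where "rel_projective_resolution ZF D forgetful V P d \<epsilon>" unfolding Pd by auto
  from double_complex.cohomology_isomorphic[OF resolution_double_complex[OF V W this]]
  show ?thesis unfolding DY_cohomology_def rel_Ext_def Pd_def[symmetric] Pd by simp
qed

end

theorem theorem1:
  fixes C :: "('k::field, 'o, 'm) mon_cat"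
    and D :: "('k, 'p, 'n) mon_cat"
    and F :: "('o, 'm, 'p, 'n) functor_data"
    and V W :: "'p \<times> ('o \<Rightarrow> 'n)"
  assumes "finite_strict_tensor_category C"
    and "finite_strict_tensor_category D"
    and "linear_functor C D F"
    and "exact_functor C D F"
    and "strict_monoidal_functor C D F"
    and "V \<in> Obj (centralizer C D F)"
    and "W \<in> Obj (centralizer C D F)"
  shows "\<forall>n. lin_isomorphic (DY_cohomology C D F V W n)
               (rel_Ext (centralizer C D F) D forgetful V W n)"
proof
  fix n
  interpret tensor_functor C D F
    by (intro tensor_functor.intro tensor_functor_axioms.intro assms)
  show "lin_isomorphic (DY_cohomology C D F V W n) (rel_Ext (centralizer C D F) D forgetful V W n)"
    by (rule DY_cohomology_rel_Ext[OF assms(6,7)])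
qed

end
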